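(* Let $C$ be a bounded operator on $H^2(\mathbb{C}_+)$. On $H^2(\mathbb{C}_+)$ consider the isometries $S_tf = e_{it}f$, $t\geq 0$, where $e_{it}(z) = e^{itz}$, and the multiplication operators $m_gf = gf$, $g\in H^\infty(\mathbb{C}_+)$. Consider also the unitary isomorphism $$\Gamma_2: L^2(\mathbb{T})\to L^2(\mathbb{R}),\qquad(\Gamma_2f)(x) := \frac{\sqrt 2}{x+i}\,f\Big(\frac{x-i}{x+i}\Big),$$ which maps $H^2(\mathbb{D})$ onto $H^2(\mathbb{C}_+)$, and the operator $D := \Gamma_2^{-1}C\Gamma_2: H^2(\mathbb{D})\to H^2(\mathbb{D})$. Then the following are equivalent: (a) There exists $h\in L^\infty(\mathbb{R})$ with $C = H_h$. (b) $Cm_g = m_{g^\sharp}^*C$ for all $g\in H^\infty(\mathbb{C}_+)$, where $g^\sharp(z) = \overline{g(-\overline z)}$. (c) $CS_t = S_t^*C$ for all $t>0$. (d) $D$ is a Hankel operator on $H^2(\mathbb{D})$.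
   Context: $\mathbb{C}_+$ is the open upper half plane, $\mathbb{D}$ the open unit disc, and $\mathbb{T}$ the unit circle with the length measure of total mass $2\pi$. The Hardy spaces $H^2(\mathbb{C}_+)$ and $H^2(\mathbb{D})$ are identified via non-tangential boundary values with closed subspaces of $L^2(\mathbb{R})$ and $L^2(\mathbb{T})$, respectively. $H^\infty(\mathbb{C}_+)$ is the algebra of bounded holomorphic functions on $\mathbb{C}_+$. For $h\in L^\infty(\mathbb{R})$, $H_h := P_+hRP_+^*\in B(H^2(\mathbb{C}_+))$, where $P_+:L^2(\mathbb{R})\to H^2(\mathbb{C}_+)$ is the orthogonal projection and $(Rf)(x) = f(-x)$. A bounded operator $D$ on $H^2(\mathbb{D})$ is called a Hankel operator if $DS = S^*D$ for the shift operator $(Sf)(z) = zf(z)$ on $H^2(\mathbb{D})$; equivalently, there is $k\in L^\infty(\mathbb{T})$ such that $D$ is the compression to $H^2(\mathbb{D})$ of the operator $f\mapsto k(z)f(\overline z)$ on $L^2(\mathbb{T})$. *)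

theory Defs
  imports "HOL-Complex_Analysis.Complex_Analysis"
begin

abbreviation upper_half_plane :: "complex set"
  where "upper_half_plane \<equiv> {z. Im z > 0}"

abbreviation unit_disc :: "complex set"
  where "unit_disc \<equiv> ball 0 1"


section \<open>Non-tangential boundary values\<close>

text \<open>
  A non-tangential limit is a limit within every Stolz region at the boundary point, whatever
  its aperture. The boundary functions take an unspecified value at the points without a
  non-tangential limit; for functions in the Hardy spaces these form a null set.
\<close>

definition nt_limit_uhp :: "(complex \<Rightarrow> complex) \<Rightarrow> real \<Rightarrow> complex \<Rightarrow> bool" where
  "nt_limit_uhp F x l \<longleftrightarrow>
     (\<forall>a>0. (F \<longlongrightarrow> l) (at (of_real x) within {z. Im z > 0 \<and> \<bar>Re z - x\<bar> < a * Im z}))"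

definition bval_uhp :: "(complex \<Rightarrow> complex) \<Rightarrow> real \<Rightarrow> complex" where
  "bval_uhp F x = (THE l. nt_limit_uhp F x l)"

definition nt_limit_disc :: "(complex \<Rightarrow> complex) \<Rightarrow> complex \<Rightarrow> complex \<Rightarrow> bool" where
  "nt_limit_disc f w l \<longleftrightarrow>
     (\<forall>a>1. (f \<longlongrightarrow> l) (at w within {z. norm z < 1 \<and> norm (z - w) < a * (1 - norm z)}))"

definition bval_disc :: "(complex \<Rightarrow> complex) \<Rightarrow> complex \<Rightarrow> complex" where
  "bval_disc f w = (THE l. nt_limit_disc f w l)"


section \<open>Hardy spaces\<close>

text \<open>
  The elements of the Hardy spaces are holomorphic functions, extended by \<open>0\<close> outside the
  domain so that equality in the Hardy space is equality in HOL. The identification with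
  subspaces of \<open>L\<^sup>2\<close> is made through the boundary functions; in particular the inner products
  are those of the boundary functions.
\<close>

definition H2_uhp :: "(complex \<Rightarrow> complex) set" where
  "H2_uhp = {F. F holomorphic_on upper_half_plane \<and> (\<forall>z. z \<notin> upper_half_plane \<longrightarrow> F z = 0) \<and>
     (SUP y\<in>{0<..}. \<integral>\<^sup>+x. ennreal ((norm (F (Complex x y)))\<^sup>2) \<partial>lborel) < \<infinity>}"

definition H2_disc :: "(complex \<Rightarrow> complex) set" where
  "H2_disc = {f. f holomorphic_on unit_disc \<and> (\<forall>z. z \<notin> unit_disc \<longrightarrow> f z = 0) \<and>
     (SUP r\<in>{0<..<1}. \<integral>\<^sup>+t\<in>{0..2*pi}. ennreal ((norm (f (of_real r * cis t)))\<^sup>2) \<partial>lborel) < \<infinity>}"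

definition Hinf_uhp :: "(complex \<Rightarrow> complex) set" where
  "Hinf_uhp = {g. g holomorphic_on upper_half_plane \<and> bounded (g ` upper_half_plane)}"

definition Linf_real :: "(real \<Rightarrow> complex) set" where
  "Linf_real = {h. h \<in> borel_measurable lebesgue \<and> (\<exists>M. AE x in lebesgue. norm (h x) \<le> M)}"

definition L2_inner_real :: "(real \<Rightarrow> complex) \<Rightarrow> (real \<Rightarrow> complex) \<Rightarrow> complex" where
  "L2_inner_real u v = (LINT x|lebesgue. u x * cnj (v x))"

text \<open>The length measure on the circle is the image of Lebesgue measure under \<^const>\<open>cis\<close>.\<close>

definition L2_inner_circle :: "(complex \<Rightarrow> complex) \<Rightarrow> (complex \<Rightarrow> complex) \<Rightarrow> complex" where
  "L2_inner_circle u v = (LINT t:{0..2*pi}|lebesgue. u (cis t) * cnj (v (cis t)))"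

definition inner_uhp :: "(complex \<Rightarrow> complex) \<Rightarrow> (complex \<Rightarrow> complex) \<Rightarrow> complex" where
  "inner_uhp F G = L2_inner_real (bval_uhp F) (bval_uhp G)"

definition inner_disc :: "(complex \<Rightarrow> complex) \<Rightarrow> (complex \<Rightarrow> complex) \<Rightarrow> complex" where
  "inner_disc f g = L2_inner_circle (bval_disc f) (bval_disc g)"


section \<open>Operators\<close>

text \<open>
  Operators on a space of functions \<open>H\<close> with inner product \<open>ip\<close> (linear in the first argument).
  Only their values on \<open>H\<close> are relevant.
\<close>

definition bounded_operator_on ::
  "('a \<Rightarrow> complex) set \<Rightarrow> (('a \<Rightarrow> complex) \<Rightarrow> ('a \<Rightarrow> complex) \<Rightarrow> complex) \<Rightarrow>
   (('a \<Rightarrow> complex) \<Rightarrow> ('a \<Rightarrow> complex)) \<Rightarrow> bool" where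
  "bounded_operator_on H ip A \<longleftrightarrow>
     (\<forall>f\<in>H. A f \<in> H) \<and>
     (\<forall>f\<in>H. \<forall>g\<in>H. A (\<lambda>z. f z + g z) = (\<lambda>z. A f z + A g z)) \<and>
     (\<forall>c. \<forall>f\<in>H. A (\<lambda>z. c * f z) = (\<lambda>z. c * A f z)) \<and>
     (\<exists>K. \<forall>f\<in>H. sqrt (Re (ip (A f) (A f))) \<le> K * sqrt (Re (ip f f)))"

definition adjoint_on ::
  "('a \<Rightarrow> complex) set \<Rightarrow> (('a \<Rightarrow> complex) \<Rightarrow> ('a \<Rightarrow> complex) \<Rightarrow> complex) \<Rightarrow>
   (('a \<Rightarrow> complex) \<Rightarrow> ('a \<Rightarrow> complex)) \<Rightarrow> (('a \<Rightarrow> complex) \<Rightarrow> ('a \<Rightarrow> complex))" where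
  "adjoint_on H ip A v = (THE u. u \<in> H \<and> (\<forall>w\<in>H. ip (A w) v = ip w u))"

abbreviation adjoint_uhp where "adjoint_uhp \<equiv> adjoint_on H2_uhp inner_uhp"
abbreviation adjoint_disc where "adjoint_disc \<equiv> adjoint_on H2_disc inner_disc"

definition mult_op :: "(complex \<Rightarrow> complex) \<Rightarrow> (complex \<Rightarrow> complex) \<Rightarrow> (complex \<Rightarrow> complex)" where
  "mult_op g f = (\<lambda>z. g z * f z)"

definition sharp :: "(complex \<Rightarrow> complex) \<Rightarrow> (complex \<Rightarrow> complex)" where
  "sharp g = (\<lambda>z. cnj (g (- cnj z)))"

definition S_uhp :: "real \<Rightarrow> (complex \<Rightarrow> complex) \<Rightarrow> (complex \<Rightarrow> complex)" where
  "S_uhp t f = (\<lambda>z. exp (\<i> * of_real t * z) * f z)"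

definition shift_disc :: "(complex \<Rightarrow> complex) \<Rightarrow> (complex \<Rightarrow> complex)" where
  "shift_disc f = (\<lambda>z. z * f z)"

text \<open>
  The orthogonal projection from \<open>L\<^sup>2\<close> of the real line onto the Hardy space; its values matter
  for square integrable \<open>u\<close> only.
\<close>

definition P_plus :: "(real \<Rightarrow> complex) \<Rightarrow> (complex \<Rightarrow> complex)" where
  "P_plus u = (THE F. F \<in> H2_uhp \<and>
     (\<forall>G\<in>H2_uhp. L2_inner_real (\<lambda>x. u x - bval_uhp F x) (bval_uhp G) = 0))"

definition reflection :: "(real \<Rightarrow> complex) \<Rightarrow> (real \<Rightarrow> complex)" where
  "reflection u = (\<lambda>x. u (- x))"

text \<open>
  The adjoint of \<^const>\<open>P_plus\<close> is the inclusion of the Hardy space into \<open>L\<^sup>2\<close>, that is,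
  \<^const>\<open>bval_uhp\<close>.
\<close>

definition hankel_uhp :: "(real \<Rightarrow> complex) \<Rightarrow> (complex \<Rightarrow> complex) \<Rightarrow> (complex \<Rightarrow> complex)" where
  "hankel_uhp h F = P_plus (\<lambda>x. h x * reflection (bval_uhp F) x)"

definition is_hankel_disc :: "((complex \<Rightarrow> complex) \<Rightarrow> (complex \<Rightarrow> complex)) \<Rightarrow> bool" where
  "is_hankel_disc D \<longleftrightarrow> bounded_operator_on H2_disc inner_disc D \<and>
     (\<forall>f\<in>H2_disc. D (shift_disc f) = adjoint_disc shift_disc (D f))"

definition Gamma2 :: "(complex \<Rightarrow> complex) \<Rightarrow> (real \<Rightarrow> complex)" where
  "Gamma2 f = (\<lambda>x. of_real (sqrt 2) / (of_real x + \<i>) *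
     f ((of_real x - \<i>) / (of_real x + \<i>)))"

text \<open>
  The restriction of \<^const>\<open>Gamma2\<close> to a map between the Hardy spaces, and the operator
  that it induces on the Hardy space of the disc.
\<close>

definition Gamma2_H2 :: "(complex \<Rightarrow> complex) \<Rightarrow> (complex \<Rightarrow> complex)" where
  "Gamma2_H2 f = (THE F. F \<in> H2_uhp \<and>
     (AE x in lebesgue. bval_uhp F x = Gamma2 (bval_disc f) x))"

definition transfer_disc ::
  "((complex \<Rightarrow> complex) \<Rightarrow> (complex \<Rightarrow> complex)) \<Rightarrow> ((complex \<Rightarrow> complex) \<Rightarrow> (complex \<Rightarrow> complex))" where
  "transfer_disc C f = inv_into H2_disc Gamma2_H2 (C (Gamma2_H2 f))"

end

theory Submission
  imports Defs
begin

text \<open>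
  For (a) \<open>\<Rightarrow>\<close> (b), reflection turns multiplication by the boundary function of \<open>g\<close> into multiplication by
  the complex conjugate of that of \<open>g\<^sup>\<sharp>\<close>, and (c) is the case \<open>g = exp (\<i> * t * z)\<close>, where \<open>g\<^sup>\<sharp> = g\<close>. The
  Cayley function \<open>(z - \<i>) / (z + \<i>)\<close> is a bounded pointwise limit of finite linear combinations of
  these exponentials, so that (c) extends to it; on the disc it becomes the variable, and this is (d).

  For (d) \<open>\<Rightarrow>\<close> (a), the matrix of \<open>C\<close> in the orthogonal basis that corresponds to the monomials has entries
  \<open>\<gamma> (i + j)\<close> up to a constant. A polynomial without zeros in the disc is a square there, and zeros can be divided out by a
  Blaschke product; therefore \<open>\<gamma>\<close> is a bounded functional on polynomials in the \<open>L\<^sup>1\<close> norm of the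
  circle. It has an extremal polynomial in each degree, whose sign yields a bounded function with the
  first Fourier coefficients of \<open>\<gamma>\<close>, and compactness gives a symbol on the circle. Both Hardy spaces are
  parametrized by square summable coefficients, with boundary values from Fatou's theorem.
\<close>

section \<open>Square integrable functions\<close>

text \<open>The Hardy spaces are given by growth conditions and their inner products by
  non-tangential limits chosen with \<open>THE\<close>, so boundary identities are out of reach
  until these limits are known to exist almost everywhere. Therefore square summable sequences
  \<open>a\<close> carry everything: \<open>ps a\<close> in the disc, \<open>bdry a\<close> on the
  circle, \<open>line_bdry a\<close> on the line, with the same inner product up to the factor 2 pi.
  The hard point is that nothing else occurs, above all that each \<open>F\<close> in
  \<open>H2_uhp\<close> comes from the disc.

  The functional \<open>\<gamma>\<close> is bounded in the L1 norm because a polynomial factors in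
  the disc into two functions whose squared L2 norms are at most its L1 norm, and the matrix bound
  applies to this pair. In each degree a maximizer exists and its first variation gives a symbol.
  Letting the degree grow, only single Fourier coefficients converge; the uniform bound is recovered
  from Poisson means, which depend on finitely many coefficients up to a geometrically small
  error.\<close>

definition square_integrable :: "'a measure \<Rightarrow> ('a \<Rightarrow> complex) \<Rightarrow> bool" where
  "square_integrable M u \<longleftrightarrow> u \<in> borel_measurable M \<and> integrable M (\<lambda>x. (norm (u x))\<^sup>2)"

definition L2_ip :: "'a measure \<Rightarrow> ('a \<Rightarrow> complex) \<Rightarrow> ('a \<Rightarrow> complex) \<Rightarrow> complex" where
  "L2_ip M u v = (LINT x|M. u x * cnj (v x))"

definition L2_sq :: "'a measure \<Rightarrow> ('a \<Rightarrow> complex) \<Rightarrow> real" where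
  "L2_sq M u = (LINT x|M. (norm (u x))\<^sup>2)"

lemma L2_sq_nonneg [simp]: "0 \<le> L2_sq M u"
  by (simp add: L2_sq_def)

lemma L2_ip_self: "L2_ip M u u = of_real (L2_sq M u)"
proof -
  have "u x * cnj (u x) = of_real ((norm (u x))\<^sup>2)" for x
    by (metis complex_norm_square)
  then show ?thesis
    unfolding L2_ip_def L2_sq_def by (simp only: integral_complex_of_real)
qed

lemma norm_add_sq_le: "(norm (a + b))\<^sup>2 \<le> 2 * (norm a)\<^sup>2 + 2 * (norm (b::complex))\<^sup>2"
proof -
  have "(norm (a + b))\<^sup>2 \<le> (norm a + norm b)\<^sup>2"
    by (simp add: norm_triangle_ineq power_mono)
  also have "\<dots> \<le> 2 * (norm a)\<^sup>2 + 2 * (norm b)\<^sup>2"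
    using zero_le_power2[of "norm a - norm b"] by (simp add: power2_eq_square algebra_simps)
  finally show ?thesis .
qed

lemma square_integrable_add:
  assumes "square_integrable M u" "square_integrable M v"
  shows "square_integrable M (\<lambda>x. u x + v x)"
proof -
  have [measurable]: "u \<in> borel_measurable M" "v \<in> borel_measurable M"
    using assms by (auto simp: square_integrable_def)
  have "integrable M (\<lambda>x. 2 * (norm (u x))\<^sup>2 + 2 * (norm (v x))\<^sup>2)"
    using assms by (auto simp: square_integrable_def)
  then have "integrable M (\<lambda>x. (norm (u x + v x))\<^sup>2)"
    by (rule Bochner_Integration.integrable_bound) (auto intro!: AE_I2 norm_add_sq_le)
  then show ?thesis by (simp add: square_integrable_def)
qed

lemma square_integrable_bounded_mult:
  assumes [measurable]: "h \<in> borel_measurable M" and B: "AE x in M. norm (h x) \<le> B"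
    and u: "square_integrable M u"
  shows "square_integrable M (\<lambda>x. h x * u x)"
proof -
  have [measurable]: "u \<in> borel_measurable M"
    using u by (auto simp: square_integrable_def)
  have "integrable M (\<lambda>x. B\<^sup>2 * (norm (u x))\<^sup>2)"
    using u by (auto simp: square_integrable_def)
  then have "integrable M (\<lambda>x. (norm (h x * u x))\<^sup>2)"
    apply (rule Bochner_Integration.integrable_bound)
     apply measurable
    using B by eventually_elim (auto simp: norm_mult power_mult_distrib intro!: mult_right_mono power_mono)
  then show ?thesis by (simp add: square_integrable_def)
qed

lemma square_integrable_cmult:
  assumes "square_integrable M u" shows "square_integrable M (\<lambda>x. c * u x)"
  by (rule square_integrable_bounded_mult[where B="norm c"]) (use assms in auto)

lemma square_integrable_diff:
  assumes "square_integrable M u" "square_integrable M v"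
  shows "square_integrable M (\<lambda>x. u x - v x)"
  using square_integrable_add[OF assms(1) square_integrable_cmult[OF assms(2), of "-1"]] by simp

lemma square_integrable_cnj: 
  assumes "square_integrable M u" shows "square_integrable M (\<lambda>x. cnj (u x))"
  using assms measurable_compose[of u M borel cnj borel]
    borel_measurable_continuous_onI[OF continuous_on_cnj[OF continuous_on_id]]
  by (auto simp: square_integrable_def)

lemma square_integrable_mult:
  assumes "square_integrable M u" "square_integrable M v"
  shows "integrable M (\<lambda>x. u x * v x)"
proof -
  have [measurable]: "u \<in> borel_measurable M" "v \<in> borel_measurable M"
    using assms by (auto simp: square_integrable_def)
  have "integrable M (\<lambda>x. (norm (u x))\<^sup>2 + (norm (v x))\<^sup>2)"
    using assms by (auto simp: square_integrable_def)
  then show ?thesis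
  proof (rule Bochner_Integration.integrable_bound)
    have "norm a * norm b \<le> (norm a)\<^sup>2 + (norm b)\<^sup>2" for a b :: complex
      using zero_le_power2[of "norm a - norm b"] mult_nonneg_nonneg[OF norm_ge_zero[of a] norm_ge_zero[of b]]
      unfolding power2_diff by linarith
    then show "AE x in M. norm (u x * v x) \<le> norm ((norm (u x))\<^sup>2 + (norm (v x))\<^sup>2)"
      by (intro AE_I2) (simp add: norm_mult)
  qed simp
qed

lemma integrable_L2_ip:
  assumes "square_integrable M u" "square_integrable M v"
  shows "integrable M (\<lambda>x. u x * cnj (v x))"
  by (rule square_integrable_mult[OF assms(1) square_integrable_cnj[OF assms(2)]])

lemma L2_ip_add_left:
  assumes "square_integrable M u" "square_integrable M v" "square_integrable M w"
  shows "L2_ip M (\<lambda>x. u x + v x) w = L2_ip M u w + L2_ip M v w"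
  using integrable_L2_ip[OF assms(1,3)] integrable_L2_ip[OF assms(2,3)]
  by (simp add: L2_ip_def distrib_right)

lemma L2_ip_diff_left:
  assumes "square_integrable M u" "square_integrable M v" "square_integrable M w"
  shows "L2_ip M (\<lambda>x. u x - v x) w = L2_ip M u w - L2_ip M v w"
  using integrable_L2_ip[OF assms(1,3)] integrable_L2_ip[OF assms(2,3)]
  by (simp add: L2_ip_def left_diff_distrib)

lemma L2_ip_cmult_left: "L2_ip M (\<lambda>x. c * u x) v = c * L2_ip M u v"
  by (simp add: L2_ip_def mult.assoc)

lemma L2_ip_commute: "L2_ip M v u = cnj (L2_ip M u v)"
proof -
  have "L2_ip M v u = (LINT x|M. cnj (u x * cnj (v x)))"
    by (simp add: L2_ip_def mult.commute)
  also have "\<dots> = cnj (LINT x|M. u x * cnj (v x))" by (rule Bochner_Integration.integral_cnj)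
  finally show ?thesis by (simp only: L2_ip_def)
qed

lemma L2_sq_eq_0_iff:
  assumes "square_integrable M u"
  shows "L2_sq M u = 0 \<longleftrightarrow> (AE x in M. u x = 0)"
  using assms integral_nonneg_eq_0_iff_AE[of M "\<lambda>x. (norm (u x))\<^sup>2"]
  by (simp add: square_integrable_def L2_sq_def)

lemma L2_Cauchy_Schwarz:
  assumes u: "square_integrable M u" and v: "square_integrable M v"
  shows "norm (L2_ip M u v) \<le> sqrt (L2_sq M u) * sqrt (L2_sq M v)"
proof (cases "L2_sq M u = 0 \<or> L2_sq M v = 0")
  case True
  then have "AE x in M. u x * cnj (v x) = 0"
    using L2_sq_eq_0_iff[OF u] L2_sq_eq_0_iff[OF v] by auto
  then have "L2_ip M u v = 0"
    unfolding L2_ip_def by (rule integral_eq_zero_AE)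
  then show ?thesis using True by simp
next
  case False
  define a where "a = sqrt (L2_sq M u)"
  define b where "b = sqrt (L2_sq M v)"
  have a: "a > 0" "a\<^sup>2 = L2_sq M u" and b: "b > 0" "b\<^sup>2 = L2_sq M v"
    using False by (auto simp: a_def b_def less_le)
  have "norm (L2_ip M u v) \<le> (LINT x|M. norm (u x * cnj (v x)))"
    unfolding L2_ip_def by (rule integral_norm_bound)
  \<comment> \<open>The arithmetic-geometric mean inequality with weights that balance the two
    norms, so that the right side integrates to exactly \<open>a * b\<close>.\<close>
  also have "\<dots> \<le> (LINT x|M. (b / a * (norm (u x))\<^sup>2 + a / b * (norm (v x))\<^sup>2) / 2)"
  proof (rule integral_mono)
    show "integrable M (\<lambda>x. norm (u x * cnj (v x)))"
      using integrable_L2_ip[OF u v] by (rule integrable_norm)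
    show "integrable M (\<lambda>x. (b / a * (norm (u x))\<^sup>2 + a / b * (norm (v x))\<^sup>2) / 2)"
      using u v by (auto simp: square_integrable_def)
    fix x
    have "2 * (norm (u x) * norm (v x)) \<le> b / a * (norm (u x))\<^sup>2 + a / b * (norm (v x))\<^sup>2"
    proof -
      have "0 \<le> (b * norm (u x) - a * norm (v x))\<^sup>2 / (a * b)"
        using a b by simp
      also have "\<dots> = b / a * (norm (u x))\<^sup>2 + a / b * (norm (v x))\<^sup>2 - 2 * (norm (u x) * norm (v x))"
        using a b by (simp add: field_simps power2_eq_square)
      finally show ?thesis by simp
    qed
    then show "norm (u x * cnj (v x)) \<le> (b / a * (norm (u x))\<^sup>2 + a / b * (norm (v x))\<^sup>2) / 2"
      by (simp add: norm_mult)
  qed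
  also have "\<dots> = (b / a * L2_sq M u + a / b * L2_sq M v) / 2"
    using u v by (simp add: square_integrable_def L2_sq_def)
  also have "\<dots> = a * b"
    using a(1) b(1) by (simp add: a(2)[symmetric] b(2)[symmetric] power2_eq_square)
  finally show ?thesis by (simp add: a_def b_def)
qed

text \<open>The form in which Bessel's inequality is used: for a partial Fourier sum
  \<open>w\<close> of \<open>u\<close> the hypothesis says that \<open>u - w\<close> is orthogonal
  to \<open>w\<close>, and Cauchy-Schwarz does the rest.\<close>

lemma L2_sq_le_of_L2_ip:
  assumes "square_integrable M w" "square_integrable M u" "L2_ip M w u = of_real (L2_sq M w)"
  shows "L2_sq M w \<le> L2_sq M u"
proof (cases "L2_sq M w = 0")
  case False
  then have pos: "sqrt (L2_sq M w) > 0" by (simp add: less_le)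
  have "sqrt (L2_sq M w) * sqrt (L2_sq M w) \<le> sqrt (L2_sq M w) * sqrt (L2_sq M u)"
    using L2_Cauchy_Schwarz[OF assms(1,2)] unfolding assms(3) norm_of_real by simp
  from mult_left_le_imp_le[OF this pos] show ?thesis by simp
qed simp

lemma L2_ip_tendsto_left:
  assumes u: "\<And>n. square_integrable M (u n)" and w: "square_integrable M w" and v: "square_integrable M v"
    and lim: "(\<lambda>n. L2_sq M (\<lambda>x. u n x - w x)) \<longlonglongrightarrow> 0"
  shows "(\<lambda>n. L2_ip M (u n) v) \<longlonglongrightarrow> L2_ip M w v"
proof -
  have "(\<lambda>n. L2_ip M (u n) v - L2_ip M w v) \<longlonglongrightarrow> 0"
  proof (rule Lim_null_comparison)
    show "\<forall>\<^sub>F n in sequentially. norm (L2_ip M (u n) v - L2_ip M w v)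
            \<le> sqrt (L2_sq M (\<lambda>x. u n x - w x)) * sqrt (L2_sq M v)"
      using L2_Cauchy_Schwarz[OF square_integrable_diff[OF u w] v]
      by (simp add: L2_ip_diff_left[OF u w v])
    have "(\<lambda>n. sqrt (L2_sq M (\<lambda>x. u n x - w x)) * sqrt (L2_sq M v)) \<longlonglongrightarrow> sqrt 0 * sqrt (L2_sq M v)"
      by (intro tendsto_intros lim)
    then show "(\<lambda>n. sqrt (L2_sq M (\<lambda>x. u n x - w x)) * sqrt (L2_sq M v)) \<longlonglongrightarrow> 0" by simp
  qed
  then show ?thesis by (simp add: LIM_zero_iff)
qed

lemma nn_integral_norm_sq:
  assumes "square_integrable M u"
  shows "(\<integral>\<^sup>+x. ennreal ((norm (u x))\<^sup>2) \<partial>M) = ennreal (L2_sq M u)"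
  using assms by (simp add: square_integrable_def L2_sq_def nn_integral_eq_integral)

text \<open>Fatou's lemma for the squared norms: pointwise convergence together with a uniform norm
  bound is enough.\<close>

lemma square_integrable_limit:
  assumes u: "\<And>n. square_integrable M (u n)" and [measurable]: "w \<in> borel_measurable M"
    and B: "\<And>n. L2_sq M (u n) \<le> B"
    and lim: "AE x in M. (\<lambda>n. u n x) \<longlonglongrightarrow> w x"
  shows "square_integrable M w" "L2_sq M w \<le> B"
proof -
  have [measurable]: "u n \<in> borel_measurable M" for n
    using u by (auto simp: square_integrable_def)
  have "(\<integral>\<^sup>+x. ennreal ((norm (w x))\<^sup>2) \<partial>M) = (\<integral>\<^sup>+x. liminf (\<lambda>n. ennreal ((norm (u n x))\<^sup>2)) \<partial>M)"
  proof (rule nn_integral_cong_AE)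
    show "AE x in M. ennreal ((norm (w x))\<^sup>2) = liminf (\<lambda>n. ennreal ((norm (u n x))\<^sup>2))"
      using lim
    proof eventually_elim
      fix x assume "(\<lambda>n. u n x) \<longlonglongrightarrow> w x"
      then have "(\<lambda>n. ennreal ((norm (u n x))\<^sup>2)) \<longlonglongrightarrow> ennreal ((norm (w x))\<^sup>2)"
        by (intro tendsto_ennrealI tendsto_intros)
      then show "ennreal ((norm (w x))\<^sup>2) = liminf (\<lambda>n. ennreal ((norm (u n x))\<^sup>2))"
        using lim_imp_Liminf[OF sequentially_bot] by metis
    qed
  qed
  also have "\<dots> \<le> liminf (\<lambda>n. \<integral>\<^sup>+x. ennreal ((norm (u n x))\<^sup>2) \<partial>M)"
    by (rule nn_integral_liminf) simp
  also have "\<dots> \<le> ennreal B"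
    by (rule Liminf_le) (use B in \<open>auto simp: nn_integral_norm_sq[OF u] intro!: always_eventually ennreal_leI\<close>)
  finally have le: "(\<integral>\<^sup>+x. ennreal ((norm (w x))\<^sup>2) \<partial>M) \<le> ennreal B" .
  also have "\<dots> < \<infinity>" by simp
  finally show w: "square_integrable M w"
    by (auto simp: square_integrable_def intro!: integrableI_bounded)
  have "0 \<le> B" using B[of 0] L2_sq_nonneg[of M "u 0"] by linarith
  then show "L2_sq M w \<le> B" using le by (simp add: nn_integral_norm_sq[OF w])
qed

theorem Riesz_Fischer:
  assumes u: "\<And>n. square_integrable M (u n)"
    and Cauchy: "\<And>e. e > 0 \<Longrightarrow> \<exists>N. \<forall>m\<ge>N. \<forall>n\<ge>N. L2_sq M (\<lambda>x. u m x - u n x) \<le> e"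
  obtains w where "square_integrable M w" "(\<lambda>n. L2_sq M (\<lambda>x. u n x - w x)) \<longlonglongrightarrow> 0"
proof -
  have [measurable]: "u n \<in> borel_measurable M" for n
    using u by (auto simp: square_integrable_def)
  \<comment> \<open>A subsequence along which the squared distances decay like
    \<open>(1/4)^k\<close>, fast enough to survive the weights used next.\<close>
  have "\<exists>r. \<forall>k. (\<forall>m\<ge>r k. \<forall>n\<ge>r k. L2_sq M (\<lambda>x. u m x - u n x) \<le> (1/4)^k) \<and> r k < r (Suc k)"
  proof (rule dependent_nat_choice)
    show "\<exists>N. \<forall>m\<ge>N. \<forall>n\<ge>N. L2_sq M (\<lambda>x. u m x - u n x) \<le> (1/4)^0"
      using Cauchy[of 1] by simp
    fix N k
    obtain N' where N': "\<forall>m\<ge>N'. \<forall>n\<ge>N'. L2_sq M (\<lambda>x. u m x - u n x) \<le> (1/4)^Suc k"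
      using Cauchy[of "(1/4)^Suc k"] by auto
    then show "\<exists>N''. (\<forall>m\<ge>N''. \<forall>n\<ge>N''. L2_sq M (\<lambda>x. u m x - u n x) \<le> (1/4)^Suc k) \<and> N < N''"
      by (intro exI[of _ "max N' (Suc N)"]) auto
  qed
  then obtain r where r: "\<And>k m n. m \<ge> r k \<Longrightarrow> n \<ge> r k \<Longrightarrow> L2_sq M (\<lambda>x. u m x - u n x) \<le> (1/4)^k"
    and rs: "strict_mono r" by (auto simp: strict_mono_Suc_iff)
  define d where "d k x = u (r (Suc k)) x - u (r k) x" for k x
  have d: "square_integrable M (d k)" for k
    unfolding d_def by (intro square_integrable_diff u)
  have [measurable]: "d k \<in> borel_measurable M" for k
    using d by (auto simp: square_integrable_def)
  have dk: "L2_sq M (d k) \<le> (1/4)^k" for k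
    unfolding d_def using rs by (intro r) (auto simp: strict_mono_def less_imp_le)
  \<comment> \<open>The weights \<open>2^k\<close> still leave a convergent series, and finiteness
    of the weighted sum at \<open>x\<close> forces \<open>norm (d k x)\<close> to decay
    geometrically, which makes the telescoping series converge at \<open>x\<close>.\<close>
  have "(\<integral>\<^sup>+x. (\<Sum>k. ennreal (2^k * (norm (d k x))\<^sup>2)) \<partial>M) = (\<Sum>k. \<integral>\<^sup>+x. ennreal (2^k * (norm (d k x))\<^sup>2) \<partial>M)"
    by (rule nn_integral_suminf) simp
  also have "\<dots> = (\<Sum>k. ennreal (2^k * L2_sq M (d k)))"
    by (simp add: ennreal_mult nn_integral_cmult nn_integral_norm_sq[OF d])
  also have "\<dots> \<le> (\<Sum>k. ennreal ((1/2)^k))"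
  proof (intro suminf_le allI ennreal_leI)
    fix k show "2^k * L2_sq M (d k) \<le> (1/2)^k"
      using mult_left_mono[OF dk[of k], of "2^k"] by (simp add: power_mult_distrib[symmetric])
  qed auto
  also have "\<dots> = ennreal (\<Sum>k. (1/2)^k)"
    by (rule suminf_ennreal2) (auto intro: summable_geometric)
  finally have "(\<integral>\<^sup>+x. (\<Sum>k. ennreal (2^k * (norm (d k x))\<^sup>2)) \<partial>M) \<noteq> \<infinity>"
    by (auto simp: top_unique)
  then have "AE x in M. (\<Sum>k. ennreal (2^k * (norm (d k x))\<^sup>2)) \<noteq> \<infinity>"
    by (intro nn_integral_PInf_AE) auto
  then have conv: "AE x in M. convergent (\<lambda>k. u (r k) x)"
  proof eventually_elim
    fix x assume fin: "(\<Sum>k. ennreal (2^k * (norm (d k x))\<^sup>2)) \<noteq> \<infinity>"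
    define B where "B = enn2real (\<Sum>k. ennreal (2^k * (norm (d k x))\<^sup>2))"
    have B: "2^k * (norm (d k x))\<^sup>2 \<le> B" for k
    proof -
      have "ennreal (2^k * (norm (d k x))\<^sup>2) \<le> (\<Sum>k. ennreal (2^k * (norm (d k x))\<^sup>2))"
      proof -
        have "c k \<le> (\<Sum>k. c k)" for c :: "nat \<Rightarrow> ennreal"
          using sum_le_suminf[of c "{k}"] by simp
        then show ?thesis .
      qed
      also have "\<dots> = ennreal B"
        using fin unfolding B_def by (simp add: less_top)
      finally show ?thesis
        unfolding B_def by (subst (asm) ennreal_le_iff) simp_all
    qed
    have nd: "norm (d k x) \<le> sqrt B * (sqrt (1/2))^k" for k
    proof -
      have "(norm (d k x))\<^sup>2 \<le> B * (1/2)^k"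
        using B[of k] by (simp add: field_simps power_divide)
      then have "sqrt ((norm (d k x))\<^sup>2) \<le> sqrt (B * (1/2)^k)" by (rule real_sqrt_le_mono)
      then show ?thesis by (simp add: real_sqrt_mult real_sqrt_power)
    qed
    have "summable (\<lambda>k. sqrt B * (sqrt (1/2))^k)"
      by (intro summable_mult summable_geometric) (simp add: real_sqrt_divide)
    then have "summable (\<lambda>k. d k x)"
      by (rule summable_comparison_test') (use nd in auto)
    then have "convergent (\<lambda>n. \<Sum>k<n. u (r (Suc k)) x - u (r k) x)"
      by (simp add: summable_iff_convergent d_def)
    then have "convergent (\<lambda>n. u (r n) x - u (r 0) x)"
      by (simp add: sum_lessThan_telescope[of "\<lambda>k. u (r k) x"])
    then show "convergent (\<lambda>k. u (r k) x)"
      using convergent_add[OF _ convergent_const[of "u (r 0) x"]] by fastforce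
  qed
  define w where "w x = lim (\<lambda>k. u (r k) x)" for x
  have [measurable]: "w \<in> borel_measurable M"
    unfolding w_def by (rule borel_measurable_lim_metric) simp
  have lim: "AE x in M. (\<lambda>k. u (r k) x) \<longlonglongrightarrow> w x"
    using conv by eventually_elim (simp add: w_def convergent_LIMSEQ_iff)
  \<comment> \<open>Fatou's lemma along the subsequence for a fixed \<open>n\<close>. It controls
    the whole sequence and shows that \<open>u n - w\<close> is square integrable, from which the
    same follows for \<open>w\<close>.\<close>
  have diff: "square_integrable M (\<lambda>x. u n x - w x) \<and> L2_sq M (\<lambda>x. u n x - w x) \<le> (1/4)^k"
    if "n \<ge> r k" for n k
  proof -
    have lim': "AE x in M. (\<lambda>j. u n x - u (r (j + k)) x) \<longlonglongrightarrow> u n x - w x"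
      using lim
    proof eventually_elim
      fix x assume "(\<lambda>k. u (r k) x) \<longlonglongrightarrow> w x"
      then have "(\<lambda>j. u (r (j + k)) x) \<longlonglongrightarrow> w x" by (rule LIMSEQ_ignore_initial_segment)
      then show "(\<lambda>j. u n x - u (r (j + k)) x) \<longlonglongrightarrow> u n x - w x" by (intro tendsto_intros)
    qed
    have B: "L2_sq M (\<lambda>x. u n x - u (r (j + k)) x) \<le> (1/4)^k" for j
      using that rs by (intro r) (auto simp: strict_mono_less_eq)
    show ?thesis
      using square_integrable_limit[OF square_integrable_diff[OF u u] _ B lim'] by simp
  qed
  have "square_integrable M (\<lambda>x. u (r 0) x - (u (r 0) x - w x))"
    by (intro square_integrable_diff u conjunct1[OF diff]) auto
  then have w: "square_integrable M w" by simp
  have "(\<lambda>n. L2_sq M (\<lambda>x. u n x - w x)) \<longlonglongrightarrow> 0"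
  proof (rule LIMSEQ_I)
    fix e :: real assume "e > 0"
    then obtain k where "(1/4)^k < e" using real_arch_pow_inv[of e "1/4"] by auto
    then show "\<exists>no. \<forall>n\<ge>no. norm (L2_sq M (\<lambda>x. u n x - w x) - 0) < e"
      using diff[of k] by (intro exI[of _ "r k"]) (auto intro: le_less_trans)
  qed
  with w that show ?thesis by blast
qed

section \<open>The Hardy space of the disc in terms of Taylor coefficients\<close>

abbreviation circle_measure :: "real measure" where
  "circle_measure \<equiv> lebesgue_on {0..2*pi}"

lemma finite_measure_circle: "finite_measure circle_measure"
  by (rule finite_measure_lebesgue_on) simp

lemma continuous_square_integrable_circle:
  fixes u :: "real \<Rightarrow> complex"
  assumes "continuous_on {0..2*pi} u" shows "square_integrable circle_measure u"
proof -
  have "(\<lambda>x. (norm (u x))\<^sup>2) integrable_on {0..2*pi}"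
    by (intro integrable_continuous_interval continuous_intros assms)
  moreover have "continuous_on {0..2*pi} (\<lambda>x. (norm (u x))\<^sup>2)"
    by (intro continuous_intros assms)
  ultimately show ?thesis
    unfolding square_integrable_def
    by (auto intro!: continuous_imp_measurable_on_sets_lebesgue assms
        absolutely_integrable_imp_integrable absolutely_integrable_continuous_real)
qed

lemma square_integrable_cis: "square_integrable circle_measure (\<lambda>t. cis (c * t))"
  by (intro continuous_square_integrable_circle continuous_intros)

lemma L2_inner_circle_eq: "L2_inner_circle u v = L2_ip circle_measure (\<lambda>t. u (cis t)) (\<lambda>t. v (cis t))"
  unfolding L2_inner_circle_def L2_ip_def
  by (simp add: integral_restrict_space set_lebesgue_integral_def)

lemma integral_circle_cis:
  "(LINT t|circle_measure. cis (of_int n * t)) = (if n = 0 then 2 * pi else 0)"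
proof (cases "n = 0")
  case False
  have "((\<lambda>t. cis (of_int n * t)) has_integral
      (cis (of_int n * (2*pi)) / (\<i> * of_int n) - cis (of_int n * 0) / (\<i> * of_int n))) {0..2*pi}"
  proof (rule fundamental_theorem_of_calculus)
    fix t :: real
    have "((\<lambda>z. exp (\<i> * of_int n * z) / (\<i> * of_int n)) has_field_derivative
       exp (\<i> * of_int n * of_real t)) (at (of_real t))"
      using False by (auto intro!: derivative_eq_intros)
    from has_vector_derivative_real_field[OF this]
    show "((\<lambda>t. cis (of_int n * t) / (\<i> * of_int n)) has_vector_derivative
       cis (of_int n * t)) (at t within {0..2*pi})"
      by (simp add: cis_conv_exp mult.assoc has_vector_derivative_at_within)
  qed auto
  moreover have "cis (of_int n * (2*pi)) = 1"
    using cis_multiple_2pi[of "of_int n"] by (simp add: mult.commute mult.left_commute)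
  ultimately have "integral {0..2*pi} (\<lambda>t. cis (of_int n * t)) = 0"
    by (simp add: integral_unique)
  moreover have "integrable circle_measure (\<lambda>t. cis (of_int n * t))"
    by (intro absolutely_integrable_imp_integrable absolutely_integrable_continuous_real continuous_intros) auto
  ultimately show ?thesis
    using False by (subst lebesgue_integral_eq_integral) auto
qed (simp add: measure_restrict_space scaleR_conv_of_real)

lemma mult_cnj_eq_norm_sq: "z * cnj z = (of_real (norm z))\<^sup>2"
  by (metis complex_norm_square of_real_power)

lemma norm_term_cis [simp]: "norm (c * cis t) = norm c"
  by (simp add: norm_mult)

lemma summable_cis:
  fixes a :: "nat \<Rightarrow> complex"
  assumes "summable (\<lambda>n. norm (a n))" shows "summable (\<lambda>n. a n * cis (real n * t))"
  by (rule summable_norm_cancel) (use assms in simp)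

lemma continuous_cis_series:
  fixes a :: "nat \<Rightarrow> complex"
  assumes "summable (\<lambda>n. norm (a n))" 
  shows "continuous_on S (\<lambda>t. \<Sum>n. a n * cis (real n * t))"
proof (rule uniform_limit_theorem)
  show "\<forall>\<^sub>F n in sequentially. continuous_on S (\<lambda>t. \<Sum>k<n. a k * cis (real k * t))"
    by (intro always_eventually allI continuous_intros)
  show "uniform_limit S (\<lambda>n t. \<Sum>k<n. a k * cis (real k * t)) (\<lambda>t. \<Sum>n. a n * cis (real n * t)) sequentially"
    by (rule Weierstrass_m_test) (use assms in auto)
qed simp

text \<open>Integrating term by term leaves only the index \<open>n = k\<close>, which does not
  occur for negative \<open>k\<close>.\<close>

lemma cis_series_coeff:
  fixes a :: "nat \<Rightarrow> complex"
  assumes a: "summable (\<lambda>n. norm (a n))"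
  shows "L2_ip circle_measure (\<lambda>t. \<Sum>n. a n * cis (real n * t)) (\<lambda>t. cis (of_int k * t)) =
           2 * pi * (if k \<ge> 0 then a (nat k) else 0)"
proof -
  have eq: "(\<Sum>n. a n * cis (real n * t)) * cnj (cis (of_int k * t)) = (\<Sum>n. a n * cis (of_int (int n - k) * t))" for t
    using suminf_mult2[OF summable_cis[OF a], of t "cnj (cis (of_int k * t))"]
    by (simp add: cis_cnj mult.assoc cis_mult algebra_simps)
  have "L2_ip circle_measure (\<lambda>t. \<Sum>n. a n * cis (real n * t)) (\<lambda>t. cis (of_int k * t))
      = (LINT t|circle_measure. (\<Sum>n. a n * cis (of_int (int n - k) * t)))"
    unfolding L2_ip_def eq ..
  also have "\<dots> = (\<Sum>n. (LINT t|circle_measure. a n * cis (of_int (int n - k) * t)))"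
  proof (rule integral_suminf)
    show "integrable circle_measure (\<lambda>t. a n * cis (of_int (int n - k) * t))" for n
      by (intro absolutely_integrable_imp_integrable absolutely_integrable_continuous_real continuous_intros) auto
    show "AE t in circle_measure. summable (\<lambda>n. norm (a n * cis (of_int (int n - k) * t)))"
      using a by simp
    show "summable (\<lambda>n. LINT t|circle_measure. norm (a n * cis (of_int (int n - k) * t)))"
      using summable_mult2[OF a, of "2*pi"] by (simp add: measure_restrict_space mult.commute)
  qed
  also have "\<dots> = (\<Sum>n. if int n = k then a n * (2 * pi) else 0)"
    by (rule suminf_cong) (simp add: integral_circle_cis del: of_int_diff)
  also have "\<dots> = 2 * pi * (if k \<ge> 0 then a (nat k) else 0)"
  proof (cases "k \<ge> 0")
    case True
    have "(\<Sum>n. if int n = k then a n * (2 * pi) else 0) = (\<Sum>n\<in>{nat k}. if int n = k then a n * (2 * pi) else 0)"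
      by (rule suminf_finite) (use True in auto)
    then show ?thesis using True by simp
  next
    case False
    then have "\<And>n. int n \<noteq> k" by auto
    then show ?thesis using False by simp
  qed
  finally show ?thesis .
qed

text \<open>Expanding only the second series reduces the claim to the Fourier coefficients of the
  first, so that no double series appears.\<close>

lemma cis_series_Parseval:
  fixes a b :: "nat \<Rightarrow> complex"
  assumes a: "summable (\<lambda>n. norm (a n))" and b: "summable (\<lambda>n. norm (b n))"
  shows "L2_ip circle_measure (\<lambda>t. \<Sum>n. a n * cis (real n * t)) (\<lambda>t. \<Sum>n. b n * cis (real n * t))
     = 2 * pi * (\<Sum>n. a n * cnj (b n))"
proof -
  let ?u = "\<lambda>t. \<Sum>n. a n * cis (real n * t)"
  have u: "continuous_on {0..2*pi} ?u" by (rule continuous_cis_series[OF a])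
  then obtain B where B: "\<And>t. t \<in> {0..2*pi} \<Longrightarrow> norm (?u t) \<le> B"
    using compact_continuous_image[OF u] by (meson compact_Icc compact_imp_bounded bounded_iff imageI)
  have B0: "0 \<le> B" using B[of 0] norm_ge_zero[of "?u 0"] by (smt (verit) atLeastAtMost_iff pi_gt_zero)
  have eq: "?u t * cnj (\<Sum>n. b n * cis (real n * t)) = (\<Sum>n. cnj (b n) * (?u t * cnj (cis (of_int (int n) * t))))" for t
  proof -
    have "cnj (\<Sum>n. b n * cis (real n * t)) = (\<Sum>n. cnj (b n * cis (real n * t)))"
      using bounded_linear.suminf[OF bounded_linear_cnj summable_cis[OF b]] by simp
    moreover have "summable (\<lambda>n. cnj (b n * cis (real n * t)))"
      by (rule bounded_linear.summable[OF bounded_linear_cnj summable_cis[OF b]])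
    ultimately have "?u t * cnj (\<Sum>n. b n * cis (real n * t)) = (\<Sum>n. ?u t * cnj (b n * cis (real n * t)))"
      by (simp add: suminf_mult)
    then show ?thesis by (simp add: mult_ac)
  qed
  have "L2_ip circle_measure ?u (\<lambda>t. \<Sum>n. b n * cis (real n * t)) =
     (LINT t|circle_measure. (\<Sum>n. cnj (b n) * (?u t * cnj (cis (of_int (int n) * t)))))"
    unfolding L2_ip_def eq ..
  also have "\<dots> = (\<Sum>n. (LINT t|circle_measure. cnj (b n) * (?u t * cnj (cis (of_int (int n) * t)))))"
  proof (rule integral_suminf)
    have cont: "continuous_on {0..2*pi} (\<lambda>t. ?u t * cnj (cis (of_int (int n) * t)))" for n
      by (intro continuous_intros u)
    then have int: "integrable circle_measure (\<lambda>t. ?u t * cnj (cis (of_int (int n) * t)))" for n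
      by (intro absolutely_integrable_imp_integrable absolutely_integrable_continuous_real) auto
    then show "integrable circle_measure (\<lambda>t. cnj (b n) * (?u t * cnj (cis (of_int (int n) * t))))" for n
      by (intro integrable_mult_right)
    show "AE t in circle_measure. summable (\<lambda>n. norm (cnj (b n) * (?u t * cnj (cis (of_int (int n) * t)))))"
      using summable_mult2[OF b] by (simp add: norm_mult)
    have "(LINT t|circle_measure. norm (cnj (b n) * (?u t * cnj (cis (of_int (int n) * t))))) \<le> norm (b n) * (2 * pi * B)" for n
    proof -
      have "(LINT t|circle_measure. norm (cnj (b n) * (?u t * cnj (cis (of_int (int n) * t))))) \<le> (LINT t|circle_measure. norm (b n) * B)"
      proof (rule integral_mono)
        show "integrable circle_measure (\<lambda>t. norm (cnj (b n) * (?u t * cnj (cis (of_int (int n) * t)))))"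
          by (intro integrable_norm integrable_mult_right int)
        show "integrable circle_measure (\<lambda>t. norm (b n) * B)"
          using finite_measure.integrable_const[OF finite_measure_circle] by blast
      qed (use B in \<open>auto simp: norm_mult intro!: mult_left_mono\<close>)
      also have "\<dots> = norm (b n) * (2 * pi * B)" by (simp add: measure_restrict_space)
      finally show ?thesis .
    qed
    then show "summable (\<lambda>n. LINT t|circle_measure. norm (cnj (b n) * (?u t * cnj (cis (of_int (int n) * t)))))"
      by (intro summable_comparison_test'[OF summable_mult2[OF b, of "2 * pi * B"]]) simp
  qed
  also have "\<dots> = (\<Sum>n. 2 * pi * (a n * cnj (b n)))"
    using cis_series_coeff[OF a, of "int n" for n]
    by (simp add: L2_ip_def mult_ac)
  also have "\<dots> = 2 * pi * (\<Sum>n. a n * cnj (b n))"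
  proof (rule suminf_mult)
    have "bounded (range (\<lambda>n. norm (a n)))"
      using summable_LIMSEQ_zero[OF a] convergent_imp_bounded by blast
    then obtain C where C: "\<And>n. norm (a n) \<le> C" by (auto simp: bounded_iff)
    show "summable (\<lambda>n. a n * cnj (b n))"
      by (rule summable_comparison_test'[OF summable_mult[OF b, of C]])
        (use C in \<open>auto simp: norm_mult intro!: mult_right_mono\<close>)
  qed
  finally show ?thesis .
qed

section \<open>Trigonometric polynomials and their L2 limits\<close>

definition trig :: "(nat \<Rightarrow> complex) \<Rightarrow> nat \<Rightarrow> real \<Rightarrow> complex" where
  "trig a N t = (\<Sum>n<N. a n * cis (real n * t))"

lemma square_integrable_trig: "square_integrable circle_measure (trig a N)"
  unfolding trig_def by (intro continuous_square_integrable_circle continuous_intros)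

lemma trig_eq_series: "trig a N t = (\<Sum>n. (if n < N then a n else 0) * cis (real n * t))"
proof -
  have "(\<Sum>n. (if n < N then a n else 0) * cis (real n * t)) = (\<Sum>n<N. (if n < N then a n else 0) * cis (real n * t))"
    by (rule suminf_finite) auto
  then show ?thesis by (simp add: trig_def)
qed

lemma summable_cut: "summable (\<lambda>n. norm (if n < N then a n else (0::complex)))"
  by (rule summable_finite[of "{..<N}"]) auto

lemma L2_ip_trig: "L2_ip circle_measure (trig a N) (trig b M) = 2 * pi * (\<Sum>n<min N M. a n * cnj (b n))"
proof -
  have "L2_ip circle_measure (trig a N) (trig b M) = 
     2 * pi * (\<Sum>n. (if n < N then a n else 0) * cnj (if n < M then b n else 0))"
    using cis_series_Parseval[OF summable_cut summable_cut, of N a M b]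
    unfolding trig_eq_series[symmetric] .
  also have "(\<Sum>n. (if n < N then a n else 0) * cnj (if n < M then b n else 0)) = 
     (\<Sum>n<min N M. (if n < N then a n else 0) * cnj (if n < M then b n else 0))"
    by (rule suminf_finite) auto
  finally show ?thesis by simp
qed

lemma L2_ip_trig_cis:
  fixes a :: "nat \<Rightarrow> complex"
  shows "L2_ip circle_measure (trig a N) (\<lambda>t. cis (of_int k * t)) =
   2 * pi * (if k \<ge> 0 \<and> k < int N then a (nat k) else 0)"
  using cis_series_coeff[OF summable_cut, of N a k]
  unfolding trig_eq_series[symmetric] by (auto simp: nat_less_iff)

lemma L2_sq_trig: "L2_sq circle_measure (trig a N) = 2 * pi * (\<Sum>n<N. (norm (a n))\<^sup>2)"
proof -
  have "complex_of_real (L2_sq circle_measure (trig a N)) = of_real (2 * pi * (\<Sum>n<N. (norm (a n))\<^sup>2))"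
    unfolding L2_ip_self[symmetric] L2_ip_trig
    by (simp add: mult_cnj_eq_norm_sq)
  then show ?thesis unfolding of_real_eq_iff .
qed

lemma L2_sq_trig_diff:
  assumes "M \<le> N"
  shows "L2_sq circle_measure (\<lambda>t. trig a N t - trig a M t) = 2 * pi * (\<Sum>n\<in>{M..<N}. (norm (a n))\<^sup>2)"
proof -
  define c where "c n = (if n \<ge> M then a n else 0)" for n
  have "trig a N t - trig a M t = trig c N t" for t
  proof -
    have "{..<N} = {..<M} \<union> {M..<N}" using assms by auto
    moreover have "(\<Sum>n<M. c n * cis (real n * t)) = 0" by (rule sum.neutral) (auto simp: c_def)
    moreover have "(\<Sum>n=M..<N. c n * cis (real n * t)) = (\<Sum>n=M..<N. a n * cis (real n * t))"
      by (rule sum.cong) (auto simp: c_def)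
    ultimately show ?thesis by (simp add: trig_def sum.union_disjoint ivl_disj_int)
  qed
  then have "L2_sq circle_measure (\<lambda>t. trig a N t - trig a M t) = 2 * pi * (\<Sum>n<N. (norm (c n))\<^sup>2)"
    by (simp add: L2_sq_trig)
  also have "(\<Sum>n<N. (norm (c n))\<^sup>2) = (\<Sum>n\<in>{M..<N}. (norm (c n))\<^sup>2)"
    by (rule sum.mono_neutral_right) (auto simp: c_def)
  also have "\<dots> = (\<Sum>n\<in>{M..<N}. (norm (a n))\<^sup>2)"
    by (rule sum.cong) (auto simp: c_def)
  finally show ?thesis .
qed

lemma L2_sq_minus_commute: "L2_sq M (\<lambda>x. u x - v x) = L2_sq M (\<lambda>x. v x - u x)"
  by (simp add: L2_sq_def norm_minus_commute)

definition l2 :: "(nat \<Rightarrow> complex) \<Rightarrow> bool" where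
  "l2 a \<longleftrightarrow> summable (\<lambda>n. (norm (a n))\<^sup>2)"

text \<open>The L2 sum of the Fourier series. It is a choice within a class modulo null sets, so
  later identities for its values hold almost everywhere.\<close>

definition bdry :: "(nat \<Rightarrow> complex) \<Rightarrow> real \<Rightarrow> complex" where
  "bdry a = (SOME u. square_integrable circle_measure u \<and>
      (\<lambda>N. L2_sq circle_measure (\<lambda>t. trig a N t - u t)) \<longlonglongrightarrow> 0)"

lemma bdry:
  assumes "l2 a"
  shows "square_integrable circle_measure (bdry a)"
    and "(\<lambda>N. L2_sq circle_measure (\<lambda>t. trig a N t - bdry a t)) \<longlonglongrightarrow> 0"
proof -
  have "\<exists>u. square_integrable circle_measure u \<and>
      (\<lambda>N. L2_sq circle_measure (\<lambda>t. trig a N t - u t)) \<longlonglongrightarrow> 0"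
  proof (rule Riesz_Fischer)
    show "square_integrable circle_measure (trig a n)" for n by (rule square_integrable_trig)
    fix e :: real assume e: "e > 0"
    have "summable (\<lambda>n. 2 * pi * (norm (a n))\<^sup>2)"
      using assms by (simp add: l2_def)
    then obtain N where N: "\<And>m n. m \<ge> N \<Longrightarrow> norm (\<Sum>k\<in>{m..<n}. 2 * pi * (norm (a k))\<^sup>2) < e"
      using e unfolding summable_Cauchy by blast
    have *: "L2_sq circle_measure (\<lambda>t. trig a n t - trig a m t) \<le> e" if "m \<ge> N" "m \<le> n" for m n
      using N[OF that(1), of n] L2_sq_trig_diff[OF that(2), of a] by (simp add: sum_distrib_left)
    show "\<exists>N. \<forall>m\<ge>N. \<forall>n\<ge>N. L2_sq circle_measure (\<lambda>t. trig a m t - trig a n t) \<le> e"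
    proof (intro exI allI impI)
      fix m n assume "N \<le> m" "N \<le> n"
      then show "L2_sq circle_measure (\<lambda>t. trig a m t - trig a n t) \<le> e"
        using *[of m n] *[of n m] L2_sq_minus_commute[of circle_measure "trig a m" "trig a n"]
        by (cases "m \<le> n") auto
    qed
  qed blast
  then have "square_integrable circle_measure (bdry a) \<and>
      (\<lambda>N. L2_sq circle_measure (\<lambda>t. trig a N t - bdry a t)) \<longlonglongrightarrow> 0"
    unfolding bdry_def by (rule someI_ex)
  then show "square_integrable circle_measure (bdry a)"
    and "(\<lambda>N. L2_sq circle_measure (\<lambda>t. trig a N t - bdry a t)) \<longlonglongrightarrow> 0" by auto
qed

lemma l2_summable_mult:
  assumes a: "l2 a" and b: "l2 b" shows "summable (\<lambda>n. norm (a n * cnj (b n)))"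
proof (rule summable_comparison_test')
  show "summable (\<lambda>n. (norm (a n))\<^sup>2 + (norm (b n))\<^sup>2)"
    using assms by (auto simp: l2_def intro: summable_add)
  fix n :: nat
  show "norm (norm (a n * cnj (b n))) \<le> (norm (a n))\<^sup>2 + (norm (b n))\<^sup>2"
    using zero_le_power2[of "norm (a n) - norm (b n)"] mult_nonneg_nonneg[OF norm_ge_zero[of "a n"] norm_ge_zero[of "b n"]]
    unfolding power2_diff by (simp add: norm_mult; linarith)
qed

lemma L2_ip_bdry:
  assumes a: "l2 a" and b: "l2 b"
  shows "L2_ip circle_measure (bdry a) (bdry b) = 2 * pi * (\<Sum>n. a n * cnj (b n))"
proof -
  \<comment> \<open>The limit is taken in one argument at a time. With \<open>N\<close> fixed the
    inner products no longer change once \<open>M\<close> reaches \<open>N\<close>.\<close>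
  have 1: "L2_ip circle_measure (bdry b) (trig a N) = 2 * pi * cnj (\<Sum>n<N. a n * cnj (b n))" for N
  proof (rule LIMSEQ_unique)
    show "(\<lambda>M. L2_ip circle_measure (trig b M) (trig a N)) \<longlonglongrightarrow> L2_ip circle_measure (bdry b) (trig a N)"
      by (rule L2_ip_tendsto_left) (auto intro: square_integrable_trig bdry b)
    have "L2_ip circle_measure (trig b M) (trig a N) = 2 * pi * cnj (\<Sum>n<N. a n * cnj (b n))" if "M \<ge> N" for M
      using that unfolding L2_ip_trig by (simp add: min_absorb2 mult.commute)
    then show "(\<lambda>M. L2_ip circle_measure (trig b M) (trig a N)) \<longlonglongrightarrow> 2 * pi * cnj (\<Sum>n<N. a n * cnj (b n))"
      by (intro tendsto_eventually eventually_sequentiallyI[of N])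
  qed
  have "L2_ip circle_measure (trig a N) (bdry b) = 2 * pi * (\<Sum>n<N. a n * cnj (b n))" for N
    unfolding L2_ip_commute[of _ _ "bdry b"] 1 by simp
  moreover have "(\<lambda>N. L2_ip circle_measure (trig a N) (bdry b)) \<longlonglongrightarrow> L2_ip circle_measure (bdry a) (bdry b)"
    by (rule L2_ip_tendsto_left) (auto intro: square_integrable_trig bdry a b)
  ultimately have "(\<lambda>N. 2 * pi * (\<Sum>n<N. a n * cnj (b n))) \<longlonglongrightarrow> L2_ip circle_measure (bdry a) (bdry b)"
    by simp
  moreover have "(\<lambda>N. 2 * pi * (\<Sum>n<N. a n * cnj (b n))) \<longlonglongrightarrow> 2 * pi * (\<Sum>n. a n * cnj (b n))"
    by (intro tendsto_intros summable_LIMSEQ summable_norm_cancel[OF l2_summable_mult[OF a b]])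
  ultimately show ?thesis by (rule LIMSEQ_unique)
qed

text \<open>The vanishing at negative \<open>k\<close> is what later separates the two halves of the
  symbol in Nehari's theorem.\<close>

lemma L2_ip_bdry_cis:
  fixes a :: "nat \<Rightarrow> complex"
  assumes a: "l2 a"
  shows "L2_ip circle_measure (bdry a) (\<lambda>t. cis (of_int k * t)) = 2 * pi * (if k \<ge> 0 then a (nat k) else 0)"
proof (rule LIMSEQ_unique)
  show "(\<lambda>N. L2_ip circle_measure (trig a N) (\<lambda>t. cis (of_int k * t))) \<longlonglongrightarrow> L2_ip circle_measure (bdry a) (\<lambda>t. cis (of_int k * t))"
    by (rule L2_ip_tendsto_left)
      (auto intro: square_integrable_trig bdry[OF a] intro: square_integrable_cis)
  show "(\<lambda>N. L2_ip circle_measure (trig a N) (\<lambda>t. cis (of_int k * t))) \<longlonglongrightarrow> 2 * pi * (if k \<ge> 0 then a (nat k) else 0)"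
    by (rule tendsto_eventually, rule eventually_sequentiallyI[of "Suc (nat k)"]) (auto simp: L2_ip_trig_cis)
qed

lemma L2_sq_bdry:
  assumes "l2 a" shows "L2_sq circle_measure (bdry a) = 2 * pi * (\<Sum>n. (norm (a n))\<^sup>2)"
proof -
  have "(\<Sum>n. a n * cnj (a n)) = of_real (\<Sum>n. (norm (a n))\<^sup>2)"
    using assms by (simp add: mult_cnj_eq_norm_sq suminf_of_real l2_def)
  then have "complex_of_real (L2_sq circle_measure (bdry a)) = of_real (2 * pi * (\<Sum>n. (norm (a n))\<^sup>2))"
    using L2_ip_bdry[OF assms assms] by (simp add: L2_ip_self)
  then show ?thesis unfolding of_real_eq_iff .
qed

section \<open>Power series with square summable coefficients\<close>

definition ps :: "(nat \<Rightarrow> complex) \<Rightarrow> complex \<Rightarrow> complex" where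
  "ps a z = (if norm z < 1 then (\<Sum>n. a n * z ^ n) else 0)"

lemma l2_summable_power:
  assumes a: "l2 a" and z: "norm z < 1"
  shows "summable (\<lambda>n. norm (a n * z ^ n))"
proof -
  have "(\<lambda>n. (norm (a n))\<^sup>2) \<longlonglongrightarrow> 0" using a unfolding l2_def by (rule summable_LIMSEQ_zero)
  then have "bounded (range (\<lambda>n. (norm (a n))\<^sup>2))" using convergent_imp_bounded by blast
  then obtain C where C: "\<And>n. (norm (a n))\<^sup>2 \<le> C" by (auto simp: bounded_iff)
  have C': "norm (a n) \<le> sqrt C" for n using C[of n] by (rule real_le_rsqrt)
  have "summable (\<lambda>n. sqrt C * norm z ^ n)"
    by (intro summable_mult summable_geometric) (use z in auto)
  then show ?thesis
    by (rule summable_comparison_test')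
      (use C' in \<open>auto simp: norm_mult norm_power intro!: mult_right_mono\<close>)
qed

lemma ps_holomorphic: assumes "l2 a" shows "ps a holomorphic_on unit_disc"
proof (rule power_series_holomorphic)
  fix w :: complex assume "w \<in> unit_disc"
  then show "(\<lambda>n. a n * (w - 0) ^ n) sums ps a w"
    using summable_norm_cancel[OF l2_summable_power[OF assms, of w]] by (simp add: ps_def summable_sums)
qed

lemma holomorphic_disc_series:
  assumes f: "f holomorphic_on unit_disc" and z: "norm z < 1"
  shows "(\<lambda>n. (deriv ^^ n) f 0 / fact n * z ^ n) sums f z"
  using holomorphic_power_series[OF f, of z] z by simp

lemma cis_power_mult: "(of_real r * cis t) ^ n = of_real (r ^ n) * cis (real n * t)"
  by (simp only: power_mult_distrib Complex.DeMoivre of_real_power)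

text \<open>Stated for any convergent expansion, so that it serves both \<open>ps a\<close> and
  Taylor series of functions not yet known to lie in the Hardy space.\<close>

lemma L2_sq_holomorphic_circle:
  assumes s: "\<And>z. norm z < 1 \<Longrightarrow> (\<lambda>n. a n * z ^ n) sums f z" and r: "0 \<le> r" "r < 1"
  shows "square_integrable circle_measure (\<lambda>t. f (of_real r * cis t))"
    and "summable (\<lambda>n. (norm (a n))\<^sup>2 * (r\<^sup>2) ^ n)"
    and "L2_sq circle_measure (\<lambda>t. f (of_real r * cis t)) = 2 * pi * (\<Sum>n. (norm (a n))\<^sup>2 * (r\<^sup>2) ^ n)"
proof -
  define c where "c n = a n * of_real (r ^ n)" for n
  \<comment> \<open>Convergence at a radius between \<open>r\<close> and 1 gives absolute
    convergence at \<open>r\<close>.\<close>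
  obtain R where R: "r < R" "R < 1" using r dense by blast
  have "summable (\<lambda>n. a n * of_real R ^ n)" using s[of "of_real R"] R r by (simp add: sums_iff)
  then have c: "summable (\<lambda>n. norm (c n))"
    unfolding c_def using R r powser_insidea[of a "of_real R" "of_real r"] by simp
  have f: "f (of_real r * cis t) = (\<Sum>n. c n * cis (real n * t))" for t
    using s[of "of_real r * cis t"] r by (simp add: norm_mult cis_power_mult c_def sums_iff mult.assoc)
  show "square_integrable circle_measure (\<lambda>t. f (of_real r * cis t))"
    unfolding f by (intro continuous_square_integrable_circle continuous_cis_series c)
  have nc: "(norm (c n))\<^sup>2 = (norm (a n))\<^sup>2 * (r\<^sup>2) ^ n" for n
    using r by (simp add: c_def norm_mult norm_power power_mult_distrib power_mult[symmetric] mult.commute)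
  have "summable (\<lambda>n. norm (c n) * norm (c n))"
  proof -
    have "bounded (range (\<lambda>n. norm (c n)))"
      using summable_LIMSEQ_zero[OF c] convergent_imp_bounded by blast
    then obtain C where C: "\<And>n. norm (c n) \<le> C" by (auto simp: bounded_iff)
    show ?thesis
      by (rule summable_comparison_test'[OF summable_mult[OF c, of C]])
        (use C in \<open>auto simp: intro!: mult_right_mono\<close>)
  qed
  then have sq: "summable (\<lambda>n. (norm (c n))\<^sup>2)" by (simp add: power2_eq_square)
  then show "summable (\<lambda>n. (norm (a n))\<^sup>2 * (r\<^sup>2) ^ n)" by (simp add: nc)
  have "of_real (L2_sq circle_measure (\<lambda>t. f (of_real r * cis t))) = 2 * pi * (\<Sum>n. c n * cnj (c n))"
    unfolding L2_ip_self[symmetric] f by (rule cis_series_Parseval[OF c c])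
  also have "(\<Sum>n. c n * cnj (c n)) = of_real (\<Sum>n. (norm (c n))\<^sup>2)"
    using sq by (simp add: mult_cnj_eq_norm_sq suminf_of_real)
  finally have "of_real (L2_sq circle_measure (\<lambda>t. f (of_real r * cis t))) = complex_of_real (2 * pi * (\<Sum>n. (norm (c n))\<^sup>2))"
    by simp
  then show "L2_sq circle_measure (\<lambda>t. f (of_real r * cis t)) = 2 * pi * (\<Sum>n. (norm (a n))\<^sup>2 * (r\<^sup>2) ^ n)"
    unfolding of_real_eq_iff nc .
qed

lemma L2_sq_circle_mono:
  assumes f: "f holomorphic_on unit_disc" and r: "0 \<le> r" "r \<le> R" "R < 1"
  shows "L2_sq circle_measure (\<lambda>t. f (of_real r * cis t)) \<le> L2_sq circle_measure (\<lambda>t. f (of_real R * cis t))"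
proof -
  note series = holomorphic_disc_series[OF f]
  note 1 = L2_sq_holomorphic_circle[OF series, of r] and 2 = L2_sq_holomorphic_circle[OF series, of R]
  have "(\<Sum>k. (norm ((deriv ^^ k) f 0 / fact k))\<^sup>2 * (r\<^sup>2) ^ k) \<le> (\<Sum>k. (norm ((deriv ^^ k) f 0 / fact k))\<^sup>2 * (R\<^sup>2) ^ k)"
  proof (rule suminf_le[OF _ 1(2) 2(2)])
    show "(norm ((deriv ^^ k) f 0 / fact k))\<^sup>2 * (r\<^sup>2) ^ k \<le> (norm ((deriv ^^ k) f 0 / fact k))\<^sup>2 * (R\<^sup>2) ^ k" for k
      using r by (intro mult_left_mono power_mono) auto
  qed (use r in auto)
  then have "2 * pi * (\<Sum>k. (norm ((deriv ^^ k) f 0 / fact k))\<^sup>2 * (r\<^sup>2) ^ k) \<le> 2 * pi * (\<Sum>k. (norm ((deriv ^^ k) f 0 / fact k))\<^sup>2 * (R\<^sup>2) ^ k)"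
    by (intro mult_left_mono) auto
  then show ?thesis using 1(3) 2(3) r by auto
qed

lemma nn_integral_circle:
  "(\<integral>\<^sup>+t\<in>{0..2*pi}. f t \<partial>lborel) = (\<integral>\<^sup>+t. f t \<partial>circle_measure)"
  by (simp add: nn_integral_restrict_space nn_integral_completion)

lemma ps_sums: "l2 a \<Longrightarrow> norm z < 1 \<Longrightarrow> (\<lambda>n. a n * z ^ n) sums ps a z"
  using summable_norm_cancel[OF l2_summable_power[of a z]] by (simp add: ps_def summable_sums)

lemma ps_outside: "\<not> norm z < 1 \<Longrightarrow> ps a z = 0"
  by (simp add: ps_def)

lemma ps_in_H2_disc:
  assumes "l2 a" shows "ps a \<in> H2_disc"
proof -
  have "(\<integral>\<^sup>+t\<in>{0..2*pi}. ennreal ((norm (ps a (of_real r * cis t)))\<^sup>2) \<partial>lborel) \<le> ennreal (2 * pi * (\<Sum>n. (norm (a n))\<^sup>2))"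
    if r: "r \<in> {0<..<1}" for r
  proof -
    note * = L2_sq_holomorphic_circle[OF ps_sums[OF assms], of r]
    have "2 * pi * (\<Sum>n. (norm (a n))\<^sup>2 * (r\<^sup>2) ^ n) \<le> 2 * pi * (\<Sum>n. (norm (a n))\<^sup>2)"
      by (intro mult_left_mono suminf_le *(2))
        (use r assms in \<open>auto simp: l2_def intro!: mult_left_le power_le_one\<close>)
    then show ?thesis
      unfolding nn_integral_circle using r * by (simp add: nn_integral_norm_sq ennreal_leI)
  qed
  then have "(SUP r\<in>{0<..<1}. \<integral>\<^sup>+t\<in>{0..2*pi}. ennreal ((norm (ps a (of_real r * cis t)))\<^sup>2) \<partial>lborel)
     \<le> ennreal (2 * pi * (\<Sum>n. (norm (a n))\<^sup>2))"
    by (intro SUP_least)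
  also have "\<dots> < \<infinity>" by simp
  finally show ?thesis
    using ps_holomorphic[OF assms] by (simp add: H2_disc_def ps_outside)
qed

text \<open>The Taylor coefficients inherit the bound on the circle means. The explicit constant is
  kept because the factorization in Nehari's theorem depends on it.\<close>

lemma H2_discI_bound:
  assumes f: "f holomorphic_on unit_disc" and B: "\<And>r. 0 < r \<Longrightarrow> r < 1 \<Longrightarrow> L2_sq circle_measure (\<lambda>t. f (of_real r * cis t)) \<le> B"
  obtains a where "l2 a" "\<And>z. norm z < 1 \<Longrightarrow> f z = ps a z" "2 * pi * (\<Sum>n. (norm (a n))\<^sup>2) \<le> B"
proof -
  define a where "a n = (deriv ^^ n) f 0 / fact n" for n
  have s: "(\<lambda>n. a n * z ^ n) sums f z" if "norm z < 1" for z
    using holomorphic_disc_series[OF f that] by (simp add: a_def)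
  have 1: "(\<Sum>n<N. 2 * pi * ((norm (a n))\<^sup>2 * (r\<^sup>2) ^ n)) \<le> B" if r: "0 < r" "r < 1" for r N
  proof -
    note * = L2_sq_holomorphic_circle[OF s, of r]
    have "(\<Sum>n<N. 2 * pi * ((norm (a n))\<^sup>2 * (r\<^sup>2) ^ n)) \<le> (\<Sum>n. 2 * pi * ((norm (a n))\<^sup>2 * (r\<^sup>2) ^ n))"
      using r by (intro sum_le_suminf summable_mult *(2)) auto
    also have "\<dots> = 2 * pi * (\<Sum>n. (norm (a n))\<^sup>2 * (r\<^sup>2) ^ n)"
      using r by (intro suminf_mult *(2)) auto
    finally show ?thesis using B[OF r] *(3) r by simp
  qed
  \<comment> \<open>In a finite sum the radius may tend to 1; only afterwards does the number of
    terms grow.\<close>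
  have 2: "(\<Sum>n<N. 2 * pi * (norm (a n))\<^sup>2) \<le> B" for N
  proof (rule tendsto_upperbound)
    have "((\<lambda>r. \<Sum>n<N. 2 * pi * ((norm (a n))\<^sup>2 * (r\<^sup>2) ^ n)) \<longlongrightarrow> (\<Sum>n<N. 2 * pi * ((norm (a n))\<^sup>2 * (1\<^sup>2) ^ n))) (at_left 1)"
      by (intro tendsto_intros)
    then show "((\<lambda>r. \<Sum>n<N. 2 * pi * ((norm (a n))\<^sup>2 * (r\<^sup>2) ^ n)) \<longlongrightarrow> (\<Sum>n<N. 2 * pi * (norm (a n))\<^sup>2)) (at_left 1)"
      by simp
    show "\<forall>\<^sub>F r in at_left 1. (\<Sum>n<N. 2 * pi * ((norm (a n))\<^sup>2 * (r\<^sup>2) ^ n)) \<le> B"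
      by (rule eventually_mono[OF eventually_at_left_real[of 0 "1::real"]]) (use 1 in auto)
  qed simp
  have "summable (\<lambda>n. 2 * pi * (norm (a n))\<^sup>2)"
    by (rule bounded_imp_summable) (use 2[of "Suc n" for n] in \<open>auto simp: lessThan_Suc_atMost\<close>)
  then have sm: "summable (\<lambda>n. (norm (a n))\<^sup>2)"
    by (simp add: summable_cmult_iff)
  have "2 * pi * (\<Sum>n. (norm (a n))\<^sup>2) = (\<Sum>n. 2 * pi * (norm (a n))\<^sup>2)"
    by (rule suminf_mult[OF sm, symmetric])
  also have "\<dots> \<le> B"
    by (rule suminf_le_const) (use 2 sm in \<open>auto intro: summable_mult\<close>)
  finally show ?thesis
    using s sm by (intro that[of a]) (auto simp: l2_def ps_def sums_iff)
qed

lemma H2_disc_cases: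
  assumes "f \<in> H2_disc" obtains a where "l2 a" "f = ps a"
proof -
  have hol: "f holomorphic_on unit_disc" and out: "\<And>z. z \<notin> unit_disc \<Longrightarrow> f z = 0"
    using assms by (auto simp: H2_disc_def)
  define S where "S = (SUP r\<in>{0<..<1}. \<integral>\<^sup>+t\<in>{0..2*pi}. ennreal ((norm (f (of_real r * cis t)))\<^sup>2) \<partial>lborel)"
  have S: "S < \<infinity>" using assms by (simp add: H2_disc_def S_def)
  have "L2_sq circle_measure (\<lambda>t. f (of_real r * cis t)) \<le> enn2real S" if r: "0 < r" "r < 1" for r
  proof -
    have "(\<integral>\<^sup>+t\<in>{0..2*pi}. ennreal ((norm (f (of_real r * cis t)))\<^sup>2) \<partial>lborel) \<le> S"
      unfolding S_def using r by (intro SUP_upper) auto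
    then have "ennreal (L2_sq circle_measure (\<lambda>t. f (of_real r * cis t))) \<le> S"
      unfolding nn_integral_circle
      using r by (subst (asm) nn_integral_norm_sq) (auto intro!: L2_sq_holomorphic_circle holomorphic_disc_series[OF hol])
    then show ?thesis
      using S by (metis L2_sq_nonneg enn2real_ennreal enn2real_mono infinity_ennreal_def)
  qed
  then obtain a where a: "l2 a" "\<And>z. norm z < 1 \<Longrightarrow> f z = ps a z"
    using H2_discI_bound[OF hol] by metis
  have "f = ps a"
  proof
    fix z show "f z = ps a z"
      using a(2)[of z] out[of z] ps_outside[of z a] by (cases "norm z < 1") auto
  qed
  with a(1) that show ?thesis by blast
qed

section \<open>Fatou's theorem\<close>

lemma circlepath_integral:
  "contour_integral (circlepath 0 1) f = integral {0..2*pi} (\<lambda>t. f (cis t) * (\<i> * cis t))"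
proof -
  have "contour_integral (part_circlepath 0 1 0 (2*pi)) f = integral {0..2*pi} (\<lambda>t. f (0 + of_real 1 * cis t) * of_real 1 * \<i> * cis t)"
    by (rule contour_integral_part_circlepath_eq) simp
  then show ?thesis by (simp add: circlepath_def mult.assoc)
qed

text \<open>On the circle \<open>1 = cnj z * z\<close>. This compares the two kernels below and
  later shows that Blaschke factors have modulus 1 there.\<close>

lemma one_minus_cnj_mult:
  assumes "norm z = 1"
  shows "norm (1 - cnj w * z) = norm (z - w)"
proof -
  have "norm (1 - cnj w * z) = norm (cnj z * z - cnj w * z)"
    using assms complex_norm_square[of z] by (simp add: mult.commute)
  also have "\<dots> = norm (cnj (z - w)) * norm z" by (simp only: complex_cnj_diff left_diff_distrib norm_mult[symmetric])
  finally show ?thesis using assms by (simp del: complex_cnj_diff)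
qed

text \<open>Cauchy's formula for \<open>f z / (1 - cnj w * z)\<close>, which is holomorphic in the
  disc. On the circle \<open>(1 - cnj w * z) * (z - w)\<close> equals \<open>z\<close> times the
  squared distance from \<open>z\<close> to \<open>w\<close>, and the factor \<open>z\<close>
  cancels against the parametrization.\<close>

theorem Poisson_integral_formula:
  fixes f :: "complex \<Rightarrow> complex"
  assumes cont: "continuous_on (cball 0 1) f" and hol: "f holomorphic_on ball 0 1" and w: "norm w < 1"
  shows "integral {0..2*pi} (\<lambda>t. of_real ((1 - (norm w)\<^sup>2) / (norm (cis t - w))\<^sup>2) * f (cis t)) = 2 * pi * f w"
proof -
  define H where "H z = f z / (1 - cnj w * z)" for z
  have nz: "1 - cnj w * z \<noteq> 0" if "norm z \<le> 1" for z
  proof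
    assume "1 - cnj w * z = 0"
    then have "norm w * norm z = 1" by (metis complex_mod_cnj eq_iff_diff_eq_0 norm_mult norm_one)
    moreover have "norm w * norm z \<le> norm w" using that by (simp add: mult_left_le)
    ultimately show False using w by linarith
  qed
  have H: "continuous_on (cball 0 1) H" "H holomorphic_on ball 0 1"
    unfolding H_def using nz by (auto intro!: continuous_intros holomorphic_intros cont hol)
  have "contour_integral (circlepath 0 1) (\<lambda>u. H u / (u - w) ^ Suc 0) = 2 * pi * \<i> * H w"
    using Cauchy_contour_integral_circlepath[OF H, of w 0] w by simp
  moreover have "H (cis t) / (cis t - w) ^ Suc 0 * (\<i> * cis t) = \<i> * (f (cis t) / of_real ((norm (cis t - w))\<^sup>2))" for t
  proof -
    have nz': "cis t - w \<noteq> 0" using w by auto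
    have "cnj (1 - cnj w * cis t) * cis t = cis t - w"
      using complex_norm_square[of "cis t"] by (simp add: left_diff_distrib mult.assoc)
        (metis mult.commute mult.right_neutral mult.assoc)
    then have "H (cis t) / (cis t - w) ^ Suc 0 * (\<i> * cis t) = \<i> * (f (cis t) * cis t / ((1 - cnj w * cis t) * (cnj (1 - cnj w * cis t) * cis t)))"
      by (simp add: H_def)
    also have "\<dots> = \<i> * (f (cis t) / ((1 - cnj w * cis t) * cnj (1 - cnj w * cis t)))" by simp
    also have "(1 - cnj w * cis t) * cnj (1 - cnj w * cis t) = of_real ((norm (cis t - w))\<^sup>2)"
      unfolding complex_norm_square[symmetric] by (simp add: one_minus_cnj_mult)
    finally show ?thesis .
  qed
  ultimately have 1: "integral {0..2*pi} (\<lambda>t. \<i> * (f (cis t) / of_real ((norm (cis t - w))\<^sup>2))) = 2 * pi * \<i> * H w"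
    unfolding circlepath_integral by simp
  have "1 - cnj w * w = of_real (1 - (norm w)\<^sup>2)" 
    using complex_norm_square[of w] by (simp add: mult.commute)
  then have Hw: "of_real (1 - (norm w)\<^sup>2) * H w = f w"
    using nz[of w] w unfolding H_def by simp
  have "(\<lambda>t. of_real ((1 - (norm w)\<^sup>2) / (norm (cis t - w))\<^sup>2) * f (cis t)) =
     (\<lambda>t. (- \<i> * of_real (1 - (norm w)\<^sup>2)) * (\<i> * (f (cis t) / of_real ((norm (cis t - w))\<^sup>2))))"
    by (rule ext) (simp add: field_simps)
  then have "integral {0..2*pi} (\<lambda>t. of_real ((1 - (norm w)\<^sup>2) / (norm (cis t - w))\<^sup>2) * f (cis t)) =
     (- \<i> * of_real (1 - (norm w)\<^sup>2)) * (2 * pi * \<i> * H w)"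
    using 1 by (simp only: Henstock_Kurzweil_Integration.integral_mult_right[of _ "- \<i> * of_real (1 - (norm w)\<^sup>2)" "\<lambda>t. \<i> * (f (cis t) / of_real ((norm (cis t - w))\<^sup>2))"])
  also have "\<dots> = 2 * pi * (of_real (1 - (norm w)\<^sup>2) * H w)" by (simp add: algebra_simps)
  finally show ?thesis unfolding Hw by simp
qed

lemma continuous_on_Poisson_kernel:
  assumes "norm w < 1" shows "continuous_on S (\<lambda>t. (1 - (norm w)\<^sup>2) / (norm (cis t - w))\<^sup>2)"
  using assms by (auto intro!: continuous_intros)

lemma Poisson_kernel_integral:
  assumes w: "norm w < 1"
  shows "((\<lambda>t. (1 - (norm w)\<^sup>2) / (norm (cis t - w))\<^sup>2) has_integral 2 * pi) {0..2*pi}"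
proof -
  let ?P = "\<lambda>t. (1 - (norm w)\<^sup>2) / (norm (cis t - w))\<^sup>2"
  have int: "?P integrable_on {0..2*pi}"
    by (intro integrable_continuous_interval continuous_on_Poisson_kernel w)
  then have "((\<lambda>t. of_real (?P t)) has_integral complex_of_real (integral {0..2*pi} ?P)) {0..2*pi}"
    by (intro has_integral_of_real) (simp add: integrable_integral)
  then have "integral {0..2*pi} (\<lambda>t. complex_of_real (?P t)) = of_real (integral {0..2*pi} ?P)"
    by (rule integral_unique)
  moreover have "integral {0..2*pi} (\<lambda>t. complex_of_real (?P t)) = of_real (2 * pi)"
    using Poisson_integral_formula[of "\<lambda>_. 1" w] w by (simp only: mult_1_right) simp
  ultimately have "integral {0..2*pi} ?P = 2 * pi"
    by (simp only: of_real_eq_iff)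
  then show ?thesis using integrable_integral[OF int] by simp
qed

text \<open>
  Subtracting the kernel at the reflected point \<open>1 / cnj w\<close>, which contributes nothing, improves
  the decay of the Cauchy kernel to that of the derivative of the Poisson kernel.
\<close>
lemma deriv_reflected_kernel:
  assumes cont: "continuous_on (cball 0 1) f" and hol: "f holomorphic_on ball 0 1"
    and w: "norm w < 1" "w \<noteq> 0"
  shows "2 * pi * \<i> * deriv f w =
     integral {0..2*pi} (\<lambda>t. f (cis t) * (1 / (cis t - w)^2 - 1 / (cis t - 1 / cnj w)^2) * (\<i> * cis t))"
proof -
  have nw: "norm (1 / cnj w) > 1" using w by (simp add: norm_divide)
  have nz: "z - 1 / cnj w \<noteq> 0" if "norm z \<le> 1" for z
    using that nw by (metis eq_iff_diff_eq_0 not_less)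
  have 1: "2 * pi * \<i> * deriv f w = integral {0..2*pi} (\<lambda>t. f (cis t) / (cis t - w)^2 * (\<i> * cis t))"
    using Cauchy_contour_integral_circlepath_2[OF cont hol, of w] w by (simp add: circlepath_integral)
  \<comment> \<open>The factor \<open>z\<close> makes \<open>K 0 = 0\<close>, so Cauchy's formula at
    the center says that the reflected kernel contributes nothing.\<close>
  define K where "K z = f z * z / (z - 1 / cnj w)^2" for z
  have K: "continuous_on (cball 0 1) K" "K holomorphic_on ball 0 1"
    unfolding K_def using nz by (auto intro!: continuous_intros holomorphic_intros cont hol)
  have "contour_integral (circlepath 0 1) (\<lambda>u. K u / (u - 0) ^ Suc 0) = 0"
    using Cauchy_contour_integral_circlepath[OF K, of 0 0] by (simp add: K_def)
  then have 2: "integral {0..2*pi} (\<lambda>t. f (cis t) / (cis t - 1 / cnj w)^2 * (\<i> * cis t)) = 0"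
    by (simp add: circlepath_integral K_def mult.commute mult.left_commute)
  have cf: "continuous_on {0..2*pi} (\<lambda>t. f (cis t))"
    by (rule continuous_on_compose2[OF cont]) (auto intro!: continuous_intros)
  have i1: "(\<lambda>t. f (cis t) / (cis t - w)^2 * (\<i> * cis t)) integrable_on {0..2*pi}"
    using w by (intro integrable_continuous_interval continuous_intros cf) auto
  have i2: "(\<lambda>t. f (cis t) / (cis t - 1 / cnj w)^2 * (\<i> * cis t)) integrable_on {0..2*pi}"
  proof (intro integrable_continuous_interval continuous_intros cf)
    show "\<forall>x\<in>{0..2 * pi}. (cis x - 1 / cnj w)\<^sup>2 \<noteq> 0"
      using nz[of "cis x" for x] by simp
  qed
  have "integral {0..2*pi} (\<lambda>t. f (cis t) * (1 / (cis t - w)^2 - 1 / (cis t - 1 / cnj w)^2) * (\<i> * cis t))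
    = integral {0..2*pi} (\<lambda>t. f (cis t) / (cis t - w)^2 * (\<i> * cis t) - f (cis t) / (cis t - 1 / cnj w)^2 * (\<i> * cis t))"
    by (rule Henstock_Kurzweil_Integration.integral_cong) (simp add: algebra_simps diff_divide_distrib)
  also have "\<dots> = 2 * pi * \<i> * deriv f w"
    unfolding Henstock_Kurzweil_Integration.integral_diff[OF i1 i2] 1[symmetric] 2 by simp
  finally show ?thesis by simp
qed

text \<open>A difference of squares contains the factor \<open>w - 1 / cnj w\<close>, of order
  \<open>1 - (norm w)^2\<close>. On the circle the distances to \<open>w\<close> and to the
  reflected point differ by the factor \<open>norm w\<close>; keeping it above 1/2 gives the
  constants 2 and 3 whose product is 6.\<close>

lemma reflected_kernel_bound:
  assumes z: "norm z = 1" and w: "1/2 \<le> norm w" "norm w < 1"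
  shows "norm (1 / (z - w)^2 - 1 / (z - 1 / cnj w)^2) \<le> 6 * (1 - (norm w)\<^sup>2) / norm (z - w) ^ 3"
proof -
  define v where "v = 1 / cnj w"
  have w0: "w \<noteq> 0" using w by auto
  have zw: "z - w \<noteq> 0" using z w by auto
  have "z - v = - (1 - cnj w * z) / cnj w" using w0 by (simp add: v_def field_simps)
  then have nv: "norm (z - v) = norm (z - w) / norm w"
    by (simp only: norm_divide norm_minus_cancel complex_mod_cnj one_minus_cnj_mult[OF z])
  have d: "norm (z - w) > 0" using zw by simp
  have nv_ge: "norm (z - w) \<le> norm (z - v)"
    unfolding nv using w d by (subst pos_le_divide_eq) (auto simp: mult_left_le)
  have nv_le: "norm (z - v) \<le> 2 * norm (z - w)"
  proof -
    have "norm (z - w) * 1 \<le> norm (z - w) * (2 * norm w)" using w d by (intro mult_left_mono) auto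
    then show ?thesis unfolding nv using w by (subst pos_divide_le_eq) (auto simp: algebra_simps)
  qed
  have zv: "z - v \<noteq> 0" using nv_ge d by auto
  have "w - v = of_real ((norm w)\<^sup>2 - 1) / cnj w"
    using w0 complex_norm_square[of w] by (simp add: v_def field_simps)
  then have "norm (w - v) = \<bar>(norm w)\<^sup>2 - 1\<bar> / norm w"
    by (simp only: norm_divide norm_of_real complex_mod_cnj)
  also have "\<dots> = (1 - (norm w)\<^sup>2) / norm w" using w by (simp add: abs_square_le_1 power_le_one)
  also have "\<dots> \<le> 2 * (1 - (norm w)\<^sup>2)"
  proof -
    have "(1 - (norm w)\<^sup>2) * 1 \<le> (1 - (norm w)\<^sup>2) * (2 * norm w)"
      using w by (intro mult_left_mono) (auto simp: power_le_one)
    then show ?thesis using w by (subst pos_divide_le_eq) (auto simp: algebra_simps)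
  qed
  finally have wv: "norm (w - v) \<le> 2 * (1 - (norm w)\<^sup>2)" .
  have eq: "1 / (z - w)^2 - 1 / (z - v)^2 = (w - v) * ((z - w) + (z - v)) / ((z - w)^2 * (z - v)^2)"
    using zw zv by (simp add: divide_simps) (simp add: power2_eq_square algebra_simps)
  have "norm (1 / (z - w)^2 - 1 / (z - v)^2) = norm (w - v) * norm ((z - w) + (z - v)) / (norm (z - w)^2 * norm (z - v)^2)"
    unfolding eq by (simp add: norm_mult norm_divide norm_power)
  also have "\<dots> \<le> (2 * (1 - (norm w)\<^sup>2) * (3 * norm (z - w))) / (norm (z - w)^2 * norm (z - w)^2)"
  proof (rule frac_le)
    show "norm (w - v) * norm ((z - w) + (z - v)) \<le> 2 * (1 - (norm w)\<^sup>2) * (3 * norm (z - w))"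
      by (intro mult_mono wv order_trans[OF norm_triangle_ineq])
         (use nv_le w in \<open>auto simp: power_le_one\<close>)
    show "norm (z - w)^2 * norm (z - w)^2 \<le> norm (z - w)^2 * norm (z - v)^2"
      by (intro mult_left_mono power_mono nv_ge) auto
    show "0 \<le> 2 * (1 - (norm w)\<^sup>2) * (3 * norm (z - w))"
      using w by (intro mult_nonneg_nonneg) (auto simp: power_le_one)
  qed (use d in auto)
  also have "\<dots> = 6 * (1 - (norm w)\<^sup>2) / norm (z - w) ^ 3"
    using d by (simp add: field_simps power2_eq_square power3_eq_cube)
  finally show ?thesis by (simp add: v_def)
qed

section \<open>Non-tangential limits of a derivative\<close>

lemma cis_inj_open_interval:
  assumes "cis t = cis t0" "0 < t0" "t0 < 2 * pi" "0 \<le> t" "t \<le> 2 * pi"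
  shows "t = t0"
proof -
  obtain n :: int where n: "t = t0 + 2 * of_int n * pi"
    using arg_cong[OF assms(1), of Re] arg_cong[OF assms(1), of Im] sin_cos_eq_iff[of t t0]
    by (auto simp: mult_ac)
  have "\<bar>t - t0\<bar> < 2 * pi" using assms by linarith
  then have "\<bar>of_int n\<bar> < (1::real)" using n by (simp add: abs_mult)
  then have "n = 0" by linarith
  with n show ?thesis by simp
qed


text \<open>The primitive of an L2 function is differentiable almost everywhere, so the limit is
  sought for a derivative. Subtracting the tangent at \<open>cis t0\<close> leaves an error
  \<open>E\<close> that on the circle is of smaller order than the distance to that point. For
  \<open>w\<close> in a Stolz region this distance is at most \<open>1 + \<alpha>\<close> times the
  distance to \<open>w\<close>, which absorbs one power of the cubic kernel bound and leaves the
  Poisson kernel, of mass 2 pi.\<close>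

theorem nt_limit_disc_deriv:
  assumes cont: "continuous_on (cball 0 1) G" and hol: "G holomorphic_on ball 0 1"
    and t0: "0 < t0" "t0 < 2 * pi"
    and der: "((\<lambda>t. G (cis t)) has_vector_derivative (\<i> * cis t0 * A)) (at t0)"
  shows "nt_limit_disc (deriv G) (cis t0) A"
  unfolding nt_limit_disc_def
proof (intro allI impI)
  fix \<alpha> :: real assume \<alpha>: "\<alpha> > 1"
  define \<zeta> where "\<zeta> = cis t0"
  define E where "E z = G z - G \<zeta> - A * (z - \<zeta>)" for z
  have E: "continuous_on (cball 0 1) E" "E holomorphic_on ball 0 1"
    unfolding E_def by (auto intro!: continuous_intros holomorphic_intros cont hol)
  have derivE: "deriv E w = deriv G w - A" if "norm w < 1" for w
  proof (rule DERIV_imp_deriv)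
    have "(G has_field_derivative deriv G w) (at w)"
      using hol that by (auto intro: holomorphic_derivI)
    then show "(E has_field_derivative deriv G w - A) (at w)"
      unfolding E_def by (auto intro!: derivative_eq_intros)
  qed
  have "bounded (E ` cball 0 1)"
    by (intro compact_imp_bounded compact_continuous_image E) auto
  then obtain M where M: "\<And>z. norm z \<le> 1 \<Longrightarrow> norm (E z) \<le> M"
    unfolding bounded_iff by (metis image_eqI mem_cball_0)
  have M0: "0 \<le> M" by (rule order_trans[OF norm_ge_zero M[of 0]]) simp
  have near: "\<exists>\<eta>>0. \<forall>t. \<bar>t - t0\<bar> < \<eta> \<longrightarrow> norm (E (cis t)) \<le> e * norm (cis t - \<zeta>)" if e: "e > 0" for e
  proof -
    \<comment> \<open>\<open>e1\<close> pays for the difference quotient of \<open>G\<close> along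
      the circle, \<open>e2\<close> for that of \<open>cis\<close> multiplied by \<open>A\<close>.
      The cap 1/2 on \<open>e2\<close> bounds the parameter distance by twice the distance in the
      plane.\<close>
    define e1 where "e1 = e / 4"
    define e2 where "e2 = min (1/2) (e / (4 * (norm A + 1)))"
    have e12: "e1 > 0" "e2 > 0" using e by (auto simp: e1_def e2_def add_nonneg_pos)
    obtain d1 where d1: "d1 > 0" "\<And>t. \<bar>t - t0\<bar> < d1 \<Longrightarrow> norm (G (cis t) - G \<zeta> - (t - t0) *\<^sub>R (\<i> * \<zeta> * A)) \<le> e1 * \<bar>t - t0\<bar>"
      using der e12 unfolding has_vector_derivative_def has_derivative_at_alt \<zeta>_def real_norm_def by blast
    have "((\<lambda>t. cis t) has_derivative (\<lambda>t. t *\<^sub>R (\<i> * cis t0))) (at t0)"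
      by (rule derivative_eq_intros refl)+
    then obtain d2 where d2: "d2 > 0" "\<And>t. \<bar>t - t0\<bar> < d2 \<Longrightarrow> norm (cis t - \<zeta> - (t - t0) *\<^sub>R (\<i> * \<zeta>)) \<le> e2 * \<bar>t - t0\<bar>"
      using e12 unfolding has_derivative_at_alt \<zeta>_def real_norm_def by blast
    show ?thesis
    proof (intro exI[of _ "min d1 d2"] conjI allI impI)
      fix t assume t: "\<bar>t - t0\<bar> < min d1 d2"
      have n1: "norm (G (cis t) - G \<zeta> - (t - t0) *\<^sub>R (\<i> * \<zeta> * A)) \<le> e1 * \<bar>t - t0\<bar>" using d1 t by simp
      have n2: "norm (cis t - \<zeta> - (t - t0) *\<^sub>R (\<i> * \<zeta>)) \<le> e2 * \<bar>t - t0\<bar>" using d2 t by simp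
      have "E (cis t) = (G (cis t) - G \<zeta> - (t - t0) *\<^sub>R (\<i> * \<zeta> * A)) - A * (cis t - \<zeta> - (t - t0) *\<^sub>R (\<i> * \<zeta>))"
        by (simp add: E_def scaleR_conv_of_real algebra_simps)
      then have "norm (E (cis t)) \<le> e1 * \<bar>t - t0\<bar> + norm A * (e2 * \<bar>t - t0\<bar>)"
        by (simp only:) (intro order_trans[OF norm_triangle_ineq4] add_mono n1, simp add: norm_mult n2 mult_left_mono)
      also have "\<dots> \<le> e1 * \<bar>t - t0\<bar> + e / 4 * \<bar>t - t0\<bar>"
      proof -
        have "norm A * e2 \<le> (norm A + 1) * (e / (4 * (norm A + 1)))"
          using e by (intro mult_mono) (auto simp: e2_def)
        also have "\<dots> = e / 4" by (simp add: field_simps add_nonneg_eq_0_iff)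
        finally show ?thesis using mult_right_mono[of "norm A * e2" "e/4" "\<bar>t - t0\<bar>"] by (simp add: mult.assoc)
      qed
      also have "\<dots> = e * (\<bar>t - t0\<bar> / 2)" by (simp add: e1_def)
      also have "\<dots> \<le> e * norm (cis t - \<zeta>)"
      proof (intro mult_left_mono)
        have "\<bar>t - t0\<bar> = norm ((t - t0) *\<^sub>R (\<i> * \<zeta>))" by (simp add: norm_mult \<zeta>_def)
        also have "\<dots> \<le> norm (cis t - \<zeta>) + norm (cis t - \<zeta> - (t - t0) *\<^sub>R (\<i> * \<zeta>))"
          by (metis norm_triangle_sub add.commute norm_minus_commute)
        also have "\<dots> \<le> norm (cis t - \<zeta>) + 1/2 * \<bar>t - t0\<bar>"
        proof -
          have "e2 \<le> 1/2" unfolding e2_def by (rule min.cobounded1)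
          then have "e2 * \<bar>t - t0\<bar> \<le> 1/2 * \<bar>t - t0\<bar>" by (intro mult_right_mono) auto
          then show ?thesis using n2 by linarith
        qed
        finally show "\<bar>t - t0\<bar> / 2 \<le> norm (cis t - \<zeta>)" by simp
      qed (use e in simp)
      finally show "norm (E (cis t)) \<le> e * norm (cis t - \<zeta>)" .
    qed (use d1 d2 in simp)
  qed
  \<comment> \<open>Compactness of the parameters away from \<open>t0\<close>. The minimal distance
    is positive because \<open>t0\<close> is interior, so that neither endpoint gives the same point
    of the circle.\<close>
  have far: "\<exists>\<delta>>0. \<forall>t\<in>{0..2*pi}. \<bar>t - t0\<bar> \<ge> \<eta> \<longrightarrow> norm (cis t - \<zeta>) \<ge> \<delta>" if "\<eta> > 0" for \<eta>
  proof -
    define S where "S = {0..2*pi} - ball t0 \<eta>"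
    have S: "compact S" unfolding S_def by (intro compact_diff) auto
    show ?thesis
    proof (cases "S = {}")
      case True
      then show ?thesis unfolding S_def by (intro exI[of _ 1]) (auto simp: dist_real_def)
    next
      case False
      obtain s where s: "s \<in> S" "\<And>t. t \<in> S \<Longrightarrow> norm (cis s - \<zeta>) \<le> norm (cis t - \<zeta>)"
      proof -
        have "continuous_on S (\<lambda>t. norm (cis t - \<zeta>))" by (intro continuous_intros)
        from continuous_attains_inf[OF S False this] that show ?thesis by blast
      qed
      have "cis s \<noteq> \<zeta>"
        using cis_inj_open_interval[of s t0] t0 s(1) that by (auto simp: S_def \<zeta>_def)
      then show ?thesis
        using s(2) by (intro exI[of _ "norm (cis s - \<zeta>)"]) (auto simp: S_def dist_real_def abs_minus_commute)
    qed
  qed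
  show "(deriv G \<longlongrightarrow> A) (at (cis t0) within {z. norm z < 1 \<and> norm (z - cis t0) < \<alpha> * (1 - norm z)})"
    unfolding tendsto_iff eventually_at
  proof (intro allI impI)
    fix \<epsilon> :: real assume \<epsilon>: "\<epsilon> > 0"
    \<comment> \<open>With this value the near arc contributes
      \<open>6 * e * (1 + \<alpha>) = \<epsilon> / 4\<close>.\<close>
    define e where "e = \<epsilon> / (24 * (1 + \<alpha>))"
    have e: "e > 0" using \<epsilon> \<alpha> by (simp add: e_def)
    obtain \<eta> where \<eta>: "\<eta> > 0" "\<And>t. \<bar>t - t0\<bar> < \<eta> \<Longrightarrow> norm (E (cis t)) \<le> e * norm (cis t - \<zeta>)"
      using near[OF e] by blast
    obtain \<delta> where \<delta>: "\<delta> > 0" "\<And>t. t \<in> {0..2*pi} \<Longrightarrow> \<bar>t - t0\<bar> \<ge> \<eta> \<Longrightarrow> norm (cis t - \<zeta>) \<ge> \<delta>"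
      using far[OF \<eta>(1)] by blast
    \<comment> \<open>This is \<open>6 * M / (\<delta> / 2)^3\<close>, from the kernel bound on the
      far arc, where the distance to \<open>w\<close> is at least \<open>\<delta> / 2\<close>. The
      last entry of \<open>d\<close> then makes the far contribution at most
      \<open>\<epsilon> / 2\<close>.\<close>
    define c where "c = 48 * M / \<delta>^3"
    have c0: "c \<ge> 0" using M0 \<delta> by (simp add: c_def)
    define d where "d = min (min (1/2) (\<delta>/2)) (\<epsilon> / (32 * (c + 1)))"
    have d: "d > 0" using \<delta> \<epsilon> c0 by (simp add: d_def)
    show "\<exists>d>0. \<forall>w\<in>{z. norm z < 1 \<and> norm (z - cis t0) < \<alpha> * (1 - norm z)}.
       w \<noteq> cis t0 \<and> dist w (cis t0) < d \<longrightarrow> dist (deriv G w) A < \<epsilon>"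
    proof (intro exI[of _ d] conjI ballI impI d)
      fix w assume w': "w \<in> {z. norm z < 1 \<and> norm (z - cis t0) < \<alpha> * (1 - norm z)}" "w \<noteq> cis t0 \<and> dist w (cis t0) < d"
      then have w: "norm w < 1" "norm (w - \<zeta>) < \<alpha> * (1 - norm w)" "norm (w - \<zeta>) < d"
        by (auto simp: \<zeta>_def dist_norm)
      have nz: "norm \<zeta> = 1" by (simp add: \<zeta>_def)
      have w1: "1 - norm w \<le> norm (w - \<zeta>)"
        using norm_triangle_ineq2[of \<zeta> w] by (simp add: nz norm_minus_commute)
      then have w2: "norm w \<ge> 1/2" using w(3) by (simp add: d_def)
      have w0: "w \<noteq> 0" using w2 by auto
      have Q: "0 \<le> 1 - (norm w)\<^sup>2" using w by (simp add: power_le_one)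
      let ?K = "\<lambda>t. 1 / (cis t - w)^2 - 1 / (cis t - 1 / cnj w)^2"
      let ?P = "\<lambda>t. (1 - (norm w)\<^sup>2) / (norm (cis t - w))\<^sup>2"
      have bound: "norm (E (cis t) * ?K t * (\<i> * cis t)) \<le> 6 * e * (1 + \<alpha>) * ?P t + 8 * c * (1 - (norm w)\<^sup>2)"
        if t: "t \<in> {0..2*pi}" for t
      proof -
        have p: "norm (cis t - w) > 0" using w by auto
        have "norm (E (cis t) * ?K t * (\<i> * cis t)) = norm (E (cis t)) * norm (?K t)"
          by (simp add: norm_mult)
        also have "\<dots> \<le> norm (E (cis t)) * (6 * (1 - (norm w)\<^sup>2) / norm (cis t - w) ^ 3)"
          using reflected_kernel_bound[of "cis t" w] w w2 by (intro mult_left_mono) auto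
        also have "\<dots> \<le> 6 * e * (1 + \<alpha>) * ?P t + 8 * c * (1 - (norm w)\<^sup>2)"
        proof (cases "\<bar>t - t0\<bar> < \<eta>")
          case True
          have cw: "1 - norm w \<le> norm (cis t - w)"
            using norm_triangle_ineq2[of "cis t" w] by simp
          have "norm (cis t - \<zeta>) \<le> norm (cis t - w) + norm (w - \<zeta>)"
            using norm_triangle_ineq[of "cis t - w" "w - \<zeta>"] by simp
          also have "norm (w - \<zeta>) \<le> \<alpha> * norm (cis t - w)"
            using w(2) mult_left_mono[OF cw, of \<alpha>] \<alpha> by linarith
          finally have "norm (cis t - \<zeta>) \<le> (1 + \<alpha>) * norm (cis t - w)" by (simp add: algebra_simps)
          then have "norm (E (cis t)) \<le> e * ((1 + \<alpha>) * norm (cis t - w))"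
            using \<eta>(2)[OF True] e by (meson mult_left_mono less_imp_le order_trans)
          then have "norm (E (cis t)) * (6 * (1 - (norm w)\<^sup>2) / norm (cis t - w) ^ 3) \<le>
             e * ((1 + \<alpha>) * norm (cis t - w)) * (6 * (1 - (norm w)\<^sup>2) / norm (cis t - w) ^ 3)"
            using Q p by (intro mult_right_mono) auto
          also have "\<dots> = 6 * e * (1 + \<alpha>) * ?P t"
            using p by (simp add: field_simps power2_eq_square power3_eq_cube)
          finally show ?thesis using c0 Q by (simp add: add_increasing2)
        next
          case False
          then have "\<delta> \<le> norm (cis t - \<zeta>)" using \<delta>(2)[OF t] by simp
          also have "\<dots> \<le> norm (cis t - w) + norm (w - \<zeta>)"
            using norm_triangle_ineq[of "cis t - w" "w - \<zeta>"] by simp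
          finally have ge: "\<delta> / 2 \<le> norm (cis t - w)" using w(3) by (simp add: d_def)
          have "norm (E (cis t)) * (6 * (1 - (norm w)\<^sup>2) / norm (cis t - w) ^ 3) \<le> M * (6 * (1 - (norm w)\<^sup>2) / (\<delta>/2) ^ 3)"
            using ge \<delta>(1) Q M0 p
            by (intro mult_mono M frac_le power_mono) (auto simp: zero_less_power)
          also have "\<dots> \<le> 8 * c * (1 - (norm w)\<^sup>2)"
          proof -
            have "M * (6 * (1 - (norm w)\<^sup>2) / (\<delta>/2) ^ 3) = c * (1 - (norm w)\<^sup>2)"
              using \<delta>(1) by (simp add: c_def field_simps power_divide)
            then show ?thesis using mult_nonneg_nonneg[OF c0 Q] by simp
          qed
          finally show ?thesis using e \<alpha> Q by (simp add: add_increasing)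
        qed
        finally show ?thesis .
      qed
      have hi: "((\<lambda>t. 6 * e * (1 + \<alpha>) * ?P t + 8 * c * (1 - (norm w)\<^sup>2)) has_integral
          (6 * e * (1 + \<alpha>) * (2 * pi) + (2 * pi - 0) *\<^sub>R (8 * c * (1 - (norm w)\<^sup>2)))) {0..2*pi}"
      proof (intro has_integral_add has_integral_mult_right Poisson_kernel_integral w)
        show "((\<lambda>t. 8 * c * (1 - (norm w)\<^sup>2)) has_integral (2 * pi - 0) *\<^sub>R (8 * c * (1 - (norm w)\<^sup>2))) {0..2*pi}"
          using has_integral_const_real[of "8 * c * (1 - (norm w)\<^sup>2)" 0 "2*pi"] by simp
      qed
      have "2 * pi * norm (deriv E w) = norm (2 * pi * \<i> * deriv E w)"
        by (simp add: norm_mult)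
      also have "\<dots> = norm (integral {0..2*pi} (\<lambda>t. E (cis t) * ?K t * (\<i> * cis t)))"
        by (simp only: deriv_reflected_kernel[OF E w(1) w0])
      also have "\<dots> \<le> integral {0..2*pi} (\<lambda>t. 6 * e * (1 + \<alpha>) * ?P t + 8 * c * (1 - (norm w)\<^sup>2))"
      proof (rule integral_norm_bound_integral)
        show "(\<lambda>t. E (cis t) * ?K t * (\<i> * cis t)) integrable_on {0..2*pi}"
        proof (intro integrable_continuous_interval continuous_intros ballI)
          show "continuous_on {0..2 * pi} (\<lambda>x. E (cis x))"
            by (rule continuous_on_compose2[OF E(1)]) (auto intro!: continuous_intros)
          fix t show "(cis t - w)\<^sup>2 \<noteq> 0" using w by auto
          have "norm (1 / cnj w) > 1" using w w0 by (simp add: norm_divide)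
          then show "(cis t - 1 / cnj w)\<^sup>2 \<noteq> 0"
            by (metis norm_cis less_irrefl eq_iff_diff_eq_0 power_eq_0_iff)
        qed
      qed (use hi bound in \<open>auto simp: has_integral_integrable\<close>)
      also have "\<dots> = 2 * pi * (6 * e * (1 + \<alpha>) + 8 * c * (1 - (norm w)\<^sup>2))"
        using integral_unique[OF hi] by (simp add: algebra_simps)
      finally have "norm (deriv E w) \<le> 6 * e * (1 + \<alpha>) + 8 * c * (1 - (norm w)\<^sup>2)"
        by simp
      moreover have "6 * e * (1 + \<alpha>) = \<epsilon> / 4" using \<alpha> by (simp add: e_def field_simps)
      moreover have "8 * c * (1 - (norm w)\<^sup>2) \<le> \<epsilon> / 2"
      proof -
        have "1 - (norm w)\<^sup>2 = (1 + norm w) * (1 - norm w)" by (simp add: power2_eq_square algebra_simps)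
        also have "\<dots> \<le> 2 * (1 - norm w)" using w by (intro mult_right_mono) auto
        also have "\<dots> \<le> 2 * (\<epsilon> / (32 * (c + 1)))" using w1 w(3) by (simp add: d_def)
        finally have "8 * c * (1 - (norm w)\<^sup>2) \<le> 8 * c * (2 * (\<epsilon> / (32 * (c + 1))))"
          using c0 by (intro mult_left_mono) auto
        also have "\<dots> \<le> 8 * (c + 1) * (2 * (\<epsilon> / (32 * (c + 1))))"
          using c0 \<epsilon> by (intro mult_right_mono) auto
        also have "\<dots> = \<epsilon> / 2" using c0 by (simp add: field_simps add_nonneg_eq_0_iff)
        finally show ?thesis .
      qed
      ultimately show "dist (deriv G w) A < \<epsilon>"
        using \<epsilon> derivE[OF w(1)] by (simp add: dist_norm)
    qed
  qed
qed

text \<open>The differentiation theorem for intervals to the right of a point, applied to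
  \<open>f\<close> and to its reflection, gives both one-sided derivatives; the second exceptional
  set has to be reflected back.\<close>

theorem indefinite_integral_derivative_ae:
  fixes f :: "real \<Rightarrow> complex"
  assumes f: "\<And>a b. f integrable_on {a..b}"
  obtains N where "negligible N"
    "\<And>u t. t \<notin> N \<Longrightarrow> u < t \<Longrightarrow> ((\<lambda>s. integral {u..s} f) has_vector_derivative f t) (at t)"
proof -
  obtain N1 where N1: "negligible N1" 
    "\<And>x e. x \<notin> N1 \<Longrightarrow> 0 < e \<Longrightarrow> \<exists>d>0. \<forall>h. 0 < h \<and> h < d \<longrightarrow> norm (integral {x..x + h} f /\<^sub>R h - f x) < e"
    using integrable_ccontinuous_explicit[of f] f by (auto simp: cbox_interval)
  have "(\<lambda>x. f (- x)) integrable_on {a..b}" for a b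
    using f[of "-b" "-a"] Henstock_Kurzweil_Integration.integrable_reflect_real[where f=f and a="-b" and b="-a"] by simp
  then obtain N2 where N2: "negligible N2" 
    "\<And>x e. x \<notin> N2 \<Longrightarrow> 0 < e \<Longrightarrow> \<exists>d>0. \<forall>h. 0 < h \<and> h < d \<longrightarrow> norm (integral {x..x + h} (\<lambda>x. f (- x)) /\<^sub>R h - f (- x)) < e"
    using integrable_ccontinuous_explicit[of "\<lambda>x. f (- x)"] by (auto simp: cbox_interval)
  show ?thesis
  proof (rule that)
    have "negligible (uminus ` N2)"
      by (rule negligible_differentiable_image_negligible[OF _ N2(1)]) (auto intro!: derivative_intros)
    then show "negligible (N1 \<union> uminus ` N2)" using N1(1) by (rule negligible_Un[rotated])
    fix u t assume t: "t \<notin> N1 \<union> uminus ` N2" and u: "u < t"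
    have t1: "t \<notin> N1" and t2: "- t \<notin> N2" using t by (auto simp: image_iff)
    have scale: "norm (w - h *\<^sub>R z) \<le> e * h" if "norm (w /\<^sub>R h - z) < e" "h > 0" for w z :: complex and e h :: real
    proof -
      have "w - h *\<^sub>R z = h *\<^sub>R (w /\<^sub>R h - z)" using that(2) by (simp add: algebra_simps)
      then have "norm (w - h *\<^sub>R z) = h * norm (w /\<^sub>R h - z)" using that(2) by simp
      then show ?thesis using that by (simp add: mult.commute)
    qed
    show "((\<lambda>s. integral {u..s} f) has_vector_derivative f t) (at t)"
      unfolding has_vector_derivative_def has_derivative_at_alt
    proof (intro conjI allI impI)
      show "bounded_linear (\<lambda>x. x *\<^sub>R f t)" by (rule bounded_linear_scaleR_left)
      fix e :: real assume e: "e > 0"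
      obtain d1 where d1: "d1 > 0" "\<And>h. 0 < h \<Longrightarrow> h < d1 \<Longrightarrow> norm (integral {t..t + h} f /\<^sub>R h - f t) < e"
        using N1(2)[OF t1 e] by blast
      obtain d2 where d2: "d2 > 0" "\<And>h. 0 < h \<Longrightarrow> h < d2 \<Longrightarrow> norm (integral {-t..-t + h} (\<lambda>x. f (- x)) /\<^sub>R h - f (-(-t))) < e"
        using N2(2)[OF t2 e] by blast
      show "\<exists>d>0. \<forall>s. norm (s - t) < d \<longrightarrow> norm (integral {u..s} f - integral {u..t} f - (s - t) *\<^sub>R f t) \<le> e * norm (s - t)"
      proof (intro exI[of _ "min (min d1 d2) (t - u)"] conjI allI impI)
        fix s assume s: "norm (s - t) < min (min d1 d2) (t - u)"
        consider "s = t" | "s > t" | "s < t" by linarith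
        then show "norm (integral {u..s} f - integral {u..t} f - (s - t) *\<^sub>R f t) \<le> e * norm (s - t)"
        proof cases
          case 2
          have "integral {u..t} f + integral {t..s} f = integral {u..s} f"
            by (rule Henstock_Kurzweil_Integration.integral_combine) (use 2 u f in auto)
          then have "integral {u..s} f - integral {u..t} f = integral {t..s} f" by (metis add_diff_cancel_left')
          then show ?thesis using scale[OF d1(2)[of "s - t"]] 2 s by simp
        next
          case 3
          have "integral {u..s} f + integral {s..t} f = integral {u..t} f"
            by (rule Henstock_Kurzweil_Integration.integral_combine) (use 3 u f s in auto)
          then have "integral {u..s} f - integral {u..t} f - (s - t) *\<^sub>R f t = - (integral {s..t} f - (t - s) *\<^sub>R f t)"
            by (simp add: algebra_simps)
          moreover have "integral {-t..-t + (t - s)} (\<lambda>x. f (- x)) = integral {s..t} f"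
            using integral_reflect_real[of t s f] by simp
          ultimately show ?thesis using scale[OF d2(2)[of "t - s"]] 3 s by (simp only: norm_minus_cancel) simp
        qed simp
      qed (use d1 d2 u in auto)
    qed
  qed
qed

section \<open>The primitive of a power series, up to the circle\<close>

definition prim_coeff :: "(nat \<Rightarrow> complex) \<Rightarrow> nat \<Rightarrow> complex" where
  "prim_coeff a n = (case n of 0 \<Rightarrow> 0 | Suc k \<Rightarrow> a k / of_nat (Suc k))"

text \<open>Unlike \<open>ps\<close> it is not cut off outside the disc, because its values on the
  circle are the ones that matter.\<close>

definition prim :: "(nat \<Rightarrow> complex) \<Rightarrow> complex \<Rightarrow> complex" where
  "prim a z = (\<Sum>n. prim_coeff a n * z ^ n)"

text \<open>The product of two square summable sequences, \<open>a\<close> and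
  \<open>1 / (n + 1)\<close>. This summability is the reason why the primitive is continuous on the
  closed disc.\<close>

lemma summable_prim_coeff:
  assumes "l2 a" shows "summable (\<lambda>n. norm (prim_coeff a n))"
proof -
  have "summable (\<lambda>n. inverse (real (Suc n) ^ 2))"
    using inverse_power_summable[of 2, where ?'a = real] by (subst summable_Suc_iff) simp
  then have "l2 (\<lambda>n. 1 / of_nat (Suc n))"
    by (simp add: l2_def norm_divide power_divide inverse_eq_divide del: of_nat_Suc)
  from l2_summable_mult[OF assms this]
  have "summable (\<lambda>n. norm (prim_coeff a (Suc n)))"
    by (simp add: prim_coeff_def del: of_nat_Suc)
  then show ?thesis by (subst (asm) summable_Suc_iff)
qed

lemma prim_sums: 
  assumes "l2 a" "norm z \<le> 1" shows "summable (\<lambda>n. norm (prim_coeff a n * z ^ n))"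
  by (rule summable_comparison_test'[OF summable_prim_coeff[OF assms(1)]])
    (use assms(2) in \<open>auto simp: norm_mult norm_power intro!: mult_left_le power_le_one\<close>)

lemma prim_continuous: assumes "l2 a" shows "continuous_on (cball 0 1) (prim a)"
  unfolding prim_def
proof (rule uniform_limit_theorem)
  show "\<forall>\<^sub>F n in sequentially. continuous_on (cball 0 1) (\<lambda>z. \<Sum>k<n. prim_coeff a k * z ^ k)"
    by (intro always_eventually allI continuous_intros)
  show "uniform_limit (cball 0 1) (\<lambda>n z. \<Sum>k<n. prim_coeff a k * z ^ k) (\<lambda>z. \<Sum>n. prim_coeff a n * z ^ n) sequentially"
    by (rule Weierstrass_m_test[OF _ summable_prim_coeff[OF assms]])
      (auto simp: norm_mult norm_power intro!: mult_left_le power_le_one)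
qed simp

lemma prim_has_field_derivative:
  assumes "l2 a" "norm z < 1" shows "(prim a has_field_derivative ps a z) (at z)"
proof -
  have "diffs (prim_coeff a) = a"
    by (auto simp: diffs_def prim_coeff_def fun_eq_iff simp del: of_nat_Suc)
  moreover have "summable (\<lambda>n. prim_coeff a n * 1 ^ n)"
    using summable_norm_cancel[OF summable_prim_coeff[OF assms(1)]] by simp
  ultimately show ?thesis
    using termdiffs_strong[of "prim_coeff a" 1 z] assms(2) by (simp add: prim_def[abs_def] ps_def)
qed

lemma integrable_circle_square_integrable:
  assumes u: "square_integrable circle_measure u" and v: "continuous_on {0..2*pi} v"
  shows "integrable circle_measure (\<lambda>s. v s * u s)"
  using square_integrable_mult[OF u continuous_square_integrable_circle[OF v]] by (simp add: mult.commute)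

text \<open>Pairing with this kernel integrates \<open>\<i> * cis s * u s\<close> over the arc from
  0 to \<open>t\<close>, so that L2 convergence passes to integrals over arcs.\<close>

definition prim_kernel :: "real \<Rightarrow> real \<Rightarrow> complex" where
  "prim_kernel t s = (if s \<in> {0..t} then cnj (\<i> * cis s) else 0)"

lemma prim_kernel_square_integrable: "square_integrable circle_measure (prim_kernel t)"
proof -
  have "(indicator {0..t} :: real \<Rightarrow> complex) \<in> borel_measurable circle_measure"
    by (intro measurable_restrict_space1 borel_measurable_indicator) simp
  then have "square_integrable circle_measure (\<lambda>s. indicator {0..t} s * cnj (\<i> * cis s))"
    by (rule square_integrable_bounded_mult[where B=1])
      (auto intro!: continuous_square_integrable_circle continuous_intros split: split_indicator)
  moreover have "(\<lambda>s. indicator {0..t} s * cnj (\<i> * cis s)) = prim_kernel t"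
    by (auto simp: prim_kernel_def)
  ultimately show ?thesis by simp
qed

lemma L2_ip_prim_kernel:
  assumes u: "square_integrable circle_measure u" and t: "t \<le> 2 * pi"
  shows "L2_ip circle_measure u (prim_kernel t) = integral {0..t} (\<lambda>s. \<i> * cis s * u s)"
proof -
  have "L2_ip circle_measure u (prim_kernel t) = integral {0..2*pi} (\<lambda>s. u s * cnj (prim_kernel t s))"
    unfolding L2_ip_def
    by (rule lebesgue_integral_eq_integral) (auto intro!: integrable_L2_ip u prim_kernel_square_integrable)
  also have "\<dots> = integral {0..2*pi} (\<lambda>s. if s \<in> {0..t} then \<i> * cis s * u s else 0)"
    by (rule Henstock_Kurzweil_Integration.integral_cong) (auto simp: prim_kernel_def)
  also have "\<dots> = integral ({0..t} \<inter> {0..2*pi}) (\<lambda>s. \<i> * cis s * u s)"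
    by (rule Henstock_Kurzweil_Integration.integral_restrict_Int)
  also have "{0..t} \<inter> {0..2*pi} = {0..t}" using t by auto
  finally show ?thesis .
qed

text \<open>For polynomials this is the fundamental theorem along the arc. The left side converges
  by absolute summability, the right side as a pairing with \<open>prim_kernel\<close>.\<close>

lemma prim_circle:
  assumes a: "l2 a" and t: "0 \<le> t" "t \<le> 2 * pi"
  shows "prim a (cis t) - prim a 1 = integral {0..t} (\<lambda>s. \<i> * cis s * bdry a s)"
proof -
  \<comment> \<open>Integration raises the degree, so \<open>Suc N\<close> coefficients of the
    primitive correspond to \<open>N\<close> coefficients of \<open>a\<close>.\<close>
  have fin: "(\<Sum>n<Suc N. prim_coeff a n * cis t ^ n) - (\<Sum>n<Suc N. prim_coeff a n * 1 ^ n) = L2_ip circle_measure (trig a N) (prim_kernel t)" for N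
  proof -
    define F where "F z = (\<Sum>n<Suc N. prim_coeff a n * z ^ n)" for z
    have F': "(F has_field_derivative (\<Sum>n<N. a n * z ^ n)) (at z)" for z
    proof -
      have "F = (\<lambda>z. \<Sum>n<N. prim_coeff a (Suc n) * z ^ Suc n)"
        unfolding F_def by (subst sum.lessThan_Suc_shift) (simp add: prim_coeff_def)
      moreover have "((\<lambda>z. \<Sum>n<N. prim_coeff a (Suc n) * z ^ Suc n) has_field_derivative (\<Sum>n<N. a n * z ^ n)) (at z)"
      proof (rule DERIV_sum)
        fix n
        show "((\<lambda>z. prim_coeff a (Suc n) * z ^ Suc n) has_field_derivative a n * z ^ n) (at z)"
          by (rule derivative_eq_intros refl)+ (simp add: prim_coeff_def del: of_nat_Suc)
      qed
      ultimately show ?thesis by simp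
    qed
    have "((\<lambda>s. \<i> * cis s * trig a N s) has_integral F (cis t) - F (cis 0)) {0..t}"
    proof (rule fundamental_theorem_of_calculus)
      fix s
      have 1: "(cis has_derivative (\<lambda>h. h *\<^sub>R (\<i> * cis s))) (at s within {0..t})"
        using has_derivative_cis[OF has_derivative_ident] by simp
      have 2: "(F has_derivative (\<lambda>h. (\<Sum>n<N. a n * cis s ^ n) * h)) (at (cis s))"
        using F'[of "cis s"] by (simp add: has_field_derivative_def)
      have "((\<lambda>s. F (cis s)) has_derivative (\<lambda>h. (\<Sum>n<N. a n * cis s ^ n) * (h *\<^sub>R (\<i> * cis s)))) (at s within {0..t})"
        by (rule has_derivative_compose[OF 1 2])
      moreover have "(\<Sum>n<N. a n * cis s ^ n) = trig a N s"
        by (simp add: trig_def Complex.DeMoivre)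
      ultimately show "((\<lambda>s. F (cis s)) has_vector_derivative \<i> * cis s * trig a N s) (at s within {0..t})"
        by (simp add: has_vector_derivative_def mult_ac)
    qed (use t in auto)
    then show ?thesis
      unfolding L2_ip_prim_kernel[OF square_integrable_trig t(2)] by (simp add: F_def integral_unique)
  qed
  have "(\<lambda>N. L2_ip circle_measure (trig a N) (prim_kernel t)) \<longlonglongrightarrow> L2_ip circle_measure (bdry a) (prim_kernel t)"
    by (intro L2_ip_tendsto_left bdry a square_integrable_trig prim_kernel_square_integrable)
  moreover have "(\<lambda>N. (\<Sum>n<Suc N. prim_coeff a n * cis t ^ n) - (\<Sum>n<Suc N. prim_coeff a n * 1 ^ n)) \<longlonglongrightarrow> prim a (cis t) - prim a 1"
    unfolding prim_def
    by (intro tendsto_diff LIMSEQ_Suc[OF summable_LIMSEQ] summable_norm_cancel[OF prim_sums[OF a]]) auto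
  ultimately have "prim a (cis t) - prim a 1 = L2_ip circle_measure (bdry a) (prim_kernel t)"
    unfolding fin by (metis LIMSEQ_unique)
  then show ?thesis
    unfolding L2_ip_prim_kernel[OF bdry(1)[OF a] t(2)] .
qed

text \<open>The endpoints are dropped since \<open>cis\<close> does not separate them and
  \<open>cayley_angle\<close> does not reach them.\<close>

lemma AE_circle_iff: "(AE t in circle_measure. P t) \<longleftrightarrow> (AE t in lebesgue. t \<in> {0<..<2*pi} \<longrightarrow> P t)"
proof -
  have "(AE t in lebesgue. t \<noteq> 0)" "(AE t in lebesgue. t \<noteq> 2 * pi)"
    using AE_lborel_singleton by (auto intro!: AE_completion)
  then have "(AE t in lebesgue. t \<in> {0..2*pi} \<longrightarrow> P t) \<longleftrightarrow> (AE t in lebesgue. t \<in> {0<..<2*pi} \<longrightarrow> P t)"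
    by (intro AE_cong_simp iffI) (auto elim!: AE_mp)
  then show ?thesis by (simp add: AE_restrict_space_iff)
qed

text \<open>Fatou's theorem: \<open>ps a\<close> is the derivative of \<open>prim a\<close>, and at
  almost every \<open>t\<close> the arc integral of \<open>bdry a\<close> is differentiable with the
  expected derivative.\<close>

theorem nt_limit_disc_ps:
  assumes a: "l2 a"
  shows "AE t in circle_measure. nt_limit_disc (ps a) (cis t) (bdry a t)"
proof -
  \<comment> \<open>Extended by 0, the integrand is integrable on every interval, as the
    differentiation theorem demands.\<close>
  define f where "f s = (if s \<in> {0..2*pi} then \<i> * cis s * bdry a s else 0)" for s
  have "integrable circle_measure (\<lambda>s. \<i> * cis s * bdry a s)"
    by (intro integrable_circle_square_integrable bdry a continuous_intros)
  then have "(\<lambda>s. \<i> * cis s * bdry a s) integrable_on {0..2*pi}"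
    by (rule integrable_on_lebesgue_on) simp
  then have "f integrable_on UNIV"
    unfolding f_def integrable_restrict_UNIV .
  then have "f integrable_on {a..b}" for a b
    by (rule integrable_on_subinterval) simp
  then obtain N where N: "negligible N"
    "\<And>u t. t \<notin> N \<Longrightarrow> u < t \<Longrightarrow> ((\<lambda>s. integral {u..s} f) has_vector_derivative f t) (at t)"
    using indefinite_integral_derivative_ae by blast
  have "AE t in lebesgue. t \<notin> N"
    using N(1) by (simp add: negligible_iff_null_sets AE_not_in)
  then show ?thesis
    unfolding AE_circle_iff
  proof eventually_elim
    fix t assume tN: "t \<notin> N"
    show "t \<in> {0<..<2*pi} \<longrightarrow> nt_limit_disc (ps a) (cis t) (bdry a t)"
    proof
      assume t: "t \<in> {0<..<2*pi}"
      have "((\<lambda>s. prim a 1 + integral {0..s} f) has_vector_derivative f t) (at t)"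
        using N(2)[OF tN, of 0] t by (auto intro!: derivative_eq_intros)
      then have "((\<lambda>s. prim a (cis s)) has_vector_derivative f t) (at t)"
      proof (rule has_vector_derivative_transform_within_open)
        show "open {0<..<2*pi}" by simp
        fix s assume s: "s \<in> {0<..<2*pi}"
        have "integral {0..s} f = integral {0..s} (\<lambda>s. \<i> * cis s * bdry a s)"
          by (rule Henstock_Kurzweil_Integration.integral_cong) (use s in \<open>auto simp: f_def\<close>)
        then show "prim a 1 + integral {0..s} f = prim a (cis s)"
          using prim_circle[OF a, of s] s by (simp add: diff_eq_eq add.commute)
      qed (rule t)
      then have "((\<lambda>s. prim a (cis s)) has_vector_derivative \<i> * cis t * bdry a t) (at t)"
        using t by (simp add: f_def)
      moreover have "prim a holomorphic_on ball 0 1"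
        unfolding holomorphic_on_open[OF open_ball] using prim_has_field_derivative[OF a]
        by (metis mem_ball_0)
      ultimately have "nt_limit_disc (deriv (prim a)) (cis t) (bdry a t)"
        using nt_limit_disc_deriv[OF prim_continuous[OF a]] t by simp
      moreover have "\<forall>\<^sub>F z in at (cis t) within {z. norm z < 1 \<and> norm (z - cis t) < \<alpha> * (1 - norm z)}. deriv (prim a) z = ps a z" for \<alpha>
        unfolding eventually_at_filter
        by (intro always_eventually) (auto intro!: DERIV_imp_deriv prim_has_field_derivative a)
      ultimately show "nt_limit_disc (ps a) (cis t) (bdry a t)"
        unfolding nt_limit_disc_def using Lim_transform_eventually by blast
    qed
  qed
qed

section \<open>Uniqueness and measurability of boundary values\<close>

lemma at_within_stolz_region:
  fixes w :: complex
  assumes "norm w = 1" shows "at w within {z. norm z < 1 \<and> norm (z - w) < 2 * (1 - norm z)} \<noteq> bot"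
proof -
  let ?S = "{z. norm z < 1 \<and> norm (z - w) < 2 * (1 - norm z)}"
  have "w islimpt ?S"
    unfolding islimpt_approachable
  proof (intro allI impI)
    fix e :: real assume "e > 0"
    define d where "d = min (e/2) (1/2)"
    have d: "0 < d" "d < e" "d < 1" using \<open>e > 0\<close> by (auto simp: d_def)
    define z where "z = of_real (1 - d) * w"
    have "z - w = of_real (- d) * w" by (simp add: z_def algebra_simps)
    then have "norm (z - w) = d" using assms d by (simp add: norm_mult del: of_real_minus)
    moreover have "norm z = 1 - d" using assms d by (simp add: z_def norm_mult del: of_real_diff)
    ultimately show "\<exists>z\<in>?S. z \<noteq> w \<and> dist z w < e" using d by (intro bexI[of _ z]) (auto simp: dist_norm)
  qed
  then show ?thesis by (simp add: trivial_limit_within)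
qed

lemma nt_limit_disc_unique:
  assumes "norm w = 1" "nt_limit_disc f w l" "nt_limit_disc f w l'"
  shows "l = l'"
proof (rule tendsto_unique[OF at_within_stolz_region[OF assms(1)]])
  show "(f \<longlongrightarrow> l) (at w within {z. norm z < 1 \<and> norm (z - w) < 2 * (1 - norm z)})"
    "(f \<longlongrightarrow> l') (at w within {z. norm z < 1 \<and> norm (z - w) < 2 * (1 - norm z)})"
    using assms(2,3) unfolding nt_limit_disc_def by (meson one_less_numeral_iff semiring_norm(76))+
qed

lemma at_within_stolz_region_uhp: "at (of_real x) within {z. Im z > 0 \<and> \<bar>Re z - x\<bar> < 1 * Im z} \<noteq> bot"
proof -
  have "of_real x islimpt {z. Im z > 0 \<and> \<bar>Re z - x\<bar> < 1 * Im z}"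
    unfolding islimpt_approachable
  proof (intro allI impI)
    fix e :: real assume "e > 0"
    then show "\<exists>z\<in>{z. Im z > 0 \<and> \<bar>Re z - x\<bar> < 1 * Im z}. z \<noteq> of_real x \<and> dist z (of_real x) < e"
      by (intro bexI[of _ "Complex x (e/2)"]) (auto simp: dist_norm complex_eq_iff cmod_def)
  qed
  then show ?thesis by (simp add: trivial_limit_within)
qed

lemma nt_limit_uhp_unique:
  assumes "nt_limit_uhp F x l" "nt_limit_uhp F x l'"
  shows "l = l'"
proof (rule tendsto_unique[OF at_within_stolz_region_uhp])
  show "(F \<longlongrightarrow> l) (at (of_real x) within {z. Im z > 0 \<and> \<bar>Re z - x\<bar> < 1 * Im z})"
    "(F \<longlongrightarrow> l') (at (of_real x) within {z. Im z > 0 \<and> \<bar>Re z - x\<bar> < 1 * Im z})"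
    using assms unfolding nt_limit_uhp_def by (meson zero_less_one)+
qed

lemma bval_uhp_eqI: "nt_limit_uhp F x l \<Longrightarrow> bval_uhp F x = l"
  unfolding bval_uhp_def using nt_limit_uhp_unique by blast

lemma bval_disc_eqI: "norm w = 1 \<Longrightarrow> nt_limit_disc f w l \<Longrightarrow> bval_disc f w = l"
  unfolding bval_disc_def using nt_limit_disc_unique by blast

lemma bval_disc_ps: "l2 a \<Longrightarrow> AE t in circle_measure. bval_disc (ps a) (cis t) = bdry a t"
  by (rule eventually_mono[OF nt_limit_disc_ps]) (auto intro: bval_disc_eqI)

text \<open>Measurability of the functions defined by \<open>THE\<close> is accessible only through
  almost everywhere equality; extension by 0 reduces this to completeness of Lebesgue measure on the
  whole line.\<close>

lemma borel_measurable_lebesgue_on_AE: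
  fixes u v :: "real \<Rightarrow> complex"
  assumes u: "u \<in> borel_measurable (lebesgue_on S)" and S: "S \<in> sets lebesgue" and ae: "AE x in lebesgue_on S. u x = v x"
  shows "v \<in> borel_measurable (lebesgue_on S)"
proof -
  have "(\<lambda>x. if x \<in> S then u x else 0) \<in> borel_measurable lebesgue"
    using borel_measurable_if[OF S] u by blast
  moreover have "AE x in lebesgue. (if x \<in> S then u x else 0) = (if x \<in> S then v x else 0)"
    using ae S by (auto simp: AE_restrict_space_iff elim!: AE_mp)
  ultimately have "(\<lambda>x. if x \<in> S then v x else 0) \<in> borel_measurable lebesgue"
    by (rule borel_measurable_AE)
  then show ?thesis using borel_measurable_if[OF S] by blast
qed

lemma square_integrable_AE:
  assumes u: "square_integrable M u" and ae: "AE x in M. u x = v x" and "v \<in> borel_measurable M"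
  shows "square_integrable M v"
proof -
  have "integrable M (\<lambda>x. (norm (v x))\<^sup>2)"
  proof (rule integrable_cong_AE_imp)
    show "integrable M (\<lambda>x. (norm (u x))\<^sup>2)" using u by (simp add: square_integrable_def)
    show "(\<lambda>x. (norm (v x))\<^sup>2) \<in> borel_measurable M" using assms(3) by measurable
    show "AE x in M. (norm (u x))\<^sup>2 = (norm (v x))\<^sup>2" using ae by eventually_elim simp
  qed
  then show ?thesis using assms(3) by (simp add: square_integrable_def)
qed

lemma L2_ip_AE:
  assumes "square_integrable M u" "square_integrable M u'" "square_integrable M v" "square_integrable M v'"
    "AE x in M. u x = u' x" "AE x in M. v x = v' x"
  shows "L2_ip M u v = L2_ip M u' v'"
  unfolding L2_ip_def
proof (rule integral_cong_AE)
  show "(\<lambda>x. u x * cnj (v x)) \<in> borel_measurable M" "(\<lambda>x. u' x * cnj (v' x)) \<in> borel_measurable M"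
    using borel_measurable_integrable[OF integrable_L2_ip[OF assms(1,3)]]
      borel_measurable_integrable[OF integrable_L2_ip[OF assms(2,4)]] .
  show "AE x in M. u x * cnj (v x) = u' x * cnj (v' x)"
    using assms(5,6) by eventually_elim simp
qed

lemma square_integrable_bval_disc:
  assumes "l2 a" shows "square_integrable circle_measure (\<lambda>t. bval_disc (ps a) (cis t))"
proof (rule square_integrable_AE[OF bdry(1)[OF assms]])
  show *: "AE t in circle_measure. bdry a t = bval_disc (ps a) (cis t)"
    using bval_disc_ps[OF assms] by eventually_elim simp
  show "(\<lambda>t. bval_disc (ps a) (cis t)) \<in> borel_measurable circle_measure"
    by (rule borel_measurable_lebesgue_on_AE[OF _ _ *])
      (use bdry(1)[OF assms] in \<open>auto simp: square_integrable_def\<close>)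
qed

theorem inner_disc_ps:
  assumes "l2 a" "l2 b" shows "inner_disc (ps a) (ps b) = 2 * pi * (\<Sum>n. a n * cnj (b n))"
proof -
  have "inner_disc (ps a) (ps b) = L2_ip circle_measure (bdry a) (bdry b)"
    unfolding inner_disc_def L2_inner_circle_eq
    by (intro L2_ip_AE square_integrable_bval_disc bval_disc_ps bdry assms)
  then show ?thesis by (simp add: L2_ip_bdry assms)
qed

section \<open>The Cayley transform\<close>

text \<open>The argument, between 0 and 2 pi, of the point of the circle that corresponds to
  \<open>x\<close>.\<close>

definition cayley_angle :: "real \<Rightarrow> real" where
  "cayley_angle x = 2 * arctan x + pi"

lemma of_real_plus_i_neq [simp]: "complex_of_real x + \<i> \<noteq> 0" 
  by (auto simp: complex_eq_iff)

lemma of_real_minus_i_neq [simp]: "complex_of_real x - \<i> \<noteq> 0" 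
  by (auto simp: complex_eq_iff)

lemma cis_cayley_angle: "cis (cayley_angle x) = (of_real x - \<i>) / (of_real x + \<i>)"
proof -
  have c: "cis (arctan x) = (1 + \<i> * of_real x) / of_real (sqrt (1 + x\<^sup>2))"
    by (simp add: complex_eq_iff cos_arctan sin_arctan)
  have "cis (cayley_angle x) = - (cis (arctan x))\<^sup>2"
    by (simp add: cayley_angle_def cis_mult[symmetric] Complex.DeMoivre)
  also have "\<dots> = - ((1 + \<i> * of_real x)\<^sup>2 / of_real (1 + x\<^sup>2))"
    unfolding c power_divide of_real_power[symmetric] by (simp add: add_nonneg_nonneg)
  also have "of_real (1 + x\<^sup>2) = (1 + \<i> * of_real x) * (1 - \<i> * of_real x)"
    by (simp add: algebra_simps power2_eq_square)
  also have "- ((1 + \<i> * of_real x)\<^sup>2 / ((1 + \<i> * of_real x) * (1 - \<i> * of_real x))) = (of_real x - \<i>) / (of_real x + \<i>)"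
  proof -
    have A: "1 + \<i> * of_real x = \<i> * (of_real x - \<i>)" and B: "1 - \<i> * of_real x = - \<i> * (of_real x + \<i>)"
      by (simp_all add: algebra_simps)
    show ?thesis unfolding A B by (simp add: power2_eq_square)
  qed
  finally show ?thesis .
qed

lemma cayley_angle_range: "range cayley_angle = {0<..<2*pi}"
proof (intro equalityI subsetI)
  fix t assume "t \<in> range cayley_angle"
  then show "t \<in> {0<..<2*pi}"
    using arctan_bounded by (auto simp: cayley_angle_def) (smt (verit, best) arctan_bounded field_sum_of_halves)+
next
  fix t assume t: "t \<in> {0<..<2*pi}"
  then have "arctan (tan ((t - pi) / 2)) = (t - pi) / 2" by (intro arctan_tan) auto
  then have "t = cayley_angle (tan ((t - pi) / 2))" by (simp add: cayley_angle_def)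
  then show "t \<in> range cayley_angle" by blast
qed

lemma cayley_angle_deriv: "(cayley_angle has_field_derivative 2 / (1 + x\<^sup>2)) (at x within S)"
  unfolding cayley_angle_def[abs_def]
  by (auto intro!: derivative_eq_intros simp: divide_simps)

text \<open>The derivative of the angle, \<open>2 / (1 + x^2)\<close>, is also the squared modulus
  of the factor in \<open>Gamma2\<close>.\<close>

lemma cayley_change_of_variables:
  fixes f :: "real \<Rightarrow> 'a::euclidean_space"
  shows "integrable lebesgue (\<lambda>x. (2 / (1 + x\<^sup>2)) *\<^sub>R f (cayley_angle x)) \<longleftrightarrow> integrable circle_measure f" (is ?A)
    and "(LINT x|lebesgue. (2 / (1 + x\<^sup>2)) *\<^sub>R f (cayley_angle x)) = (LINT t|circle_measure. f t)" (is ?B)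
proof -
  let ?F = "\<lambda>x. (2 / (1 + x\<^sup>2)) *\<^sub>R f (cayley_angle x)"
  have inj: "inj cayley_angle" by (auto intro!: injI simp: cayley_angle_def arctan_eq_iff)
  have abs: "\<bar>2 / (1 + x\<^sup>2)\<bar> = 2 / (1 + x\<^sup>2)" for x :: real
    by (simp add: add_nonneg_nonneg)
  have neg: "negligible {x \<in> {0<..<2*pi} - {0..2*pi}. f x \<noteq> 0}" "negligible {x \<in> {0..2*pi} - {0<..<2*pi}. f x \<noteq> 0}"
    by (rule negligible_subset[of "{0, 2*pi}"]; auto)+
  have 1: "integrable lebesgue ?F \<longleftrightarrow> ?F absolutely_integrable_on UNIV"
    by (simp add: set_integrable_def)
  have 2: "f absolutely_integrable_on {0<..<2*pi} \<longleftrightarrow> integrable circle_measure f"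
    unfolding absolutely_integrable_spike_set_eq[OF neg] by (simp add: set_integrable_def integrable_restrict_space)
  have 3: "integral {0<..<2*pi} f = integral {0..2*pi} f"
    by (rule integral_spike_set) (use neg in auto)
  note cv = has_absolute_integral_change_of_variables_real[of UNIV cayley_angle "\<lambda>x. 2 / (1 + x\<^sup>2)" f,
      OF _ cayley_angle_deriv inj, unfolded cayley_angle_range abs]
  show A: ?A unfolding 1 2[symmetric] using cv by auto
  show ?B
  proof (cases "integrable circle_measure f")
    case True
    then have T: "integrable lebesgue ?F" using A by simp
    have "integral UNIV ?F = integral {0<..<2*pi} f"
      using cv[of "integral {0<..<2*pi} f"] True 2 by simp
    then show ?thesis
      using integral_lebesgue[OF T] lebesgue_integral_eq_integral[OF True] 3 by simp
  next
    \<comment> \<open>Both integrals take the default value 0, by the equivalence of integrability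
      just shown.\<close>
    case False
    then show ?thesis using A by (simp add: not_integrable_integral_eq)
  qed
qed

text \<open>The exceptional set on the line is the image of the one on the circle under the inverse
  of the angle function, which is differentiable and hence preserves null sets.\<close>

lemma AE_cayley_angle:
  assumes "AE t in circle_measure. P t" shows "AE x in lebesgue. P (cayley_angle x)"
proof -
  have "AE t in lebesgue. t \<in> {0<..<2*pi} \<longrightarrow> P t" using assms by (simp add: AE_circle_iff)
  then obtain N where N: "negligible N" "\<And>t. t \<notin> N \<Longrightarrow> t \<in> {0<..<2*pi} \<Longrightarrow> P t"
    unfolding completion.AE_iff_null_sets negligible_iff_null_sets by auto
  have "negligible ((\<lambda>t. tan ((t - pi) / 2)) ` (N \<inter> {0<..<2*pi}))"
  proof (rule negligible_differentiable_image_negligible)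
    show "negligible (N \<inter> {0<..<2*pi})" by (rule negligible_subset[OF N(1)]) auto
    show "(\<lambda>t. tan ((t - pi) / 2)) differentiable_on N \<inter> {0<..<2*pi}"
    proof (unfold differentiable_on_def, intro ballI)
      fix t assume t: "t \<in> N \<inter> {0<..<2*pi}"
      then have "cos ((t - pi) / 2) > 0" by (intro cos_gt_zero_pi) auto
      then have "((\<lambda>t. tan ((t - pi) / 2)) has_field_derivative inverse ((cos ((t - pi) / 2))\<^sup>2) * (1 / 2)) (at t within N \<inter> {0<..<2*pi})"
        by (auto intro!: derivative_eq_intros)
      then show "(\<lambda>t. tan ((t - pi) / 2)) differentiable (at t within N \<inter> {0<..<2*pi})"
        using field_differentiable_imp_differentiable field_differentiable_def by blast
    qed
  qed simp
  moreover have "P (cayley_angle x)" if "x \<notin> (\<lambda>t. tan ((t - pi) / 2)) ` (N \<inter> {0<..<2*pi})" for x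
  proof -
    have r: "cayley_angle x \<in> {0<..<2*pi}" using cayley_angle_range by blast
    have "tan ((cayley_angle x - pi) / 2) = x" by (simp add: cayley_angle_def tan_arctan)
    then have "cayley_angle x \<notin> N" using that r by force
    then show ?thesis using N(2) r by blast
  qed
  ultimately show ?thesis
    unfolding negligible_iff_null_sets by (auto intro: eventually_mono[OF AE_not_in])
qed

section \<open>The Cayley transform between disc and half plane\<close>

definition cayley :: "complex \<Rightarrow> complex" where "cayley z = (z - \<i>) / (z + \<i>)"

text \<open>The formula of \<open>Gamma2\<close> at interior points, extended by 0 as the elements
  of \<open>H2_uhp\<close> are. It turns out to be \<open>Gamma2_H2\<close>.\<close>

definition Gam :: "(complex \<Rightarrow> complex) \<Rightarrow> complex \<Rightarrow> complex" where
  "Gam f z = (if Im z > 0 then of_real (sqrt 2) / (z + \<i>) * f (cayley z) else 0)"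

lemma plus_i_neq: "Im z \<ge> 0 \<Longrightarrow> z + \<i> \<noteq> 0"
  by (auto simp: complex_eq_iff)

lemma one_minus_norm_cayley:
  assumes "Im z \<ge> 0" shows "1 - (norm (cayley z))\<^sup>2 = 4 * Im z / (norm (z + \<i>))\<^sup>2"
proof -
  have "norm (z + \<i>) > 0" using plus_i_neq[OF assms] by simp
  moreover have "(norm (z + \<i>))\<^sup>2 - (norm (z - \<i>))\<^sup>2 = 4 * Im z"
    by (simp add: cmod_power2) (simp add: power2_eq_square algebra_simps)
  ultimately have "(norm (z + \<i>))\<^sup>2 - (norm (z - \<i>))\<^sup>2 = 4 * Im z" "(norm (z + \<i>))\<^sup>2 \<noteq> 0" by simp_all
  then show ?thesis
    by (simp add: cayley_def norm_divide power_divide diff_divide_distrib[symmetric] eq_divide_eq left_diff_distrib)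
qed

lemma norm_cayley_less_1: assumes "Im z > 0" shows "norm (cayley z) < 1"
proof -
  have "norm (z + \<i>) > 0" using plus_i_neq[of z] assms by simp
  then have "(norm (cayley z))\<^sup>2 < 1" using one_minus_norm_cayley[of z] assms
    by (smt (verit) divide_pos_pos zero_less_power)
  then show ?thesis by (simp add: power_less_one_iff abs_square_less_1)
qed

text \<open>The Cayley map carries a Stolz angle at \<open>x\<close>, near \<open>x\<close>, into a
  Stolz region at the image point. The aperture \<open>2 * (1 + a) + 1\<close> comes from
  \<open>norm (z + \<i>) \<le> 2 * norm (x + \<i>)\<close>, valid within distance 1 of
  \<open>x\<close>; the added 1 makes the inequality strict.\<close>

lemma nt_limit_uhp_Gam:
  assumes "nt_limit_disc f (cayley (of_real x)) l"
  shows "nt_limit_uhp (Gam f) x (of_real (sqrt 2) / (of_real x + \<i>) * l)"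
  unfolding nt_limit_uhp_def
proof (intro allI impI)
  fix a :: real assume a: "a > 0"
  let ?S = "{z. Im z > 0 \<and> \<bar>Re z - x\<bar> < a * Im z}"
  let ?R = "{z. norm z < 1 \<and> norm (z - cayley (of_real x)) < (2 * (1 + a) + 1) * (1 - norm z)}"
  have S: "\<forall>\<^sub>F z in at (of_real x) within ?S. z \<in> ?S" by (simp add: eventually_at_filter)
  have near: "\<forall>\<^sub>F z in at (of_real x) within ?S. dist z (of_real x) < 1"
    unfolding eventually_at by (intro exI[of _ 1]) auto
  have "filterlim cayley (at (cayley (of_real x)) within ?R) (at (of_real x) within ?S)"
    unfolding filterlim_at
  proof (intro conjI)
    show "(cayley \<longlongrightarrow> cayley (of_real x)) (at (of_real x) within ?S)"
      unfolding cayley_def by (intro tendsto_intros) auto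
    show "\<forall>\<^sub>F z in at (of_real x) within ?S. cayley z \<in> ?R \<and> cayley z \<noteq> cayley (of_real x)"
      using S near
    proof eventually_elim
      fix z assume z: "z \<in> ?S" and d: "dist z (of_real x) < 1"
      have y: "Im z > 0" using z by simp
      have n: "norm (cayley z) < 1" by (rule norm_cayley_less_1[OF y])
      define p where "p = norm (z + \<i>)"
      define q where "q = norm (complex_of_real x + \<i>)"
      have p: "p > 0" using plus_i_neq[of z] y by (simp add: p_def)
      have q: "q \<ge> 1" using abs_Im_le_cmod[of "of_real x + \<i>"] by (simp add: q_def)
      have "p \<le> q + norm (z - of_real x)"
        unfolding p_def q_def using norm_triangle_ineq[of "of_real x + \<i>" "z - of_real x"] by (simp add: algebra_simps)
      then have pq: "p \<le> 2 * q" using d q by (simp add: dist_norm)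
      have eq: "cayley z - cayley (of_real x) = 2 * \<i> * (z - of_real x) / ((z + \<i>) * (of_real x + \<i>))"
      proof -
        have "(z - \<i>) * (of_real x + \<i>) - (of_real x - \<i>) * (z + \<i>) = 2 * \<i> * (z - of_real x)"
          by (simp add: algebra_simps)
        then show ?thesis
          using plus_i_neq[of z] y unfolding cayley_def by (subst diff_frac_eq) auto
      qed
      have zx: "norm (z - of_real x) \<le> (1 + a) * Im z"
        using cmod_le[of "z - of_real x"] z by (simp add: algebra_simps)
      have "norm (cayley z - cayley (of_real x)) = 2 * norm (z - of_real x) / (p * q)"
        unfolding eq by (simp add: norm_mult norm_divide p_def q_def)
      also have "\<dots> \<le> 2 * ((1 + a) * Im z) / (p * q)"
        using zx p q by (intro divide_right_mono) auto
      also have "\<dots> = (1 + a) * (p / q) * (2 * Im z / p\<^sup>2)"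
        using p q by (simp add: field_simps power2_eq_square)
      also have "\<dots> \<le> (1 + a) * 2 * (1 - norm (cayley z))"
      proof (intro mult_mono)
        show "p / q \<le> 2" using pq q by (simp add: divide_simps)
        have "2 * (2 * Im z / p\<^sup>2) = (1 - norm (cayley z)) * (1 + norm (cayley z))"
          using one_minus_norm_cayley[of z] y by (simp add: p_def power2_eq_square algebra_simps)
        also have "\<dots> \<le> (1 - norm (cayley z)) * 2" using n by (intro mult_left_mono) auto
        finally show "2 * Im z / p\<^sup>2 \<le> 1 - norm (cayley z)" by simp
      qed (use a y p q n in auto)
      also have "\<dots> < (2 * (1 + a) + 1) * (1 - norm (cayley z))" using n by (simp add: algebra_simps)
      finally have "cayley z \<in> ?R" using n by simp
      moreover have "cayley z \<noteq> cayley (of_real x)"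
      proof
        assume "cayley z = cayley (of_real x)"
        then have "z = of_real x" using eq plus_i_neq[of z] y by simp
        then show False using y by simp
      qed
      ultimately show "cayley z \<in> ?R \<and> cayley z \<noteq> cayley (of_real x)" by blast
    qed
  qed
  moreover have "(f \<longlongrightarrow> l) (at (cayley (of_real x)) within ?R)"
    using assms a unfolding nt_limit_disc_def by auto
  ultimately have "((\<lambda>z. f (cayley z)) \<longlongrightarrow> l) (at (of_real x) within ?S)" by (rule filterlim_compose[rotated])
  then have "((\<lambda>z. of_real (sqrt 2) / (z + \<i>) * f (cayley z)) \<longlongrightarrow> of_real (sqrt 2) / (of_real x + \<i>) * l) (at (of_real x) within ?S)"
    by (intro tendsto_intros) auto
  moreover have "\<forall>\<^sub>F z in at (of_real x) within ?S. of_real (sqrt 2) / (z + \<i>) * f (cayley z) = Gam f z"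
    using S by eventually_elim (simp add: Gam_def)
  ultimately show "(Gam f \<longlongrightarrow> of_real (sqrt 2) / (of_real x + \<i>) * l) (at (of_real x) within ?S)"
    by (rule Lim_transform_eventually)
qed

definition line_bdry :: "(nat \<Rightarrow> complex) \<Rightarrow> real \<Rightarrow> complex" where
  "line_bdry a x = of_real (sqrt 2) / (of_real x + \<i>) * bdry a (cayley_angle x)"

lemma nt_limit_uhp_Gam_ps:
  assumes "l2 a" shows "AE x in lebesgue. nt_limit_uhp (Gam (ps a)) x (line_bdry a x)"
  using AE_cayley_angle[OF nt_limit_disc_ps[OF assms]]
proof eventually_elim
  fix x assume "nt_limit_disc (ps a) (cis (cayley_angle x)) (bdry a (cayley_angle x))"
  then show "nt_limit_uhp (Gam (ps a)) x (line_bdry a x)"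
    unfolding line_bdry_def by (intro nt_limit_uhp_Gam) (simp add: cis_cayley_angle cayley_def)
qed

lemma bval_uhp_Gam_ps:
  assumes "l2 a" shows "AE x in lebesgue. bval_uhp (Gam (ps a)) x = line_bdry a x"
  using nt_limit_uhp_Gam_ps[OF assms] by eventually_elim (rule bval_uhp_eqI)

text \<open>The two factors of \<open>Gamma2\<close> multiply to exactly the density of the change
  of variables, which is why \<open>Gamma2\<close> preserves inner products.\<close>

lemma cayley_weight: 
  "of_real (sqrt 2) / (of_real x + \<i>) * u * cnj (of_real (sqrt 2) / (of_real x + \<i>) * v) = (2 / (1 + x\<^sup>2)) *\<^sub>R (u * cnj v)"
proof -
  have 1: "(of_real x + \<i>) * cnj (of_real x + \<i>) = of_real (1 + x\<^sup>2)"
    by (simp add: algebra_simps power2_eq_square)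
  have "of_real (sqrt 2) / (of_real x + \<i>) * u * cnj (of_real (sqrt 2) / (of_real x + \<i>) * v) =
     (of_real (sqrt 2) * of_real (sqrt 2)) * (u * cnj v) / ((of_real x + \<i>) * cnj (of_real x + \<i>))"
    by (simp add: mult_ac)
  also have "\<dots> = (2 / (1 + x\<^sup>2)) *\<^sub>R (u * cnj v)"
    unfolding 1 of_real_mult[symmetric] by (simp add: scaleR_conv_of_real)
  finally show ?thesis .
qed

lemma cayley_transfer:
  shows "integrable lebesgue (\<lambda>x. of_real (sqrt 2) / (of_real x + \<i>) * u (cayley_angle x) * cnj (of_real (sqrt 2) / (of_real x + \<i>) * v (cayley_angle x)))
    \<longleftrightarrow> integrable circle_measure (\<lambda>t. u t * cnj (v t))"
    "L2_ip lebesgue (\<lambda>x. of_real (sqrt 2) / (of_real x + \<i>) * u (cayley_angle x)) (\<lambda>x. of_real (sqrt 2) / (of_real x + \<i>) * v (cayley_angle x))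
     = L2_ip circle_measure u v"
  unfolding L2_ip_def cayley_weight
  using cayley_change_of_variables[of "\<lambda>t. u t * cnj (v t)"] by auto

text \<open>Composition with a Lebesgue measurable function need not be measurable. Here it follows
  from the integrability in the change of variables, after dividing out the continuous
  weight.\<close>

lemma borel_measurable_cayley_angle:
  fixes u :: "real \<Rightarrow> complex"
  assumes u: "square_integrable circle_measure u"
  shows "(\<lambda>x. u (cayley_angle x)) \<in> borel_measurable lebesgue"
proof -
  have "integrable circle_measure u"
    using integrable_circle_square_integrable[OF u, of "\<lambda>_. 1"] by simp
  then have "integrable lebesgue (\<lambda>x. (2 / (1 + x\<^sup>2)) *\<^sub>R u (cayley_angle x))"
    by (simp only: cayley_change_of_variables)
  then have 1: "(\<lambda>x. (2 / (1 + x\<^sup>2)) *\<^sub>R u (cayley_angle x)) \<in> borel_measurable lebesgue" by (rule borel_measurable_integrable)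
  have 2: "(\<lambda>x::real. (1 + x\<^sup>2) / 2) \<in> borel_measurable lebesgue"
    by (intro measurable_completion) measurable
  have 3: "((1 + x\<^sup>2) / 2) *\<^sub>R ((2 / (1 + x\<^sup>2)) *\<^sub>R u (cayley_angle x)) = u (cayley_angle x)" for x
  proof -
    have "(1 + x\<^sup>2) / 2 * (2 / (1 + x\<^sup>2)) = 1"
      using add_nonneg_eq_0_iff[of 1 "x\<^sup>2"] by (simp add: divide_simps)
    then show ?thesis by (simp only: scaleR_scaleR scaleR_one)
  qed
  show ?thesis using borel_measurable_scaleR[OF 2 1] unfolding 3 .
qed

lemma borel_measurable_lebesgue_continuous:
  fixes f :: "real \<Rightarrow> complex"
  shows "continuous_on UNIV f \<Longrightarrow> f \<in> borel_measurable lebesgue"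
  by (intro measurable_completion) (simp add: borel_measurable_continuous_onI)

lemma square_integrable_cayley:
  assumes u: "square_integrable circle_measure u"
  shows "square_integrable lebesgue (\<lambda>x. of_real (sqrt 2) / (of_real x + \<i>) * u (cayley_angle x))" (is "square_integrable _ ?U")
proof -
  have m: "?U \<in> borel_measurable lebesgue"
    by (intro borel_measurable_times borel_measurable_cayley_angle u borel_measurable_lebesgue_continuous continuous_intros) auto
  have "integrable lebesgue (\<lambda>x. ?U x * cnj (?U x))"
    unfolding cayley_transfer by (rule integrable_L2_ip[OF u u])
  then have "integrable lebesgue (\<lambda>x. norm (?U x * cnj (?U x)))" by (rule integrable_norm)
  then show ?thesis
    using m unfolding square_integrable_def norm_mult complex_mod_cnj power2_eq_square by blast
qed

lemma square_integrable_line_bdry: "l2 a \<Longrightarrow> square_integrable lebesgue (line_bdry a)"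
  unfolding line_bdry_def[abs_def] by (intro square_integrable_cayley bdry)

lemma L2_ip_line_bdry: "l2 a \<Longrightarrow> l2 b \<Longrightarrow> L2_ip lebesgue (line_bdry a) (line_bdry b) = 2 * pi * (\<Sum>n. a n * cnj (b n))"
  unfolding line_bdry_def[abs_def] cayley_transfer by (rule L2_ip_bdry)

lemma square_integrable_bval_uhp:
  assumes "l2 a" shows "square_integrable lebesgue (bval_uhp (Gam (ps a)))"
proof (rule square_integrable_AE[OF square_integrable_line_bdry[OF assms]])
  show *: "AE x in lebesgue. line_bdry a x = bval_uhp (Gam (ps a)) x"
    using bval_uhp_Gam_ps[OF assms] by eventually_elim simp
  show "bval_uhp (Gam (ps a)) \<in> borel_measurable lebesgue"
    by (rule borel_measurable_AE[OF _ *])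
      (use square_integrable_line_bdry[OF assms] in \<open>auto simp: square_integrable_def\<close>)
qed

theorem inner_uhp_Gam_ps:
  assumes "l2 a" "l2 b" shows "inner_uhp (Gam (ps a)) (Gam (ps b)) = 2 * pi * (\<Sum>n. a n * cnj (b n))"
proof -
  have "inner_uhp (Gam (ps a)) (Gam (ps b)) = L2_ip lebesgue (line_bdry a) (line_bdry b)"
    unfolding inner_uhp_def L2_inner_real_def L2_ip_def[symmetric]
    by (intro L2_ip_AE square_integrable_bval_uhp square_integrable_line_bdry bval_uhp_Gam_ps assms)
  then show ?thesis by (simp add: L2_ip_line_bdry assms)
qed

section \<open>The Hardy space of the half plane\<close>

text \<open>The case \<open>c = 1\<close>, \<open>s = 0\<close> is half the length of the circle;
  the rest is an affine substitution.\<close>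

lemma nn_integral_Cauchy_density:
  assumes c: "c > 0"
  shows "(\<integral>\<^sup>+x. ennreal (c / ((x - s)\<^sup>2 + c\<^sup>2)) \<partial>lborel) = ennreal pi"
proof -
  have "integrable circle_measure (\<lambda>_. 1/2 :: real)"
    using finite_measure.integrable_const[OF finite_measure_circle] by blast
  then have i: "integrable lebesgue (\<lambda>x. (2 / (1 + x\<^sup>2)) *\<^sub>R (1/2 :: real))"
    by (rule iffD2[OF cayley_change_of_variables(1)[of "\<lambda>_. 1/2 :: real"]])
  have "(LINT x|lebesgue. (2 / (1 + x\<^sup>2)) *\<^sub>R (1/2 :: real)) = (LINT t|circle_measure. 1/2)"
    by (rule cayley_change_of_variables(2))
  also have "\<dots> = pi" by (simp add: measure_restrict_space)
  finally have "(\<integral>\<^sup>+x. ennreal ((2 / (1 + x\<^sup>2)) *\<^sub>R (1/2 :: real)) \<partial>lebesgue) = ennreal pi"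
    using i by (subst nn_integral_eq_integral) (auto simp: add_nonneg_nonneg)
  moreover have "(2 / c) *\<^sub>R (1/2 :: real) = 1 / c" for c by simp
  ultimately have *: "(\<integral>\<^sup>+x. ennreal (1 / (1 + x\<^sup>2)) \<partial>lborel) = ennreal pi"
    by (simp only: nn_integral_completion)
  have "(\<integral>\<^sup>+x. ennreal (c / ((x - s)\<^sup>2 + c\<^sup>2)) \<partial>lborel) = ennreal c * (\<integral>\<^sup>+x. ennreal (c / ((s + c * x - s)\<^sup>2 + c\<^sup>2)) \<partial>lborel)"
    using nn_integral_real_affine[of "\<lambda>x. ennreal (c / ((x - s)\<^sup>2 + c\<^sup>2))" c s] c by simp
  also have "\<dots> = (\<integral>\<^sup>+x. ennreal c * ennreal (c / ((s + c * x - s)\<^sup>2 + c\<^sup>2)) \<partial>lborel)"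
    by (rule nn_integral_cmult[symmetric]) simp
  also have "\<dots> = (\<integral>\<^sup>+x. ennreal (1 / (1 + x\<^sup>2)) \<partial>lborel)"
  proof (rule nn_integral_cong)
    fix x :: real
    have "c * (c / ((s + c * x - s)\<^sup>2 + c\<^sup>2)) = c\<^sup>2 / (c\<^sup>2 * (1 + x\<^sup>2))"
      by (simp add: power_mult_distrib algebra_simps power2_eq_square)
    also have "\<dots> = 1 / (1 + x\<^sup>2)" using c by simp
    finally show "ennreal c * ennreal (c / ((s + c * x - s)\<^sup>2 + c\<^sup>2)) = ennreal (1 / (1 + x\<^sup>2))"
      using c by (simp add: ennreal_mult[symmetric] add_nonneg_nonneg)
  qed
  finally show ?thesis using * by simp
qed

text \<open>Applying the Poisson formula to the holomorphic function \<open>f^2\<close> gives the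
  bound for the squared modulus from the triangle inequality alone.\<close>

lemma Poisson_inequality:
  assumes cont: "continuous_on (cball 0 1) f" and hol: "f holomorphic_on ball 0 1" and w: "norm w < 1"
  shows "ennreal ((norm (f w))\<^sup>2) \<le>
    (\<integral>\<^sup>+t. ennreal ((1 - (norm w)\<^sup>2) / (norm (cis t - w))\<^sup>2 * (norm (f (cis t)))\<^sup>2 / (2 * pi)) * indicator {0..2*pi} t \<partial>lborel)"
proof -
  let ?P = "\<lambda>t. (1 - (norm w)\<^sup>2) / (norm (cis t - w))\<^sup>2"
  have cf: "continuous_on {0..2*pi} (\<lambda>t. f (cis t))"
    by (rule continuous_on_compose2[OF cont]) (auto intro!: continuous_intros)
  have P0: "0 \<le> ?P t" for t using w by (simp add: power_le_one)
  have c2: "continuous_on {0..2*pi} (\<lambda>t. ?P t * (norm (f (cis t)))\<^sup>2)"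
    by (intro continuous_intros continuous_on_Poisson_kernel cf w)
  have "2 * pi * (norm (f w))\<^sup>2 = norm (2 * pi * (f w)\<^sup>2)"
    by (simp add: norm_mult norm_power)
  also have "2 * pi * (f w)\<^sup>2 = integral {0..2*pi} (\<lambda>t. of_real (?P t) * (f (cis t))\<^sup>2)"
    by (rule Poisson_integral_formula[of "\<lambda>z. (f z)\<^sup>2", symmetric])
      (auto intro!: continuous_intros holomorphic_intros cont hol w)
  also have "norm \<dots> \<le> integral {0..2*pi} (\<lambda>t. ?P t * (norm (f (cis t)))\<^sup>2)"
  proof (rule integral_norm_bound_integral)
    have cP: "continuous_on {0..2*pi} (\<lambda>t. complex_of_real (?P t))"
      by (intro continuous_on_of_real continuous_on_Poisson_kernel w)
    show "(\<lambda>t. of_real (?P t) * (f (cis t))\<^sup>2) integrable_on {0..2*pi}"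
      by (intro integrable_continuous_interval continuous_on_mult continuous_on_power cf cP)
    show "(\<lambda>t. ?P t * (norm (f (cis t)))\<^sup>2) integrable_on {0..2*pi}"
      by (intro integrable_continuous_interval c2)
    fix t
    show "norm (of_real (?P t) * (f (cis t))\<^sup>2) \<le> ?P t * (norm (f (cis t)))\<^sup>2"
      unfolding norm_mult norm_of_real norm_power abs_of_nonneg[OF P0] by simp
  qed
  finally have le: "(norm (f w))\<^sup>2 \<le> integral {0..2*pi} (\<lambda>t. ?P t * (norm (f (cis t)))\<^sup>2) / (2 * pi)"
    by (simp add: field_simps)
  have "(\<lambda>t. ?P t * (norm (f (cis t)))\<^sup>2 / (2 * pi)) absolutely_integrable_on {0..2*pi}"
    by (intro absolutely_integrable_continuous_real continuous_on_divide c2 continuous_intros) auto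
  then have i: "integrable circle_measure (\<lambda>t. ?P t * (norm (f (cis t)))\<^sup>2 / (2 * pi))"
    by (intro absolutely_integrable_imp_integrable) auto
  have "ennreal ((norm (f w))\<^sup>2) \<le> ennreal (integral {0..2*pi} (\<lambda>t. ?P t * (norm (f (cis t)))\<^sup>2 / (2 * pi)))"
    using le by (intro ennreal_leI) (simp only: Henstock_Kurzweil_Integration.integral_divide)
  also have "\<dots> = ennreal (LINT t|circle_measure. ?P t * (norm (f (cis t)))\<^sup>2 / (2 * pi))"
    by (subst lebesgue_integral_eq_integral[OF i]) auto
  also have "\<dots> = (\<integral>\<^sup>+t. ennreal (?P t * (norm (f (cis t)))\<^sup>2 / (2 * pi)) \<partial>circle_measure)"
    by (rule nn_integral_eq_integral[symmetric, OF i]) (intro AE_I2 P0 divide_nonneg_pos mult_nonneg_nonneg zero_le_power2, simp)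
  also have "\<dots> = (\<integral>\<^sup>+t. ennreal (?P t * (norm (f (cis t)))\<^sup>2 / (2 * pi)) * indicator {0..2*pi} t \<partial>lborel)"
    by (rule nn_integral_circle[symmetric])
  finally show ?thesis .
qed

text \<open>The disc kernel at \<open>cayley z\<close> with the weight of \<open>Gam\<close>,
  rewritten in the coordinates of the line so that it can be integrated along horizontal
  lines.\<close>

lemma Poisson_kernel_cayley:
  assumes y: "Im z > 0"
  shows "2 / (norm (z + \<i>))\<^sup>2 * ((1 - (norm (cayley z))\<^sup>2) / (norm (cis (cayley_angle s) - cayley z))\<^sup>2)
    = 2 * Im z * (1 + s\<^sup>2) / ((norm (z + \<i>))\<^sup>2 * (norm (z - of_real s))\<^sup>2)"
proof -
  define p where "p = norm (z + \<i>)"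
  define q where "q = norm (complex_of_real s + \<i>)"
  define r where "r = norm (z - of_real s)"
  have p: "p > 0" using plus_i_neq[of z] y by (simp add: p_def)
  have q: "q > 0" by (simp add: q_def)
  have r: "r > 0" using y by (auto simp: r_def)
  have q2: "q\<^sup>2 = 1 + s\<^sup>2" by (simp add: q_def cmod_power2 add.commute)
  have "(of_real s - \<i>) * (z + \<i>) - (z - \<i>) * (of_real s + \<i>) = 2 * \<i> * (of_real s - z)"
    by (simp add: algebra_simps)
  then have "cis (cayley_angle s) - cayley z = 2 * \<i> * (of_real s - z) / ((of_real s + \<i>) * (z + \<i>))"
    using plus_i_neq[of z] y unfolding cayley_def cis_cayley_angle by (subst diff_frac_eq) auto
  then have 1: "norm (cis (cayley_angle s) - cayley z) = 2 * r / (q * p)"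
    by (simp add: norm_mult norm_divide p_def q_def r_def norm_minus_commute)
  have 2: "1 - (norm (cayley z))\<^sup>2 = 4 * Im z / p\<^sup>2"
    using one_minus_norm_cayley[of z] y by (simp add: p_def)
  show ?thesis
    unfolding 1 2 p_def[symmetric] r_def[symmetric] q2[symmetric]
    using p q r by (simp add: field_simps power2_eq_square)
qed

text \<open>The inequality \<open>1 + s^2 \<le> 2 * B + 2 * A\<close> splits the kernel into Cauchy
  densities of heights \<open>1 + y\<close> and \<open>y\<close>, each of mass pi. The bound is
  uniform in \<open>s\<close> and \<open>y\<close>.\<close>

lemma nn_integral_Poisson_cayley_le:
  assumes y: "y > 0"
  shows "(\<integral>\<^sup>+x. ennreal (2 / (norm (Complex x y + \<i>))\<^sup>2 * ((1 - (norm (cayley (Complex x y)))\<^sup>2) /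
      (norm (cis (cayley_angle s) - cayley (Complex x y)))\<^sup>2)) \<partial>lborel) \<le> ennreal (8 * pi)"
proof -
  have le: "2 / (norm (Complex x y + \<i>))\<^sup>2 * ((1 - (norm (cayley (Complex x y)))\<^sup>2) / (norm (cis (cayley_angle s) - cayley (Complex x y)))\<^sup>2)
     \<le> 4 * (y / (1 + y)) * ((1 + y) / ((x - 0)\<^sup>2 + (1 + y)\<^sup>2)) + 4 * (y / ((x - s)\<^sup>2 + y\<^sup>2))" for x
  proof -
    define A where "A = x\<^sup>2 + (1 + y)\<^sup>2"
    define B where "B = (x - s)\<^sup>2 + y\<^sup>2"
    have A: "A > 0" using y by (simp add: A_def add_nonneg_pos)
    have B: "B > 0" using y by (simp add: B_def add_nonneg_pos)
    have AA: "(norm (Complex x y + \<i>))\<^sup>2 = A" by (simp add: A_def cmod_power2 add.commute)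
    have BB: "(norm (Complex x y - of_real s))\<^sup>2 = B" by (simp add: B_def cmod_power2)
    have "1 + s\<^sup>2 \<le> 2 * B + 2 * A"
    proof -
      have "s\<^sup>2 \<le> 2 * (x - s)\<^sup>2 + 2 * x\<^sup>2"
        using zero_le_power2[of "s - 2 * x"] by (simp add: power2_eq_square algebra_simps)
      moreover have "1 \<le> (1 + y)\<^sup>2" using y by simp
      moreover have "1 + s2 \<le> 2 * (a + d) + 2 * (b + c)"
        if "s2 \<le> 2 * a + 2 * b" "1 \<le> c" "0 \<le> d" for s2 a b c d :: real
      proof -
        have "1 + s2 \<le> 2 * c + (2 * a + 2 * b) + 2 * d"
          using that(1) mult_left_mono[OF that(2), of 2] mult_left_mono[OF that(3), of 2] by simp
        then show ?thesis by (simp add: algebra_simps)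
      qed
      ultimately show ?thesis unfolding A_def B_def using zero_le_power2[of y] by blast
    qed
    then have "2 * y * (1 + s\<^sup>2) / (A * B) \<le> 2 * y * (2 * B + 2 * A) / (A * B)"
      using A B y by (intro divide_right_mono mult_left_mono) auto
    also have "\<dots> = 4 * (y / A) + 4 * (y / B)"
      using A B by (simp add: field_simps)
    also have "y / A = y / (1 + y) * ((1 + y) / A)" using y by simp
    also have "4 * (y / (1 + y) * ((1 + y) / A)) = 4 * (y / (1 + y)) * ((1 + y) / A)" by (simp only: mult.assoc)
    finally show ?thesis
      using Poisson_kernel_cayley[of "Complex x y" s] y unfolding AA BB by (simp add: A_def B_def)
  qed
  have "(\<integral>\<^sup>+x. ennreal (2 / (norm (Complex x y + \<i>))\<^sup>2 * ((1 - (norm (cayley (Complex x y)))\<^sup>2) /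
      (norm (cis (cayley_angle s) - cayley (Complex x y)))\<^sup>2)) \<partial>lborel)
    \<le> (\<integral>\<^sup>+x. ennreal (4 * (y / (1 + y))) * ennreal ((1 + y) / ((x - 0)\<^sup>2 + (1 + y)\<^sup>2)) + ennreal 4 * ennreal (y / ((x - s)\<^sup>2 + y\<^sup>2)) \<partial>lborel)"
  proof (rule nn_integral_mono)
    fix x
    show "ennreal (2 / (norm (Complex x y + \<i>))\<^sup>2 * ((1 - (norm (cayley (Complex x y)))\<^sup>2) /
      (norm (cis (cayley_angle s) - cayley (Complex x y)))\<^sup>2)) \<le> ennreal (4 * (y / (1 + y))) * ennreal ((1 + y) / ((x - 0)\<^sup>2 + (1 + y)\<^sup>2)) + ennreal 4 * ennreal (y / ((x - s)\<^sup>2 + y\<^sup>2))"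
      using le[of x] y
      by (simp only: ennreal_mult[symmetric] ennreal_plus[symmetric] divide_nonneg_nonneg mult_nonneg_nonneg zero_le_power2 add_nonneg_nonneg less_imp_le zero_less_one zero_le_numeral ennreal_leI)
  qed
  also have "\<dots> = ennreal (4 * (y / (1 + y))) * ennreal pi + ennreal 4 * ennreal pi"
  proof (subst nn_integral_add)
    have m: "(\<lambda>x. ennreal (c / ((x - s)\<^sup>2 + c\<^sup>2))) \<in> borel_measurable lborel" for c s :: real by measurable
    then show "(\<lambda>x. ennreal c' * ennreal (c / ((x - s)\<^sup>2 + c\<^sup>2))) \<in> borel_measurable lborel" for c c' s :: real by measurable
    then show "(\<lambda>x. ennreal c' * ennreal (c / ((x - s)\<^sup>2 + c\<^sup>2))) \<in> borel_measurable lborel" for c c' s :: real .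
    have "(\<integral>\<^sup>+x. ennreal c' * ennreal (c / ((x - s)\<^sup>2 + c\<^sup>2)) \<partial>lborel) = ennreal c' * ennreal pi" if "c > 0" for c c' s :: real
      unfolding nn_integral_cmult[OF m] nn_integral_Cauchy_density[OF that] ..
    then show "(\<integral>\<^sup>+x. ennreal (4 * (y / (1 + y))) * ennreal ((1 + y) / ((x - 0)\<^sup>2 + (1 + y)\<^sup>2)) \<partial>lborel) +
        (\<integral>\<^sup>+x. ennreal 4 * ennreal (y / ((x - s)\<^sup>2 + y\<^sup>2)) \<partial>lborel) = ennreal (4 * (y / (1 + y))) * ennreal pi + ennreal 4 * ennreal pi"
      using y by (simp only: add_pos_pos zero_less_one)
  qed
  also have "\<dots> = ennreal (4 * (y / (1 + y)) * pi + 4 * pi)"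
  proof -
    have "ennreal A * ennreal pi + ennreal 4 * ennreal pi = ennreal (A * pi + 4 * pi)" if "A \<ge> 0" for A
      using that by (subst ennreal_plus) (auto simp: ennreal_mult)
    then show ?thesis using y by simp
  qed
  also have "\<dots> \<le> ennreal (8 * pi)"
  proof (intro ennreal_leI)
    have "4 * q * pi + 4 * pi \<le> 8 * pi" if "q \<le> 1" for q
      using mult_right_mono[OF that, of pi] by simp
    moreover have "y / (1 + y) \<le> 1" using y by simp
    ultimately show "4 * (y / (1 + y)) * pi + 4 * pi \<le> 8 * pi" by blast
  qed
  finally show ?thesis .
qed

text \<open>The squared modulus of \<open>Gam f\<close> is at most a Poisson integral over the
  circle. After exchanging the integrals the kernel has mass at most \<open>8 * pi\<close> on each
  horizontal line; the normalization \<open>2 * pi\<close> of the Poisson formula leaves the factor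
  4.\<close>

lemma Gam_dilation_bound:
  assumes cont: "continuous_on (cball 0 1) f" and hol: "f holomorphic_on ball 0 1" and y: "y > 0"
  shows "(\<integral>\<^sup>+x. ennreal ((norm (Gam f (Complex x y)))\<^sup>2) \<partial>lborel) \<le> 4 * ennreal (L2_sq circle_measure (\<lambda>t. f (cis t)))"
proof -
  \<comment> \<open>Cut off to the interval, the boundary modulus is Borel on the whole line, so
    that Tonelli's theorem applies to \<open>lborel\<close>.\<close>
  define h where "h t = (if t \<in> {0..2*pi} then (norm (f (cis t)))\<^sup>2 else 0)" for t
  have cf: "continuous_on {0..2*pi} (\<lambda>t. f (cis t))"
    by (rule continuous_on_compose2[OF cont]) (auto intro!: continuous_intros)
  have hm [measurable]: "h \<in> borel_measurable borel"
  proof -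
    have "continuous_on {0..2*pi} (\<lambda>t. (norm (f (cis t)))\<^sup>2)" by (intro continuous_intros cf)
    then have "(\<lambda>t. indicator {0..2*pi} t *\<^sub>R (norm (f (cis t)))\<^sup>2) \<in> borel_measurable borel"
      by (intro borel_measurable_continuous_on_indicator) auto
    moreover have "(\<lambda>t. indicator {0..2*pi} t *\<^sub>R (norm (f (cis t)))\<^sup>2) = h"
      by (auto simp: h_def)
    ultimately show ?thesis by simp
  qed
  define k where "k x t = 2 / (norm (Complex x y + \<i>))\<^sup>2 * ((1 - (norm (cayley (Complex x y)))\<^sup>2) / (norm (cis t - cayley (Complex x y)))\<^sup>2)" for x t
  have Cxy: "Complex x y = of_real x + \<i> * of_real y" for x by (simp add: complex_eq_iff)
  have w: "norm (cayley (Complex x y)) < 1" for x by (rule norm_cayley_less_1) (use y in simp)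
  have k0: "k x t \<ge> 0" for x t
    unfolding k_def using w[of x] by (intro mult_nonneg_nonneg divide_nonneg_nonneg) (auto simp: power_le_one)
  have kc: "continuous_on UNIV (\<lambda>p. k (fst p) (snd p))"
  proof -
    have nz: "of_real x + \<i> * of_real y + \<i> \<noteq> 0" for x
      using plus_i_neq[of "Complex x y"] y by (simp add: Cxy)
    then have cc: "continuous_on UNIV (\<lambda>p::real\<times>real. cayley (Complex (fst p) y))"
      unfolding cayley_def Cxy by (auto intro!: continuous_intros)
    show ?thesis unfolding k_def
      by (intro continuous_intros cc) (use nz w in \<open>auto simp: Cxy intro!: continuous_intros\<close>, metis norm_cis less_irrefl)
  qed
  then have km [measurable]: "(\<lambda>p. k (fst p) (snd p)) \<in> borel_measurable (borel \<Otimes>\<^sub>M borel)"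
    by (metis borel_measurable_continuous_onI borel_prod)
  have 1: "ennreal ((norm (Gam f (Complex x y)))\<^sup>2) \<le> (\<integral>\<^sup>+t. ennreal (k x t) * ennreal (h t / (2 * pi)) \<partial>lborel)" for x
  proof -
    have "(norm (Gam f (Complex x y)))\<^sup>2 = 2 / (norm (Complex x y + \<i>))\<^sup>2 * (norm (f (cayley (Complex x y))))\<^sup>2"
      using y by (simp add: Gam_def norm_mult norm_divide power_mult_distrib power_divide)
    then have "ennreal ((norm (Gam f (Complex x y)))\<^sup>2) = ennreal (2 / (norm (Complex x y + \<i>))\<^sup>2) * ennreal ((norm (f (cayley (Complex x y))))\<^sup>2)"
      by (subst ennreal_mult[symmetric]) auto
    also have "\<dots> \<le> ennreal (2 / (norm (Complex x y + \<i>))\<^sup>2) * (\<integral>\<^sup>+t. ennreal ((1 - (norm (cayley (Complex x y)))\<^sup>2) / (norm (cis t - cayley (Complex x y)))\<^sup>2 * (norm (f (cis t)))\<^sup>2 / (2 * pi)) * indicator {0..2*pi} t \<partial>lborel)"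
      by (intro mult_left_mono Poisson_inequality cont hol w) auto
    also have "\<dots> = ennreal (2 / (norm (Complex x y + \<i>))\<^sup>2) * (\<integral>\<^sup>+t. ennreal ((1 - (norm (cayley (Complex x y)))\<^sup>2) / (norm (cis t - cayley (Complex x y)))\<^sup>2 * h t / (2 * pi)) \<partial>lborel)"
      by (intro arg_cong2[where f="(*)"] refl nn_integral_cong) (auto simp: h_def split: split_indicator)
    also have "\<dots> = (\<integral>\<^sup>+t. ennreal (2 / (norm (Complex x y + \<i>))\<^sup>2) * ennreal ((1 - (norm (cayley (Complex x y)))\<^sup>2) / (norm (cis t - cayley (Complex x y)))\<^sup>2 * h t / (2 * pi)) \<partial>lborel)"
    proof (rule nn_integral_cmult[symmetric])
      have [measurable]: "(\<lambda>t. (1 - (norm (cayley (Complex x y)))\<^sup>2) / (norm (cis t - cayley (Complex x y)))\<^sup>2) \<in> borel_measurable borel"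
        by (intro borel_measurable_continuous_onI continuous_on_Poisson_kernel w)
      show "(\<lambda>t. ennreal ((1 - (norm (cayley (Complex x y)))\<^sup>2) / (norm (cis t - cayley (Complex x y)))\<^sup>2 * h t / (2 * pi))) \<in> borel_measurable lborel"
        by (rule measurable_compose[OF _ measurable_ennreal]) measurable
    qed
    also have "\<dots> = (\<integral>\<^sup>+t. ennreal (k x t) * ennreal (h t / (2 * pi)) \<partial>lborel)"
    proof (rule nn_integral_cong)
      fix t
      have h0: "h t \<ge> 0" by (simp add: h_def)
      have p0: "(1 - (norm (cayley (Complex x y)))\<^sup>2) / (norm (cis t - cayley (Complex x y)))\<^sup>2 \<ge> 0"
        using w[of x] by (intro divide_nonneg_nonneg) (auto simp: power_le_one)
      show "ennreal (2 / (norm (Complex x y + \<i>))\<^sup>2) * ennreal ((1 - (norm (cayley (Complex x y)))\<^sup>2) / (norm (cis t - cayley (Complex x y)))\<^sup>2 * h t / (2 * pi)) = ennreal (k x t) * ennreal (h t / (2 * pi))"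
      proof -
        have *: "ennreal A * ennreal (P * H / (2 * pi)) = ennreal (A * P) * ennreal (H / (2 * pi))"
          if "A \<ge> 0" "P \<ge> 0" "H \<ge> 0" for A P H :: real
          using that by (simp add: ennreal_mult[symmetric] mult.assoc)
        show ?thesis unfolding k_def by (rule *) (simp_all only: h0 p0, simp)
      qed
    qed
    finally show ?thesis .
  qed
  have "(\<integral>\<^sup>+x. ennreal ((norm (Gam f (Complex x y)))\<^sup>2) \<partial>lborel) \<le> (\<integral>\<^sup>+x. \<integral>\<^sup>+t. ennreal (k x t) * ennreal (h t / (2 * pi)) \<partial>lborel \<partial>lborel)"
    by (intro nn_integral_mono 1)
  also have "\<dots> = (\<integral>\<^sup>+t. \<integral>\<^sup>+x. ennreal (k x t) * ennreal (h t / (2 * pi)) \<partial>lborel \<partial>lborel)"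
  proof (rule lborel_pair.Fubini'[symmetric])
    show "(\<lambda>(x, t). ennreal (k x t) * ennreal (h t / (2 * pi))) \<in> borel_measurable (lborel \<Otimes>\<^sub>M lborel)"
      using km hm by (simp add: case_prod_beta) measurable
  qed
  also have "\<dots> = (\<integral>\<^sup>+t. (\<integral>\<^sup>+x. ennreal (k x t) \<partial>lborel) * ennreal (h t / (2 * pi)) \<partial>lborel)"
  proof (rule nn_integral_cong)
    fix t
    have "continuous_on UNIV (\<lambda>x. k x t)"
      using continuous_on_compose2[OF kc, of UNIV "\<lambda>x. (x, t)"] continuous_on_Pair[OF continuous_on_id continuous_on_const]
      by auto
    then have "(\<lambda>x. k x t) \<in> borel_measurable borel" by (rule borel_measurable_continuous_onI)
    then show "(\<integral>\<^sup>+x. ennreal (k x t) * ennreal (h t / (2 * pi)) \<partial>lborel) = (\<integral>\<^sup>+x. ennreal (k x t) \<partial>lborel) * ennreal (h t / (2 * pi))"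
      by (intro nn_integral_multc) simp
  qed
  also have "\<dots> \<le> (\<integral>\<^sup>+t. ennreal (8 * pi) * ennreal (h t / (2 * pi)) \<partial>lborel)"
  proof (rule nn_integral_mono_AE)
    \<comment> \<open>The endpoints are not values of \<open>cayley_angle\<close>, and the kernel
      bound is available at such values only.\<close>
    have "AE t in lborel. t \<noteq> 0" "AE t in lborel. t \<noteq> 2 * pi" by (rule AE_lborel_singleton)+
    then show "AE t in lborel. (\<integral>\<^sup>+x. ennreal (k x t) \<partial>lborel) * ennreal (h t / (2 * pi)) \<le> ennreal (8 * pi) * ennreal (h t / (2 * pi))"
    proof eventually_elim
      fix t :: real assume t: "t \<noteq> 0" "t \<noteq> 2 * pi"
      show "(\<integral>\<^sup>+x. ennreal (k x t) \<partial>lborel) * ennreal (h t / (2 * pi)) \<le> ennreal (8 * pi) * ennreal (h t / (2 * pi))"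
      proof (cases "t \<in> {0..2*pi}")
        case True
        then have "t \<in> range cayley_angle" using t by (simp add: cayley_angle_range)
        then obtain s where "t = cayley_angle s" by blast
        then have "(\<integral>\<^sup>+x. ennreal (k x t) \<partial>lborel) \<le> ennreal (8 * pi)"
          using nn_integral_Poisson_cayley_le[OF y, of s] by (simp add: k_def)
        then show ?thesis by (rule mult_right_mono) simp
      next
        case False
        then have "h t = 0" unfolding h_def by (rule if_not_P)
        then show ?thesis by simp
      qed
    qed
  qed
  also have "\<dots> = (\<integral>\<^sup>+t. 4 * (ennreal ((norm (f (cis t)))\<^sup>2) * indicator {0..2*pi} t) \<partial>lborel)"
  proof (rule nn_integral_cong)
    fix t
    have "ennreal (8 * pi) * ennreal (h t / (2 * pi)) = ennreal (8 * pi * (h t / (2 * pi)))"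
      by (rule ennreal_mult[symmetric]) (auto simp: h_def)
    also have "8 * pi * (h t / (2 * pi)) = 4 * h t" by simp
    finally show "ennreal (8 * pi) * ennreal (h t / (2 * pi)) = 4 * (ennreal ((norm (f (cis t)))\<^sup>2) * indicator {0..2*pi} t)"
      by (auto simp: h_def ennreal_mult split: split_indicator)
  qed
  also have "\<dots> = 4 * (\<integral>\<^sup>+t. ennreal ((norm (f (cis t)))\<^sup>2) * indicator {0..2*pi} t \<partial>lborel)"
  proof (rule nn_integral_cmult)
    have "(\<lambda>t. ennreal (h t)) \<in> borel_measurable lborel" by measurable
    moreover have "(\<lambda>t. ennreal (h t)) = (\<lambda>t. ennreal ((norm (f (cis t)))\<^sup>2) * indicator {0..2*pi} t)"
      by (auto simp: h_def split: split_indicator)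
    ultimately show "(\<lambda>t. ennreal ((norm (f (cis t)))\<^sup>2) * indicator {0..2*pi} t) \<in> borel_measurable lborel" by simp
  qed
  also have "\<dots> = 4 * ennreal (L2_sq circle_measure (\<lambda>t. f (cis t)))"
    unfolding nn_integral_circle by (subst nn_integral_norm_sq) (auto intro!: continuous_square_integrable_circle cf)
  finally show ?thesis .
qed

lemma Gam_holomorphic:
  assumes "f holomorphic_on unit_disc" shows "Gam f holomorphic_on upper_half_plane"
proof -
  have "(\<lambda>z. of_real (sqrt 2) / (z + \<i>) * f (cayley z)) holomorphic_on upper_half_plane"
  proof (intro holomorphic_intros)
    have "cayley holomorphic_on upper_half_plane"
      unfolding cayley_def[abs_def] by (intro holomorphic_intros) (auto simp: complex_eq_iff)
    then have "(f \<circ> cayley) holomorphic_on upper_half_plane"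
      by (rule holomorphic_on_compose_gen[OF _ assms]) (auto intro: norm_cayley_less_1)
    then show "(\<lambda>z. f (cayley z)) holomorphic_on upper_half_plane" by (simp add: o_def)
  qed (auto simp: complex_eq_iff)
  then show ?thesis by (rule holomorphic_transform) (simp add: Gam_def)
qed

text \<open>\<open>ps a\<close> need not extend continuously to the circle, but its dilations do.
  Their bounds are uniform in the radius, and Fatou's lemma passes to the limit.\<close>

theorem Gam_ps_in_H2_uhp:
  assumes a: "l2 a" shows "Gam (ps a) \<in> H2_uhp"
proof -
  define B where "B = 2 * pi * (\<Sum>n. (norm (a n))\<^sup>2)"
  have le: "(\<integral>\<^sup>+x. ennreal ((norm (Gam (ps a) (Complex x y)))\<^sup>2) \<partial>lborel) \<le> 4 * ennreal B" if y: "y > 0" for y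
  proof -
    \<comment> \<open>The double successor keeps the first radius positive, at 1/2.\<close>
    define r where "r n = 1 - inverse (real (Suc (Suc n)))" for n
    have r: "0 < r n" "r n < 1" for n by (auto simp: r_def field_simps)
    have "(\<lambda>n. 1 - inverse (real (Suc (Suc n)))) \<longlonglongrightarrow> 1 - 0"
      by (intro tendsto_diff tendsto_const LIMSEQ_Suc[OF LIMSEQ_inverse_real_of_nat])
    then have rlim: "r \<longlonglongrightarrow> 1" by (simp add: r_def[abs_def])
    have m: "norm (of_real (r n) * z) < 1" if "norm z \<le> 1" for z :: complex and n
    proof -
      have "r n * norm z \<le> r n * 1" using r[of n] that by (intro mult_left_mono) auto
      also have "\<dots> < 1" using r[of n] by simp
      finally show ?thesis using r[of n] by (simp add: norm_mult)
    qed
    have hol: "(\<lambda>z. ps a (of_real (r n) * z)) holomorphic_on ball 0 1" 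
      and cont: "continuous_on (cball 0 1) (\<lambda>z. ps a (of_real (r n) * z))" for n
    proof -
      have "((ps a) \<circ> (\<lambda>z. of_real (r n) * z)) holomorphic_on ball 0 1"
      proof (rule holomorphic_on_compose_gen[OF _ ps_holomorphic[OF a]])
        show "(\<lambda>z. of_real (r n) * z) ` ball 0 1 \<subseteq> unit_disc"
          using m[OF less_imp_le] by auto
      qed (intro holomorphic_intros)
      then show "(\<lambda>z. ps a (of_real (r n) * z)) holomorphic_on ball 0 1" by (simp add: o_def)
      show "continuous_on (cball 0 1) (\<lambda>z. ps a (of_real (r n) * z))"
        by (rule continuous_on_compose2[OF holomorphic_on_imp_continuous_on[OF ps_holomorphic[OF a]]])
          (auto intro!: continuous_intros m)
    qed
    have B: "L2_sq circle_measure (\<lambda>t. ps a (of_real (r n) * cis t)) \<le> B" for n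
    proof -
      note * = L2_sq_holomorphic_circle[OF ps_sums[OF a], of "r n"]
      have "(\<Sum>k. (norm (a k))\<^sup>2 * ((r n)\<^sup>2) ^ k) \<le> (\<Sum>k. (norm (a k))\<^sup>2)"
        by (intro suminf_le *(2)) (use r[of n] a in \<open>auto simp: l2_def intro!: mult_left_le power_le_one\<close>)
      then show ?thesis using *(3) r[of n] by (simp add: B_def)
    qed
    let ?G = "\<lambda>n x. ennreal ((norm (Gam (\<lambda>z. ps a (of_real (r n) * z)) (Complex x y)))\<^sup>2)"
    have lim: "(\<lambda>n. ?G n x) \<longlonglongrightarrow> ennreal ((norm (Gam (ps a) (Complex x y)))\<^sup>2)" for x
    proof -
      have w: "norm (cayley (Complex x y)) < 1" by (rule norm_cayley_less_1) (use y in simp)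
      have "(\<lambda>n. of_real (r n) * cayley (Complex x y)) \<longlonglongrightarrow> of_real 1 * cayley (Complex x y)"
        by (intro tendsto_intros rlim)
      moreover have "isCont (ps a) (cayley (Complex x y))"
        using holomorphic_on_imp_continuous_on[OF ps_holomorphic[OF a]] w
        unfolding continuous_on_eq_continuous_at[OF open_ball] by simp
      ultimately have "(\<lambda>n. ps a (of_real (r n) * cayley (Complex x y))) \<longlonglongrightarrow> ps a (cayley (Complex x y))"
        by (intro isCont_tendsto_compose[of _ "ps a"]) simp_all
      then show ?thesis
        using y plus_i_neq[of "Complex x y"] by (auto simp: Gam_def intro!: tendsto_ennrealI tendsto_intros)
    qed
    have meas: "?G n \<in> borel_measurable lborel" for n
    proof -
      have "continuous_on UNIV (\<lambda>x. Gam (\<lambda>z. ps a (of_real (r n) * z)) (Complex x y))"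
        by (rule continuous_on_compose2[OF holomorphic_on_imp_continuous_on[OF Gam_holomorphic[OF hol]]])
          (use y in \<open>auto simp: Complex_eq intro!: continuous_intros\<close>)
      then have "(\<lambda>x. Gam (\<lambda>z. ps a (of_real (r n) * z)) (Complex x y)) \<in> borel_measurable borel"
        by (rule borel_measurable_continuous_onI)
      then show ?thesis by measurable
    qed
    have "(\<integral>\<^sup>+x. ennreal ((norm (Gam (ps a) (Complex x y)))\<^sup>2) \<partial>lborel) = (\<integral>\<^sup>+x. liminf (\<lambda>n. ?G n x) \<partial>lborel)"
      by (intro nn_integral_cong) (metis lim lim_imp_Liminf sequentially_bot)
    also have "\<dots> \<le> liminf (\<lambda>n. \<integral>\<^sup>+x. ?G n x \<partial>lborel)"
      by (rule nn_integral_liminf) (rule meas)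
    also have "\<dots> \<le> 4 * ennreal B"
    proof (rule Liminf_le)
      show "\<forall>\<^sub>F n in sequentially. (\<integral>\<^sup>+x. ?G n x \<partial>lborel) \<le> 4 * ennreal B"
        by (intro always_eventually allI order_trans[OF Gam_dilation_bound[OF cont hol y]] mult_left_mono ennreal_leI B) auto
    qed simp
    finally show ?thesis .
  qed
  then have "(SUP y\<in>{0<..}. \<integral>\<^sup>+x. ennreal ((norm (Gam (ps a) (Complex x y)))\<^sup>2) \<partial>lborel) \<le> 4 * ennreal B"
    by (intro SUP_least) auto
  also have "\<dots> < \<infinity>" by (simp add: ennreal_mult_less_top)
  finally show ?thesis
    using Gam_holomorphic[OF ps_holomorphic[OF a]] by (simp add: H2_uhp_def Gam_def)
qed

section \<open>Growth of functions with bounded line means\<close>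

lemma H2_uhp_line_bound:
  assumes "F \<in> H2_uhp"
  obtains M where "M \<ge> 0" "\<And>y. y > 0 \<Longrightarrow> square_integrable lebesgue (\<lambda>x. F (Complex x y))"
     "\<And>y. y > 0 \<Longrightarrow> L2_sq lebesgue (\<lambda>x. F (Complex x y)) \<le> M"
proof -
  have hol: "F holomorphic_on upper_half_plane" using assms by (simp add: H2_uhp_def)
  define S where "S = (SUP y\<in>{0<..}. \<integral>\<^sup>+x. ennreal ((norm (F (Complex x y)))\<^sup>2) \<partial>lborel)"
  have S: "S < \<infinity>" using assms by (simp add: H2_uhp_def S_def)
  have le: "(\<integral>\<^sup>+x. ennreal ((norm (F (Complex x y)))\<^sup>2) \<partial>lebesgue) \<le> S" if "y > 0" for y
    unfolding nn_integral_completion S_def using that by (intro SUP_upper) auto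
  have sq: "square_integrable lebesgue (\<lambda>x. F (Complex x y))" if y: "y > 0" for y
  proof -
    have "continuous_on UNIV (\<lambda>x. F (Complex x y))"
      by (rule continuous_on_compose2[OF holomorphic_on_imp_continuous_on[OF hol]])
        (use y in \<open>auto simp: Complex_eq intro!: continuous_intros\<close>)
    then have [measurable]: "(\<lambda>x. F (Complex x y)) \<in> borel_measurable lebesgue"
      by (rule borel_measurable_lebesgue_continuous)
    have "(\<integral>\<^sup>+x. ennreal (norm ((norm (F (Complex x y)))\<^sup>2)) \<partial>lebesgue) < \<infinity>"
      using le[OF y] S by (simp add: le_less_trans)
    then show ?thesis
      unfolding square_integrable_def by (intro conjI integrableI_bounded) measurable
  qed
  show ?thesis
  proof (rule that[of "enn2real S"])
    fix y :: real assume y: "y > 0"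
    show "square_integrable lebesgue (\<lambda>x. F (Complex x y))" by (rule sq[OF y])
    have "ennreal (L2_sq lebesgue (\<lambda>x. F (Complex x y))) \<le> S"
      using le[OF y] by (simp add: nn_integral_norm_sq[OF sq[OF y]])
    then show "L2_sq lebesgue (\<lambda>x. F (Complex x y)) \<le> enn2real S"
      using S by (metis L2_sq_nonneg enn2real_ennreal enn2real_mono infinity_ennreal_def)
  qed simp
qed

text \<open>
  Differences \<open>F (z + h) - F z\<close> are derivatives of averages of \<open>F\<close> over horizontal segments, which
  are bounded by the Cauchy-Schwarz inequality.
\<close>
lemma H2_uhp_bounded:
  assumes F: "F \<in> H2_uhp" and e: "e > 0"
  obtains B where "\<And>z. Im z \<ge> e \<Longrightarrow> norm (F z) \<le> B"
proof -
  obtain M where M: "M \<ge> 0" "\<And>y. y > 0 \<Longrightarrow> square_integrable lebesgue (\<lambda>x. F (Complex x y))"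
     "\<And>y. y > 0 \<Longrightarrow> L2_sq lebesgue (\<lambda>x. F (Complex x y)) \<le> M"
    using H2_uhp_line_bound[OF F] by metis
  have hol: "F holomorphic_on upper_half_plane" using F by (simp add: H2_uhp_def)
  have cvx: "convex upper_half_plane" by (rule convex_halfspace_Im_gt)
  have op: "open upper_half_plane" by (rule open_halfspace_Im_gt)
  obtain \<Phi> where \<Phi>: "\<And>z. z \<in> upper_half_plane \<Longrightarrow> (\<Phi> has_field_derivative F z) (at z within upper_half_plane)"
    using holomorphic_convex_primitive'[OF cvx op hol] by blast
  then have \<Phi>': "(\<Phi> has_field_derivative F z) (at z)" if "Im z > 0" for z
    using that op by (metis at_within_open mem_Collect_eq)
  have seg: "((\<lambda>s. F (z + of_real s)) has_integral \<Phi> (z + of_real h) - \<Phi> (z + of_real 0)) {0..h}" if z: "Im z > 0" and h: "0 \<le> h" for z h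
  proof (rule fundamental_theorem_of_calculus[OF h])
    fix s
    have "((\<lambda>w. \<Phi> (z + w)) has_field_derivative F (z + of_real s) * 1) (at (of_real s))"
      by (rule DERIV_chain2[OF \<Phi>']) (use z in \<open>auto intro!: derivative_eq_intros\<close>)
    then show "((\<lambda>s. \<Phi> (z + of_real s)) has_vector_derivative F (z + of_real s)) (at s within {0..h})"
      using has_vector_derivative_real_field[of "\<lambda>w. \<Phi> (z + w)" "F (z + of_real s)" s]
      by (simp add: has_vector_derivative_at_within)
  qed
  \<comment> \<open>The mean square over a unit segment is at most the integral over the full
    horizontal line.\<close>
  have sqz: "((\<lambda>s. (norm (F (z + of_real s)))\<^sup>2) has_integral I) {0..1} \<Longrightarrow> I \<le> M" if z: "Im z > 0" for z I
  proof -
    assume I: "((\<lambda>s. (norm (F (z + of_real s)))\<^sup>2) has_integral I) {0..1}"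
    have eq: "z + of_real s = Complex (Re z + 1 * s) (Im z)" for s by (simp add: complex_eq_iff)
    have int: "integrable lebesgue (\<lambda>x. (norm (F (Complex x (Im z))))\<^sup>2)"
      using M(2)[OF z] by (simp add: square_integrable_def)
    then have int': "integrable lebesgue (\<lambda>s. (norm (F (z + of_real s)))\<^sup>2)"
      unfolding eq by (subst lebesgue_integrable_real_affine_iff) auto
    have "(LINT s|lebesgue. (norm (F (z + of_real s)))\<^sup>2) = L2_sq lebesgue (\<lambda>x. F (Complex x (Im z)))"
      unfolding eq L2_sq_def
      using lebesgue_integral_real_affine[of 1 "\<lambda>x. (norm (F (Complex x (Im z))))\<^sup>2" "Re z"] by simp
    moreover have "((\<lambda>s. (norm (F (z + of_real s)))\<^sup>2) has_integral (LINT s|lebesgue. (norm (F (z + of_real s)))\<^sup>2)) UNIV"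
      using has_integral_integral_lebesgue[OF int'] .
    ultimately show "I \<le> M"
      using has_integral_subset_le[OF subset_UNIV I] M(3)[OF z] by fastforce
  qed
  have cont: "continuous_on {0..1} (\<lambda>s. F (z + of_real s))" if z: "Im z > 0" for z
    by (rule continuous_on_compose2[OF holomorphic_on_imp_continuous_on[OF hol]])
      (use z in \<open>auto intro!: continuous_intros\<close>)
  \<comment> \<open>On a segment of length at most 1 the inequality
    \<open>norm w \<le> (norm w)^2 + 1\<close> turns the mean square bound into a bound for the
    integral of \<open>F\<close>.\<close>
  have A: "norm (\<Phi> (z + of_real h) - \<Phi> z) \<le> M + 1" if z: "Im z > 0" and h: "0 \<le> h" "h \<le> 1" for z h
  proof -
    have i: "(\<lambda>s. (norm (F (z + of_real s)))\<^sup>2 + 1) integrable_on {0..1}"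
      by (intro integrable_continuous_interval continuous_intros cont z)
    have i': "(\<lambda>s. (norm (F (z + of_real s)))\<^sup>2) integrable_on {0..1}"
      by (intro integrable_continuous_interval continuous_intros cont z)
    have "norm (\<Phi> (z + of_real h) - \<Phi> z) = norm (integral {0..h} (\<lambda>s. F (z + of_real s)))"
      using integral_unique[OF seg[OF z h(1)]] by simp
    also have "\<dots> \<le> integral {0..h} (\<lambda>s. (norm (F (z + of_real s)))\<^sup>2 + 1)"
    proof (rule integral_norm_bound_integral)
      show "(\<lambda>s. F (z + of_real s)) integrable_on {0..h}" using seg[OF z h(1)] by blast
      show "(\<lambda>s. (norm (F (z + of_real s)))\<^sup>2 + 1) integrable_on {0..h}"
        by (rule integrable_on_subinterval[OF i]) (use h in auto)
      show "norm w \<le> (norm w)\<^sup>2 + 1" for w :: complex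
        using zero_le_power2[of "norm w - 1"] norm_ge_zero[of w] unfolding power2_diff by (simp; linarith)
    qed
    also have "\<dots> \<le> integral {0..1} (\<lambda>s. (norm (F (z + of_real s)))\<^sup>2 + 1)"
      by (rule integral_subset_le) (use h i integrable_on_subinterval[OF i] in auto)
    also have "\<dots> = integral {0..1} (\<lambda>s. (norm (F (z + of_real s)))\<^sup>2) + 1"
      by (subst Henstock_Kurzweil_Integration.integral_add[OF i']) auto
    also have "\<dots> \<le> M + 1" using sqz[OF z integrable_integral[OF i']] by simp
    finally show ?thesis .
  qed
  \<comment> \<open>Cauchy's inequality for the derivative of the bounded difference of
    \<open>\<Phi>\<close>, on a disc of radius \<open>e / 2\<close>, which stays inside the half
    plane.\<close>
  have D: "norm (F (z + of_real h) - F z) \<le> (M + 1) / (e / 2)" if z: "Im z \<ge> e" and h: "0 \<le> h" "h \<le> 1" for z h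
  proof -
    have pos: "Im w > 0" if "w \<in> cball z (e/2)" for w
      using that z e abs_Im_le_cmod[of "z - w"] by (auto simp: dist_norm)
    have d: "((\<lambda>w. \<Phi> (w + of_real h) - \<Phi> w) has_field_derivative F (w + of_real h) - F w) (at w)" if "Im w > 0" for w
    proof -
      have "((\<lambda>w. \<Phi> (w + of_real h)) has_field_derivative F (w + of_real h) * 1) (at w)"
        by (rule DERIV_chain2[OF \<Phi>']) (use that in \<open>auto intro!: derivative_eq_intros\<close>)
      then show ?thesis using \<Phi>'[OF that] by (auto intro!: DERIV_diff)
    qed
    have hol2: "(\<lambda>w. \<Phi> (w + of_real h) - \<Phi> w) holomorphic_on cball z (e/2)"
      unfolding holomorphic_on_def field_differentiable_def
      using d pos by (meson DERIV_subset has_field_derivative_at_within)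
    have "norm ((deriv ^^ 1) (\<lambda>w. \<Phi> (w + of_real h) - \<Phi> w) z) \<le> fact 1 * (M + 1) / (e/2) ^ 1"
    proof (rule Cauchy_inequality)
      show "(\<lambda>w. \<Phi> (w + of_real h) - \<Phi> w) holomorphic_on ball z (e/2)"
        by (rule holomorphic_on_subset[OF hol2]) auto
      show "continuous_on (cball z (e/2)) (\<lambda>w. \<Phi> (w + of_real h) - \<Phi> w)"
        by (rule holomorphic_on_imp_continuous_on[OF hol2])
      show "norm (\<Phi> (w + of_real h) - \<Phi> w) \<le> M + 1" if "norm (z - w) = e/2" for w
        by (rule A[OF pos h]) (use that in \<open>auto simp: dist_norm\<close>)
    qed (use e in auto)
    moreover have "deriv (\<lambda>w. \<Phi> (w + of_real h) - \<Phi> w) z = F (z + of_real h) - F z"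
      by (rule DERIV_imp_deriv[OF d]) (use z e in auto)
    ultimately show ?thesis by simp
  qed
  show ?thesis
  proof (rule that)
    fix z assume z: "Im z \<ge> e"
    then have zp: "Im z > 0" using e by simp
    \<comment> \<open>Since the mean square over the segment is at most \<open>M\<close>, so is the
      square of the modulus at some point of it; the difference bound carries this back to
      \<open>z\<close>.\<close>
    have "\<exists>h\<in>{0..1}. (norm (F (z + of_real h)))\<^sup>2 \<le> M"
    proof (rule ccontr)
      assume "\<not> ?thesis"
      then have gt: "\<And>h. h \<in> {0..1} \<Longrightarrow> (norm (F (z + of_real h)))\<^sup>2 > M" by force
      have c: "continuous_on {0..1} (\<lambda>s. (norm (F (z + of_real s)))\<^sup>2)" by (intro continuous_intros cont zp)
      obtain h0 where h0: "h0 \<in> {0..1}" "\<And>h. h \<in> {0..1} \<Longrightarrow> (norm (F (z + of_real h0)))\<^sup>2 \<le> (norm (F (z + of_real h)))\<^sup>2"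
        using continuous_attains_inf[OF _ _ c] by auto
      have "integral {0..1::real} (\<lambda>s. (norm (F (z + of_real h0)))\<^sup>2) \<le> integral {0..1} (\<lambda>s. (norm (F (z + of_real s)))\<^sup>2)"
        by (rule integral_le) (use h0 integrable_continuous_interval[OF c] in auto)
      also have "\<dots> \<le> M" by (rule sqz[OF zp integrable_integral[OF integrable_continuous_interval[OF c]]])
      finally show False using gt[OF h0(1)] by simp
    qed
    then obtain h where h: "h \<in> {0..1}" "(norm (F (z + of_real h)))\<^sup>2 \<le> M" by blast
    have "norm (F z) \<le> norm (F (z + of_real h)) + norm (F (z + of_real h) - F z)"
      by (metis norm_triangle_sub norm_minus_commute)
    also have "\<dots> \<le> sqrt M + (M + 1) / (e / 2)"
      using h D[OF z] by (intro add_mono real_le_rsqrt) auto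
    finally show "norm (F z) \<le> sqrt M + (M + 1) / (e / 2)" .
  qed
qed

section \<open>The inverse Cayley transform and regularization\<close>

definition uncayley :: "complex \<Rightarrow> complex" where
  "uncayley w = \<i> * (1 + w) / (1 - w)"

lemma cayley_uncayley: "w \<noteq> 1 \<Longrightarrow> cayley (uncayley w) = w"
proof -
  assume w: "w \<noteq> 1"
  have "uncayley w - \<i> = 2 * \<i> * w / (1 - w)" "uncayley w + \<i> = 2 * \<i> / (1 - w)"
    using w by (simp_all add: uncayley_def divide_simps) (simp_all add: algebra_simps)
  then show ?thesis using w by (simp add: cayley_def)
qed

lemma uncayley_cayley: "z + \<i> \<noteq> 0 \<Longrightarrow> uncayley (cayley z) = z"
proof -
  assume z: "z + \<i> \<noteq> 0"
  have "1 + cayley z = 2 * z / (z + \<i>)" "1 - cayley z = 2 * \<i> / (z + \<i>)"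
    using z by (simp_all add: cayley_def divide_simps)
  then show ?thesis using z by (simp add: uncayley_def)
qed

lemma Im_uncayley: assumes "w \<noteq> 1" shows "Im (uncayley w) = (1 - (norm w)\<^sup>2) / (norm (1 - w))\<^sup>2"
proof -
  have "uncayley w = \<i> * ((1 + w) * cnj (1 - w)) / of_real ((norm (1 - w))\<^sup>2)"
    using assms by (simp add: uncayley_def complex_norm_square[of "1 - w"] del: of_real_power)
  then have "Im (uncayley w) = Re ((1 + w) * cnj (1 - w)) / (norm (1 - w))\<^sup>2"
    by (simp only: Im_divide_of_real) simp
  also have "Re ((1 + w) * cnj (1 - w)) = 1 - (norm w)\<^sup>2"
    by (simp add: cmod_power2) (simp add: power2_eq_square algebra_simps)
  finally show ?thesis .
qed

lemma uncayley_in_uhp: "norm w < 1 \<Longrightarrow> Im (uncayley w) > 0"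
  using Im_uncayley[of w] by (cases "w = 1") (auto intro!: divide_pos_pos simp: power_less_one_iff abs_square_less_1)

lemma uncayley_cis: "uncayley (cis (cayley_angle x)) = of_real x"
  by (simp add: cis_cayley_angle uncayley_cayley[unfolded cayley_def])

text \<open>
  \<^term>\<open>regularized F e\<close> is the preimage under \<^const>\<open>Gam\<close> of the translate by \<open>\<i> * e\<close> multiplied
  by a function that is bounded by 1 and decays like \<open>1 / z\<close>.
\<close>
definition regularized :: "(complex \<Rightarrow> complex) \<Rightarrow> real \<Rightarrow> complex \<Rightarrow> complex" where
  "regularized F e w = (uncayley w + \<i>) / of_real (sqrt 2) * F (uncayley w + \<i> * of_real e) * (\<i> / (of_real e * uncayley w + \<i>))"

lemma regularizer_bound:
  assumes z: "Im z \<ge> 0" and e: "0 \<le> e"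
  shows "norm (\<i> / (of_real e * z + \<i>)) \<le> 1" "of_real e * z + \<i> \<noteq> 0"
proof -
  have "1 \<le> Im (of_real e * z + \<i>)" using z e by simp
  also have "\<dots> \<le> norm (of_real e * z + \<i>)" by (metis abs_Im_le_cmod abs_le_D1)
  finally show "norm (\<i> / (of_real e * z + \<i>)) \<le> 1" "of_real e * z + \<i> \<noteq> 0"
    by (auto simp: norm_divide divide_simps)
qed

text \<open>The regularizer compensates the growth of the factor \<open>z + \<i>\<close> that
  inverting \<open>Gam\<close> introduces, so that \<open>regularized F e\<close> becomes
  bounded.\<close>

lemma regularizer_decay:
  assumes z: "Im z \<ge> 0" and e: "0 < e" "e \<le> 1"
  shows "norm ((z + \<i>) * (\<i> / (of_real e * z + \<i>))) \<le> 1 / e"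
proof -
  have "e * norm (z + \<i>) = norm (of_real e * (z + \<i>))" using e by (simp add: norm_mult)
  also have "\<dots> \<le> norm (of_real e * z + \<i>)"
  proof (rule power2_le_imp_le)
    have "(e * Im z + e)\<^sup>2 \<le> (e * Im z + 1)\<^sup>2" using e z by (intro power_mono) auto
    then show "(norm (of_real e * (z + \<i>)))\<^sup>2 \<le> (norm (of_real e * z + \<i>))\<^sup>2"
      by (simp add: cmod_power2 distrib_left)
  qed simp
  finally have "e * norm (z + \<i>) \<le> norm (of_real e * z + \<i>)" .
  moreover have "norm (of_real e * z + \<i>) > 0" using regularizer_bound(2)[OF z] e by simp
  ultimately show ?thesis using e by (simp add: norm_mult norm_divide divide_simps mult.commute)
qed

lemma uncayley_holomorphic: "1 \<notin> S \<Longrightarrow> uncayley holomorphic_on S"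
  unfolding uncayley_def by (intro holomorphic_intros) auto

text \<open>The shift by \<open>\<i> * e\<close> makes points of the circle admissible in
  \<open>S\<close>, except for 1, the image of infinity. Continuity up to the circle is taken from
  here.\<close>

lemma regularized_holomorphic:
  assumes F: "F holomorphic_on upper_half_plane" and e: "0 < e"
    and S: "\<And>w. w \<in> S \<Longrightarrow> norm w \<le> 1 \<and> w \<noteq> 1"
  shows "regularized F e holomorphic_on S"
proof -
  have u: "uncayley holomorphic_on S" by (rule uncayley_holomorphic) (use S in blast)
  have Im: "Im (uncayley w) \<ge> 0" if "w \<in> S" for w
    using S[OF that] Im_uncayley[of w] by (simp add: power_le_one)
  have "(F \<circ> (\<lambda>w. uncayley w + \<i> * of_real e)) holomorphic_on S"
    by (rule holomorphic_on_compose_gen[OF _ F]) (use Im e in \<open>auto intro!: holomorphic_intros u add_nonneg_pos\<close>)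
  then have F': "(\<lambda>w. F (uncayley w + \<i> * of_real e)) holomorphic_on S" by (simp add: o_def)
  show ?thesis
    unfolding regularized_def
    by (intro holomorphic_intros u F') (use regularizer_bound(2)[OF Im, of _ e] e in auto)
qed

text \<open>Circle means grow with the radius. As the regularized function is bounded and continuous
  up to the circle except at 1, they converge to its boundary mean, which on the line is the mean of
  \<open>F\<close> at height \<open>e\<close> with a factor of modulus at most 1.\<close>

lemma L2_sq_regularized:
  assumes F: "F \<in> H2_uhp" and e: "0 < e" "e \<le> 1" 
    and M: "square_integrable lebesgue (\<lambda>x. F (Complex x e))" "L2_sq lebesgue (\<lambda>x. F (Complex x e)) \<le> M"
    and r: "0 < r" "r < 1"
  shows "L2_sq circle_measure (\<lambda>t. regularized F e (of_real r * cis t)) \<le> M"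
proof -
  let ?f = "regularized F e"
  have Fh: "F holomorphic_on upper_half_plane" using F by (simp add: H2_uhp_def)
  obtain B where B: "\<And>z. Im z \<ge> e \<Longrightarrow> norm (F z) \<le> B" using H2_uhp_bounded[OF F e(1)] by metis
  have B0: "0 \<le> B" using order_trans[OF norm_ge_zero B[of "\<i> * of_real e"]] by simp
  have bound: "norm (?f w) \<le> B / e" if w: "norm w \<le> 1" "w \<noteq> 1" for w
  proof -
    have Im: "Im (uncayley w) \<ge> 0" using Im_uncayley[of w] w by (simp add: power_le_one)
    have "norm (?f w) = norm ((uncayley w + \<i>) * (\<i> / (of_real e * uncayley w + \<i>))) * norm (F (uncayley w + \<i> * of_real e)) / sqrt 2"
      by (simp add: regularized_def norm_mult norm_divide mult_ac)
    also have "\<dots> \<le> (1 / e) * B / 1"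
      using Im e B0 by (intro frac_le mult_mono regularizer_decay B) auto
    finally show ?thesis by simp
  qed
  define R where "R n = 1 - inverse (real (Suc (Suc n)))" for n
  have R: "0 < R n" "R n < 1" for n by (auto simp: R_def field_simps)
  have "(\<lambda>n. 1 - inverse (real (Suc (Suc n)))) \<longlonglongrightarrow> 1 - 0"
    by (intro tendsto_diff tendsto_const LIMSEQ_Suc[OF LIMSEQ_inverse_real_of_nat])
  then have Rlim: "R \<longlonglongrightarrow> 1" by (simp add: R_def[abs_def])
  have hol: "?f holomorphic_on unit_disc" by (rule regularized_holomorphic[OF Fh e(1)]) auto
  note series = holomorphic_disc_series[OF hol]
  have sqn: "square_integrable circle_measure (\<lambda>t. ?f (of_real (R n) * cis t))" for n
    using L2_sq_holomorphic_circle(1)[OF series, of "R n"] R[of n] by simp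
  have "(\<lambda>n. L2_sq circle_measure (\<lambda>t. ?f (of_real (R n) * cis t))) \<longlonglongrightarrow> L2_sq circle_measure (\<lambda>t. ?f (cis t))"
    unfolding L2_sq_def
  proof (rule integral_dominated_convergence)
    have tpos: "AE t in circle_measure. cis t \<noteq> 1"
      unfolding AE_circle_iff
    proof (intro AE_I2 impI)
      fix t :: real assume "t \<in> {0<..<2*pi}"
      then show "cis t \<noteq> 1" using cis_inj_open_interval[of 0 t] by auto
    qed
    show lim: "AE t in circle_measure. (\<lambda>n. (norm (?f (of_real (R n) * cis t)))\<^sup>2) \<longlonglongrightarrow> (norm (?f (cis t)))\<^sup>2"
      using tpos
    proof eventually_elim
      fix t assume t: "cis t \<noteq> 1"
      have c: "continuous_on (cball 0 1 - {1}) ?f"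
        by (rule holomorphic_on_imp_continuous_on[OF regularized_holomorphic[OF Fh e(1)]]) auto
      have l: "(\<lambda>n. of_real (R n) * cis t) \<longlonglongrightarrow> of_real 1 * cis t" by (intro tendsto_intros Rlim)
      have "norm (of_real (R n) * cis t) < 1" for n using R[of n] by (simp add: norm_mult)
      then have "of_real (R n) * cis t \<in> cball 0 1 - {1}" for n
        by (metis DiffI less_imp_le less_irrefl mem_cball_0 norm_one singletonD)
      then have "(\<lambda>n. ?f (of_real (R n) * cis t)) \<longlonglongrightarrow> ?f (of_real 1 * cis t)"
        using t by (intro continuous_on_tendsto_compose[OF c l]) auto
      then have "(\<lambda>n. ?f (of_real (R n) * cis t)) \<longlonglongrightarrow> ?f (cis t)" by simp
      then show "(\<lambda>n. (norm (?f (of_real (R n) * cis t)))\<^sup>2) \<longlonglongrightarrow> (norm (?f (cis t)))\<^sup>2" by (intro tendsto_intros)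
    qed
    show m: "(\<lambda>t. (norm (?f (of_real (R n) * cis t)))\<^sup>2) \<in> borel_measurable circle_measure" for n
      using sqn[of n] unfolding square_integrable_def by (blast intro: borel_measurable_integrable)
    show "AE t in circle_measure. norm ((norm (?f (of_real (R n) * cis t)))\<^sup>2) \<le> (B / e)\<^sup>2" for n
    proof (intro AE_I2)
      fix t
      have "norm (of_real (R n) * cis t) < 1" using R[of n] by (simp add: norm_mult)
      then have "norm (?f (of_real (R n) * cis t)) \<le> B / e"
        by (intro bound) (simp, metis less_irrefl norm_one)
      then show "norm ((norm (?f (of_real (R n) * cis t)))\<^sup>2) \<le> (B / e)\<^sup>2" by (simp add: power_mono)
    qed
    show "integrable circle_measure (\<lambda>_. (B / e)\<^sup>2)"
      using finite_measure.integrable_const[OF finite_measure_circle] by blast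
    show "(\<lambda>t. (norm (?f (cis t)))\<^sup>2) \<in> borel_measurable circle_measure"
    proof -
      have "continuous_on {0<..<2*pi} (\<lambda>t. (norm (?f (cis t)))\<^sup>2)"
      proof (intro continuous_intros continuous_on_compose2[OF holomorphic_on_imp_continuous_on[OF regularized_holomorphic[OF Fh e(1)]]])
        show "cis ` {0<..<2*pi} \<subseteq> cball 0 1 - {1}"
          using cis_inj_open_interval[of 0] by auto
      qed auto
      then have "(\<lambda>t. indicator {0<..<2*pi} t *\<^sub>R (norm (?f (cis t)))\<^sup>2) \<in> borel_measurable borel"
        by (intro borel_measurable_continuous_on_indicator) auto
      then have "(\<lambda>t. indicator {0<..<2*pi} t *\<^sub>R (norm (?f (cis t)))\<^sup>2) \<in> borel_measurable lebesgue"
        by (intro measurable_completion) simp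
      moreover have "AE t in lebesgue. t \<noteq> 0" "AE t in lebesgue. t \<noteq> 2 * pi"
        using AE_lborel_singleton by (auto intro!: AE_completion)
      then have "AE t in lebesgue. indicator {0<..<2*pi} t *\<^sub>R (norm (?f (cis t)))\<^sup>2 = (if t \<in> {0..2*pi} then (norm (?f (cis t)))\<^sup>2 else 0)"
        by eventually_elim (auto split: split_indicator)
      ultimately have "(\<lambda>t. if t \<in> {0..2*pi} then (norm (?f (cis t)))\<^sup>2 else 0) \<in> borel_measurable lebesgue"
        by (rule borel_measurable_AE)
      then show ?thesis by (subst borel_measurable_if[symmetric]) auto
    qed
  qed
  moreover have le_M: "L2_sq circle_measure (\<lambda>t. ?f (cis t)) \<le> M"
  proof -
    have "L2_sq circle_measure (\<lambda>t. ?f (cis t)) = (LINT x|lebesgue. (2 / (1 + x\<^sup>2)) *\<^sub>R (norm (?f (cis (cayley_angle x))))\<^sup>2)"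
      unfolding L2_sq_def by (rule cayley_change_of_variables(2)[symmetric])
    also have "\<dots> \<le> L2_sq lebesgue (\<lambda>x. F (Complex x e))"
      unfolding L2_sq_def
    proof (rule integral_mono')
      show "integrable lebesgue (\<lambda>x. (norm (F (Complex x e)))\<^sup>2)" using M(1) by (simp add: square_integrable_def)
      fix x :: real
      have "(norm (of_real x + \<i>))\<^sup>2 = 1 + x\<^sup>2" by (simp add: cmod_power2 add.commute)
      moreover have "of_real x + \<i> * of_real e = Complex x e" by (simp add: complex_eq_iff)
      ultimately have "(2 / (1 + x\<^sup>2)) *\<^sub>R (norm (?f (cis (cayley_angle x))))\<^sup>2 = (norm (F (Complex x e)))\<^sup>2 * (norm (\<i> / (of_real e * of_real x + \<i>)))\<^sup>2"
        unfolding regularized_def uncayley_cis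
        using add_nonneg_eq_0_iff[of 1 "x\<^sup>2"] by (simp add: norm_mult norm_divide power_mult_distrib power_divide)
      also have "\<dots> \<le> (norm (F (Complex x e)))\<^sup>2"
        using regularizer_bound(1)[of "of_real x" e] e by (intro mult_left_le power_le_one) auto
      finally show "(2 / (1 + x\<^sup>2)) *\<^sub>R (norm (?f (cis (cayley_angle x))))\<^sup>2 \<le> (norm (F (Complex x e)))\<^sup>2" .
    qed simp
    also have "\<dots> \<le> M" by (rule M(2))
    finally show ?thesis .
  qed
  moreover have "L2_sq circle_measure (\<lambda>t. ?f (of_real r * cis t)) \<le> L2_sq circle_measure (\<lambda>t. ?f (of_real (R n) * cis t))"
    if "R n > r" for n
    using L2_sq_circle_mono[OF hol, of r "R n"] r R[of n] that by simp
  moreover have "\<forall>\<^sub>F n in sequentially. R n > r" using Rlim r by (simp add: order_tendsto_iff)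
  ultimately have "L2_sq circle_measure (\<lambda>t. ?f (of_real r * cis t)) \<le> L2_sq circle_measure (\<lambda>t. ?f (cis t))"
    by (intro tendsto_lowerbound[where F=sequentially]) (auto elim!: eventually_mono)
  with le_M show ?thesis by simp
qed

text \<open>The function \<open>f\<close> inverts \<open>Gam\<close>. Its circle means are bounded
  by those of the regularizations, uniformly in \<open>e\<close>, through Fatou's lemma as
  \<open>e\<close> tends to 0.\<close>

theorem H2_uhp_cases:
  assumes F: "F \<in> H2_uhp" obtains a where "l2 a" "F = Gam (ps a)"
proof -
  have Fh: "F holomorphic_on upper_half_plane" and F0: "\<And>z. \<not> Im z > 0 \<Longrightarrow> F z = 0" using F by (auto simp: H2_uhp_def)
  obtain M where M: "M \<ge> 0" "\<And>y. y > 0 \<Longrightarrow> square_integrable lebesgue (\<lambda>x. F (Complex x y))"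
     "\<And>y. y > 0 \<Longrightarrow> L2_sq lebesgue (\<lambda>x. F (Complex x y)) \<le> M"
    using H2_uhp_line_bound[OF F] by metis
  define f where "f w = (uncayley w + \<i>) / of_real (sqrt 2) * F (uncayley w)" for w
  have fh: "f holomorphic_on unit_disc"
  proof -
    have u: "uncayley holomorphic_on unit_disc" by (rule uncayley_holomorphic) simp
    have "(F \<circ> uncayley) holomorphic_on unit_disc"
      by (rule holomorphic_on_compose_gen[OF u Fh]) (auto intro: uncayley_in_uhp)
    then show ?thesis unfolding f_def o_def by (intro holomorphic_intros u) auto
  qed
  have "L2_sq circle_measure (\<lambda>t. f (of_real r * cis t)) \<le> M" if r: "0 < r" "r < 1" for r
  proof (rule square_integrable_limit(2))
    define e where "e n = inverse (real (Suc n))" for n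
    have e: "0 < e n" "e n \<le> 1" for n by (auto simp: e_def divide_simps)
    have elim: "e \<longlonglongrightarrow> 0" unfolding e_def by (rule LIMSEQ_inverse_real_of_nat)
    have m: "norm (of_real r * cis t) < 1" for t using r by (simp add: norm_mult)
    have hol: "regularized F (e n) holomorphic_on unit_disc" for n
      by (rule regularized_holomorphic[OF Fh e(1)]) auto
    show "square_integrable circle_measure (\<lambda>t. regularized F (e n) (of_real r * cis t))" for n
      using L2_sq_holomorphic_circle(1)[OF holomorphic_disc_series[OF hol], of r] r by simp
    show "L2_sq circle_measure (\<lambda>t. regularized F (e n) (of_real r * cis t)) \<le> M" for n
      using e r by (intro L2_sq_regularized F M) auto
    show "(\<lambda>t. f (of_real r * cis t)) \<in> borel_measurable circle_measure"
      using L2_sq_holomorphic_circle(1)[OF holomorphic_disc_series[OF fh], of r] r by (simp add: square_integrable_def)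
    show "AE t in circle_measure. (\<lambda>n. regularized F (e n) (of_real r * cis t)) \<longlonglongrightarrow> f (of_real r * cis t)"
    proof (intro AE_I2)
      fix t
      define z where "z = uncayley (of_real r * cis t)"
      have z: "Im z > 0" unfolding z_def by (rule uncayley_in_uhp[OF m])
      have "(\<lambda>n. z + \<i> * of_real (e n)) \<longlonglongrightarrow> z + \<i> * of_real 0" by (intro tendsto_intros elim)
      moreover have "isCont F z"
        using holomorphic_on_imp_continuous_on[OF Fh] z
        unfolding continuous_on_eq_continuous_at[OF open_halfspace_Im_gt] by simp
      ultimately have "(\<lambda>n. F (z + \<i> * of_real (e n))) \<longlonglongrightarrow> F z"
        by (intro isCont_tendsto_compose[of _ F]) simp_all
      moreover have "(\<lambda>n. \<i> / (of_real (e n) * z + \<i>)) \<longlonglongrightarrow> \<i> / (of_real 0 * z + \<i>)" 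
        by (intro tendsto_intros elim) auto
      ultimately have "(\<lambda>n. (z + \<i>) / of_real (sqrt 2) * F (z + \<i> * of_real (e n)) * (\<i> / (of_real (e n) * z + \<i>))) \<longlonglongrightarrow> (z + \<i>) / of_real (sqrt 2) * F z * (\<i> / (of_real 0 * z + \<i>))"
        by (intro tendsto_mult tendsto_const)
      then show "(\<lambda>n. regularized F (e n) (of_real r * cis t)) \<longlonglongrightarrow> f (of_real r * cis t)"
        by (simp add: regularized_def f_def z_def)
    qed
  qed
  then obtain a where a: "l2 a" "\<And>w. norm w < 1 \<Longrightarrow> f w = ps a w"
    using H2_discI_bound[OF fh] by metis
  have "F = Gam (ps a)"
  proof
    fix z show "F z = Gam (ps a) z"
    proof (cases "Im z > 0")
      case True
      then have "Gam (ps a) z = of_real (sqrt 2) / (z + \<i>) * f (cayley z)"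
        by (simp add: Gam_def a(2) norm_cayley_less_1)
      also have "\<dots> = F z" using True plus_i_neq[of z] by (simp add: f_def uncayley_cayley)
      finally show ?thesis by simp
    qed (simp add: F0 Gam_def)
  qed
  with a(1) that show ?thesis by blast
qed

section \<open>Hankel operators on the half plane\<close>

lemma l2_add: assumes "l2 a" "l2 b" shows "l2 (\<lambda>n. a n + b n)"
  unfolding l2_def
proof (rule summable_comparison_test')
  show "summable (\<lambda>n. 2 * (norm (a n))\<^sup>2 + 2 * (norm (b n))\<^sup>2)"
    using assms by (intro summable_add summable_mult) (auto simp: l2_def)
qed (simp add: norm_add_sq_le)

lemma l2_cmult: assumes "l2 a" shows "l2 (\<lambda>n. c * a n)"
  using assms by (simp add: l2_def norm_mult power_mult_distrib summable_mult)

lemma l2_finite: assumes "finite {n. a n \<noteq> 0}" shows "l2 a"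
  unfolding l2_def by (rule summable_finite[OF assms]) auto

lemma ps_add: assumes "l2 a" "l2 b" shows "ps (\<lambda>n. a n + b n) = (\<lambda>z. ps a z + ps b z)"
proof
  fix z show "ps (\<lambda>n. a n + b n) z = ps a z + ps b z"
    using sums_unique[OF sums_add[OF ps_sums[OF assms(1), of z] ps_sums[OF assms(2), of z]]]
    by (cases "norm z < 1") (auto simp: ps_def distrib_right)
qed

lemma ps_cmult: assumes "l2 a" shows "ps (\<lambda>n. c * a n) = (\<lambda>z. c * ps a z)"
proof
  fix z show "ps (\<lambda>n. c * a n) z = c * ps a z"
    using sums_unique[OF sums_mult[OF ps_sums[OF assms, of z], of c]]
    by (cases "norm z < 1") (auto simp: ps_def mult.assoc)
qed

lemma Gam_add: "Gam (\<lambda>z. f z + g z) = (\<lambda>z. Gam f z + Gam g z)"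
  by (auto simp: Gam_def fun_eq_iff distrib_left)

lemma Gam_cmult: "Gam (\<lambda>z. c * f z) = (\<lambda>z. c * Gam f z)"
  by (auto simp: Gam_def fun_eq_iff)

lemma H2_disc_add: assumes "f \<in> H2_disc" "g \<in> H2_disc" shows "(\<lambda>z. f z + g z) \<in> H2_disc"
proof -
  obtain a where a: "l2 a" "f = ps a" using H2_disc_cases[OF assms(1)] .
  obtain b where b: "l2 b" "g = ps b" using H2_disc_cases[OF assms(2)] .
  show ?thesis
    unfolding a(2) b(2) ps_add[OF a(1) b(1), symmetric] by (rule ps_in_H2_disc[OF l2_add[OF a(1) b(1)]])
qed

lemma H2_disc_cmult: assumes "f \<in> H2_disc" shows "(\<lambda>z. c * f z) \<in> H2_disc"
proof -
  obtain a where a: "l2 a" "f = ps a" using H2_disc_cases[OF assms] .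
  show ?thesis
    unfolding a(2) ps_cmult[OF a(1), symmetric] by (rule ps_in_H2_disc[OF l2_cmult[OF a(1)]])
qed

lemma H2_uhp_add: assumes "f \<in> H2_uhp" "g \<in> H2_uhp" shows "(\<lambda>z. f z + g z) \<in> H2_uhp"
proof -
  obtain a where a: "l2 a" "f = Gam (ps a)" using H2_uhp_cases[OF assms(1)] .
  obtain b where b: "l2 b" "g = Gam (ps b)" using H2_uhp_cases[OF assms(2)] .
  show ?thesis
    unfolding a(2) b(2) Gam_add[symmetric] ps_add[OF a(1) b(1), symmetric]
    by (rule Gam_ps_in_H2_uhp[OF l2_add[OF a(1) b(1)]])
qed

lemma H2_uhp_cmult: assumes "f \<in> H2_uhp" shows "(\<lambda>z. c * f z) \<in> H2_uhp"
proof -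
  obtain a where a: "l2 a" "f = Gam (ps a)" using H2_uhp_cases[OF assms] .
  show ?thesis
    unfolding a(2) Gam_cmult[symmetric] ps_cmult[OF a(1), symmetric]
    by (rule Gam_ps_in_H2_uhp[OF l2_cmult[OF a(1)]])
qed

lemma H2_uhp_diff: assumes "f \<in> H2_uhp" "g \<in> H2_uhp" shows "(\<lambda>z. f z - g z) \<in> H2_uhp"
  using H2_uhp_add[OF assms(1) H2_uhp_cmult[OF assms(2), of "-1"]] by simp

lemma H2_uhp_nt_limit:
  assumes "F \<in> H2_uhp" shows "AE x in lebesgue. nt_limit_uhp F x (bval_uhp F x)"
proof -
  obtain a where a: "l2 a" "F = Gam (ps a)" using H2_uhp_cases[OF assms] .
  show ?thesis
    using nt_limit_uhp_Gam_ps[OF a(1)] unfolding a(2)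
    by eventually_elim (metis bval_uhp_eqI)
qed

lemma square_integrable_bval: "F \<in> H2_uhp \<Longrightarrow> square_integrable lebesgue (bval_uhp F)"
  by (erule H2_uhp_cases) (simp add: square_integrable_bval_uhp)

lemma inner_uhp_eq: "inner_uhp F G = L2_ip lebesgue (bval_uhp F) (bval_uhp G)"
  by (simp add: inner_uhp_def L2_inner_real_def L2_ip_def)

lemma nt_limit_uhp_add: "nt_limit_uhp F x l \<Longrightarrow> nt_limit_uhp G x m \<Longrightarrow> nt_limit_uhp (\<lambda>z. F z + G z) x (l + m)"
  unfolding nt_limit_uhp_def by (auto intro: tendsto_add)

lemma nt_limit_uhp_mult: "nt_limit_uhp F x l \<Longrightarrow> nt_limit_uhp G x m \<Longrightarrow> nt_limit_uhp (\<lambda>z. F z * G z) x (l * m)"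
  unfolding nt_limit_uhp_def by (auto intro: tendsto_mult)

lemma nt_limit_uhp_const: "nt_limit_uhp (\<lambda>_. c) x c"
  unfolding nt_limit_uhp_def by auto

text \<open>Almost everywhere only: where a limit fails to exist, \<open>bval_uhp\<close> takes an
  unspecified value.\<close>

lemma bval_uhp_add:
  assumes "F \<in> H2_uhp" "G \<in> H2_uhp"
  shows "AE x in lebesgue. bval_uhp (\<lambda>z. F z + G z) x = bval_uhp F x + bval_uhp G x"
  using H2_uhp_nt_limit[OF assms(1)] H2_uhp_nt_limit[OF assms(2)]
  by eventually_elim (intro bval_uhp_eqI nt_limit_uhp_add)

lemma bval_uhp_cmult:
  assumes "F \<in> H2_uhp"
  shows "AE x in lebesgue. bval_uhp (\<lambda>z. c * F z) x = c * bval_uhp F x"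
  using H2_uhp_nt_limit[OF assms]
  by eventually_elim (intro bval_uhp_eqI nt_limit_uhp_mult nt_limit_uhp_const)

lemma inner_uhp_add_left:
  assumes "F \<in> H2_uhp" "G \<in> H2_uhp" "K \<in> H2_uhp"
  shows "inner_uhp (\<lambda>z. F z + G z) K = inner_uhp F K + inner_uhp G K"
proof -
  have "inner_uhp (\<lambda>z. F z + G z) K = L2_ip lebesgue (\<lambda>x. bval_uhp F x + bval_uhp G x) (bval_uhp K)"
    unfolding inner_uhp_eq
    by (intro L2_ip_AE square_integrable_add square_integrable_bval H2_uhp_add assms bval_uhp_add) simp
  then show ?thesis by (simp add: inner_uhp_eq L2_ip_add_left square_integrable_bval assms)
qed

lemma inner_uhp_cmult_left:
  assumes "F \<in> H2_uhp" "K \<in> H2_uhp"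
  shows "inner_uhp (\<lambda>z. c * F z) K = c * inner_uhp F K"
proof -
  have "inner_uhp (\<lambda>z. c * F z) K = L2_ip lebesgue (\<lambda>x. c * bval_uhp F x) (bval_uhp K)"
    unfolding inner_uhp_eq
    by (intro L2_ip_AE square_integrable_cmult square_integrable_bval H2_uhp_cmult assms bval_uhp_cmult) simp
  then show ?thesis by (simp add: inner_uhp_eq L2_ip_cmult_left)
qed

lemma inner_uhp_commute: "inner_uhp G F = cnj (inner_uhp F G)"
  unfolding inner_uhp_eq by (rule L2_ip_commute)

lemma inner_uhp_diff_left:
  assumes "F \<in> H2_uhp" "G \<in> H2_uhp" "K \<in> H2_uhp"
  shows "inner_uhp (\<lambda>z. F z - G z) K = inner_uhp F K - inner_uhp G K"
  using inner_uhp_add_left[OF assms(1) H2_uhp_cmult[OF assms(2), of "-1"] assms(3)]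
    inner_uhp_cmult_left[OF assms(2,3), of "-1"] by simp

text \<open>The inner product is a positive multiple of the sum of the squared moduli of the
  coefficients, so all of them vanish and the function is 0 at every point.\<close>

lemma inner_uhp_self_eq_0:
  assumes "F \<in> H2_uhp" "inner_uhp F F = 0" shows "F = (\<lambda>_. 0)"
proof -
  obtain a where a: "l2 a" "F = Gam (ps a)" using H2_uhp_cases[OF assms(1)] .
  have "complex_of_real (2 * pi * (\<Sum>n. (norm (a n))\<^sup>2)) = inner_uhp F F"
    unfolding a(2) inner_uhp_Gam_ps[OF a(1) a(1)] L2_ip_bdry[OF a(1) a(1), symmetric] L2_ip_self L2_sq_bdry[OF a(1)] ..
  then have "(\<Sum>n. (norm (a n))\<^sup>2) = 0" using assms(2) by simp
  then have "\<forall>n. (norm (a n))\<^sup>2 = 0"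
    using suminf_eq_zero_iff[OF a(1)[unfolded l2_def]] by simp
  then have "a n = 0" for n by simp
  then show ?thesis by (auto simp: a(2) Gam_def ps_def)
qed

lemma inner_uhp_ext:
  assumes "F \<in> H2_uhp" "G \<in> H2_uhp" "\<And>K. K \<in> H2_uhp \<Longrightarrow> inner_uhp K F = inner_uhp K G"
  shows "F = G"
proof -
  have D: "(\<lambda>z. F z - G z) \<in> H2_uhp" using assms by (intro H2_uhp_diff)
  have "inner_uhp F K = inner_uhp G K" if "K \<in> H2_uhp" for K
    using assms(3)[OF that] unfolding inner_uhp_commute[of _ K] by simp
  then have "inner_uhp (\<lambda>z. F z - G z) (\<lambda>z. F z - G z) = 0"
    using inner_uhp_diff_left[OF assms(1,2) D] D by simp
  from inner_uhp_self_eq_0[OF D this] show ?thesis by (simp add: fun_eq_iff)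
qed

section \<open>The orthogonal projection onto the Hardy space\<close>

definition line_trig :: "(nat \<Rightarrow> complex) \<Rightarrow> nat \<Rightarrow> real \<Rightarrow> complex" where
  "line_trig a N x = of_real (sqrt 2) / (of_real x + \<i>) * trig a N (cayley_angle x)"

text \<open>Boundary functions of an orthogonal basis whose elements have squared norm 2 pi; hence
  the division by \<open>2 * pi\<close> in the Fourier coefficients.\<close>

definition line_basis :: "nat \<Rightarrow> real \<Rightarrow> complex" where
  "line_basis n x = of_real (sqrt 2) / (of_real x + \<i>) * cis (real n * cayley_angle x)"

lemma square_integrable_line_trig: "square_integrable lebesgue (line_trig a N)"
  unfolding line_trig_def[abs_def] by (intro square_integrable_cayley square_integrable_trig)

lemma square_integrable_line_basis: "square_integrable lebesgue (line_basis n)"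
  unfolding line_basis_def[abs_def] by (intro square_integrable_cayley square_integrable_cis)

lemma L2_ip_line_trig:
  assumes u: "square_integrable lebesgue u"
  shows "L2_ip lebesgue (line_trig a N) u = (\<Sum>n<N. a n * L2_ip lebesgue (line_basis n) u)"
proof -
  have "line_trig a N x * cnj (u x) = (\<Sum>n<N. a n * (line_basis n x * cnj (u x)))" for x
    by (simp add: line_trig_def trig_def line_basis_def sum_distrib_left sum_distrib_right mult_ac)
  then have "L2_ip lebesgue (line_trig a N) u = (LINT x|lebesgue. (\<Sum>n<N. a n * (line_basis n x * cnj (u x))))"
    by (simp add: L2_ip_def)
  also have "\<dots> = (\<Sum>n<N. LINT x|lebesgue. a n * (line_basis n x * cnj (u x)))"
    by (intro Bochner_Integration.integral_sum integrable_mult_right integrable_L2_ip square_integrable_line_basis u)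
  finally show ?thesis by (simp add: L2_ip_def)
qed

lemma line_trig_tendsto:
  assumes a: "l2 a" and u: "square_integrable lebesgue u"
  shows "(\<lambda>N. L2_ip lebesgue (line_trig a N) u) \<longlonglongrightarrow> L2_ip lebesgue (line_bdry a) u"
proof (rule L2_ip_tendsto_left[OF square_integrable_line_trig square_integrable_line_bdry[OF a] u])
  have "L2_sq lebesgue (\<lambda>x. line_trig a N x - line_bdry a x) = L2_sq circle_measure (\<lambda>t. trig a N t - bdry a t)" for N
  proof -
    have "complex_of_real (L2_sq lebesgue (\<lambda>x. line_trig a N x - line_bdry a x)) = of_real (L2_sq circle_measure (\<lambda>t. trig a N t - bdry a t))"
      unfolding L2_ip_self[symmetric] line_trig_def line_bdry_def right_diff_distrib[symmetric]
      by (rule cayley_transfer(2)[of "\<lambda>t. trig a N t - bdry a t" "\<lambda>t. trig a N t - bdry a t"])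
    then show ?thesis unfolding of_real_eq_iff .
  qed
  then show "(\<lambda>N. L2_sq lebesgue (\<lambda>x. line_trig a N x - line_bdry a x)) \<longlonglongrightarrow> 0"
    using bdry(2)[OF a] by simp
qed

lemma Bessel_line:
  assumes u: "square_integrable lebesgue u"
  shows "l2 (\<lambda>n. L2_ip lebesgue u (line_basis n) / (2 * pi))"
proof -
  define a where "a n = L2_ip lebesgue u (line_basis n) / (2 * pi)" for n
  have "(\<Sum>n<N. (norm (a n))\<^sup>2) \<le> L2_sq lebesgue u / (2 * pi)" for N
  proof -
    have "a n * L2_ip lebesgue (line_basis n) u = 2 * pi * of_real ((norm (a n))\<^sup>2)" for n
    proof -
      have "L2_ip lebesgue (line_basis n) u = cnj (2 * pi * a n)"
        unfolding L2_ip_commute[of _ "line_basis n"] by (simp add: a_def)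
      then show ?thesis by (simp add: mult_cnj_eq_norm_sq)
    qed
    then have ip: "L2_ip lebesgue (line_trig a N) u = of_real (2 * pi * (\<Sum>n<N. (norm (a n))\<^sup>2))"
      unfolding L2_ip_line_trig[OF u] by (simp add: sum_distrib_left)
    have sq: "L2_sq lebesgue (line_trig a N) = 2 * pi * (\<Sum>n<N. (norm (a n))\<^sup>2)"
    proof -
      have "complex_of_real (L2_sq lebesgue (line_trig a N)) = of_real (L2_sq circle_measure (trig a N))"
        unfolding L2_ip_self[symmetric] line_trig_def[abs_def] by (rule cayley_transfer(2))
      then show ?thesis unfolding of_real_eq_iff by (simp add: L2_sq_trig)
    qed
    show ?thesis
      using L2_sq_le_of_L2_ip[OF square_integrable_line_trig u ip[folded sq]] by (simp add: sq field_simps)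
  qed
  then have "summable (\<lambda>n. (norm (a n))\<^sup>2)"
    by (intro bounded_imp_summable[of _ "L2_sq lebesgue u / (2 * pi)"]) (auto simp: lessThan_Suc_atMost[symmetric] simp del: sum.lessThan_Suc)
  then show ?thesis by (simp add: l2_def a_def)
qed

text \<open>The projection is built from the Fourier coefficients of \<open>u\<close>, square
  summable by Bessel's inequality, and is tested against \<open>G\<close> through the partial sums
  of \<open>G\<close>.\<close>

theorem projection_exists:
  assumes u: "square_integrable lebesgue u"
  shows "\<exists>F\<in>H2_uhp. \<forall>G\<in>H2_uhp. L2_ip lebesgue (bval_uhp F) (bval_uhp G) = L2_ip lebesgue u (bval_uhp G)"
proof -
  define a where "a n = L2_ip lebesgue u (line_basis n) / (2 * pi)" for n
  have a: "l2 a" using Bessel_line[OF u] by (simp add: a_def[abs_def])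
  have eq: "L2_ip lebesgue (bval_uhp (Gam (ps a))) (bval_uhp G) = L2_ip lebesgue u (bval_uhp G)" if G: "G \<in> H2_uhp" for G
  proof -
    obtain b where b: "l2 b" "G = Gam (ps b)" using H2_uhp_cases[OF G] .
    have 1: "(\<lambda>N. L2_ip lebesgue (line_trig b N) u) \<longlonglongrightarrow> L2_ip lebesgue (line_bdry b) u"
      by (rule line_trig_tendsto[OF b(1) u])
    have 2: "L2_ip lebesgue (line_trig b N) u = 2 * pi * (\<Sum>n<N. b n * cnj (a n))" for N
    proof -
      have "L2_ip lebesgue (line_basis n) u = 2 * pi * cnj (a n)" for n
        unfolding L2_ip_commute[of _ "line_basis n"] by (simp add: a_def)
      then show ?thesis unfolding L2_ip_line_trig[OF u] by (simp add: sum_distrib_left mult_ac)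
    qed
    have 3: "(\<lambda>N. 2 * pi * (\<Sum>n<N. b n * cnj (a n))) \<longlonglongrightarrow> 2 * pi * (\<Sum>n. b n * cnj (a n))"
      by (intro tendsto_intros summable_LIMSEQ summable_norm_cancel[OF l2_summable_mult[OF b(1) a]])
    have "L2_ip lebesgue (line_bdry b) u = 2 * pi * (\<Sum>n. b n * cnj (a n))"
      by (rule LIMSEQ_unique[OF 1[unfolded 2] 3])
    also have "\<dots> = inner_uhp G (Gam (ps a))"
      unfolding b(2) by (rule inner_uhp_Gam_ps[OF b(1) a, symmetric])
    finally have "L2_ip lebesgue (line_bdry b) u = inner_uhp G (Gam (ps a))" .
    moreover have "L2_ip lebesgue (line_bdry b) u = L2_ip lebesgue (bval_uhp G) u"
    proof (rule L2_ip_AE)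
      show "AE x in lebesgue. line_bdry b x = bval_uhp G x"
        unfolding b(2) using bval_uhp_Gam_ps[OF b(1)] by eventually_elim simp
    qed (auto intro: square_integrable_line_bdry b square_integrable_bval that u)
    ultimately have "L2_ip lebesgue (bval_uhp G) u = L2_ip lebesgue (bval_uhp G) (bval_uhp (Gam (ps a)))"
      by (simp add: inner_uhp_eq)
    then have "cnj (L2_ip lebesgue (bval_uhp G) (bval_uhp (Gam (ps a)))) = cnj (L2_ip lebesgue (bval_uhp G) u)"
      by simp
    then show ?thesis by (simp only: L2_ip_commute[symmetric])
  qed
  show ?thesis by (rule bexI[of _ "Gam (ps a)"]) (auto intro: eq Gam_ps_in_H2_uhp a)
qed

lemma P_plus:
  assumes u: "square_integrable lebesgue u"
  shows "P_plus u \<in> H2_uhp" "\<And>G. G \<in> H2_uhp \<Longrightarrow> inner_uhp (P_plus u) G = L2_ip lebesgue u (bval_uhp G)"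
proof -
  have iff: "L2_inner_real (\<lambda>x. u x - bval_uhp F x) (bval_uhp G) = 0 \<longleftrightarrow> inner_uhp F G = L2_ip lebesgue u (bval_uhp G)"
    if "F \<in> H2_uhp" "G \<in> H2_uhp" for F G
    using L2_ip_diff_left[OF u square_integrable_bval[OF that(1)] square_integrable_bval[OF that(2)]]
    by (auto simp: L2_inner_real_def L2_ip_def[symmetric] inner_uhp_eq)
  have "\<exists>!F. F \<in> H2_uhp \<and> (\<forall>G\<in>H2_uhp. L2_inner_real (\<lambda>x. u x - bval_uhp F x) (bval_uhp G) = 0)"
  proof (rule ex_ex1I)
    obtain F where F: "F \<in> H2_uhp" "\<forall>G\<in>H2_uhp. L2_ip lebesgue (bval_uhp F) (bval_uhp G) = L2_ip lebesgue u (bval_uhp G)"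
      using projection_exists[OF u] by blast
    then have "\<forall>G\<in>H2_uhp. L2_inner_real (\<lambda>x. u x - bval_uhp F x) (bval_uhp G) = 0"
      using iff[OF F(1)] by (simp add: inner_uhp_eq)
    then show "\<exists>F. F \<in> H2_uhp \<and> (\<forall>G\<in>H2_uhp. L2_inner_real (\<lambda>x. u x - bval_uhp F x) (bval_uhp G) = 0)"
      using F(1) by blast
  next
    fix F G
    assume F: "F \<in> H2_uhp \<and> (\<forall>K\<in>H2_uhp. L2_inner_real (\<lambda>x. u x - bval_uhp F x) (bval_uhp K) = 0)"
      and G: "G \<in> H2_uhp \<and> (\<forall>K\<in>H2_uhp. L2_inner_real (\<lambda>x. u x - bval_uhp G x) (bval_uhp K) = 0)"
    show "F = G"
    proof (rule inner_uhp_ext)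
      fix K assume K: "K \<in> H2_uhp"
      have "inner_uhp F K = inner_uhp G K" using F G iff[OF _ K, of F] iff[OF _ K, of G] K by auto
      then show "inner_uhp K F = inner_uhp K G" unfolding inner_uhp_commute[of K] by simp
    qed (use F G in auto)
  qed
  then have *: "P_plus u \<in> H2_uhp \<and> (\<forall>G\<in>H2_uhp. L2_inner_real (\<lambda>x. u x - bval_uhp (P_plus u) x) (bval_uhp G) = 0)"
    unfolding P_plus_def by (rule theI')
  then show "P_plus u \<in> H2_uhp" by blast
  fix G assume "G \<in> H2_uhp"
  then show "inner_uhp (P_plus u) G = L2_ip lebesgue u (bval_uhp G)"
    using * iff by blast
qed

lemma P_plus_eqI:
  assumes u: "square_integrable lebesgue u" and F: "F \<in> H2_uhp"
    and eq: "\<And>G. G \<in> H2_uhp \<Longrightarrow> inner_uhp F G = L2_ip lebesgue u (bval_uhp G)"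
  shows "P_plus u = F"
proof (rule inner_uhp_ext[OF P_plus(1)[OF u] F])
  fix K assume "K \<in> H2_uhp"
  then have "inner_uhp (P_plus u) K = inner_uhp F K" using P_plus(2)[OF u] eq by simp
  then show "inner_uhp K (P_plus u) = inner_uhp K F" unfolding inner_uhp_commute[of K] by simp
qed

section \<open>Multiplication by bounded holomorphic functions\<close>

lemma mult_Hinf_in_H2_uhp:
  assumes g: "g \<in> Hinf_uhp" and F: "F \<in> H2_uhp"
  shows "mult_op g F \<in> H2_uhp"
proof -
  obtain B where B: "\<And>z. Im z > 0 \<Longrightarrow> norm (g z) \<le> B"
    using g by (auto simp: Hinf_uhp_def bounded_iff)
  have "(SUP y\<in>{0<..}. \<integral>\<^sup>+x. ennreal ((norm (mult_op g F (Complex x y)))\<^sup>2) \<partial>lborel)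
     \<le> ennreal (B\<^sup>2) * (SUP y\<in>{0<..}. \<integral>\<^sup>+x. ennreal ((norm (F (Complex x y)))\<^sup>2) \<partial>lborel)"
  proof (rule SUP_least)
    fix y :: real assume y: "y \<in> {0<..}"
    have "continuous_on UNIV (\<lambda>x. F (Complex x y))"
      by (rule continuous_on_compose2[OF holomorphic_on_imp_continuous_on, of F upper_half_plane])
        (use F y in \<open>auto simp: Complex_eq H2_uhp_def intro!: continuous_intros\<close>)
    then have [measurable]: "(\<lambda>x. F (Complex x y)) \<in> borel_measurable borel" by (rule borel_measurable_continuous_onI)
    have "(\<integral>\<^sup>+x. ennreal ((norm (mult_op g F (Complex x y)))\<^sup>2) \<partial>lborel) \<le> (\<integral>\<^sup>+x. ennreal (B\<^sup>2) * ennreal ((norm (F (Complex x y)))\<^sup>2) \<partial>lborel)"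
    proof (rule nn_integral_mono)
      fix x
      have "(norm (mult_op g F (Complex x y)))\<^sup>2 \<le> B\<^sup>2 * (norm (F (Complex x y)))\<^sup>2"
        using B[of "Complex x y"] y
        by (auto simp: mult_op_def norm_mult power_mult_distrib intro!: mult_right_mono power_mono)
      then show "ennreal ((norm (mult_op g F (Complex x y)))\<^sup>2) \<le> ennreal (B\<^sup>2) * ennreal ((norm (F (Complex x y)))\<^sup>2)"
        by (simp add: ennreal_mult[symmetric] ennreal_leI)
    qed
    also have "\<dots> = ennreal (B\<^sup>2) * (\<integral>\<^sup>+x. ennreal ((norm (F (Complex x y)))\<^sup>2) \<partial>lborel)"
      by (rule nn_integral_cmult) measurable
    also have "\<dots> \<le> ennreal (B\<^sup>2) * (SUP y\<in>{0<..}. \<integral>\<^sup>+x. ennreal ((norm (F (Complex x y)))\<^sup>2) \<partial>lborel)"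
      by (intro mult_left_mono SUP_upper y) simp
    finally show "(\<integral>\<^sup>+x. ennreal ((norm (mult_op g F (Complex x y)))\<^sup>2) \<partial>lborel) \<le> \<dots>" .
  qed
  also have "\<dots> < \<infinity>" using F by (simp add: H2_uhp_def ennreal_mult_less_top)
  finally have "(SUP y\<in>{0<..}. \<integral>\<^sup>+x. ennreal ((norm (mult_op g F (Complex x y)))\<^sup>2) \<partial>lborel) < \<infinity>" .
  moreover have "mult_op g F holomorphic_on upper_half_plane"
    unfolding mult_op_def using g F by (auto simp: Hinf_uhp_def H2_uhp_def intro!: holomorphic_intros)
  ultimately show ?thesis using F by (simp add: H2_uhp_def mult_op_def)
qed

definition unit_seq :: "nat \<Rightarrow> nat \<Rightarrow> complex" where
  "unit_seq n k = (if k = n then 1 else 0)"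

lemma l2_unit_seq: "l2 (unit_seq n)"
  by (rule l2_finite) (auto simp: unit_seq_def)

lemma ps_unit_seq: assumes "norm z < 1" shows "ps (unit_seq n) z = z ^ n"
proof -
  have "(\<Sum>k. unit_seq n k * z ^ k) = (\<Sum>k\<in>{n}. unit_seq n k * z ^ k)"
    by (rule suminf_finite) (auto simp: unit_seq_def)
  then show ?thesis using assms by (simp add: ps_def unit_seq_def)
qed

text \<open>In the half plane this is the function
  \<open>sqrt 2 / (z + \<i>) * cayley z ^ n\<close>.\<close>

definition Gam_basis :: "nat \<Rightarrow> complex \<Rightarrow> complex" where
  "Gam_basis n = Gam (ps (unit_seq n))"

lemma Gam_basis_in_H2_uhp: "Gam_basis n \<in> H2_uhp"
  unfolding Gam_basis_def by (rule Gam_ps_in_H2_uhp[OF l2_unit_seq])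

text \<open>A bounded function need not be square integrable on lines, but its product with the
  nowhere vanishing \<open>Gam_basis 0\<close> lies in \<open>H2_uhp\<close>. The limit of the
  product is divided by that of the factor.\<close>

lemma Hinf_nt_limit:
  assumes g: "g \<in> Hinf_uhp" shows "AE x in lebesgue. nt_limit_uhp g x (bval_uhp g x)"
proof -
  have "mult_op g (Gam_basis 0) \<in> H2_uhp" by (intro mult_Hinf_in_H2_uhp g Gam_basis_in_H2_uhp)
  from H2_uhp_nt_limit[OF this] show ?thesis
  proof eventually_elim
    fix x assume n: "nt_limit_uhp (mult_op g (Gam_basis 0)) x (bval_uhp (mult_op g (Gam_basis 0)) x)"
    define l where "l = bval_uhp (mult_op g (Gam_basis 0)) x"
    have "nt_limit_uhp g x ((of_real x + \<i>) / of_real (sqrt 2) * l)"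
      unfolding nt_limit_uhp_def
    proof (intro allI impI)
      fix a :: real assume a: "a > 0"
      let ?S = "{z. Im z > 0 \<and> \<bar>Re z - x\<bar> < a * Im z}"
      have "((\<lambda>z. (z + \<i>) / of_real (sqrt 2) * mult_op g (Gam_basis 0) z) \<longlongrightarrow> (of_real x + \<i>) / of_real (sqrt 2) * l) (at (of_real x) within ?S)"
        using n a unfolding nt_limit_uhp_def l_def by (intro tendsto_intros) auto
      moreover have "\<forall>\<^sub>F z in at (of_real x) within ?S. (z + \<i>) / of_real (sqrt 2) * mult_op g (Gam_basis 0) z = g z"
        unfolding eventually_at_filter
      proof (intro always_eventually allI impI)
        fix z assume z: "z \<in> ?S"
        then show "(z + \<i>) / of_real (sqrt 2) * mult_op g (Gam_basis 0) z = g z"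
          using plus_i_neq[of z] by (simp add: mult_op_def Gam_basis_def Gam_def ps_unit_seq norm_cayley_less_1)
      qed
      ultimately show "(g \<longlongrightarrow> (of_real x + \<i>) / of_real (sqrt 2) * l) (at (of_real x) within ?S)"
        by (rule Lim_transform_eventually)
    qed
    then show "nt_limit_uhp g x (bval_uhp g x)" using bval_uhp_eqI by metis
  qed
qed

lemma bval_mult:
  assumes "g \<in> Hinf_uhp" "F \<in> H2_uhp"
  shows "AE x in lebesgue. bval_uhp (mult_op g F) x = bval_uhp g x * bval_uhp F x"
  using Hinf_nt_limit[OF assms(1)] H2_uhp_nt_limit[OF assms(2)]
  unfolding mult_op_def by eventually_elim (intro bval_uhp_eqI nt_limit_uhp_mult)

lemma bval_Hinf_bounded:
  assumes g: "g \<in> Hinf_uhp" and B: "\<And>z. Im z > 0 \<Longrightarrow> norm (g z) \<le> B"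
  shows "AE x in lebesgue. norm (bval_uhp g x) \<le> B"
  using Hinf_nt_limit[OF g]
proof eventually_elim
  fix x assume n: "nt_limit_uhp g x (bval_uhp g x)"
  let ?S = "{z. Im z > 0 \<and> \<bar>Re z - x\<bar> < 1 * Im z}"
  have "at (of_real x) within ?S \<noteq> bot" by (rule at_within_stolz_region_uhp)
  moreover have "((\<lambda>z. norm (g z)) \<longlongrightarrow> norm (bval_uhp g x)) (at (of_real x) within ?S)"
    using n unfolding nt_limit_uhp_def by (intro tendsto_norm) (meson zero_less_one)
  moreover have "\<forall>\<^sub>F z in at (of_real x) within ?S. norm (g z) \<le> B"
    unfolding eventually_at_filter by (intro always_eventually) (auto intro: B)
  ultimately show "norm (bval_uhp g x) \<le> B" by (intro tendsto_upperbound)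
qed

lemma bval_Hinf_measurable:
  assumes g: "g \<in> Hinf_uhp" shows "bval_uhp g \<in> borel_measurable lebesgue"
proof -
  define E where "E = Gam_basis 0"
  have E: "E \<in> H2_uhp" unfolding E_def by (rule Gam_basis_in_H2_uhp)
  have bE: "bval_uhp E x = of_real (sqrt 2) / (of_real x + \<i>)" for x
  proof (rule bval_uhp_eqI, unfold nt_limit_uhp_def, intro allI impI)
    fix a :: real assume a: "a > 0"
    let ?S = "{z. Im z > 0 \<and> \<bar>Re z - x\<bar> < a * Im z}"
    have "((\<lambda>z. of_real (sqrt 2) / (z + \<i>)) \<longlongrightarrow> of_real (sqrt 2) / (of_real x + \<i>)) (at (of_real x) within ?S)"
      by (intro tendsto_intros) auto
    moreover have "\<forall>\<^sub>F z in at (of_real x) within ?S. of_real (sqrt 2) / (z + \<i>) = E z"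
      unfolding eventually_at_filter
      by (intro always_eventually) (auto simp: E_def Gam_basis_def Gam_def ps_unit_seq norm_cayley_less_1)
    ultimately show "(E \<longlongrightarrow> of_real (sqrt 2) / (of_real x + \<i>)) (at (of_real x) within ?S)"
      by (rule Lim_transform_eventually)
  qed
  have "bval_uhp (mult_op g E) \<in> borel_measurable lebesgue"
    using square_integrable_bval[OF mult_Hinf_in_H2_uhp[OF g E]] by (simp add: square_integrable_def)
  moreover have "(\<lambda>x. (of_real x + \<i>) / of_real (sqrt 2)) \<in> borel_measurable lebesgue"
    by (rule borel_measurable_lebesgue_continuous) (auto intro!: continuous_intros)
  ultimately have "(\<lambda>x. (of_real x + \<i>) / of_real (sqrt 2) * bval_uhp (mult_op g E) x) \<in> borel_measurable lebesgue"
    by (rule borel_measurable_times[rotated])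
  moreover have "AE x in lebesgue. (of_real x + \<i>) / of_real (sqrt 2) * bval_uhp (mult_op g E) x = bval_uhp g x"
    using bval_mult[OF g E] by eventually_elim (simp add: bE)
  ultimately show ?thesis by (rule borel_measurable_AE)
qed

lemma adjoint_uhp_eqI:
  assumes "u \<in> H2_uhp" "\<And>w. w \<in> H2_uhp \<Longrightarrow> inner_uhp (A w) v = inner_uhp w u"
  shows "adjoint_uhp A v = u"
  unfolding adjoint_on_def
proof (rule the_equality)
  fix u' assume u': "u' \<in> H2_uhp \<and> (\<forall>w\<in>H2_uhp. inner_uhp (A w) v = inner_uhp w u')"
  show "u' = u" by (rule inner_uhp_ext) (use u' assms in auto)
qed (use assms in blast)

text \<open>The adjoint is multiplication by the conjugate boundary function followed by
  \<open>P_plus\<close>; exhibiting it gives a meaning to the \<open>THE\<close> in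
  \<open>adjoint_on\<close>.\<close>

lemma adjoint_mult:
  assumes g: "g \<in> Hinf_uhp" and v: "v \<in> H2_uhp"
  shows "adjoint_uhp (mult_op g) v \<in> H2_uhp"
    "\<And>w. w \<in> H2_uhp \<Longrightarrow> inner_uhp (mult_op g w) v = inner_uhp w (adjoint_uhp (mult_op g) v)"
proof -
  obtain B where B: "\<And>z. Im z > 0 \<Longrightarrow> norm (g z) \<le> B"
    using g by (auto simp: Hinf_uhp_def bounded_iff)
  let ?u = "\<lambda>x. cnj (bval_uhp g x) * bval_uhp v x"
  have u: "square_integrable lebesgue ?u"
  proof (rule square_integrable_bounded_mult)
    show "(\<lambda>x. cnj (bval_uhp g x)) \<in> borel_measurable lebesgue"
      by (rule measurable_compose[OF bval_Hinf_measurable[OF g] borel_measurable_continuous_onI]) (intro continuous_intros)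
    show "AE x in lebesgue. norm (cnj (bval_uhp g x)) \<le> B" using bval_Hinf_bounded[OF g B] by simp
  qed (rule square_integrable_bval[OF v])
  have eq: "inner_uhp (mult_op g w) v = inner_uhp w (P_plus ?u)" if w: "w \<in> H2_uhp" for w
  proof -
    have "inner_uhp w (P_plus ?u) = cnj (L2_ip lebesgue ?u (bval_uhp w))"
      unfolding inner_uhp_commute[of w] P_plus(2)[OF u w] ..
    also have "\<dots> = L2_ip lebesgue (bval_uhp w) ?u" by (rule L2_ip_commute[symmetric])
    also have "\<dots> = inner_uhp (mult_op g w) v"
      unfolding inner_uhp_eq L2_ip_def
    proof (rule integral_cong_AE)
      show "AE x in lebesgue. bval_uhp w x * cnj (?u x) = bval_uhp (mult_op g w) x * cnj (bval_uhp v x)"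
        using bval_mult[OF g w] by eventually_elim simp
    qed (intro borel_measurable_integrable integrable_L2_ip square_integrable_bval u v w mult_Hinf_in_H2_uhp g)+
    finally show ?thesis by simp
  qed
  have "adjoint_uhp (mult_op g) v = P_plus ?u"
    by (rule adjoint_uhp_eqI) (auto intro: P_plus(1)[OF u] eq)
  then show "adjoint_uhp (mult_op g) v \<in> H2_uhp"
    "\<And>w. w \<in> H2_uhp \<Longrightarrow> inner_uhp (mult_op g w) v = inner_uhp w (adjoint_uhp (mult_op g) v)"
    using P_plus(1)[OF u] eq by auto
qed

text \<open>The map \<open>z \<mapsto> - cnj z\<close> takes the Stolz angle at \<open>x\<close> to
  the one at \<open>- x\<close> with the same aperture.\<close>

lemma nt_limit_sharp:
  assumes "nt_limit_uhp g (- x) l" shows "nt_limit_uhp (sharp g) x (cnj l)"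
  unfolding nt_limit_uhp_def
proof (intro allI impI)
  fix a :: real assume a: "a > 0"
  let ?S = "\<lambda>x. {z. Im z > 0 \<and> \<bar>Re z - x\<bar> < a * Im z}"
  have "filterlim (\<lambda>z. - cnj z) (at (of_real (- x)) within ?S (- x)) (at (of_real x) within ?S x)"
    unfolding filterlim_at
  proof
    have "((\<lambda>z. - cnj z) \<longlongrightarrow> - cnj (of_real x)) (at (of_real x) within ?S x)" by (intro tendsto_intros)
    then show "((\<lambda>z. - cnj z) \<longlongrightarrow> of_real (- x)) (at (of_real x) within ?S x)" by simp
    show "\<forall>\<^sub>F z in at (of_real x) within ?S x. - cnj z \<in> ?S (- x) \<and> - cnj z \<noteq> of_real (- x)"
      unfolding eventually_at_filter
      by (intro always_eventually) (auto simp: complex_eq_iff)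
  qed
  moreover have "(g \<longlongrightarrow> l) (at (of_real (- x)) within ?S (- x))"
    using assms a unfolding nt_limit_uhp_def by blast
  ultimately have "((\<lambda>z. g (- cnj z)) \<longlongrightarrow> l) (at (of_real x) within ?S x)"
    by (rule filterlim_compose[rotated])
  then show "(sharp g \<longlongrightarrow> cnj l) (at (of_real x) within ?S x)"
    unfolding sharp_def by (rule tendsto_cnj)
qed

lemma AE_reflect:
  assumes "AE x in lebesgue. P (x::real)" shows "AE x in lebesgue. P (- x)"
proof -
  obtain N where N: "negligible N" "\<And>x. x \<notin> N \<Longrightarrow> P x"
    using assms unfolding completion.AE_iff_null_sets negligible_iff_null_sets by auto
  have "negligible (uminus ` N)"
    by (rule negligible_differentiable_image_negligible[OF _ N(1)]) (auto intro!: derivative_intros)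
  then have "AE x in lebesgue. x \<notin> uminus ` N"
    by (simp add: negligible_iff_null_sets AE_not_in)
  then show ?thesis
  proof eventually_elim
    fix x assume "x \<notin> uminus ` N"
    then have "- x \<notin> N" by (metis image_eqI minus_minus)
    then show "P (- x)" by (rule N(2))
  qed
qed

lemma bval_sharp:
  assumes g: "g \<in> Hinf_uhp" shows "AE x in lebesgue. bval_uhp (sharp g) x = cnj (bval_uhp g (- x))"
  using AE_reflect[OF Hinf_nt_limit[OF g]] by eventually_elim (intro bval_uhp_eqI nt_limit_sharp)

lemma sharp_in_Hinf:
  assumes g: "g \<in> Hinf_uhp" shows "sharp g \<in> Hinf_uhp"
proof -
  have img: "(\<lambda>z. - cnj z) ` upper_half_plane = upper_half_plane"
  proof (intro equalityI subsetI)
    fix z assume "z \<in> upper_half_plane"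
    then show "z \<in> (\<lambda>z. - cnj z) ` upper_half_plane" by (intro image_eqI[of _ _ "- cnj z"]) auto
  qed auto
  \<comment> \<open>\<open>sharp g\<close> arises from this function on the lower half plane by
    conjugating both argument and value, which preserves holomorphy.\<close>
  have "(\<lambda>z. g (- z)) holomorphic_on {z. Im z < 0}"
  proof -
    have "(g \<circ> uminus) holomorphic_on {z. Im z < 0}"
      by (rule holomorphic_on_compose_gen[of _ _ _ upper_half_plane]) (use g in \<open>auto simp: Hinf_uhp_def intro!: holomorphic_intros\<close>)
    then show ?thesis by (simp add: o_def)
  qed
  moreover have "{z. Im z < 0} = cnj ` upper_half_plane"
  proof (intro equalityI subsetI)
    fix z assume "z \<in> {z. Im z < 0}"
    then show "z \<in> cnj ` upper_half_plane" by (intro image_eqI[of _ _ "cnj z"]) auto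
  qed auto
  ultimately have "(cnj \<circ> (\<lambda>z. g (- z)) \<circ> cnj) holomorphic_on upper_half_plane"
    by (intro holomorphic_on_compose_cnj_cnj) (auto simp: open_halfspace_Im_gt)
  then have "sharp g holomorphic_on upper_half_plane" by (simp add: sharp_def o_def)
  moreover have "bounded (sharp g ` upper_half_plane)"
  proof -
    obtain B where B: "\<And>z. Im z > 0 \<Longrightarrow> norm (g z) \<le> B"
      using g by (auto simp: Hinf_uhp_def bounded_iff)
    then show ?thesis unfolding bounded_iff by (intro exI[of _ B]) (auto simp: sharp_def)
  qed
  ultimately show ?thesis by (simp add: Hinf_uhp_def)
qed

section \<open>Hankel operators with a given symbol\<close>

lemma square_integrable_reflection:
  assumes "square_integrable lebesgue u" shows "square_integrable lebesgue (reflection u)"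
proof -
  have "(\<lambda>x. u (- x)) \<in> borel_measurable lebesgue"
  proof (rule measurable_compose[of uminus lebesgue lebesgue u borel])
    show "u \<in> borel_measurable lebesgue" using assms by (simp add: square_integrable_def)
    show "(uminus :: real \<Rightarrow> real) \<in> lebesgue \<rightarrow>\<^sub>M lebesgue"
      using lebesgue_affine_measurable[where c="\<lambda>x::real. -1" and t=0] by simp
  qed
  moreover have "integrable lebesgue (\<lambda>x. (norm (u (- x)))\<^sup>2)"
    using assms lebesgue_integrable_real_affine_iff[of "-1" "\<lambda>x. (norm (u x))\<^sup>2" 0] by (simp add: square_integrable_def)
  ultimately show ?thesis by (simp add: square_integrable_def reflection_def[abs_def])
qed

lemma hankel_uhp:
  assumes h: "h \<in> Linf_real" and F: "F \<in> H2_uhp"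
  shows "square_integrable lebesgue (\<lambda>x. h x * reflection (bval_uhp F) x)"
    and "hankel_uhp h F \<in> H2_uhp"
    and "\<And>G. G \<in> H2_uhp \<Longrightarrow> inner_uhp (hankel_uhp h F) G = L2_ip lebesgue (\<lambda>x. h x * reflection (bval_uhp F) x) (bval_uhp G)"
proof -
  let ?u = "\<lambda>x. h x * reflection (bval_uhp F) x"
  show u: "square_integrable lebesgue ?u"
    using h F unfolding Linf_real_def
    by (auto intro!: square_integrable_bounded_mult square_integrable_reflection square_integrable_bval)
  show "hankel_uhp h F \<in> H2_uhp" "\<And>G. G \<in> H2_uhp \<Longrightarrow> inner_uhp (hankel_uhp h F) G = L2_ip lebesgue ?u (bval_uhp G)"
    unfolding hankel_uhp_def using P_plus[OF u] by auto
qed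

theorem hankel_intertwines:
  assumes h: "h \<in> Linf_real" and C: "\<And>f. f \<in> H2_uhp \<Longrightarrow> C f = hankel_uhp h f"
    and g: "g \<in> Hinf_uhp" and f: "f \<in> H2_uhp"
  shows "C (mult_op g f) = adjoint_uhp (mult_op (sharp g)) (C f)"
proof (rule adjoint_uhp_eqI[symmetric])
  have gf: "mult_op g f \<in> H2_uhp" by (rule mult_Hinf_in_H2_uhp[OF g f])
  show "C (mult_op g f) \<in> H2_uhp" using C[OF gf] hankel_uhp(2)[OF h gf] by simp
  fix w assume w: "w \<in> H2_uhp"
  have sw: "mult_op (sharp g) w \<in> H2_uhp" by (rule mult_Hinf_in_H2_uhp[OF sharp_in_Hinf[OF g] w])
  have "inner_uhp (C f) (mult_op (sharp g) w) = inner_uhp (C (mult_op g f)) w"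
    unfolding C[OF gf] C[OF f] hankel_uhp(3)[OF h f sw] hankel_uhp(3)[OF h gf w] L2_ip_def
  proof (rule integral_cong_AE)
    show "AE x in lebesgue. h x * reflection (bval_uhp f) x * cnj (bval_uhp (mult_op (sharp g) w) x)
       = h x * reflection (bval_uhp (mult_op g f)) x * cnj (bval_uhp w x)"
      using bval_mult[OF sharp_in_Hinf[OF g] w] bval_sharp[OF g] AE_reflect[OF bval_mult[OF g f]]
      by eventually_elim (simp add: reflection_def)
  qed (intro borel_measurable_integrable integrable_L2_ip hankel_uhp(1)[OF h] square_integrable_bval f gf w sw)+
  then show "inner_uhp (mult_op (sharp g) w) (C f) = inner_uhp w (C (mult_op g f))"
    unfolding inner_uhp_commute[of _ "C f"] inner_uhp_commute[of w] by simp
qed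

lemma exp_in_Hinf:
  assumes t: "t \<ge> 0" shows "(\<lambda>z. exp (\<i> * of_real t * z)) \<in> Hinf_uhp"
proof -
  have "norm (exp (\<i> * of_real t * z)) \<le> 1" if "Im z > 0" for z
    using that t by (simp add: norm_exp_eq_Re)
  then show ?thesis
    unfolding Hinf_uhp_def bounded_iff by (auto intro!: holomorphic_intros exI[of _ 1])
qed

lemma S_uhp_eq: "S_uhp t = mult_op (\<lambda>z. exp (\<i> * of_real t * z))"
  by (simp add: S_uhp_def mult_op_def fun_eq_iff)

lemma sharp_exp: "sharp (\<lambda>z. exp (\<i> * of_real t * z)) = (\<lambda>z. exp (\<i> * of_real t * z))"
  by (simp add: sharp_def exp_cnj fun_eq_iff)

section \<open>From translations to the Cayley function\<close>

lemma Re_inner_uhp_self: "Re (inner_uhp F F) = L2_sq lebesgue (bval_uhp F)"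
  by (simp add: inner_uhp_eq L2_ip_self)

lemma inner_uhp_Cauchy_Schwarz:
  assumes "F \<in> H2_uhp" "G \<in> H2_uhp"
  shows "norm (inner_uhp F G) \<le> sqrt (Re (inner_uhp F F)) * sqrt (Re (inner_uhp G G))"
  unfolding Re_inner_uhp_self unfolding inner_uhp_eq
  by (intro L2_Cauchy_Schwarz square_integrable_bval assms)

lemma zero_in_H2_uhp: "(\<lambda>_. 0) \<in> H2_uhp"
proof -
  have "Gam (ps (\<lambda>_. 0)) \<in> H2_uhp" by (rule Gam_ps_in_H2_uhp) (simp add: l2_def)
  moreover have "Gam (ps (\<lambda>_. 0)) = (\<lambda>_. 0)" by (auto simp: Gam_def ps_def)
  ultimately show ?thesis by simp
qed

lemma H2_uhp_sum:
  assumes "\<And>i. i \<in> I \<Longrightarrow> f i \<in> H2_uhp" shows "(\<lambda>z. \<Sum>i\<in>I. c i * f i z) \<in> H2_uhp"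
  using assms
proof (induction I rule: infinite_finite_induct)
  case (insert i I)
  have "(\<lambda>z. c i * f i z + (\<Sum>i\<in>I. c i * f i z)) \<in> H2_uhp"
    by (intro H2_uhp_add H2_uhp_cmult) (use insert in auto)
  then show ?case using insert by simp
qed (simp_all add: zero_in_H2_uhp)

lemma inner_uhp_zero_left: "inner_uhp (\<lambda>_. 0) G = 0" if "G \<in> H2_uhp"
  using inner_uhp_cmult_left[OF zero_in_H2_uhp that, of 0] by simp

lemma inner_uhp_sum_left:
  assumes "\<And>i. i \<in> I \<Longrightarrow> f i \<in> H2_uhp" and G: "G \<in> H2_uhp"
  shows "inner_uhp (\<lambda>z. \<Sum>i\<in>I. c i * f i z) G = (\<Sum>i\<in>I. c i * inner_uhp (f i) G)"
  using assms(1)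
proof (induction I rule: infinite_finite_induct)
  case (insert i I)
  have "inner_uhp (\<lambda>z. c i * f i z + (\<Sum>i\<in>I. c i * f i z)) G = inner_uhp (\<lambda>z. c i * f i z) G + inner_uhp (\<lambda>z. \<Sum>i\<in>I. c i * f i z) G"
    by (intro inner_uhp_add_left H2_uhp_cmult H2_uhp_sum G) (use insert in auto)
  then show ?case using insert inner_uhp_cmult_left[of "f i" G "c i"] G by simp
qed (simp_all add: inner_uhp_zero_left G)

context
  fixes C :: "(complex \<Rightarrow> complex) \<Rightarrow> (complex \<Rightarrow> complex)"
  assumes C: "bounded_operator_on H2_uhp inner_uhp C"
begin

lemma op_in: "f \<in> H2_uhp \<Longrightarrow> C f \<in> H2_uhp"
  using C by (simp add: bounded_operator_on_def)

lemma op_add: "f \<in> H2_uhp \<Longrightarrow> g \<in> H2_uhp \<Longrightarrow> C (\<lambda>z. f z + g z) = (\<lambda>z. C f z + C g z)"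
  using C by (simp add: bounded_operator_on_def)

lemma op_cmult: "f \<in> H2_uhp \<Longrightarrow> C (\<lambda>z. c * f z) = (\<lambda>z. c * C f z)"
  using C by (simp add: bounded_operator_on_def)

lemma op_diff: "f \<in> H2_uhp \<Longrightarrow> g \<in> H2_uhp \<Longrightarrow> C (\<lambda>z. f z - g z) = (\<lambda>z. C f z - C g z)"
  using op_add[of f "\<lambda>z. -1 * g z"] op_cmult[of g "-1"] H2_uhp_cmult[of g "-1"] by simp

lemma op_sum:
  assumes "\<And>i. i \<in> I \<Longrightarrow> f i \<in> H2_uhp"
  shows "C (\<lambda>z. \<Sum>i\<in>I. c i * f i z) = (\<lambda>z. \<Sum>i\<in>I. c i * C (f i) z)"
  using assms
proof (induction I rule: infinite_finite_induct)
  case (insert i I)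
  have "C (\<lambda>z. c i * f i z + (\<Sum>i\<in>I. c i * f i z)) = (\<lambda>z. C (\<lambda>z. c i * f i z) z + C (\<lambda>z. \<Sum>i\<in>I. c i * f i z) z)"
    by (intro op_add H2_uhp_cmult H2_uhp_sum) (use insert in auto)
  then show ?case using insert op_cmult[of "f i" "c i"] by simp
qed (use op_cmult[OF zero_in_H2_uhp, of 0] in simp_all)

text \<open>Weak convergence of the images is enough, because all operator identities are tested
  against elements \<open>w\<close>.\<close>

lemma op_tendsto:
  assumes f: "\<And>n. f n \<in> H2_uhp" and g: "g \<in> H2_uhp" and w: "w \<in> H2_uhp"
    and lim: "(\<lambda>n. L2_sq lebesgue (bval_uhp (\<lambda>z. f n z - g z))) \<longlonglongrightarrow> 0"
  shows "(\<lambda>n. inner_uhp (C (f n)) w) \<longlonglongrightarrow> inner_uhp (C g) w"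
proof -
  obtain K where K: "\<And>f. f \<in> H2_uhp \<Longrightarrow> sqrt (Re (inner_uhp (C f) (C f))) \<le> K * sqrt (Re (inner_uhp f f))"
    using C unfolding bounded_operator_on_def by blast
  have "(\<lambda>n. inner_uhp (C (f n)) w - inner_uhp (C g) w) \<longlonglongrightarrow> 0"
  proof (rule Lim_null_comparison)
    show "\<forall>\<^sub>F n in sequentially. norm (inner_uhp (C (f n)) w - inner_uhp (C g) w) \<le>
       K * sqrt (L2_sq lebesgue (bval_uhp (\<lambda>z. f n z - g z))) * sqrt (Re (inner_uhp w w))"
    proof (intro always_eventually allI)
      fix n
      have d: "(\<lambda>z. f n z - g z) \<in> H2_uhp" by (intro H2_uhp_diff f g)
      have "inner_uhp (C (f n)) w - inner_uhp (C g) w = inner_uhp (C (\<lambda>z. f n z - g z)) w"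
        unfolding op_diff[OF f g] by (rule inner_uhp_diff_left[OF op_in[OF f] op_in[OF g] w, symmetric])
      then have "norm (inner_uhp (C (f n)) w - inner_uhp (C g) w) \<le>
          sqrt (Re (inner_uhp (C (\<lambda>z. f n z - g z)) (C (\<lambda>z. f n z - g z)))) * sqrt (Re (inner_uhp w w))"
        using inner_uhp_Cauchy_Schwarz[OF op_in[OF d] w] by simp
      also have "\<dots> \<le> K * sqrt (Re (inner_uhp (\<lambda>z. f n z - g z) (\<lambda>z. f n z - g z))) * sqrt (Re (inner_uhp w w))"
        by (intro mult_right_mono K d) (simp add: Re_inner_uhp_self)
      finally show "norm (inner_uhp (C (f n)) w - inner_uhp (C g) w) \<le>
         K * sqrt (L2_sq lebesgue (bval_uhp (\<lambda>z. f n z - g z))) * sqrt (Re (inner_uhp w w))"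
        by (simp only: Re_inner_uhp_self)
    qed
    have "(\<lambda>n. K * sqrt (L2_sq lebesgue (bval_uhp (\<lambda>z. f n z - g z))) * sqrt (Re (inner_uhp w w))) \<longlonglongrightarrow> K * sqrt 0 * sqrt (Re (inner_uhp w w))"
      by (intro tendsto_intros lim)
    then show "(\<lambda>n. K * sqrt (L2_sq lebesgue (bval_uhp (\<lambda>z. f n z - g z))) * sqrt (Re (inner_uhp w w))) \<longlonglongrightarrow> 0" by simp
  qed
  then show ?thesis by (simp add: LIM_zero_iff)
qed

end

text \<open>
  \<open>cayley_coeff\<close> comes from a Riemann sum for \<open>cayley z = 1 - 2 * (\<integral>t. exp (- t) * exp (\<i> * t * z))\<close>
  over the positive half-line, with mesh \<open>1 / (n + 1)\<close>.
\<close>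
definition cayley_coeff :: "nat \<Rightarrow> nat \<Rightarrow> real" where
  "cayley_coeff n k = (if k = 0 then 1 else 0) - 2 / real (Suc n) * exp (- real k / real (Suc n))"

definition cayley_approx :: "nat \<Rightarrow> complex \<Rightarrow> complex" where
  "cayley_approx n z = (\<Sum>k<(Suc n)\<^sup>2. of_real (cayley_coeff n k) * exp (\<i> * of_real (real k / real (Suc n)) * z))"

text \<open>With \<open>N = n + 1\<close> the nodes \<open>k / N\<close>, \<open>k < N^2\<close>,
  fill the interval from 0 to \<open>N\<close>, so mesh and neglected tail vanish together. The sum
  is geometric, and the hypothesis excludes the ratio 1.\<close>

lemma cayley_approx_eq:
  assumes z: "exp ((\<i> * z - 1) / of_nat (Suc n)) \<noteq> 1"
  shows "cayley_approx n z = 1 - 2 / of_nat (Suc n) * (1 - exp (of_nat (Suc n) * (\<i> * z - 1))) / (1 - exp ((\<i> * z - 1) / of_nat (Suc n)))"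
proof -
  define N where "N = Suc n"
  define q where "q = exp ((\<i> * z - 1) / of_nat N)"
  have N: "N > 0" by (simp add: N_def)
  have qk: "of_real (exp (- real k / real N)) * exp (\<i> * of_real (real k / real N) * z) = q ^ k" for k
  proof -
    have "of_real (exp (- real k / real N)) * exp (\<i> * of_real (real k / real N) * z) = exp (- of_nat k / of_nat N + \<i> * (of_nat k / of_nat N) * z)"
      by (simp add: exp_of_real[symmetric] exp_add[symmetric] exp_diff exp_minus mult_exp_exp)
        (simp add: divide_inverse mult.commute)
    also have "- of_nat k / of_nat N + \<i> * (of_nat k / of_nat N) * z = of_nat k * ((\<i> * z - 1) / of_nat N)"
      using N by (simp add: field_simps)
    also have "exp \<dots> = q ^ k" unfolding q_def by (rule exp_of_nat_mult)
    finally show ?thesis .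
  qed
  have "cayley_approx n z = (\<Sum>k<N\<^sup>2. (if k = 0 then 1 else 0) * exp (\<i> * of_real (real k / real N) * z) - 2 / of_nat N * q ^ k)"
    unfolding cayley_approx_def N_def[symmetric]
  proof (rule sum.cong[OF refl])
    fix k
    have "of_real (cayley_coeff n k) * exp (\<i> * of_real (real k / real N) * z) =
       (if k = 0 then 1 else 0) * exp (\<i> * of_real (real k / real N) * z) - 2 / of_nat N * (of_real (exp (- real k / real N)) * exp (\<i> * of_real (real k / real N) * z))"
      by (simp add: cayley_coeff_def N_def[symmetric] left_diff_distrib del: of_nat_Suc)
    then show "of_real (cayley_coeff n k) * exp (\<i> * of_real (real k / real N) * z) = (if k = 0 then 1 else 0) * exp (\<i> * of_real (real k / real N) * z) - 2 / of_nat N * q ^ k"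
      unfolding qk .
  qed
  also have "\<dots> = (\<Sum>k<N\<^sup>2. (if k = 0 then 1 else 0)) - 2 / of_nat N * (\<Sum>k<N\<^sup>2. q ^ k)"
    unfolding sum_subtractf sum_distrib_left by (intro arg_cong2[where f="(-)"] sum.cong refl) auto
  also have "(\<Sum>k<N\<^sup>2. (if k = 0 then 1 else 0)) = (1 :: complex)"
    using N by (simp add: sum.delta)
  also have "(\<Sum>k<N\<^sup>2. q ^ k) = (1 - q ^ N\<^sup>2) / (1 - q)"
    using z by (intro sum_gp_strict[THEN trans]) (auto simp: q_def N_def)
  also have "q ^ N\<^sup>2 = exp (of_nat N * (\<i> * z - 1))"
    using N unfolding q_def exp_of_nat_mult[symmetric] by (simp add: power2_eq_square)
  finally show ?thesis by (simp add: N_def[symmetric] q_def)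
qed

text \<open>In the closed form, \<open>N * (1 - exp (u / N))\<close> tends to \<open>- u\<close> by
  the derivative of the exponential function, and \<open>exp (N * u)\<close> vanishes because
  \<open>Re u = -1\<close>.\<close>

lemma cayley_approx_tendsto: "(\<lambda>n. cayley_approx n (of_real x)) \<longlonglongrightarrow> cayley (of_real x)"
proof -
  define u where "u = \<i> * of_real x - 1"
  have u: "u \<noteq> 0" "Re u = -1" by (auto simp: u_def complex_eq_iff)
  have neq: "exp (u / of_nat (Suc n)) \<noteq> 1" for n
  proof
    assume "exp (u / of_nat (Suc n)) = 1"
    then have "norm (exp (u / of_nat (Suc n))) = 1" by simp
    then have "Re (u / of_nat (Suc n)) = 0" by (simp only: norm_exp_eq_Re) simp
    then show False using u by (simp add: Re_divide_of_nat)
  qed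
  have h: "(\<lambda>n. inverse (complex_of_nat (Suc n))) \<longlonglongrightarrow> 0"
    using LIMSEQ_inverse_real_of_nat tendsto_of_real[of "\<lambda>n. inverse (real (Suc n))" 0 sequentially, where ?'a=complex]
    by (simp del: of_nat_Suc)
  have "((\<lambda>h. exp (u * h)) has_field_derivative u) (at 0)"
    by (auto intro!: derivative_eq_intros)
  then have "((\<lambda>h. (exp (u * h) - 1) / h) \<longlongrightarrow> u) (at 0)"
    by (simp add: has_field_derivative_iff)
  then have "(\<lambda>n. (exp (u * inverse (of_nat (Suc n))) - 1) / inverse (of_nat (Suc n))) \<longlonglongrightarrow> u"
    by (rule filterlim_compose) (auto simp: filterlim_at h simp del: of_nat_Suc)
  then have 1: "(\<lambda>n. of_nat (Suc n) * (1 - exp (u / of_nat (Suc n)))) \<longlonglongrightarrow> - u"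
    by (rule tendsto_minus[THEN Lim_transform_eventually])
       (auto intro!: always_eventually simp: divide_inverse algebra_simps simp del: of_nat_Suc)
  have 2: "(\<lambda>n. exp (of_nat (Suc n) * u)) \<longlonglongrightarrow> 0"
  proof -
    have "norm (exp u) < 1" using u by (simp add: norm_exp_eq_Re)
    then have "(\<lambda>n. exp u ^ Suc n) \<longlonglongrightarrow> 0" by (intro LIMSEQ_Suc LIMSEQ_power_zero)
    then show ?thesis by (simp only: exp_of_nat_mult)
  qed
  have "(\<lambda>n. 1 - 2 * (1 - exp (of_nat (Suc n) * u)) / (of_nat (Suc n) * (1 - exp (u / of_nat (Suc n))))) \<longlonglongrightarrow> 1 - 2 * (1 - 0) / (- u)"
    by (intro tendsto_intros 1 2) (use u in simp)
  moreover have "cayley_approx n (of_real x) = 1 - 2 * (1 - exp (of_nat (Suc n) * u)) / (of_nat (Suc n) * (1 - exp (u / of_nat (Suc n))))" for n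
    using cayley_approx_eq[of "of_real x" n] neq[of n] by (simp add: u_def del: of_nat_Suc)
  moreover have "1 - 2 * (1 - 0) / (- u) = cayley (of_real x)"
  proof -
    have "u = \<i> * (of_real x + \<i>)" by (simp add: u_def algebra_simps)
    then show ?thesis by (simp add: cayley_def divide_simps) (simp add: algebra_simps)
  qed
  ultimately show ?thesis by simp
qed

text \<open>The constant term contributes 1. The Riemann sum of the exponential weight contributes
  at most 4, since \<open>1 - q \<ge> 1 / (2 * N)\<close>.\<close>

lemma cayley_approx_bound: assumes "Im z \<ge> 0" shows "norm (cayley_approx n z) \<le> 5"
proof -
  define N where "N = Suc n"
  have N: "real N \<ge> 1" by (simp add: N_def)
  define q where "q = exp (- 1 / real N)"
  have q: "0 < q" "q < 1" using N by (auto simp: q_def)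
  have "norm (cayley_approx n z) \<le> (\<Sum>k<N\<^sup>2. \<bar>cayley_coeff n k\<bar>)"
    unfolding cayley_approx_def N_def[symmetric]
  proof (rule sum_norm_le)
    fix k
    have "norm (exp (\<i> * of_real (real k / real N) * z)) \<le> 1"
      using assms by (simp add: norm_exp_eq_Re)
    then show "norm (of_real (cayley_coeff n k) * exp (\<i> * of_real (real k / real N) * z)) \<le> \<bar>cayley_coeff n k\<bar>"
      by (simp add: norm_mult mult_left_le)
  qed
  also have "\<dots> \<le> (\<Sum>k<N\<^sup>2. (if k = 0 then 1 else 0) + 2 / real N * q ^ k)"
  proof (rule sum_mono)
    fix k
    have "exp (- real k / real N) = q ^ k" by (simp add: q_def exp_of_nat_mult[symmetric])
    then show "\<bar>cayley_coeff n k\<bar> \<le> (if k = 0 then 1 else 0) + 2 / real N * q ^ k"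
      using q unfolding cayley_coeff_def N_def[symmetric]
      by (intro order_trans[OF abs_triangle_ineq4]) (auto simp: abs_mult)
  qed
  also have "\<dots> = (\<Sum>k<N\<^sup>2. (if k = 0 then 1 else 0)) + 2 / real N * (\<Sum>k<N\<^sup>2. q ^ k)"
    by (simp only: sum.distrib sum_distrib_left)
  also have "\<dots> \<le> 1 + 2 / real N * (1 / (1 - q))"
  proof (intro add_mono mult_left_mono)
    show "(\<Sum>k<N\<^sup>2. (if k = 0 then 1 else 0)) \<le> (1::real)" by (simp add: sum.delta)
    show "(\<Sum>k<N\<^sup>2. q ^ k) \<le> 1 / (1 - q)"
      using q sum_gp_strict[of q "N\<^sup>2"] by (simp add: divide_right_mono)
  qed simp
  also have "2 / real N * (1 / (1 - q)) \<le> 4"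
  proof -
    have "exp (1 / real N) \<ge> 1 + 1 / real N" by (rule exp_ge_add_one_self)
    then have "q \<le> 1 / (1 + 1 / real N)"
      unfolding q_def using N by (simp add: exp_minus divide_simps mult.commute)
    also have "\<dots> \<le> 1 - 1 / (2 * real N)" using N by (simp add: field_simps)
    finally have "1 / (2 * real N) \<le> 1 - q" by simp
    then have "1 / (1 - q) \<le> 1 / (1 / (2 * real N))" using N by (intro divide_left_mono) (use q in auto)
    then have "2 / real N * (1 / (1 - q)) \<le> 2 / real N * (2 * real N)" using N by (intro mult_left_mono) auto
    then show ?thesis using N by simp
  qed
  finally show ?thesis by simp
qed

lemma cayley_approx_in_Hinf: "cayley_approx n \<in> Hinf_uhp"
proof -
  have "cayley_approx n holomorphic_on upper_half_plane"
    unfolding cayley_approx_def[abs_def] by (intro holomorphic_intros)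
  then show ?thesis
    unfolding Hinf_uhp_def bounded_iff by (auto intro!: exI[of _ 5] cayley_approx_bound)
qed

lemma cayley_in_Hinf: "cayley \<in> Hinf_uhp"
proof -
  have "cayley holomorphic_on upper_half_plane"
    unfolding cayley_def[abs_def] by (intro holomorphic_intros) (auto simp: complex_eq_iff)
  then show ?thesis
    unfolding Hinf_uhp_def bounded_iff by (auto intro!: exI[of _ 1] less_imp_le norm_cayley_less_1)
qed

lemma nt_limit_uhp_isCont: "isCont g (of_real x) \<Longrightarrow> nt_limit_uhp g x (g (of_real x))"
  unfolding nt_limit_uhp_def isCont_def by (auto intro: tendsto_within_subset)

lemma cayley_approx_L2_tendsto:
  assumes f: "f \<in> H2_uhp"
  shows "(\<lambda>n. L2_sq lebesgue (bval_uhp (\<lambda>z. mult_op (cayley_approx n) f z - mult_op cayley f z))) \<longlonglongrightarrow> 0"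
proof -
  have ca: "isCont (cayley_approx n) z" for n z
    unfolding cayley_approx_def[abs_def] by (intro continuous_intros)
  have cc: "isCont cayley (of_real x)" for x
    unfolding cayley_def[abs_def] by (intro continuous_intros) auto
  have b: "AE x in lebesgue. bval_uhp (\<lambda>z. mult_op (cayley_approx n) f z - mult_op cayley f z) x
      = (cayley_approx n (of_real x) - cayley (of_real x)) * bval_uhp f x" for n
    using H2_uhp_nt_limit[OF f]
  proof eventually_elim
    fix x assume "nt_limit_uhp f x (bval_uhp f x)"
    then have "nt_limit_uhp (\<lambda>z. cayley_approx n z * f z + (- cayley z) * f z) x
       (cayley_approx n (of_real x) * bval_uhp f x + (- cayley (of_real x)) * bval_uhp f x)"
      by (intro nt_limit_uhp_add nt_limit_uhp_mult nt_limit_uhp_isCont[where g="cayley_approx n"] ca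
           nt_limit_uhp_isCont[where g="\<lambda>z. - cayley z"] continuous_minus cc)
    from bval_uhp_eqI[OF this]
    show "bval_uhp (\<lambda>z. mult_op (cayley_approx n) f z - mult_op cayley f z) x
      = (cayley_approx n (of_real x) - cayley (of_real x)) * bval_uhp f x"
      by (simp add: mult_op_def algebra_simps)
  qed
  have d: "(\<lambda>z. mult_op (cayley_approx n) f z - mult_op cayley f z) \<in> H2_uhp" for n
    by (intro H2_uhp_diff mult_Hinf_in_H2_uhp cayley_approx_in_Hinf cayley_in_Hinf f)
  have "(\<lambda>n. L2_sq lebesgue (bval_uhp (\<lambda>z. mult_op (cayley_approx n) f z - mult_op cayley f z))) \<longlonglongrightarrow> (LINT x::real|lebesgue. (0::real))"
    unfolding L2_sq_def
  \<comment> \<open>Here \<open>36 = (5 + 1)^2\<close>: the approximants are bounded by 5 and the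
    Cayley function has modulus 1 on the line.\<close>
  proof (rule integral_dominated_convergence[where f="\<lambda>_. 0" and w="\<lambda>x. 36 * (norm (bval_uhp f x))\<^sup>2"])
    show "integrable lebesgue (\<lambda>x. 36 * (norm (bval_uhp f x))\<^sup>2)"
      using square_integrable_bval[OF f] by (simp add: square_integrable_def)
    show "(\<lambda>x. (norm (bval_uhp (\<lambda>z. mult_op (cayley_approx n) f z - mult_op cayley f z) x))\<^sup>2) \<in> borel_measurable lebesgue" for n
      using square_integrable_bval[OF d] unfolding square_integrable_def by (blast intro: borel_measurable_integrable)
    have "AE x in lebesgue. \<forall>n. bval_uhp (\<lambda>z. mult_op (cayley_approx n) f z - mult_op cayley f z) x
      = (cayley_approx n (of_real x) - cayley (of_real x)) * bval_uhp f x"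
      using b by (simp add: AE_all_countable)
    then show "AE x in lebesgue. (\<lambda>n. (norm (bval_uhp (\<lambda>z. mult_op (cayley_approx n) f z - mult_op cayley f z) x))\<^sup>2) \<longlonglongrightarrow> 0"
    proof eventually_elim
      fix x assume e: "\<forall>n. bval_uhp (\<lambda>z. mult_op (cayley_approx n) f z - mult_op cayley f z) x
        = (cayley_approx n (of_real x) - cayley (of_real x)) * bval_uhp f x"
      have "(\<lambda>n. (norm ((cayley_approx n (of_real x) - cayley (of_real x)) * bval_uhp f x))\<^sup>2) \<longlonglongrightarrow> (norm ((cayley (of_real x) - cayley (of_real x)) * bval_uhp f x))\<^sup>2"
        by (intro tendsto_intros cayley_approx_tendsto)
      then show "(\<lambda>n. (norm (bval_uhp (\<lambda>z. mult_op (cayley_approx n) f z - mult_op cayley f z) x))\<^sup>2) \<longlonglongrightarrow> 0"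
        using e by simp
    qed
    show "AE x in lebesgue. norm ((norm (bval_uhp (\<lambda>z. mult_op (cayley_approx n) f z - mult_op cayley f z) x))\<^sup>2) \<le> 36 * (norm (bval_uhp f x))\<^sup>2" for n
      using b[of n]
    proof eventually_elim
      fix x assume e: "bval_uhp (\<lambda>z. mult_op (cayley_approx n) f z - mult_op cayley f z) x
        = (cayley_approx n (of_real x) - cayley (of_real x)) * bval_uhp f x"
      have "norm (cayley (complex_of_real x)) = 1"
        using cis_cayley_angle[of x] unfolding cayley_def by (metis norm_cis)
      then have "norm (cayley_approx n (of_real x) - cayley (of_real x)) \<le> 5 + 1"
        by (intro order_trans[OF norm_triangle_ineq4] add_mono cayley_approx_bound) auto
      then have "(norm (cayley_approx n (of_real x) - cayley (of_real x)))\<^sup>2 \<le> 6\<^sup>2"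
        by (intro power_mono) auto
      then show "norm ((norm (bval_uhp (\<lambda>z. mult_op (cayley_approx n) f z - mult_op cayley f z) x))\<^sup>2) \<le> 36 * (norm (bval_uhp f x))\<^sup>2"
        unfolding e by (simp add: norm_mult power_mult_distrib mult_right_mono)
    qed
  qed simp
  then show ?thesis by simp
qed

theorem semigroup_imp_cayley:
  assumes C: "bounded_operator_on H2_uhp inner_uhp C"
    and c: "\<And>t f. t > 0 \<Longrightarrow> f \<in> H2_uhp \<Longrightarrow> C (S_uhp t f) = adjoint_uhp (S_uhp t) (C f)"
    and f: "f \<in> H2_uhp" and w: "w \<in> H2_uhp"
  shows "inner_uhp (C (mult_op cayley f)) w = inner_uhp (C f) (mult_op cayley w)"
proof -
  have S: "S_uhp t g \<in> H2_uhp" if "t \<ge> 0" "g \<in> H2_uhp" for t g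
    unfolding S_uhp_eq by (rule mult_Hinf_in_H2_uhp[OF exp_in_Hinf[OF that(1)] that(2)])
  \<comment> \<open>The node \<open>k = 0\<close> of the Riemann sum requires the parameter 0 as
    well, where \<open>S_uhp\<close> is the identity.\<close>
  have inner_S: "inner_uhp (C (S_uhp t f)) w = inner_uhp (C f) (S_uhp t w)" if "t \<ge> 0" for t
  proof (cases "t = 0")
    case False
    then have t: "t > 0" using that by simp
    have "inner_uhp (S_uhp t w) (C f) = inner_uhp w (C (S_uhp t f))"
      unfolding c[OF t f] unfolding S_uhp_eq
      by (rule adjoint_mult(2)[OF exp_in_Hinf[OF that] op_in[OF C f] w])
    then show ?thesis
      unfolding inner_uhp_commute[of _ w] inner_uhp_commute[of "C f"] by simp
  qed (simp add: S_uhp_def)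
  have mult: "mult_op (cayley_approx n) g = (\<lambda>z. \<Sum>k<(Suc n)\<^sup>2. of_real (cayley_coeff n k) * S_uhp (real k / real (Suc n)) g z)" for n g
    by (simp add: mult_op_def cayley_approx_def S_uhp_def sum_distrib_right mult.assoc del: of_nat_Suc)
  have approx: "inner_uhp (C (mult_op (cayley_approx n) f)) w = inner_uhp (C f) (mult_op (cayley_approx n) w)" for n
  proof -
    have "inner_uhp (C (mult_op (cayley_approx n) f)) w = (\<Sum>k<(Suc n)\<^sup>2. of_real (cayley_coeff n k) * inner_uhp (C (S_uhp (real k / real (Suc n)) f)) w)"
      unfolding mult by (subst op_sum[OF C]) (auto intro!: inner_uhp_sum_left S f w op_in[OF C])
    also have "\<dots> = (\<Sum>k<(Suc n)\<^sup>2. of_real (cayley_coeff n k) * inner_uhp (C f) (S_uhp (real k / real (Suc n)) w))"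
      by (intro sum.cong refl arg_cong2[where f="(*)"] inner_S) simp
    \<comment> \<open>The coefficients are real, so the conjugate linear second argument yields the
      same linear combination.\<close>
    also have "\<dots> = cnj (\<Sum>k<(Suc n)\<^sup>2. of_real (cayley_coeff n k) * inner_uhp (S_uhp (real k / real (Suc n)) w) (C f))"
      unfolding inner_uhp_commute[of "C f"] by simp
    also have "\<dots> = cnj (inner_uhp (mult_op (cayley_approx n) w) (C f))"
      unfolding mult by (subst inner_uhp_sum_left) (auto intro!: S f w op_in[OF C])
    finally show ?thesis unfolding inner_uhp_commute[of "C f"] .
  qed
  have 1: "(\<lambda>n. inner_uhp (C (mult_op (cayley_approx n) f)) w) \<longlonglongrightarrow> inner_uhp (C (mult_op cayley f)) w"
    by (intro op_tendsto[OF C] mult_Hinf_in_H2_uhp cayley_approx_in_Hinf cayley_in_Hinf f w cayley_approx_L2_tendsto)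
  \<comment> \<open>The identity is introduced so that \<open>op_tendsto\<close> also gives
    convergence in the other argument.\<close>
  have id: "bounded_operator_on H2_uhp inner_uhp (\<lambda>f. f)"
    unfolding bounded_operator_on_def by (auto intro!: exI[of _ 1])
  have "(\<lambda>n. inner_uhp (mult_op (cayley_approx n) w) (C f)) \<longlonglongrightarrow> inner_uhp (mult_op cayley w) (C f)"
    by (intro op_tendsto[OF id] mult_Hinf_in_H2_uhp cayley_approx_in_Hinf cayley_in_Hinf f w cayley_approx_L2_tendsto op_in[OF C])
  then have 2: "(\<lambda>n. inner_uhp (C f) (mult_op (cayley_approx n) w)) \<longlonglongrightarrow> inner_uhp (C f) (mult_op cayley w)"
    unfolding inner_uhp_commute[of "C f"] by (rule tendsto_cnj)
  show ?thesis by (rule LIMSEQ_unique[OF 1[unfolded approx] 2])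
qed

section \<open>Transfer to the disc\<close>

definition shift_coeff :: "(nat \<Rightarrow> complex) \<Rightarrow> nat \<Rightarrow> complex" where
  "shift_coeff a n = (case n of 0 \<Rightarrow> 0 | Suc k \<Rightarrow> a k)"

lemma l2_shift_coeff: assumes "l2 a" shows "l2 (shift_coeff a)"
proof -
  have "summable (\<lambda>n. (norm (shift_coeff a (Suc n)))\<^sup>2)" using assms by (simp add: shift_coeff_def l2_def)
  then show ?thesis unfolding l2_def by (subst (asm) summable_Suc_iff)
qed

lemma shift_disc_ps: assumes "l2 a" shows "shift_disc (ps a) = ps (shift_coeff a)"
proof
  fix z show "shift_disc (ps a) z = ps (shift_coeff a) z"
  proof (cases "norm z < 1")
    case True
    have "(\<lambda>n. z * (a n * z ^ n)) sums (z * ps a z)" by (intro sums_mult ps_sums assms True)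
    then have "(\<lambda>n. shift_coeff a (Suc n) * z ^ Suc n) sums (z * ps a z)"
      by (simp add: shift_coeff_def mult_ac)
    then have "(\<lambda>n. shift_coeff a n * z ^ n) sums (z * ps a z + shift_coeff a 0 * z ^ 0)" by (rule sums_Suc)
    then show ?thesis using True by (simp add: ps_def[of "shift_coeff a"] shift_disc_def shift_coeff_def[of a 0] sums_iff)
  qed (simp add: shift_disc_def ps_outside)
qed

lemma shift_disc_in_H2_disc: assumes "f \<in> H2_disc" shows "shift_disc f \<in> H2_disc"
proof -
  obtain a where a: "l2 a" "f = ps a" using H2_disc_cases[OF assms] .
  show ?thesis unfolding a(2) shift_disc_ps[OF a(1)] by (rule ps_in_H2_disc[OF l2_shift_coeff[OF a(1)]])
qed

lemma Gam_shift_disc: "Gam (shift_disc f) = mult_op cayley (Gam f)"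
  by (auto simp: Gam_def shift_disc_def mult_op_def fun_eq_iff)

lemma Gam_in_H2_uhp: assumes "f \<in> H2_disc" shows "Gam f \<in> H2_uhp"
proof -
  obtain a where a: "l2 a" "f = ps a" using H2_disc_cases[OF assms] .
  show ?thesis unfolding a(2) by (rule Gam_ps_in_H2_uhp[OF a(1)])
qed

lemma H2_uhp_Gam_cases: assumes "F \<in> H2_uhp" obtains f where "f \<in> H2_disc" "F = Gam f"
proof -
  obtain a where a: "l2 a" "F = Gam (ps a)" using H2_uhp_cases[OF assms] .
  show ?thesis by (rule that[OF ps_in_H2_disc[OF a(1)] a(2)])
qed

lemma inner_disc_Gam:
  assumes "f \<in> H2_disc" "g \<in> H2_disc" shows "inner_disc f g = inner_uhp (Gam f) (Gam g)"
proof -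
  obtain a where a: "l2 a" "f = ps a" using H2_disc_cases[OF assms(1)] .
  obtain b where b: "l2 b" "g = ps b" using H2_disc_cases[OF assms(2)] .
  show ?thesis unfolding a(2) b(2) using a(1) b(1) by (simp add: inner_disc_ps inner_uhp_Gam_ps)
qed

lemma Gam_inj:
  assumes "f \<in> H2_disc" "g \<in> H2_disc" "Gam f = Gam g" shows "f = g"
proof
  fix w show "f w = g w"
  proof (cases "norm w < 1")
    case True
    then have w: "w \<noteq> 1" and u: "Im (uncayley w) > 0" using uncayley_in_uhp by auto
    have "Gam f (uncayley w) = Gam g (uncayley w)" using assms(3) by simp
    then show ?thesis using u plus_i_neq[of "uncayley w"] by (simp add: Gam_def cayley_uncayley[OF w])
  next
    case False
    then show ?thesis using assms by (auto simp: H2_disc_def)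
  qed
qed

text \<open>Boundary values almost everywhere fix the inner products with all of
  \<open>H2_uhp\<close> and hence the element itself; this resolves the \<open>THE\<close>.\<close>

lemma Gamma2_H2_eq: assumes f: "f \<in> H2_disc" shows "Gamma2_H2 f = Gam f"
proof -
  obtain a where a: "l2 a" "f = ps a" using H2_disc_cases[OF f] .
  have ae: "AE x in lebesgue. bval_uhp (Gam f) x = Gamma2 (bval_disc f) x"
    using bval_uhp_Gam_ps[OF a(1)] AE_cayley_angle[OF bval_disc_ps[OF a(1)]]
    unfolding a(2) by eventually_elim (simp add: line_bdry_def Gamma2_def cis_cayley_angle)
  show ?thesis
    unfolding Gamma2_H2_def
  proof (rule the_equality)
    show "Gam f \<in> H2_uhp \<and> (AE x in lebesgue. bval_uhp (Gam f) x = Gamma2 (bval_disc f) x)"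
      using ae Gam_in_H2_uhp[OF f] by blast
    fix F assume F: "F \<in> H2_uhp \<and> (AE x in lebesgue. bval_uhp F x = Gamma2 (bval_disc f) x)"
    have eq: "AE x in lebesgue. bval_uhp F x = bval_uhp (Gam f) x"
      using ae conjunct2[OF F] by eventually_elim simp
    have "inner_uhp F K = inner_uhp (Gam f) K" if "K \<in> H2_uhp" for K
      unfolding inner_uhp_eq
      by (intro L2_ip_AE square_integrable_bval eq Gam_in_H2_uhp[OF f] that conjunct1[OF F]) simp
    then show "F = Gam f"
      by (intro inner_uhp_ext conjunct1[OF F] Gam_in_H2_uhp[OF f]) (simp add: inner_uhp_commute[of _ F] inner_uhp_commute[of _ "Gam f"])
  qed
qed

text \<open>\<open>inv_into\<close> yields a genuine preimage because \<open>C (Gam f)\<close> lies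
  in \<open>H2_uhp\<close>, which is the image of \<open>H2_disc\<close> under
  \<open>Gam\<close>.\<close>

lemma transfer_disc:
  assumes C: "\<And>f. f \<in> H2_uhp \<Longrightarrow> C f \<in> H2_uhp" and f: "f \<in> H2_disc"
  shows "transfer_disc C f \<in> H2_disc" "Gam (transfer_disc C f) = C (Gam f)"
proof -
  have "C (Gam f) \<in> H2_uhp" by (intro C Gam_in_H2_uhp f)
  then obtain g where g: "g \<in> H2_disc" "C (Gam f) = Gam g" using H2_uhp_Gam_cases by blast
  have "C (Gamma2_H2 f) \<in> Gamma2_H2 ` H2_disc"
    using g by (auto simp: Gamma2_H2_eq f intro!: image_eqI[of _ _ g])
  then have "inv_into H2_disc Gamma2_H2 (C (Gamma2_H2 f)) \<in> H2_disc"
      "Gamma2_H2 (inv_into H2_disc Gamma2_H2 (C (Gamma2_H2 f))) = C (Gamma2_H2 f)"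
    by (rule inv_into_into, rule f_inv_into_f)
  then show "transfer_disc C f \<in> H2_disc" "Gam (transfer_disc C f) = C (Gam f)"
    by (simp_all add: transfer_disc_def Gamma2_H2_eq f)
qed

lemma bounded_operator_transfer_disc:
  assumes C: "bounded_operator_on H2_uhp inner_uhp C"
  shows "bounded_operator_on H2_disc inner_disc (transfer_disc C)"
proof -
  have T: "transfer_disc C f \<in> H2_disc" "Gam (transfer_disc C f) = C (Gam f)" if "f \<in> H2_disc" for f
    using transfer_disc[of C, OF _ that] op_in[OF C] by auto
  have add: "transfer_disc C (\<lambda>z. f z + g z) = (\<lambda>z. transfer_disc C f z + transfer_disc C g z)"
    if "f \<in> H2_disc" "g \<in> H2_disc" for f g
    by (rule Gam_inj)
      (simp_all add: H2_disc_add T that Gam_add op_add[OF C] Gam_in_H2_uhp)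
  have cmult: "transfer_disc C (\<lambda>z. c * f z) = (\<lambda>z. c * transfer_disc C f z)"
    if "f \<in> H2_disc" for f c
    by (rule Gam_inj)
      (simp_all add: H2_disc_cmult T that Gam_cmult op_cmult[OF C] Gam_in_H2_uhp)
  obtain K where K: "\<And>f. f \<in> H2_uhp \<Longrightarrow> sqrt (Re (inner_uhp (C f) (C f))) \<le> K * sqrt (Re (inner_uhp f f))"
    using C unfolding bounded_operator_on_def by blast
  have "sqrt (Re (inner_disc (transfer_disc C f) (transfer_disc C f))) \<le> K * sqrt (Re (inner_disc f f))"
    if "f \<in> H2_disc" for f
    using K[OF Gam_in_H2_uhp[OF that]] by (simp add: inner_disc_Gam T that)
  then show ?thesis
    unfolding bounded_operator_on_def using add cmult T(1) by blast
qed

lemma inner_disc_commute: "inner_disc g f = cnj (inner_disc f g)"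
  unfolding inner_disc_def L2_inner_circle_eq by (rule L2_ip_commute)

lemma inner_disc_ext:
  assumes "f \<in> H2_disc" "g \<in> H2_disc" "\<And>k. k \<in> H2_disc \<Longrightarrow> inner_disc k f = inner_disc k g"
  shows "f = g"
proof (rule Gam_inj[OF assms(1,2)])
  show "Gam f = Gam g"
  proof (rule inner_uhp_ext)
    fix K assume "K \<in> H2_uhp"
    then obtain k where k: "k \<in> H2_disc" "K = Gam k" using H2_uhp_Gam_cases by blast
    then show "inner_uhp K (Gam f) = inner_uhp K (Gam g)"
      using assms(3)[OF k(1)] by (simp add: inner_disc_Gam assms)
  qed (intro Gam_in_H2_uhp assms)+
qed

lemma adjoint_disc_eqI:
  assumes "u \<in> H2_disc" "\<And>w. w \<in> H2_disc \<Longrightarrow> inner_disc (A w) v = inner_disc w u"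
  shows "adjoint_disc A v = u"
  unfolding adjoint_on_def
proof (rule the_equality)
  fix u' assume u': "u' \<in> H2_disc \<and> (\<forall>w\<in>H2_disc. inner_disc (A w) v = inner_disc w u')"
  show "u' = u" by (rule inner_disc_ext) (use u' assms in auto)
qed (use assms in blast)

text \<open>The adjoint is the backward shift of the coefficients.\<close>

lemma adjoint_disc_shift:
  assumes v: "v \<in> H2_disc"
  shows "adjoint_disc shift_disc v \<in> H2_disc"
    "\<And>w. w \<in> H2_disc \<Longrightarrow> inner_disc (shift_disc w) v = inner_disc w (adjoint_disc shift_disc v)"
proof -
  obtain b where b: "l2 b" "v = ps b" using H2_disc_cases[OF v] .
  have b': "l2 (\<lambda>n. b (Suc n))" using b(1) unfolding l2_def by (subst summable_Suc_iff)
  have eq: "inner_disc (shift_disc w) v = inner_disc w (ps (\<lambda>n. b (Suc n)))" if w: "w \<in> H2_disc" for w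
  proof -
    obtain a where a: "l2 a" "w = ps a" using H2_disc_cases[OF w] .
    have "summable (\<lambda>n. shift_coeff a n * cnj (b n))"
      by (rule summable_norm_cancel[OF l2_summable_mult[OF l2_shift_coeff[OF a(1)] b(1)]])
    from suminf_split_head[OF this]
    have "(\<Sum>n. a n * cnj (b (Suc n))) = (\<Sum>n. shift_coeff a n * cnj (b n))"
      by (simp add: shift_coeff_def)
    then show ?thesis
      unfolding a(2) b(2) shift_disc_ps[OF a(1)] inner_disc_ps[OF l2_shift_coeff[OF a(1)] b(1)] inner_disc_ps[OF a(1) b']
      by simp
  qed
  have "adjoint_disc shift_disc v = ps (\<lambda>n. b (Suc n))"
    by (rule adjoint_disc_eqI[OF ps_in_H2_disc[OF b'] eq])
  then show "adjoint_disc shift_disc v \<in> H2_disc"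
    "\<And>w. w \<in> H2_disc \<Longrightarrow> inner_disc (shift_disc w) v = inner_disc w (adjoint_disc shift_disc v)"
    using ps_in_H2_disc[OF b'] eq by simp_all
qed

text \<open>In the weak form the adjoint and the inverse of \<open>Gam\<close> disappear, and the
  shift has become multiplication by the Cayley function.\<close>

lemma is_hankel_disc_transfer_iff:
  assumes C: "bounded_operator_on H2_uhp inner_uhp C"
  shows "is_hankel_disc (transfer_disc C) \<longleftrightarrow>
    (\<forall>f\<in>H2_uhp. \<forall>w\<in>H2_uhp. inner_uhp (C (mult_op cayley f)) w = inner_uhp (C f) (mult_op cayley w))"
proof -
  have T: "transfer_disc C f \<in> H2_disc" "Gam (transfer_disc C f) = C (Gam f)" if "f \<in> H2_disc" for f
    using transfer_disc[of C, OF _ that] op_in[OF C] by auto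
  let ?D = "transfer_disc C"
  have tr: "inner_disc (?D (shift_disc f)) w = inner_uhp (C (mult_op cayley (Gam f))) (Gam w)"
    "inner_disc (?D f) (shift_disc w) = inner_uhp (C (Gam f)) (mult_op cayley (Gam w))"
    if "f \<in> H2_disc" "w \<in> H2_disc" for f w
    using that by (simp_all add: inner_disc_Gam T shift_disc_in_H2_disc Gam_shift_disc)
  have "is_hankel_disc ?D \<longleftrightarrow> (\<forall>f\<in>H2_disc. \<forall>w\<in>H2_disc. inner_disc (?D (shift_disc f)) w = inner_disc (?D f) (shift_disc w))"
  proof
    assume h: "is_hankel_disc ?D"
    show "\<forall>f\<in>H2_disc. \<forall>w\<in>H2_disc. inner_disc (?D (shift_disc f)) w = inner_disc (?D f) (shift_disc w)"
    proof (intro ballI)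
      fix f w assume f: "f \<in> H2_disc" and w: "w \<in> H2_disc"
      have "inner_disc (shift_disc w) (?D f) = inner_disc w (?D (shift_disc f))"
        using h adjoint_disc_shift(2)[OF T(1)[OF f] w] f by (simp add: is_hankel_disc_def)
      then show "inner_disc (?D (shift_disc f)) w = inner_disc (?D f) (shift_disc w)"
        unfolding inner_disc_commute[of "?D (shift_disc f)" w] inner_disc_commute[of "?D f" "shift_disc w"] by simp
    qed
  next
    assume h: "\<forall>f\<in>H2_disc. \<forall>w\<in>H2_disc. inner_disc (?D (shift_disc f)) w = inner_disc (?D f) (shift_disc w)"
    have "?D (shift_disc f) = adjoint_disc shift_disc (?D f)" if f: "f \<in> H2_disc" for f
    proof (rule adjoint_disc_eqI[symmetric])
      show "?D (shift_disc f) \<in> H2_disc" by (intro T shift_disc_in_H2_disc f)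
      fix w assume w: "w \<in> H2_disc"
      have "inner_disc (?D (shift_disc f)) w = inner_disc (?D f) (shift_disc w)" using h f w by blast
      then show "inner_disc (shift_disc w) (?D f) = inner_disc w (?D (shift_disc f))"
        unfolding inner_disc_commute[of "?D (shift_disc f)" w] inner_disc_commute[of "?D f" "shift_disc w"] by simp
    qed
    then show "is_hankel_disc ?D"
      unfolding is_hankel_disc_def using bounded_operator_transfer_disc[OF C] by blast
  qed
  also have "\<dots> \<longleftrightarrow> (\<forall>f\<in>H2_uhp. \<forall>w\<in>H2_uhp. inner_uhp (C (mult_op cayley f)) w = inner_uhp (C f) (mult_op cayley w))"
  proof
    assume h: "\<forall>f\<in>H2_disc. \<forall>w\<in>H2_disc. inner_disc (?D (shift_disc f)) w = inner_disc (?D f) (shift_disc w)"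
    show "\<forall>f\<in>H2_uhp. \<forall>w\<in>H2_uhp. inner_uhp (C (mult_op cayley f)) w = inner_uhp (C f) (mult_op cayley w)"
    proof (intro ballI)
      fix F W assume "F \<in> H2_uhp" "W \<in> H2_uhp"
      then obtain f w where "f \<in> H2_disc" "F = Gam f" "w \<in> H2_disc" "W = Gam w" using H2_uhp_Gam_cases by metis
      then show "inner_uhp (C (mult_op cayley F)) W = inner_uhp (C F) (mult_op cayley W)"
        using h tr by simp
    qed
  next
    assume h: "\<forall>f\<in>H2_uhp. \<forall>w\<in>H2_uhp. inner_uhp (C (mult_op cayley f)) w = inner_uhp (C f) (mult_op cayley w)"
    then show "\<forall>f\<in>H2_disc. \<forall>w\<in>H2_disc. inner_disc (?D (shift_disc f)) w = inner_disc (?D f) (shift_disc w)"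
      using tr Gam_in_H2_uhp by simp
  qed
  finally show ?thesis .
qed

section \<open>Nehari's theorem\<close>

lemma inner_disc_unit_seq:
  fixes a :: "nat \<Rightarrow> complex"
  assumes "l2 a" shows "inner_disc (ps a) (ps (unit_seq n)) = 2 * pi * a n"
proof -
  have "(\<Sum>k. a k * cnj (unit_seq n k)) = (\<Sum>k\<in>{n}. a k * cnj (unit_seq n k))"
    by (rule suminf_finite) (auto simp: unit_seq_def)
  then show ?thesis using inner_disc_ps[OF assms l2_unit_seq, of n] by (simp add: unit_seq_def)
qed

lemma ps_inj: assumes "l2 a" "l2 b" "ps a = ps b" shows "a = b"
proof
  fix n
  have "complex_of_real (2 * pi) * a n = of_real (2 * pi) * b n"
    using inner_disc_unit_seq[OF assms(1), of n] inner_disc_unit_seq[OF assms(2), of n] assms(3) by simp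
  then show "a n = b n" by simp
qed

lemma l2_abs_summable: assumes "summable (\<lambda>n. norm (a n))" shows "l2 a"
proof -
  have "bounded (range (\<lambda>n. norm (a n)))"
    using summable_LIMSEQ_zero[OF assms] convergent_imp_bounded by blast
  then obtain C where C: "\<And>n. norm (a n) \<le> C" by (auto simp: bounded_iff)
  show ?thesis
    unfolding l2_def power2_eq_square
    by (rule summable_comparison_test'[OF summable_mult[OF assms, of C]])
      (use C in \<open>auto intro!: mult_right_mono\<close>)
qed

text \<open>Dividing out the Blaschke product of the zeros in the disc replaces \<open>z - x\<close> by \<open>1 - cnj x * z\<close>.\<close>
lemma poly_remove_disc_zeros:
  fixes p :: "complex poly"
  assumes "p \<noteq> 0"
  obtains p1 where "\<And>z. norm z = 1 \<Longrightarrow> norm (poly p1 z) = norm (poly p z)"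
    "\<And>z. norm z < 1 \<Longrightarrow> norm (poly p z) \<le> norm (poly p1 z)" "\<And>z. norm z < 1 \<Longrightarrow> poly p1 z \<noteq> 0"
proof -
  have "\<exists>p1. (\<forall>z. norm z = 1 \<longrightarrow> norm (poly p1 z) = norm (poly p z)) \<and>
     (\<forall>z. norm z < 1 \<longrightarrow> norm (poly p z) \<le> norm (poly p1 z)) \<and> (\<forall>z. norm z < 1 \<longrightarrow> poly p1 z \<noteq> 0)"
    using assms
  proof (induction "degree p" arbitrary: p rule: less_induct)
    case less
    show ?case
    proof (cases "\<exists>x. norm x < 1 \<and> poly p x = 0")
      case False
      then show ?thesis by (intro exI[of _ p]) auto
    next
      case True
      then obtain x where x: "norm x < 1" "poly p x = 0" by blast
      then obtain q where q: "p = [:- x, 1:] * q" by (auto simp: poly_eq_0_iff_dvd)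
      then have "q \<noteq> 0" using less.prems by auto
      then have "degree q < degree p" unfolding q by (subst degree_mult_eq) auto
      from less.hyps[OF this \<open>q \<noteq> 0\<close>] obtain q1 where q1:
        "\<And>z. norm z = 1 \<Longrightarrow> norm (poly q1 z) = norm (poly q z)"
        "\<And>z. norm z < 1 \<Longrightarrow> norm (poly q z) \<le> norm (poly q1 z)" "\<And>z. norm z < 1 \<Longrightarrow> poly q1 z \<noteq> 0" by blast
      have le: "norm (z - x) \<le> norm (1 - cnj x * z)" if z: "norm z < 1" for z
      proof (rule power2_le_imp_le)
        have "(norm (1 - cnj x * z))\<^sup>2 - (norm (z - x))\<^sup>2 = (1 - (norm x)\<^sup>2) * (1 - (norm z)\<^sup>2)"
          unfolding cmod_power2 by (simp add: power2_eq_square) (simp add: algebra_simps)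
        moreover have "0 \<le> (1 - (norm x)\<^sup>2) * (1 - (norm z)\<^sup>2)"
          using x z by (intro mult_nonneg_nonneg) (auto simp: power_le_one)
        ultimately show "(norm (z - x))\<^sup>2 \<le> (norm (1 - cnj x * z))\<^sup>2" by linarith
      qed simp
      have nz: "1 - cnj x * z \<noteq> 0" if "norm z < 1" for z
      proof
        assume "1 - cnj x * z = 0"
        then have "norm x * norm z = 1" by (metis complex_mod_cnj eq_iff_diff_eq_0 norm_mult norm_one)
        moreover have "norm x * norm z \<le> norm x" using that by (simp add: mult_left_le)
        ultimately show False using x by linarith
      qed
      have ev: "poly ([:1, - cnj x:] * q1) z = (1 - cnj x * z) * poly q1 z" "poly p z = (z - x) * poly q z" for z
        unfolding q by (simp_all add: algebra_simps)
      show ?thesis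
        by (intro exI[of _ "[:1, - cnj x:] * q1"])
          (auto simp only: ev norm_mult one_minus_cnj_mult q1(1) nz q1(3) no_zero_divisors mult_eq_0_iff intro!: mult_mono le q1(2) norm_ge_zero)
    qed
  qed
  then show ?thesis using that by blast
qed

text \<open>The bound for the matrix concerns square sections, while products of power series give
  triangular ones. The difference lives on the indices with \<open>i + j \<ge> M\<close> inside the
  square, and the corresponding sum of norms vanishes by the theorem on Cauchy products.\<close>

lemma triangle_square_tendsto:
  fixes a b g :: "nat \<Rightarrow> complex"
  assumes a: "summable (\<lambda>n. norm (a n))" and b: "summable (\<lambda>n. norm (b n))" and g: "\<And>n. norm (g n) \<le> G"
  shows "(\<lambda>M. (\<Sum>i<M. \<Sum>j<M. g (i + j) * a i * b j) - (\<Sum>k<M. g k * (\<Sum>i\<le>k. a i * b (k - i)))) \<longlonglongrightarrow> 0"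
proof (rule Lim_null_comparison)
  let ?sq = "\<lambda>M. {..<M} \<times> {..<M::nat}" and ?tr = "\<lambda>M. {(i, j). i + j < (M::nat)}"
  have sub: "?tr M \<subseteq> ?sq M" and fin: "finite (?sq M)" for M by auto
  have s: "(\<Sum>i<M. \<Sum>j<M. f i j) = (\<Sum>(i, j)\<in>?sq M. f i j)" for f :: "nat \<Rightarrow> nat \<Rightarrow> 'x::comm_monoid_add" and M
    by (rule sum.cartesian_product)
  have t: "(\<Sum>k<M. \<Sum>i\<le>k. f i (k - i)) = (\<Sum>(i, j)\<in>?tr M. f i j)" for f :: "nat \<Rightarrow> nat \<Rightarrow> 'x::comm_monoid_add" and M
    by (rule sum.triangle_reindex[symmetric])
  have "norm ((\<Sum>i<M. \<Sum>j<M. g (i + j) * a i * b j) - (\<Sum>k<M. g k * (\<Sum>i\<le>k. a i * b (k - i))))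
     \<le> G * ((\<Sum>i<M. norm (a i)) * (\<Sum>j<M. norm (b j)) - (\<Sum>k<M. \<Sum>i\<le>k. norm (a i) * norm (b (k - i))))" for M
  proof -
    have "(\<Sum>k<M. g k * (\<Sum>i\<le>k. a i * b (k - i))) = (\<Sum>k<M. \<Sum>i\<le>k. g (i + (k - i)) * a i * b (k - i))"
      by (intro sum.cong refl) (simp add: sum_distrib_left mult.assoc)
    also have "\<dots> = (\<Sum>(i, j)\<in>?tr M. g (i + j) * a i * b j)" by (rule t)
    finally have "(\<Sum>i<M. \<Sum>j<M. g (i + j) * a i * b j) - (\<Sum>k<M. g k * (\<Sum>i\<le>k. a i * b (k - i)))
       = (\<Sum>(i, j)\<in>?sq M - ?tr M. g (i + j) * a i * b j)"
      unfolding s by (simp add: sum_diff[OF fin sub])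
    also have "norm \<dots> \<le> (\<Sum>(i, j)\<in>?sq M - ?tr M. G * (norm (a i) * norm (b j)))"
      by (rule sum_norm_le) (auto simp: norm_mult mult.assoc intro!: mult_right_mono g)
    also have "\<dots> = G * ((\<Sum>(i, j)\<in>?sq M. norm (a i) * norm (b j)) - (\<Sum>(i, j)\<in>?tr M. norm (a i) * norm (b j)))"
      unfolding sum_diff[OF fin sub, symmetric] by (simp add: sum_distrib_left case_prod_unfold)
    also have "\<dots> = G * ((\<Sum>i<M. norm (a i)) * (\<Sum>j<M. norm (b j)) - (\<Sum>k<M. \<Sum>i\<le>k. norm (a i) * norm (b (k - i))))"
      unfolding s[symmetric] t[symmetric] sum_product ..
    finally show ?thesis .
  qed
  then show "\<forall>\<^sub>F M in sequentially. norm ((\<Sum>i<M. \<Sum>j<M. g (i + j) * a i * b j) - (\<Sum>k<M. g k * (\<Sum>i\<le>k. a i * b (k - i))))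
     \<le> G * ((\<Sum>i<M. norm (a i)) * (\<Sum>j<M. norm (b j)) - (\<Sum>k<M. \<Sum>i\<le>k. norm (a i) * norm (b (k - i))))"
    by simp
  have "(\<lambda>M. \<Sum>k<M. \<Sum>i\<le>k. norm (a i) * norm (b (k - i))) \<longlonglongrightarrow> (\<Sum>i. norm (a i)) * (\<Sum>j. norm (b j))"
    using Cauchy_product_sums[of "\<lambda>n. norm (a n)" "\<lambda>n. norm (b n)"] a b by (simp add: sums_def)
  then have "(\<lambda>M. G * ((\<Sum>i<M. norm (a i)) * (\<Sum>j<M. norm (b j)) - (\<Sum>k<M. \<Sum>i\<le>k. norm (a i) * norm (b (k - i)))))
     \<longlonglongrightarrow> G * ((\<Sum>i. norm (a i)) * (\<Sum>j. norm (b j)) - (\<Sum>i. norm (a i)) * (\<Sum>j. norm (b j)))"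
    by (intro tendsto_intros summable_LIMSEQ a b)
  then show "(\<lambda>M. G * ((\<Sum>i<M. norm (a i)) * (\<Sum>j<M. norm (b j)) - (\<Sum>k<M. \<Sum>i\<le>k. norm (a i) * norm (b (k - i))))) \<longlonglongrightarrow> 0"
    by simp
qed

text \<open>The form is bilinear, without a conjugate on \<open>b\<close>, so that inserting the
  coefficients of two functions produces those of their product.\<close>

locale bounded_hankel_matrix =
  fixes \<gamma> :: "nat \<Rightarrow> complex" and K :: real
  assumes hankel_bound: "norm (\<Sum>i<M. \<Sum>j<M. \<gamma> (i + j) * a i * b j)
     \<le> K * sqrt (\<Sum>i<M. (norm (a i))\<^sup>2) * sqrt (\<Sum>j<M. (norm (b j))\<^sup>2)"
begin

lemma entry_bound: "norm (\<gamma> n) \<le> K"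
proof -
  have "(\<Sum>i<Suc n. \<Sum>j<Suc n. \<gamma> (i + j) * unit_seq n i * unit_seq 0 j) = (\<Sum>i<Suc n. \<gamma> i * unit_seq n i)"
    by (intro sum.cong refl) (simp add: unit_seq_def sum.delta if_distrib[of "\<lambda>x. _ * x"] cong: if_cong)
  also have "\<dots> = \<gamma> n" by (simp add: unit_seq_def if_distrib[of "\<lambda>x. _ * x"] cong: if_cong)
  finally have 1: "(\<Sum>i<Suc n. \<Sum>j<Suc n. \<gamma> (i + j) * unit_seq n i * unit_seq 0 j) = \<gamma> n" .
  have 2: "(\<Sum>i<Suc n. (norm (unit_seq m i))\<^sup>2) = 1" if "m \<le> n" for m
  proof -
    have "(\<Sum>i<Suc n. (norm (unit_seq m i))\<^sup>2) = (\<Sum>i<Suc n. if i = m then 1 else 0)"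
      by (intro sum.cong refl) (simp add: unit_seq_def)
    then show ?thesis using that by (simp del: sum.lessThan_Suc)
  qed
  show ?thesis using hankel_bound[where M="Suc n" and a="unit_seq n" and b="unit_seq 0"] unfolding 1 2[OF order_refl] 2[OF le0] by simp
qed

lemma K_nonneg: "0 \<le> K"
  using order_trans[OF norm_ge_zero entry_bound[of 0]] .

text \<open>In the disc \<open>p = q * s\<close>, where \<open>s^2\<close> is the zero-free
  polynomial \<open>p1\<close> and \<open>norm q \<le> norm s\<close>. The squared circle means of
  both factors are at most the L1 norm of \<open>p\<close>, so the matrix bound for their
  coefficients is the claim. Dilation by \<open>r\<close> makes the coefficients absolutely
  summable; at the end \<open>r\<close> tends to 1.\<close>

lemma poly_bound:
  fixes p :: "complex poly"
  assumes p: "p \<noteq> 0"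
  shows "norm (\<Sum>k\<le>degree p. \<gamma> k * coeff p k) \<le> K / (2 * pi) * (LINT t|circle_measure. norm (poly p (cis t)))"
proof -
  define I where "I = (LINT t|circle_measure. norm (poly p (cis t)))"
  obtain p1 where p1: "\<And>z. norm z = 1 \<Longrightarrow> norm (poly p1 z) = norm (poly p z)"
    "\<And>z. norm z < 1 \<Longrightarrow> norm (poly p z) \<le> norm (poly p1 z)" "\<And>z. norm z < 1 \<Longrightarrow> poly p1 z \<noteq> 0"
    using poly_remove_disc_zeros[OF p] by metis
  have "simply_connected unit_disc" by (intro convex_imp_simply_connected) simp
  moreover have "poly p1 holomorphic_on unit_disc" by (intro holomorphic_intros)
  \<comment> \<open>A holomorphic square root exists because the disc is simply connected and
    \<open>p1\<close> has no zeros there.\<close>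
  ultimately obtain s where s: "s holomorphic_on unit_disc" "\<And>z. norm z < 1 \<Longrightarrow> poly p1 z = (s z)\<^sup>2"
    using p1(3) unfolding simply_connected_eq_holomorphic_sqrt[OF open_ball] by fastforce
  have s0: "s z \<noteq> 0" if "norm z < 1" for z using p1(3)[OF that] s(2)[OF that] by auto
  define q where "q z = poly p z / s z" for z
  have q: "q holomorphic_on unit_disc"
    unfolding q_def by (intro holomorphic_intros s) (use s0 in auto)
  have m: "norm (of_real r * cis t) < 1" if "0 \<le> r" "r < 1" for r t
    using that by (simp add: norm_mult)
  \<comment> \<open>The circle means of \<open>s\<close> increase to the integral of
    \<open>norm p1\<close> over the circle, where \<open>p1\<close> has the same modulus as
    \<open>p\<close>.\<close>
  have sI: "L2_sq circle_measure (\<lambda>t. s (of_real r * cis t)) \<le> I" if r: "0 < r" "r < 1" for r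
  proof -
    define R where "R n = 1 - inverse (real (Suc (Suc n)))" for n
    have R: "0 < R n" "R n < 1" for n by (auto simp: R_def field_simps)
    have "(\<lambda>n. 1 - inverse (real (Suc (Suc n)))) \<longlonglongrightarrow> 1 - 0"
      by (intro tendsto_diff tendsto_const LIMSEQ_Suc[OF LIMSEQ_inverse_real_of_nat])
    then have Rlim: "R \<longlonglongrightarrow> 1" by (simp add: R_def[abs_def])
    have "bounded (poly p1 ` cball 0 1)"
      by (intro compact_imp_bounded compact_continuous_image continuous_intros) auto
    then obtain B where B: "\<And>z. norm z \<le> 1 \<Longrightarrow> norm (poly p1 z) \<le> B"
      unfolding bounded_iff by (metis image_eqI mem_cball_0)
    have meas: "(\<lambda>t. norm (poly p1 (of_real c * cis t))) \<in> borel_measurable circle_measure" for c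
      by (intro continuous_imp_measurable_on_sets_lebesgue continuous_intros) auto
    have "(\<lambda>n. LINT t|circle_measure. norm (poly p1 (of_real (R n) * cis t))) \<longlonglongrightarrow> (LINT t|circle_measure. norm (poly p1 (of_real 1 * cis t)))"
    proof (rule integral_dominated_convergence[where w="\<lambda>_. B"])
      show "integrable circle_measure (\<lambda>_. B)"
        using finite_measure.integrable_const[OF finite_measure_circle] by blast
      show "AE t in circle_measure. (\<lambda>n. norm (poly p1 (of_real (R n) * cis t))) \<longlonglongrightarrow> norm (poly p1 (of_real 1 * cis t))"
        by (intro AE_I2 tendsto_intros Rlim)
      show "AE t in circle_measure. norm (norm (poly p1 (of_real (R n) * cis t))) \<le> B" for n
        using B[OF less_imp_le[OF m[OF less_imp_le[OF R(1)] R(2)]]] by simp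
    qed (rule meas)+
    moreover have "(LINT t|circle_measure. norm (poly p1 (of_real 1 * cis t))) = I"
      by (simp add: I_def p1(1))
    moreover have "(LINT t|circle_measure. norm (poly p1 (of_real (R n) * cis t))) = L2_sq circle_measure (\<lambda>t. s (of_real (R n) * cis t))" for n
      unfolding L2_sq_def using s(2)[OF m[OF less_imp_le[OF R(1)] R(2)]] by (simp add: norm_power)
    ultimately have lim: "(\<lambda>n. L2_sq circle_measure (\<lambda>t. s (of_real (R n) * cis t))) \<longlonglongrightarrow> I" by simp
    have "\<forall>\<^sub>F n in sequentially. R n > r" using Rlim r by (simp add: order_tendsto_iff)
    then have "\<forall>\<^sub>F n in sequentially. L2_sq circle_measure (\<lambda>t. s (of_real r * cis t)) \<le> L2_sq circle_measure (\<lambda>t. s (of_real (R n) * cis t))"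
      by eventually_elim (use r R in \<open>auto intro!: L2_sq_circle_mono s\<close>)
    then show ?thesis by (intro tendsto_lowerbound[OF lim]) auto
  qed
  \<comment> \<open>Inside the disc \<open>norm p\<close> is at most
    \<open>norm p1 = (norm s)^2\<close>, hence \<open>norm q \<le> norm s\<close>.\<close>
  have qI: "L2_sq circle_measure (\<lambda>t. q (of_real r * cis t)) \<le> I" if r: "0 < r" "r < 1" for r
  proof -
    have "L2_sq circle_measure (\<lambda>t. q (of_real r * cis t)) \<le> L2_sq circle_measure (\<lambda>t. s (of_real r * cis t))"
      unfolding L2_sq_def
    proof (rule integral_mono)
      show "integrable circle_measure (\<lambda>t. (norm (q (of_real r * cis t)))\<^sup>2)" "integrable circle_measure (\<lambda>t. (norm (s (of_real r * cis t)))\<^sup>2)"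
        using L2_sq_holomorphic_circle(1)[OF holomorphic_disc_series[OF q], of r] L2_sq_holomorphic_circle(1)[OF holomorphic_disc_series[OF s(1)], of r] r
        by (simp_all add: square_integrable_def)
      fix t
      define z where "z = of_real r * cis t"
      have z: "norm z < 1" unfolding z_def using m r by simp
      have "norm (poly p z) \<le> norm (s z) * norm (s z)" using p1(2)[OF z] s(2)[OF z] by (simp add: norm_mult[symmetric] power2_eq_square)
      then have "norm (q z) \<le> norm (s z)" using s0[OF z] by (simp add: q_def norm_divide divide_simps)
      then show "(norm (q (of_real r * cis t)))\<^sup>2 \<le> (norm (s (of_real r * cis t)))\<^sup>2"
        unfolding z_def by (intro power_mono) auto
    qed
    then show ?thesis using sI[OF r] by simp
  qed
  obtain a where a: "l2 a" "\<And>z. norm z < 1 \<Longrightarrow> q z = ps a z" "2 * pi * (\<Sum>n. (norm (a n))\<^sup>2) \<le> I"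
    using H2_discI_bound[OF q qI] by metis
  obtain b where b: "l2 b" "\<And>z. norm z < 1 \<Longrightarrow> s z = ps b z" "2 * pi * (\<Sum>n. (norm (b n))\<^sup>2) \<le> I"
    using H2_discI_bound[OF s(1) sI] by metis
  have dil: "norm (\<Sum>k\<le>degree p. \<gamma> k * (coeff p k * of_real r ^ k)) \<le> K * I / (2 * pi)" if r: "0 < r" "r < 1" for r
  proof -
    define \<alpha> where "\<alpha> n = a n * of_real r ^ n" for n
    define \<beta> where "\<beta> n = b n * of_real r ^ n" for n
    have sa: "summable (\<lambda>n. norm (\<alpha> n))" unfolding \<alpha>_def by (rule l2_summable_power[OF a(1)]) (use r in simp)
    have sb: "summable (\<lambda>n. norm (\<beta> n))" unfolding \<beta>_def by (rule l2_summable_power[OF b(1)]) (use r in simp)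
    define c where "c k = (\<Sum>i\<le>k. \<alpha> i * \<beta> (k - i))" for k
    define d where "d k = coeff p k * of_real r ^ k" for k
    have sc: "summable (\<lambda>k. norm (c k))"
    proof (rule summable_comparison_test')
      show "summable (\<lambda>k. \<Sum>i\<le>k. norm (\<alpha> i) * norm (\<beta> (k - i)))"
        using Cauchy_product_sums[of "\<lambda>n. norm (\<alpha> n)" "\<lambda>n. norm (\<beta> n)"] sa sb by (simp add: sums_iff)
      show "norm (norm (c k)) \<le> (\<Sum>i\<le>k. norm (\<alpha> i) * norm (\<beta> (k - i)))" for k
        unfolding c_def norm_mult[symmetric] by (simp add: norm_sum)
    qed
    have d: "l2 d"
    proof (rule l2_finite)
      show "finite {n. d n \<noteq> 0}"
        by (rule finite_subset[of _ "{..degree p}"]) (auto simp: d_def intro: le_degree)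
    qed
    \<comment> \<open>Both sides equal \<open>p\<close> at \<open>r * z\<close>, one as the product
      of the two factors, so the Cauchy product has the coefficients of the dilated
      polynomial.\<close>
    have "ps c = ps d"
    proof
      fix z show "ps c z = ps d z"
      proof (cases "norm z < 1")
        case True
        define w where "w = of_real r * z"
        have w: "norm w < 1" using r True mult_strict_mono[of r 1 "norm z" 1] by (simp add: w_def norm_mult)
        have sz: "summable (\<lambda>n. norm (\<alpha> n * z ^ n))" "summable (\<lambda>n. norm (\<beta> n * z ^ n))"
          using l2_summable_power[OF a(1) w] l2_summable_power[OF b(1) w]
          by (simp_all add: \<alpha>_def \<beta>_def w_def power_mult_distrib mult.assoc)
        have "(\<Sum>n. \<alpha> n * z ^ n) * (\<Sum>n. \<beta> n * z ^ n) = (\<Sum>k. \<Sum>i\<le>k. (\<alpha> i * z ^ i) * (\<beta> (k - i) * z ^ (k - i)))"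
          by (rule Cauchy_product[OF sz])
        also have "(\<lambda>k. \<Sum>i\<le>k. (\<alpha> i * z ^ i) * (\<beta> (k - i) * z ^ (k - i))) = (\<lambda>k. c k * z ^ k)"
        proof
          fix k
          have "(\<alpha> i * z ^ i) * (\<beta> (k - i) * z ^ (k - i)) = \<alpha> i * \<beta> (k - i) * z ^ k" if "i \<le> k" for i
            using that power_add[of z i "k - i"] by (simp add: mult_ac)
          then show "(\<Sum>i\<le>k. (\<alpha> i * z ^ i) * (\<beta> (k - i) * z ^ (k - i))) = c k * z ^ k"
            unfolding c_def sum_distrib_right by (intro sum.cong refl) simp
        qed
        also have "(\<Sum>k. c k * z ^ k) = ps c z" using True by (simp add: ps_def)
        also have "(\<Sum>n. \<alpha> n * z ^ n) = q w" using w a(2)[OF w] by (simp add: ps_def \<alpha>_def w_def power_mult_distrib mult.assoc)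
        also have "(\<Sum>n. \<beta> n * z ^ n) = s w" using w b(2)[OF w] by (simp add: ps_def \<beta>_def w_def power_mult_distrib mult.assoc)
        also have "q w * s w = poly p w" using s0[OF w] by (simp add: q_def)
        also have "poly p w = (\<Sum>k\<le>degree p. d k * z ^ k)"
          by (simp add: poly_altdef d_def w_def power_mult_distrib mult.assoc)
        also have "\<dots> = ps d z"
          using True by (simp add: ps_def, intro suminf_finite[symmetric]) (auto simp: d_def coeff_eq_0)
        finally show ?thesis by simp
      qed (simp add: ps_outside)
    qed
    then have cd: "c = d" by (rule ps_inj[OF l2_abs_summable[OF sc] d])
    have bound: "norm (\<Sum>i<M. \<Sum>j<M. \<gamma> (i + j) * \<alpha> i * \<beta> j) \<le> K * I / (2 * pi)" for M
    proof -
      have le: "sqrt (\<Sum>i<M. (norm (x i * of_real r ^ i))\<^sup>2) \<le> sqrt (I / (2 * pi))"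
        if x: "l2 x" "2 * pi * (\<Sum>n. (norm (x n))\<^sup>2) \<le> I" for x
      proof (rule real_sqrt_le_mono)
        have "(\<Sum>i<M. (norm (x i * of_real r ^ i))\<^sup>2) \<le> (\<Sum>i<M. (norm (x i))\<^sup>2)"
          using r by (intro sum_mono) (simp add: norm_mult norm_power power_mult_distrib mult_left_le power_le_one)
        also have "\<dots> \<le> (\<Sum>n. (norm (x n))\<^sup>2)"
          by (rule sum_le_suminf) (use x in \<open>auto simp: l2_def\<close>)
        also have "\<dots> \<le> I / (2 * pi)" using x(2) by (simp add: field_simps)
        finally show "(\<Sum>i<M. (norm (x i * of_real r ^ i))\<^sup>2) \<le> I / (2 * pi)" .
      qed
      have I0: "0 \<le> I" unfolding I_def by simp
      have "norm (\<Sum>i<M. \<Sum>j<M. \<gamma> (i + j) * \<alpha> i * \<beta> j) \<le> K * sqrt (\<Sum>i<M. (norm (\<alpha> i))\<^sup>2) * sqrt (\<Sum>j<M. (norm (\<beta> j))\<^sup>2)"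
        by (rule hankel_bound)
      also have "\<dots> \<le> K * sqrt (I / (2 * pi)) * sqrt (I / (2 * pi))"
        unfolding \<alpha>_def \<beta>_def using K_nonneg I0
        by (intro mult_mono mult_left_mono le a b mult_nonneg_nonneg) (auto intro: sum_nonneg)
      also have "\<dots> = K * (I / (2 * pi))"
        using I0 by (simp add: mult.assoc)
      finally show ?thesis by simp
    qed
    have lim1: "(\<lambda>M. (\<Sum>i<M. \<Sum>j<M. \<gamma> (i + j) * \<alpha> i * \<beta> j) - (\<Sum>k<M. \<gamma> k * (\<Sum>i\<le>k. \<alpha> i * \<beta> (k - i)))) \<longlonglongrightarrow> 0"
      by (rule triangle_square_tendsto[OF sa sb entry_bound])
    have "(\<Sum>k<M. \<gamma> k * (\<Sum>i\<le>k. \<alpha> i * \<beta> (k - i))) = (\<Sum>k\<le>degree p. \<gamma> k * d k)" if "M > degree p" for M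
    proof -
      have "(\<Sum>k<M. \<gamma> k * (\<Sum>i\<le>k. \<alpha> i * \<beta> (k - i))) = (\<Sum>k<M. \<gamma> k * d k)"
        unfolding cd[symmetric] c_def ..
      also have "\<dots> = (\<Sum>k\<le>degree p. \<gamma> k * d k)"
        by (rule sum.mono_neutral_right) (use that in \<open>auto simp: d_def coeff_eq_0\<close>)
      finally show ?thesis .
    qed
    then have lim2: "(\<lambda>M. \<Sum>k<M. \<gamma> k * (\<Sum>i\<le>k. \<alpha> i * \<beta> (k - i))) \<longlonglongrightarrow> (\<Sum>k\<le>degree p. \<gamma> k * d k)"
      by (intro tendsto_eventually eventually_sequentiallyI[of "Suc (degree p)"]) auto
    have lim3: "(\<lambda>M. \<Sum>i<M. \<Sum>j<M. \<gamma> (i + j) * \<alpha> i * \<beta> j) \<longlonglongrightarrow> (\<Sum>k\<le>degree p. \<gamma> k * d k)"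
      using tendsto_add[OF lim1 lim2] by simp
    have "norm (\<Sum>k\<le>degree p. \<gamma> k * d k) \<le> K * I / (2 * pi)"
    proof (rule tendsto_upperbound[OF tendsto_norm[OF lim3]])
      show "\<forall>\<^sub>F M in sequentially. norm (\<Sum>i<M. \<Sum>j<M. \<gamma> (i + j) * \<alpha> i * \<beta> j) \<le> K * I / (2 * pi)"
        by (rule always_eventually) (rule allI, rule bound)
    qed simp
    then show ?thesis by (simp add: d_def)
  qed
  have "((\<lambda>r. norm (\<Sum>k\<le>degree p. \<gamma> k * (coeff p k * of_real r ^ k))) \<longlongrightarrow> norm (\<Sum>k\<le>degree p. \<gamma> k * (coeff p k * of_real 1 ^ k))) (at_left 1)"
    by (intro tendsto_intros)
  moreover have "\<forall>\<^sub>F r in at_left 1. norm (\<Sum>k\<le>degree p. \<gamma> k * (coeff p k * of_real r ^ k)) \<le> K * I / (2 * pi)"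
    by (rule eventually_mono[OF eventually_at_left_real[of 0 "1::real"]]) (use dil in auto)
  ultimately have "norm (\<Sum>k\<le>degree p. \<gamma> k * (coeff p k * of_real 1 ^ k)) \<le> K * I / (2 * pi)"
    by (intro tendsto_upperbound) auto
  then show ?thesis by (simp add: I_def)
qed

end

section \<open>Extremal trigonometric polynomials\<close>

lemma Bessel_circle:
  assumes u: "square_integrable circle_measure u"
  shows "2 * pi * (\<Sum>n<M. (norm (L2_ip circle_measure u (\<lambda>t. cis (real n * t)) / (2 * pi)))\<^sup>2) \<le> L2_sq circle_measure u"
proof -
  define a where "a n = L2_ip circle_measure u (\<lambda>t. cis (real n * t)) / (2 * pi)" for n
  have "L2_ip circle_measure (trig a M) u = (\<Sum>n<M. a n * L2_ip circle_measure (\<lambda>t. cis (real n * t)) u)"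
  proof -
    have "trig a M t * cnj (u t) = (\<Sum>n<M. a n * (cis (real n * t) * cnj (u t)))" for t
      by (simp add: trig_def sum_distrib_right mult.assoc)
    then have "L2_ip circle_measure (trig a M) u = (LINT t|circle_measure. (\<Sum>n<M. a n * (cis (real n * t) * cnj (u t))))"
      by (simp add: L2_ip_def)
    also have "\<dots> = (\<Sum>n<M. LINT t|circle_measure. a n * (cis (real n * t) * cnj (u t)))"
      by (intro Bochner_Integration.integral_sum integrable_mult_right integrable_L2_ip square_integrable_cis u)
    finally show ?thesis by (simp add: L2_ip_def)
  qed
  also have "\<dots> = of_real (2 * pi * (\<Sum>n<M. (norm (a n))\<^sup>2))"
  proof -
    have "a n * L2_ip circle_measure (\<lambda>t. cis (real n * t)) u = 2 * pi * of_real ((norm (a n))\<^sup>2)" for n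
    proof -
      have "L2_ip circle_measure (\<lambda>t. cis (real n * t)) u = cnj (2 * pi * a n)"
        unfolding L2_ip_commute[of _ "\<lambda>t. cis (real n * t)"] by (simp add: a_def)
      then show ?thesis by (simp add: mult_cnj_eq_norm_sq)
    qed
    then show ?thesis by (simp add: sum_distrib_left)
  qed
  finally have "L2_ip circle_measure (trig a M) u = of_real (L2_sq circle_measure (trig a M))"
    by (simp only: L2_sq_trig)
  from L2_sq_le_of_L2_ip[OF square_integrable_trig u this]
  show ?thesis by (simp add: L2_sq_trig a_def)
qed

text \<open>Tychonoff's theorem for pointwise convergence. It serves the extremal problem and later
  the choice of a subsequence of Fourier coefficients.\<close>

lemma compact_sequences_in_balls:
  fixes B :: "nat \<Rightarrow> complex set"
  assumes "\<And>n. compact (B n)" shows "compact {c. \<forall>n. c n \<in> B n}"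
proof -
  have "compactin (product_topology (\<lambda>n. euclidean) UNIV) (PiE UNIV B)"
    unfolding compactin_PiE using assms by (simp add: compactin_euclidean_iff)
  moreover have "PiE UNIV B = {c. \<forall>n. c n \<in> B n}" by (auto simp: PiE_def)
  ultimately show ?thesis by (simp add: euclidean_product_topology compactin_euclidean_iff)
qed

lemma trig_add: "trig (\<lambda>n. a n + b n) N t = trig a N t + trig b N t"
  by (simp add: trig_def distrib_right sum.distrib)

lemma trig_cmult: "trig (\<lambda>n. c * a n) N t = c * trig a N t"
  by (simp add: trig_def sum_distrib_left mult.assoc)

lemma trig_unit_seq: "n < N \<Longrightarrow> trig (unit_seq n) N t = cis (real n * t)"
proof -
  assume n: "n < N"
  have "trig (unit_seq n) N t = (\<Sum>k<N. if k = n then cis (real k * t) else 0)"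
    unfolding trig_def by (intro sum.cong refl) (simp add: unit_seq_def)
  then show ?thesis using n by simp
qed

lemma continuous_trig: "continuous_on S (trig a N)"
  unfolding trig_def[abs_def] by (intro continuous_intros)

lemma integrable_circle_continuous:
  fixes f :: "real \<Rightarrow> 'a::euclidean_space"
  assumes "continuous_on {0..2*pi} f" shows "integrable circle_measure f"
  by (intro absolutely_integrable_imp_integrable absolutely_integrable_continuous_real assms) auto

text \<open>The directional derivative of the norm away from 0, computed by multiplying with the sum
  of the two norms.\<close>

lemma norm_difference_quotient:
  fixes p q :: complex
  assumes "p \<noteq> 0"
  shows "(\<lambda>n. (norm (p + of_real (inverse (real (Suc n))) * q) - norm p) / inverse (real (Suc n))) \<longlonglongrightarrow> Re (cnj p / norm p * q)"
proof -
  define h where "h n = inverse (real (Suc n))" for n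
  have h: "h n > 0" for n by (simp add: h_def)
  have hl: "h \<longlonglongrightarrow> 0" unfolding h_def by (rule LIMSEQ_inverse_real_of_nat)
  have "(norm (p + of_real (h n) * q) - norm p) / h n = (2 * Re (cnj p * q) + h n * (norm q)\<^sup>2) / (norm (p + of_real (h n) * q) + norm p)" for n
  proof -
    have "(norm (p + of_real (h n) * q) - norm p) * (norm (p + of_real (h n) * q) + norm p) = (norm (p + of_real (h n) * q))\<^sup>2 - (norm p)\<^sup>2"
      by (simp add: power2_eq_square algebra_simps)
    also have "\<dots> = h n * (2 * Re (cnj p * q) + h n * (norm q)\<^sup>2)"
      unfolding cmod_power2 by (simp add: power2_eq_square) (simp add: algebra_simps)
    finally have "(norm (p + of_real (h n) * q) - norm p) * (norm (p + of_real (h n) * q) + norm p) = h n * (2 * Re (cnj p * q) + h n * (norm q)\<^sup>2)" .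
    moreover have "norm (p + of_real (h n) * q) + norm p \<noteq> 0" using assms by (simp add: add_nonneg_eq_0_iff)
    ultimately show ?thesis using h[of n] by (simp add: divide_eq_eq eq_divide_eq mult.commute)
  qed
  moreover have "(\<lambda>n. (2 * Re (cnj p * q) + h n * (norm q)\<^sup>2) / (norm (p + of_real (h n) * q) + norm p)) \<longlonglongrightarrow>
      (2 * Re (cnj p * q) + 0 * (norm q)\<^sup>2) / (norm (p + of_real 0 * q) + norm p)"
    by (intro tendsto_intros hl) (use assms in simp)
  moreover have "(2 * Re (cnj p * q) + 0 * (norm q)\<^sup>2) / (norm (p + of_real 0 * q) + norm p) = Re (cnj p / norm p * q)"
  proof -
    have "cnj p / of_real (norm p) * q = (cnj p * q) / of_real (norm p)" by simp
    then have "Re (cnj p / of_real (norm p) * q) = Re (cnj p * q) / norm p" by (simp only: Re_divide_of_real)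
    moreover have "(2 * x + 0 * y) / (norm (p + of_real 0 * q) + norm p) = x / norm p" for x y by simp
    ultimately show ?thesis by metis
  qed
  ultimately show ?thesis unfolding h_def by simp
qed

context bounded_hankel_matrix
begin

lemma trig_bound:
  "norm (\<Sum>k<N. \<gamma> k * c k) \<le> K / (2 * pi) * (LINT t|circle_measure. norm (trig c N t))"
proof -
  define p where "p = (\<Sum>k<N. monom (c k) k)"
  have coeff: "coeff p k = (if k < N then c k else 0)" for k
    unfolding p_def coeff_sum by (simp add: if_distrib sum.delta cong: if_cong)
  have ev: "poly p (cis t) = trig c N t" for t
    by (simp add: p_def poly_sum poly_monom trig_def Complex.DeMoivre)
  show ?thesis
  proof (cases "p = 0")
    case True
    then have "c k = 0" if "k < N" for k using coeff[of k] that by simp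
    then have "(\<Sum>k<N. \<gamma> k * c k) = 0" by simp
    then show ?thesis using K_nonneg by simp
  next
    case False
    have "(\<Sum>k\<le>degree p. \<gamma> k * coeff p k) = (\<Sum>k\<in>{..degree p} \<union> {..<N}. \<gamma> k * coeff p k)"
      by (rule sum.mono_neutral_left) (auto simp: coeff_eq_0)
    also have "\<dots> = (\<Sum>k<N. \<gamma> k * coeff p k)"
      by (rule sum.mono_neutral_right) (auto simp: coeff)
    also have "\<dots> = (\<Sum>k<N. \<gamma> k * c k)" by (simp add: coeff)
    finally show ?thesis using poly_bound[OF False] by (simp add: ev)
  qed
qed

lemma trig_L1_eq_0:
  assumes "(LINT t|circle_measure. norm (trig c N t)) = 0" "k < N" shows "c k = 0"
proof -
  have "AE t in circle_measure. norm (trig c N t) = 0"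
    using assms(1) by (subst (asm) integral_nonneg_eq_0_iff_AE) (auto intro!: integrable_circle_continuous continuous_intros continuous_trig)
  then have "L2_ip circle_measure (trig c N) (\<lambda>t. cis (of_int (int k) * t)) = 0"
    unfolding L2_ip_def by (intro integral_eq_zero_AE) auto
  then show ?thesis using assms(2) L2_ip_trig_cis[of c N "int k"] by simp
qed

text \<open>A nonzero polynomial has finitely many roots on the circle. This makes the norm
  differentiable almost everywhere along the extremal polynomial.\<close>

lemma AE_trig_nonzero:
  assumes "k < N" "c k \<noteq> 0" shows "AE t in circle_measure. trig c N t \<noteq> 0"
proof -
  define p where "p = (\<Sum>k<N. monom (c k) k)"
  have "coeff p k = c k" unfolding p_def coeff_sum using assms(1) by (simp add: if_distrib sum.delta cong: if_cong)
  then have "p \<noteq> 0" using assms(2) by auto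
  have ev: "poly p (cis t) = trig c N t" for t
    by (simp add: p_def poly_sum poly_monom trig_def Complex.DeMoivre)
  have inj: "inj_on cis {0<..<2*pi}" by (rule inj_onI) (auto intro: cis_inj_open_interval)
  have "finite {t \<in> {0<..<2*pi}. trig c N t = 0}"
  proof (rule finite_imageD)
    show "finite (cis ` {t \<in> {0<..<2*pi}. trig c N t = 0})"
      by (rule finite_subset[OF _ poly_roots_finite[OF \<open>p \<noteq> 0\<close>]]) (auto simp: ev)
    show "inj_on cis {t \<in> {0<..<2*pi}. trig c N t = 0}" by (rule inj_on_subset[OF inj]) auto
  qed
  then have "negligible {t \<in> {0<..<2*pi}. trig c N t = 0}" by (rule negligible_finite)
  then have "AE t in lebesgue. t \<notin> {t \<in> {0<..<2*pi}. trig c N t = 0}"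
    unfolding negligible_iff_null_sets by (rule AE_not_in)
  then show ?thesis unfolding AE_circle_iff by eventually_elim simp
qed

text \<open>
  The symbol is read off from the first-order condition for a trigonometric polynomial that
  maximizes the ratio of the functional given by \<open>\<gamma>\<close> to the \<open>L\<^sup>1\<close> norm.
\<close>
lemma finite_symbol:
  obtains u where "u \<in> borel_measurable circle_measure" "\<And>t. norm (u t) \<le> K"
    "\<And>k. k < N \<Longrightarrow> (LINT t|circle_measure. u t * cis (real k * t)) = 2 * pi * \<gamma> k"
proof (cases "N = 0")
  case True
  then show ?thesis using that[of "\<lambda>_. 0"] K_nonneg by simp
next
  case False
  define I where "I c = (LINT t|circle_measure. norm (trig c N t))" for c
  define \<Lambda> where "\<Lambda> c = (\<Sum>k<N. \<gamma> k * c k)" for c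
  have tint: "integrable circle_measure (\<lambda>t. norm (trig c N t))" for c
    by (intro integrable_circle_continuous continuous_intros continuous_trig)
  have I0: "I c \<ge> 0" for c by (simp add: I_def)
  have bound: "norm (\<Lambda> c) \<le> K / (2 * pi) * I c" for c unfolding \<Lambda>_def I_def by (rule trig_bound)
  have \<Lambda>_lin: "\<Lambda> (\<lambda>n. a n + b n) = \<Lambda> a + \<Lambda> b" "\<Lambda> (\<lambda>n. s * a n) = s * \<Lambda> a" for a b s
    by (simp_all add: \<Lambda>_def distrib_left sum.distrib sum_distrib_left mult_ac)
  have I_cmult: "I (\<lambda>n. s * a n) = norm s * I a" for s a by (simp add: I_def trig_cmult norm_mult)
  have coord: "continuous_on T (\<lambda>c :: nat \<Rightarrow> complex. c k)" for T k
    by (rule continuous_on_subset[OF continuous_on_product_coordinates]) simp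
  \<comment> \<open>The unit sphere of the first \<open>N\<close> coefficients. Fixing the other
    entries at 0 and confining each to a compact set makes it a closed subset of a compact
    product.\<close>
  define S where "S = {c :: nat \<Rightarrow> complex. \<forall>n. c n \<in> (if n < N then cball 0 1 else {0})} \<inter> {c. (\<Sum>k<N. (norm (c k))\<^sup>2) = 1}"
  have "compact S"
    unfolding S_def by (intro compact_Int_closed compact_sequences_in_balls closed_Collect_eq continuous_intros coord) auto
  have Ipos: "I c > 0" if "c \<in> S" for c
  proof -
    have "I c \<noteq> 0"
    proof
      assume "I c = 0"
      then have "c k = 0" if "k < N" for k using trig_L1_eq_0[of c N k] that by (simp add: I_def)
      then show False using \<open>c \<in> S\<close> by (simp add: S_def)
    qed
    then show ?thesis using I0[of c] by simp
  qed
  have "unit_seq 0 \<in> S"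
  proof -
    have "(\<Sum>k<N. (norm (unit_seq 0 k))\<^sup>2) = (\<Sum>k<N. if k = 0 then 1 else 0)"
      by (intro sum.cong refl) (simp add: unit_seq_def)
    then show ?thesis using False by (auto simp: S_def unit_seq_def)
  qed
  have Icont: "continuous_on T I" for T
  proof -
    have "continuous_on (UNIV \<times> cbox 0 (2*pi)) (\<lambda>(c, t). norm (trig c N t))"
      unfolding trig_def case_prod_beta
      by (intro continuous_intros continuous_on_compose2[OF coord[of UNIV]]) auto
    then have "continuous_on UNIV (\<lambda>c. integral (cbox 0 (2*pi)) (\<lambda>t. norm (trig c N t)))"
      by (rule integral_continuous_on_param)
    moreover have "(\<lambda>c. integral (cbox 0 (2*pi)) (\<lambda>t. norm (trig c N t))) = I"
      unfolding I_def by (rule ext) (simp add: lebesgue_integral_eq_integral[OF tint] cbox_interval)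
    ultimately show ?thesis by (metis continuous_on_subset subset_UNIV)
  qed
  have "continuous_on S (\<lambda>c. norm (\<Lambda> c) / I c)"
    unfolding \<Lambda>_def using Ipos by (intro continuous_intros coord Icont) force
  then obtain c0 where c0: "c0 \<in> S" "\<And>c. c \<in> S \<Longrightarrow> norm (\<Lambda> c) / I c \<le> norm (\<Lambda> c0) / I c0"
    using continuous_attains_sup[OF \<open>compact S\<close>] \<open>unit_seq 0 \<in> S\<close> by blast
  define \<mu> where "\<mu> = norm (\<Lambda> c0) / I c0"
  have \<mu>0: "\<mu> \<ge> 0" using I0 by (simp add: \<mu>_def)
  have \<mu>K: "2 * pi * \<mu> \<le> K" using bound[of c0] Ipos[OF c0(1)] by (simp add: \<mu>_def field_simps)
  have max: "norm (\<Lambda> c) \<le> \<mu> * I c" for c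
  proof -
    \<comment> \<open>By homogeneity the extremal inequality extends from the sphere to all
      coefficients.\<close>
    define \<nu> where "\<nu> = sqrt (\<Sum>k<N. (norm (c k))\<^sup>2)"
    show ?thesis
    proof (cases "\<nu> = 0")
      case True
      then have "\<forall>k\<in>{..<N}. (norm (c k))\<^sup>2 = 0" unfolding \<nu>_def by (subst (asm) real_sqrt_eq_0_iff, subst (asm) sum_nonneg_eq_0_iff) auto
      then have "\<Lambda> c = 0" by (simp add: \<Lambda>_def)
      then show ?thesis using \<mu>0 I0 by simp
    next
      case False
      then have \<nu>: "\<nu> > 0" by (simp add: \<nu>_def sum_nonneg less_le)
      have \<nu>2: "\<nu>\<^sup>2 = (\<Sum>k<N. (norm (c k))\<^sup>2)" by (simp add: \<nu>_def sum_nonneg)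
      define c' where "c' n = (if n < N then c n / \<nu> else 0)" for n
      have "c' \<in> S"
      proof -
        have "norm (c k) \<le> \<nu>" if "k < N" for k
        proof (rule power2_le_imp_le)
          show "(norm (c k))\<^sup>2 \<le> \<nu>\<^sup>2" unfolding \<nu>2 by (rule member_le_sum) (use that in auto)
        qed (use \<nu> in simp)
        moreover have "(\<Sum>k<N. (norm (c' k))\<^sup>2) = (\<Sum>k<N. (norm (c k))\<^sup>2) / \<nu>\<^sup>2"
          using \<nu> unfolding sum_divide_distrib by (intro sum.cong refl) (simp add: c'_def norm_divide power_divide)
        ultimately show ?thesis using \<nu> \<nu>2 by (auto simp: S_def c'_def norm_divide)
      qed
      then have "norm (\<Lambda> c') \<le> \<mu> * I c'" using c0(2)[of c'] Ipos[of c'] by (simp add: \<mu>_def divide_le_eq)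
      moreover have "\<Lambda> c' = \<Lambda> (\<lambda>n. (1 / \<nu>) * c n)" "I c' = I (\<lambda>n. (1 / \<nu>) * c n)"
        unfolding \<Lambda>_def I_def trig_def by (simp_all add: c'_def)
      ultimately show ?thesis using \<nu> unfolding \<Lambda>_lin I_cmult by (simp add: norm_mult norm_divide divide_right_mono field_simps)
    qed
  qed
  show ?thesis
  proof (cases "\<mu> = 0")
    case True
    have "\<gamma> k = 0" if "k < N" for k
    proof -
      have "\<Lambda> (unit_seq k) = (\<Sum>n<N. if n = k then \<gamma> n else 0)" unfolding \<Lambda>_def by (intro sum.cong refl) (simp add: unit_seq_def)
      then have "\<Lambda> (unit_seq k) = \<gamma> k" using that by simp
      then show ?thesis using max[of "unit_seq k"] True by simp
    qed
    then show ?thesis using that[of "\<lambda>_. 0"] K_nonneg by simp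
  next
    case False
    then have \<mu>: "\<mu> > 0" using \<mu>0 by simp
    then have \<Lambda>0: "\<Lambda> c0 \<noteq> 0" by (auto simp: \<mu>_def)
    \<comment> \<open>A rotation of the maximizer that makes the value of the functional positive,
      so that the maximum is attained by its real part.\<close>
    define \<omega> where "\<omega> = cnj (\<Lambda> c0) / norm (\<Lambda> c0)"
    have n\<omega>: "norm \<omega> = 1" using \<Lambda>0 by (simp add: \<omega>_def norm_divide)
    define c where "c n = \<omega> * c0 n" for n
    have \<Lambda>c: "\<Lambda> c = of_real (\<mu> * I c)"
    proof -
      have "\<Lambda> c = \<omega> * \<Lambda> c0" unfolding c_def by (rule \<Lambda>_lin)
      also have "\<dots> = of_real (norm (\<Lambda> c0))"
      proof -
        have "cnj (\<Lambda> c0) * \<Lambda> c0 = of_real (norm (\<Lambda> c0)) * of_real (norm (\<Lambda> c0))"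
          unfolding mult.commute[of "cnj _"] mult_cnj_eq_norm_sq power2_eq_square ..
        then show ?thesis using \<Lambda>0 by (simp add: \<omega>_def)
      qed
      also have "norm (\<Lambda> c0) = \<mu> * I c0" using Ipos[OF c0(1)] by (simp add: \<mu>_def)
      also have "I c0 = I c" unfolding c_def I_cmult by (simp add: n\<omega>)
      finally show ?thesis .
    qed
    obtain k0 where k0: "k0 < N" "c k0 \<noteq> 0"
    proof -
      have "\<exists>k<N. c k \<noteq> 0"
      proof (rule ccontr)
        assume "\<not> ?thesis"
        then have "c0 k = 0" if "k < N" for k using that n\<omega> by (auto simp: c_def)
        then show False using c0(1) by (simp add: S_def)
      qed
      then show ?thesis using that by blast
    qed
    \<comment> \<open>At the zeros of the polynomial the quotient is 0 by division by zero; they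
      form a null set.\<close>
    define \<sigma> where "\<sigma> t = cnj (trig c N t) / norm (trig c N t)" for t
    have \<sigma>1: "norm (\<sigma> t) \<le> 1" for t by (simp add: \<sigma>_def norm_divide)
    have trm [measurable]: "trig a N \<in> borel_measurable circle_measure" for a
      using square_integrable_trig by (simp add: square_integrable_def)
    have \<sigma>m [measurable]: "\<sigma> \<in> borel_measurable circle_measure"
    proof -
      have "(\<lambda>t. cnj (trig c N t)) \<in> borel_measurable circle_measure"
        using square_integrable_cnj[OF square_integrable_trig] by (simp add: square_integrable_def)
      then show ?thesis unfolding \<sigma>_def[abs_def] by measurable
    qed
    have \<sigma>int: "integrable circle_measure (\<lambda>t. \<sigma> t * trig d N t)" for d
    proof (rule Bochner_Integration.integrable_bound[OF tint[of d]])
      show "AE t in circle_measure. norm (\<sigma> t * trig d N t) \<le> norm (norm (trig d N t))"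
        using \<sigma>1 by (intro AE_I2) (simp add: norm_mult mult_left_le_one_le)
    qed measurable
    \<comment> \<open>First-order condition: in the extremal inequality for \<open>c + h * d\<close>
      equality holds at \<open>h = 0\<close>, so the difference quotients are ordered as
      \<open>h\<close> decreases to 0.\<close>
    have le: "Re (\<Lambda> d) \<le> \<mu> * Re (LINT t|circle_measure. \<sigma> t * trig d N t)" for d
    proof -
      define h where "h n = inverse (real (Suc n))" for n
      have h: "h n > 0" for n by (simp add: h_def)
      have step: "Re (\<Lambda> d) \<le> \<mu> * (LINT t|circle_measure. (norm (trig c N t + of_real (h n) * trig d N t) - norm (trig c N t)) / h n)" for n
      proof -
        have "Re (\<Lambda> (\<lambda>k. c k + of_real (h n) * d k)) \<le> \<mu> * I (\<lambda>k. c k + of_real (h n) * d k)"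
          by (rule order_trans[OF complex_Re_le_cmod max])
        moreover have "Re (\<Lambda> (\<lambda>k. c k + of_real (h n) * d k)) = \<mu> * I c + h n * Re (\<Lambda> d)"
          unfolding \<Lambda>_lin \<Lambda>c by simp
        ultimately have "h n * Re (\<Lambda> d) \<le> \<mu> * (I (\<lambda>k. c k + of_real (h n) * d k) - I c)" by (simp add: algebra_simps)
        then have "Re (\<Lambda> d) \<le> \<mu> * ((I (\<lambda>k. c k + of_real (h n) * d k) - I c) / h n)" using h[of n] by (simp add: field_simps)
        also have "(I (\<lambda>k. c k + of_real (h n) * d k) - I c) / h n = (LINT t|circle_measure. (norm (trig c N t + of_real (h n) * trig d N t) - norm (trig c N t)) / h n)"
          using Bochner_Integration.integral_diff[OF tint[of "\<lambda>k. c k + of_real (h n) * d k"] tint[of c]]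
          by (simp add: I_def trig_add trig_cmult)
        finally show ?thesis .
      qed
      have "(\<lambda>n. LINT t|circle_measure. (norm (trig c N t + of_real (h n) * trig d N t) - norm (trig c N t)) / h n) \<longlonglongrightarrow> (LINT t|circle_measure. Re (\<sigma> t * trig d N t))"
      proof (rule integral_dominated_convergence[where w="\<lambda>t. norm (trig d N t)"])
        show "integrable circle_measure (\<lambda>t. norm (trig d N t))" by (rule tint)
        show "AE t in circle_measure. (\<lambda>n. (norm (trig c N t + of_real (h n) * trig d N t) - norm (trig c N t)) / h n) \<longlonglongrightarrow> Re (\<sigma> t * trig d N t)"
          using AE_trig_nonzero[of k0 N c, OF k0]
        proof eventually_elim
          fix t assume "trig c N t \<noteq> 0"
          then show "(\<lambda>n. (norm (trig c N t + of_real (h n) * trig d N t) - norm (trig c N t)) / h n) \<longlonglongrightarrow> Re (\<sigma> t * trig d N t)"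
            unfolding h_def \<sigma>_def by (rule norm_difference_quotient)
        qed
        show "AE t in circle_measure. norm ((norm (trig c N t + of_real (h n) * trig d N t) - norm (trig c N t)) / h n) \<le> norm (trig d N t)" for n
        proof (intro AE_I2)
          fix t
          have "\<bar>norm (trig c N t + of_real (h n) * trig d N t) - norm (trig c N t)\<bar> \<le> norm (of_real (h n) * trig d N t)"
            using norm_triangle_ineq3[of "trig c N t + of_real (h n) * trig d N t" "trig c N t"] by simp
          also have "\<dots> = h n * norm (trig d N t)" using h[of n] by (simp add: norm_mult)
          finally show "norm ((norm (trig c N t + of_real (h n) * trig d N t) - norm (trig c N t)) / h n) \<le> norm (trig d N t)"
            using h[of n] by (simp add: divide_le_eq mult.commute)
        qed
        show "(\<lambda>t. Re (\<sigma> t * trig d N t)) \<in> borel_measurable circle_measure" by measurable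
        show "(\<lambda>t. (norm (trig c N t + of_real (h n) * trig d N t) - norm (trig c N t)) / h n) \<in> borel_measurable circle_measure" for n
          by measurable
      qed
      then have "(\<lambda>n. \<mu> * (LINT t|circle_measure. (norm (trig c N t + of_real (h n) * trig d N t) - norm (trig c N t)) / h n)) \<longlonglongrightarrow> \<mu> * (LINT t|circle_measure. Re (\<sigma> t * trig d N t))"
        by (rule tendsto_mult_left)
      then have "Re (\<Lambda> d) \<le> \<mu> * (LINT t|circle_measure. Re (\<sigma> t * trig d N t))"
        by (rule tendsto_lowerbound) (use step in auto)
      then show ?thesis unfolding integral_Re[OF \<sigma>int] .
    qed
    have lin: "(LINT t|circle_measure. \<sigma> t * trig (\<lambda>k. s * d k) N t) = s * (LINT t|circle_measure. \<sigma> t * trig d N t)" for s d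
      by (simp add: trig_cmult mult.left_commute)
    \<comment> \<open>The condition for \<open>- d\<close> gives equality of the real parts;
      replacing \<open>d\<close> by \<open>\<i> * d\<close> then gives the imaginary parts.\<close>
    have eqRe: "Re (\<Lambda> d) = Re (\<mu> * (LINT t|circle_measure. \<sigma> t * trig d N t))" for d
      using le[of d] le[of "\<lambda>k. -1 * d k"] unfolding lin \<Lambda>_lin by simp
    have eq: "\<Lambda> d = \<mu> * (LINT t|circle_measure. \<sigma> t * trig d N t)" for d
    proof (rule complex_eqI[OF eqRe])
      show "Im (\<Lambda> d) = Im (\<mu> * (LINT t|circle_measure. \<sigma> t * trig d N t))"
        using eqRe[of "\<lambda>k. \<i> * d k"] unfolding lin \<Lambda>_lin by simp
    qed
    show ?thesis
    proof (rule that[of "\<lambda>t. of_real (2 * pi * \<mu>) * \<sigma> t"])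
      show "norm (of_real (2 * pi * \<mu>) * \<sigma> t) \<le> K" for t
      proof -
        have "norm (of_real (2 * pi * \<mu>) * \<sigma> t) \<le> 2 * pi * \<mu>"
          using \<sigma>1[of t] \<mu> by (simp add: norm_mult mult_left_le)
        then show ?thesis using \<mu>K by simp
      qed
      fix k assume k: "k < N"
      have "\<Lambda> (unit_seq k) = (\<Sum>n<N. if n = k then \<gamma> n else 0)" unfolding \<Lambda>_def by (intro sum.cong refl) (simp add: unit_seq_def)
      then have "\<gamma> k = \<mu> * (LINT t|circle_measure. \<sigma> t * cis (real k * t))"
        using k eq[of "unit_seq k"] by (simp add: trig_unit_seq)
      then show "(LINT t|circle_measure. of_real (2 * pi * \<mu>) * \<sigma> t * cis (real k * t)) = 2 * pi * \<gamma> k"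
        by (simp add: mult.assoc)
    qed measurable
  qed
qed

end

text \<open>\<open>A + cnj A - 1\<close> is the Poisson kernel truncated to the frequencies below
  \<open>M\<close> in modulus; the remainder of the geometric series bounds the error.\<close>

lemma Poisson_kernel_series_bound:
  assumes z: "norm z < 1"
  defines "A \<equiv> \<lambda>M t. \<Sum>n<M. z ^ n * cnj (cis (real n * t))"
  shows "norm (A M t + cnj (A M t) - 1) \<le> (1 - (norm z)\<^sup>2) / (norm (cis t - z))\<^sup>2 + 2 * (norm z ^ M / (1 - norm z))"
proof -
  define w where "w = z * cis (- t)"
  have nw: "norm w = norm z" by (simp add: w_def norm_mult)
  have w1: "w \<noteq> 1" using nw z by auto
  have nz: "1 - w \<noteq> 0" using w1 by simp
  have "z ^ n * cnj (cis (real n * t)) = w ^ n" for n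
    unfolding w_def power_mult_distrib Complex.DeMoivre by (simp add: cis_cnj)
  then have A: "A M t = 1 / (1 - w) - w ^ M / (1 - w)"
    unfolding A_def using w1 by (simp add: sum_gp_strict diff_divide_distrib)
  define P where "P = (1 - (norm z)\<^sup>2) / (norm (cis t - z))\<^sup>2"
  have nd: "norm (1 - w) = norm (cis t - z)"
  proof -
    have "1 - w = cis (- t) * (cis t - z)" by (simp add: w_def right_diff_distrib cis_mult mult.commute)
    then show ?thesis by (simp add: norm_mult)
  qed
  have "1 / (1 - w) + cnj (1 / (1 - w)) - 1 = ((1 - cnj w) + (1 - w) - (1 - w) * cnj (1 - w)) / ((1 - w) * cnj (1 - w))"
    using nz by (simp add: divide_simps)
  also have "(1 - cnj w) + (1 - w) - (1 - w) * cnj (1 - w) = 1 - w * cnj w" by (simp add: algebra_simps)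
  also have "(1 - w * cnj w) / ((1 - w) * cnj (1 - w)) = of_real P"
    unfolding mult_cnj_eq_norm_sq nw nd by (simp add: P_def)
  finally have "A M t + cnj (A M t) - 1 = of_real P - (w ^ M / (1 - w) + cnj (w ^ M / (1 - w)))"
    unfolding A by (simp add: algebra_simps)
  then have "norm (A M t + cnj (A M t) - 1) \<le> norm (complex_of_real P) + (norm (w ^ M / (1 - w)) + norm (cnj (w ^ M / (1 - w))))"
    by (simp only:) (intro order_trans[OF norm_triangle_ineq4] add_mono order_refl norm_triangle_ineq)
  also have "norm (complex_of_real P) = P"
    unfolding norm_of_real using z by (simp add: P_def power_le_one)
  also have "norm (w ^ M / (1 - w)) + norm (cnj (w ^ M / (1 - w))) \<le> 2 * (norm z ^ M / (1 - norm z))"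
  proof -
    have "1 - norm z \<le> norm (1 - w)" using norm_triangle_ineq2[of 1 w] by (simp add: nw)
    then have "norm (w ^ M / (1 - w)) \<le> norm z ^ M / (1 - norm z)"
      using z by (simp add: norm_divide norm_power nw frac_le)
    then show ?thesis unfolding complex_mod_cnj by simp
  qed
  finally show ?thesis by (simp add: P_def)
qed

lemma integrable_bounded_circle:
  fixes f :: "real \<Rightarrow> complex"
  assumes "f \<in> borel_measurable circle_measure" "\<And>t. norm (f t) \<le> B"
  shows "integrable circle_measure f"
  by (rule finite_measure.integrable_const_bound[OF finite_measure_circle, where B=B]) (use assms in auto)

section \<open>Passage to the limit symbol\<close>

context bounded_hankel_matrix
begin

text \<open>\<open>finite_symbol\<close> pairs with \<open>cis\<close>, whereas Fourier coefficients
  pair with its conjugate. The conjugate matrix satisfies the same bound, and conjugating its symbol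
  reconciles the two.\<close>

lemma finite_symbol_cis:
  obtains v where "v \<in> borel_measurable circle_measure" "\<And>t. norm (v t) \<le> K"
    "\<And>k. k < N \<Longrightarrow> L2_ip circle_measure v (\<lambda>t. cis (real k * t)) = 2 * pi * \<gamma> k"
proof -
  interpret conj: bounded_hankel_matrix "\<lambda>n. cnj (\<gamma> n)" K
  proof
    fix M a b
    have "(\<Sum>i<M. \<Sum>j<M. cnj (\<gamma> (i + j)) * a i * b j) = cnj (\<Sum>i<M. \<Sum>j<M. \<gamma> (i + j) * cnj (a i) * cnj (b j))"
      by simp
    then have "norm (\<Sum>i<M. \<Sum>j<M. cnj (\<gamma> (i + j)) * a i * b j) = norm (\<Sum>i<M. \<Sum>j<M. \<gamma> (i + j) * cnj (a i) * cnj (b j))"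
      by (simp only: complex_mod_cnj)
    then show "norm (\<Sum>i<M. \<Sum>j<M. cnj (\<gamma> (i + j)) * a i * b j) \<le> K * sqrt (\<Sum>i<M. (norm (a i))\<^sup>2) * sqrt (\<Sum>j<M. (norm (b j))\<^sup>2)"
      using hankel_bound[where M=M and a="\<lambda>i. cnj (a i)" and b="\<lambda>j. cnj (b j)"] by simp
  qed
  obtain u where u: "u \<in> borel_measurable circle_measure" "\<And>t. norm (u t) \<le> K"
    "\<And>k. k < N \<Longrightarrow> (LINT t|circle_measure. u t * cis (real k * t)) = 2 * pi * cnj (\<gamma> k)"
    using conj.finite_symbol[of N] by blast
  show ?thesis
  proof (rule that[of "\<lambda>t. cnj (u t)"])
    show "(\<lambda>t. cnj (u t)) \<in> borel_measurable circle_measure"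
      by (rule measurable_compose[OF u(1) borel_measurable_continuous_onI]) (intro continuous_intros)
    show "norm (cnj (u t)) \<le> K" for t using u(2) by simp
    fix k assume "k < N"
    have "L2_ip circle_measure (\<lambda>t. cnj (u t)) (\<lambda>t. cis (real k * t)) = (LINT t|circle_measure. cnj (u t * cis (real k * t)))"
      by (simp add: L2_ip_def)
    also have "\<dots> = cnj (LINT t|circle_measure. u t * cis (real k * t))"
      by (rule Bochner_Integration.integral_cnj)
    finally show "L2_ip circle_measure (\<lambda>t. cnj (u t)) (\<lambda>t. cis (real k * t)) = 2 * pi * \<gamma> k"
      using u(3)[OF \<open>k < N\<close>] by simp
  qed
qed

text \<open>All finite symbols have modulus at most \<open>K\<close>. Their coefficients at
  nonnegative frequencies eventually agree with \<open>\<gamma>\<close>, those at negative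
  frequencies converge along a subsequence, and the limits define \<open>k\<close> in L2. It then
  remains to bound \<open>k\<close>.\<close>

theorem Nehari:
  obtains k where "square_integrable circle_measure k" "AE t in circle_measure. norm (k t) \<le> K"
    "\<And>n. L2_ip circle_measure k (\<lambda>t. cis (real n * t)) = 2 * pi * \<gamma> n"
proof -
  have "\<forall>N. \<exists>v. v \<in> borel_measurable circle_measure \<and> (\<forall>t. norm (v t) \<le> K) \<and>
      (\<forall>k<N. L2_ip circle_measure v (\<lambda>t. cis (real k * t)) = 2 * pi * \<gamma> k)"
    using finite_symbol_cis by metis
  then obtain v where v: "\<And>N. v N \<in> borel_measurable circle_measure" "\<And>N t. norm (v N t) \<le> K"
      "\<And>N k. k < N \<Longrightarrow> L2_ip circle_measure (v N) (\<lambda>t. cis (real k * t)) = 2 * pi * \<gamma> k"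
    by metis
  have vint: "integrable circle_measure (v N)" for N by (rule integrable_bounded_circle[OF v(1,2)])
  have vsq: "square_integrable circle_measure (v N)" for N
  proof -
    have "square_integrable circle_measure (\<lambda>t. v N t * cis (0 * t))"
      by (rule square_integrable_bounded_mult[OF v(1) _ square_integrable_cis]) (use v(2) in auto)
    then show ?thesis by simp
  qed
  have vL2: "L2_sq circle_measure (v N) \<le> 2 * pi * K\<^sup>2" for N
  proof -
    have "L2_sq circle_measure (v N) \<le> (LINT t|circle_measure. K\<^sup>2)"
      unfolding L2_sq_def
      by (rule integral_mono)
        (use vsq[of N] v(2) finite_measure.integrable_const[OF finite_measure_circle] in \<open>auto simp: square_integrable_def intro: power_mono\<close>)
    then show ?thesis by (simp add: measure_restrict_space)
  qed
  \<comment> \<open>The coefficient at the frequency \<open>- (m + 1)\<close>; frequency 0 already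
    belongs to \<open>\<gamma>\<close>.\<close>
  define x where "x N m = L2_ip circle_measure (v N) (\<lambda>t. cis (- real (Suc m) * t)) / (2 * pi)" for N m
  have xK: "norm (x N m) \<le> K" for N m
  proof -
    have "norm (L2_ip circle_measure (v N) (\<lambda>t. cis (- real (Suc m) * t))) \<le> sqrt (2 * pi * K\<^sup>2) * sqrt (L2_sq circle_measure (\<lambda>t. cis (- real (Suc m) * t)))"
      by (intro order_trans[OF L2_Cauchy_Schwarz[OF vsq square_integrable_cis]] mult_right_mono real_sqrt_le_mono vL2) simp
    also have "L2_sq circle_measure (\<lambda>t. cis (- real (Suc m) * t)) = 2 * pi"
      by (simp add: L2_sq_def measure_restrict_space)
    also have "sqrt (2 * pi * K\<^sup>2) * sqrt (2 * pi) = K * (sqrt (2 * pi) * sqrt (2 * pi))"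
      using K_nonneg by (simp add: real_sqrt_mult)
    also have "sqrt (2 * pi) * sqrt (2 * pi) = 2 * pi" by (rule real_sqrt_mult_self[THEN trans]) simp
    finally show ?thesis by (simp add: x_def norm_divide divide_le_eq del: of_nat_Suc)
  qed
  have "seq_compact {c :: nat \<Rightarrow> complex. \<forall>n. c n \<in> cball 0 K}"
    by (intro compact_imp_seq_compact compact_sequences_in_balls) simp
  then obtain d r where r: "strict_mono r" "(\<lambda>N. x (r N)) \<longlonglongrightarrow> d"
  proof (rule seq_compactE)
    show "\<forall>N. x N \<in> {c. \<forall>n. c n \<in> cball 0 K}" using xK by simp
  qed (auto simp: o_def)
  have xd: "(\<lambda>N. x (r N) m) \<longlonglongrightarrow> d m" for m
    using continuous_on_tendsto_compose[OF continuous_on_product_coordinates[of m] r(2)] by simp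
  have rN: "N \<le> r N" for N by (rule strict_mono_imp_increasing[OF r(1)])
  have \<gamma>l2: "l2 \<gamma>"
    unfolding l2_def
  proof (rule bounded_imp_summable)
    fix n
    have "2 * pi * (\<Sum>k<Suc n. (norm (L2_ip circle_measure (v (Suc n)) (\<lambda>t. cis (real k * t)) / (2 * pi)))\<^sup>2) \<le> 2 * pi * K\<^sup>2"
      by (rule order_trans[OF Bessel_circle[OF vsq] vL2])
    moreover have "(\<Sum>k<Suc n. (norm (L2_ip circle_measure (v (Suc n)) (\<lambda>t. cis (real k * t)) / (2 * pi)))\<^sup>2) = (\<Sum>k\<le>n. (norm (\<gamma> k))\<^sup>2)"
      unfolding lessThan_Suc_atMost by (intro sum.cong refl) (simp add: v(3))
    ultimately show "(\<Sum>k\<le>n. (norm (\<gamma> k))\<^sup>2) \<le> K\<^sup>2" by simp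
  qed simp
  have dl2: "l2 d"
    unfolding l2_def
  proof (rule bounded_imp_summable)
    fix n
    have "(\<Sum>m\<le>n. (norm (x N m))\<^sup>2) \<le> K\<^sup>2" for N
    proof -
      \<comment> \<open>Conjugation and the factor \<open>cis (- t)\<close> move the frequencies
        \<open>- (m + 1)\<close> to \<open>m\<close>, where \<open>Bessel_circle\<close>
        applies.\<close>
      have sqc: "square_integrable circle_measure (\<lambda>t. cnj (v N t) * cis ((- 1) * t))"
        by (rule square_integrable_bounded_mult[where B=K, OF _ _ square_integrable_cis])
          (use v(2) in \<open>auto intro!: measurable_compose[OF v(1) borel_measurable_continuous_onI] continuous_intros\<close>)
      have "L2_ip circle_measure (\<lambda>t. cnj (v N t) * cis ((- 1) * t)) (\<lambda>t. cis (real m * t)) = cnj (2 * pi * x N m)" for m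
      proof -
        have eq: "cnj (v N t) * cis ((- 1) * t) * cnj (cis (real m * t)) = cnj (v N t * cnj (cis (- real (Suc m) * t)))" for t
          by (simp add: cis_cnj mult.assoc cis_mult algebra_simps)
        have "L2_ip circle_measure (\<lambda>t. cnj (v N t) * cis ((- 1) * t)) (\<lambda>t. cis (real m * t)) = cnj (L2_ip circle_measure (v N) (\<lambda>t. cis (- real (Suc m) * t)))"
          unfolding L2_ip_def eq by (rule Bochner_Integration.integral_cnj)
        then show ?thesis by (simp add: x_def)
      qed
      then have "2 * pi * (\<Sum>m<Suc n. (norm (x N m))\<^sup>2) \<le> L2_sq circle_measure (\<lambda>t. cnj (v N t) * cis ((- 1) * t))"
        using Bessel_circle[OF sqc, of "Suc n"] by (simp del: sum.lessThan_Suc)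
      also have "\<dots> = L2_sq circle_measure (v N)" by (simp add: L2_sq_def norm_mult)
      also have "\<dots> \<le> 2 * pi * K\<^sup>2" by (rule vL2)
      finally show ?thesis by (simp add: lessThan_Suc_atMost[symmetric] del: sum.lessThan_Suc)
    qed
    moreover have "(\<lambda>N. \<Sum>m\<le>n. (norm (x (r N) m))\<^sup>2) \<longlonglongrightarrow> (\<Sum>m\<le>n. (norm (d m))\<^sup>2)"
      by (intro tendsto_intros xd)
    ultimately show "(\<Sum>m\<le>n. (norm (d m))\<^sup>2) \<le> K\<^sup>2" by (intro tendsto_upperbound) auto
  qed simp
  \<comment> \<open>The part of negative frequencies, conjugated. The shift restores the frequency
    \<open>m + 1\<close>, and \<open>e 0 = 0\<close> keeps the constant term from being counted
    twice.\<close>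
  define e where "e = shift_coeff (\<lambda>m. cnj (d m))"
  have el2: "l2 e" unfolding e_def by (rule l2_shift_coeff) (use dl2 in \<open>simp add: l2_def\<close>)
  define k where "k t = bdry \<gamma> t + cnj (bdry e t)" for t
  have ksq: "square_integrable circle_measure k"
    unfolding k_def[abs_def] by (intro square_integrable_add square_integrable_cnj bdry \<gamma>l2 el2)
  have kcoeff: "L2_ip circle_measure k (\<lambda>t. cis (real n * t)) = 2 * pi * \<gamma> n" for n
  proof -
    have "L2_ip circle_measure k (\<lambda>t. cis (real n * t)) = L2_ip circle_measure (bdry \<gamma>) (\<lambda>t. cis (real n * t)) + L2_ip circle_measure (\<lambda>t. cnj (bdry e t)) (\<lambda>t. cis (real n * t))"
      unfolding k_def[abs_def] by (intro L2_ip_add_left square_integrable_cnj bdry \<gamma>l2 el2 square_integrable_cis)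
    also have "L2_ip circle_measure (bdry \<gamma>) (\<lambda>t. cis (real n * t)) = 2 * pi * \<gamma> n"
      using L2_ip_bdry_cis[OF \<gamma>l2, of "int n"] by simp
    also have "L2_ip circle_measure (\<lambda>t. cnj (bdry e t)) (\<lambda>t. cis (real n * t)) = cnj (L2_ip circle_measure (bdry e) (\<lambda>t. cis (of_int (- int n) * t)))"
    proof -
      have eq: "cnj (bdry e t) * cnj (cis (real n * t)) = cnj (bdry e t * cnj (cis (of_int (- int n) * t)))" for t
        by (simp add: cis_cnj)
      show ?thesis unfolding L2_ip_def eq by (rule Bochner_Integration.integral_cnj)
    qed
    also have "\<dots> = 0"
      using L2_ip_bdry_cis[OF el2, of "- int n"] by (simp add: e_def shift_coeff_def)
    finally show ?thesis by simp
  qed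
  \<comment> \<open>The left side is the modulus of the harmonic extension of the symbol. It is a
    limit of truncated Poisson means of the \<open>v N\<close>: first along the subsequence in
    \<open>N\<close>, where finitely many coefficients are involved, then in \<open>M\<close>, where
    the truncation error vanishes.\<close>
  have disc: "norm (ps \<gamma> z + cnj (ps e z)) \<le> K" if z: "norm z < 1" for z
  proof -
    define A where "A M t = (\<Sum>n<M. z ^ n * cnj (cis (real n * t)))" for M t
    have Ac: "continuous_on S (A M)" for S M unfolding A_def[abs_def] by (intro continuous_intros)
    have Tc: "continuous_on S (\<lambda>t. A M t + cnj (A M t) - 1)" for S M by (intro continuous_intros Ac)
    let ?B = "\<lambda>M. 1 + 2 * (norm z ^ M / (1 - norm z))"
    have TB: "(LINT t|circle_measure. norm (A M t + cnj (A M t) - 1)) \<le> 2 * pi * ?B M" for M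
    proof -
      have iP: "integrable circle_measure (\<lambda>t. (1 - (norm z)\<^sup>2) / (norm (cis t - z))\<^sup>2)"
        by (intro integrable_circle_continuous continuous_on_Poisson_kernel z)
      have ic: "integrable circle_measure (\<lambda>_. c)" for c :: real
        using finite_measure.integrable_const[OF finite_measure_circle] by blast
      have "(LINT t|circle_measure. norm (A M t + cnj (A M t) - 1)) \<le> (LINT t|circle_measure. (1 - (norm z)\<^sup>2) / (norm (cis t - z))\<^sup>2 + 2 * (norm z ^ M / (1 - norm z)))"
      proof (rule integral_mono)
        show "integrable circle_measure (\<lambda>t. norm (A M t + cnj (A M t) - 1))"
          by (intro integrable_circle_continuous continuous_on_norm Tc)
        show "integrable circle_measure (\<lambda>t. (1 - (norm z)\<^sup>2) / (norm (cis t - z))\<^sup>2 + 2 * (norm z ^ M / (1 - norm z)))"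
          by (intro Bochner_Integration.integrable_add iP ic)
      qed (unfold A_def, rule Poisson_kernel_series_bound[OF z])
      also have "\<dots> = (LINT t|circle_measure. (1 - (norm z)\<^sup>2) / (norm (cis t - z))\<^sup>2) + (LINT t|circle_measure. 2 * (norm z ^ M / (1 - norm z)))"
        by (rule Bochner_Integration.integral_add[OF iP ic])
      also have "(LINT t|circle_measure. (1 - (norm z)\<^sup>2) / (norm (cis t - z))\<^sup>2) = 2 * pi"
        using lebesgue_integral_eq_integral[OF iP] integral_unique[OF Poisson_kernel_integral[OF z]] by simp
      also have "(LINT t|circle_measure. 2 * (norm z ^ M / (1 - norm z))) = 2 * pi * (2 * (norm z ^ M / (1 - norm z)))"
        by (simp add: measure_restrict_space)
      finally show ?thesis by (simp add: distrib_left)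
    qed
    have partial: "norm ((\<Sum>n<M. \<gamma> n * z ^ n) + cnj (\<Sum>n<M. e n * z ^ n)) \<le> K * ?B M" if M: "M > 0" for M
    proof -
      define c where "c N n = L2_ip circle_measure (v N) (\<lambda>t. cis (- real n * t)) / (2 * pi)" for N n
      have int1: "integrable circle_measure (\<lambda>t. v N t * w t)" if "continuous_on {0..2*pi} w" for N w
        by (rule square_integrable_mult[OF vsq continuous_square_integrable_circle[OF that]])
      have IA: "(LINT t|circle_measure. v N t * A M t) = 2 * pi * (\<Sum>n<M. \<gamma> n * z ^ n)" if "N \<ge> M" for N
      proof -
        have "v N t * A M t = (\<Sum>n<M. z ^ n * (v N t * cnj (cis (real n * t))))" for t
          by (simp add: A_def sum_distrib_left mult_ac)
        then have "(LINT t|circle_measure. v N t * A M t) = (\<Sum>n<M. LINT t|circle_measure. z ^ n * (v N t * cnj (cis (real n * t))))"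
          by (simp only:) (intro Bochner_Integration.integral_sum integrable_mult_right int1 continuous_intros)
        also have "\<dots> = (\<Sum>n<M. z ^ n * L2_ip circle_measure (v N) (\<lambda>t. cis (real n * t)))"
          by (simp add: L2_ip_def)
        also have "\<dots> = (\<Sum>n<M. 2 * pi * (\<gamma> n * z ^ n))"
          using that by (intro sum.cong refl) (simp add: v(3))
        finally show ?thesis by (simp add: sum_distrib_left)
      qed
      have IB: "(LINT t|circle_measure. v N t * cnj (A M t)) = 2 * pi * (\<Sum>n<M. cnj z ^ n * c N n)" for N
      proof -
        have "v N t * cnj (A M t) = (\<Sum>n<M. cnj z ^ n * (v N t * cnj (cis (- real n * t))))" for t
          by (simp add: A_def sum_distrib_left cis_cnj mult_ac)
        then have "(LINT t|circle_measure. v N t * cnj (A M t)) = (\<Sum>n<M. LINT t|circle_measure. cnj z ^ n * (v N t * cnj (cis (- real n * t))))"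
          by (simp only:) (intro Bochner_Integration.integral_sum integrable_mult_right int1 continuous_intros)
        also have "\<dots> = (\<Sum>n<M. cnj z ^ n * L2_ip circle_measure (v N) (\<lambda>t. cis (- real n * t)))"
          by (simp add: L2_ip_def)
        also have "\<dots> = (\<Sum>n<M. 2 * pi * (cnj z ^ n * c N n))"
          by (intro sum.cong refl) (simp add: c_def)
        finally show ?thesis by (simp add: sum_distrib_left)
      qed
      have c0: "c N 0 = \<gamma> 0" if "N > 0" for N using v(3)[OF that] by (simp add: c_def)
      \<comment> \<open>Both \<open>A\<close> and \<open>cnj A\<close> contain the frequency 0, so
        \<open>c N 0\<close> is subtracted once.\<close>
      have bnd: "norm ((\<Sum>n<M. \<gamma> n * z ^ n) + (\<Sum>n<M. cnj z ^ n * c N n) - c N 0) \<le> K * ?B M" if "N \<ge> M" for N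
      proof -
        have I0: "(LINT t|circle_measure. v N t) = 2 * pi * c N 0"
          by (simp add: c_def L2_ip_def)
        have "(LINT t|circle_measure. v N t * (A M t + cnj (A M t) - 1)) = (LINT t|circle_measure. v N t * A M t + v N t * cnj (A M t) - v N t)"
          by (simp add: algebra_simps)
        also have "\<dots> = (LINT t|circle_measure. v N t * A M t) + (LINT t|circle_measure. v N t * cnj (A M t)) - (LINT t|circle_measure. v N t)"
          by (subst Bochner_Integration.integral_diff Bochner_Integration.integral_add, (intro Bochner_Integration.integrable_add int1 vint Ac continuous_intros)+)+ simp
        also have "\<dots> = 2 * pi * ((\<Sum>n<M. \<gamma> n * z ^ n) + (\<Sum>n<M. cnj z ^ n * c N n) - c N 0)"
          unfolding IA[OF that] IB I0 by (simp add: algebra_simps)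
        finally have "2 * pi * norm ((\<Sum>n<M. \<gamma> n * z ^ n) + (\<Sum>n<M. cnj z ^ n * c N n) - c N 0) = norm (LINT t|circle_measure. v N t * (A M t + cnj (A M t) - 1))"
          by (simp add: norm_mult)
        also have "\<dots> \<le> (LINT t|circle_measure. K * norm (A M t + cnj (A M t) - 1))"
        proof (rule order_trans[OF integral_norm_bound integral_mono])
          show "integrable circle_measure (\<lambda>t. norm (v N t * (A M t + cnj (A M t) - 1)))"
            by (intro integrable_norm int1 Tc)
          show "integrable circle_measure (\<lambda>t. K * norm (A M t + cnj (A M t) - 1))"
            by (intro integrable_mult_right integrable_circle_continuous continuous_on_norm Tc)
        qed (auto simp: norm_mult intro!: mult_right_mono v(2))
        also have "\<dots> \<le> K * (2 * pi * ?B M)"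
          using mult_left_mono[OF TB K_nonneg] by simp
        finally show ?thesis by (simp add: mult.left_commute)
      qed
      have "(\<lambda>N. c (r N) n) \<longlonglongrightarrow> (if n = 0 then \<gamma> 0 else cnj (e n))" for n
      proof (cases n)
        case 0
        have "\<forall>\<^sub>F N in sequentially. c (r N) 0 = \<gamma> 0"
          using eventually_gt_at_top[of 0] by eventually_elim (use rN in \<open>auto intro!: c0 intro: less_le_trans\<close>)
        then show ?thesis unfolding 0 by (auto intro: tendsto_eventually)
      next
        case (Suc m)
        then show ?thesis using xd[of m] by (simp add: c_def x_def e_def shift_coeff_def)
      qed
      note cl = this
      have "(\<lambda>N. norm ((\<Sum>n<M. \<gamma> n * z ^ n) + (\<Sum>n<M. cnj z ^ n * c (r N) n) - c (r N) 0)) \<longlonglongrightarrow>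
          norm ((\<Sum>n<M. \<gamma> n * z ^ n) + (\<Sum>n<M. cnj z ^ n * (if n = 0 then \<gamma> 0 else cnj (e n))) - (if (0::nat) = 0 then \<gamma> 0 else cnj (e 0)))"
        by (intro tendsto_intros cl)
      then have "norm ((\<Sum>n<M. \<gamma> n * z ^ n) + (\<Sum>n<M. cnj z ^ n * (if n = 0 then \<gamma> 0 else cnj (e n))) - (if (0::nat) = 0 then \<gamma> 0 else cnj (e 0))) \<le> K * ?B M"
      proof (rule tendsto_upperbound)
        show "\<forall>\<^sub>F N in sequentially. norm ((\<Sum>n<M. \<gamma> n * z ^ n) + (\<Sum>n<M. cnj z ^ n * c (r N) n) - c (r N) 0) \<le> K * ?B M"
          using eventually_ge_at_top[of M] by eventually_elim (intro bnd order_trans[OF _ rN])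
      qed simp
      moreover have "(\<Sum>n<M. cnj z ^ n * (if n = 0 then \<gamma> 0 else cnj (e n))) = \<gamma> 0 + cnj (\<Sum>n<M. e n * z ^ n)"
      proof -
        have e0: "e 0 = 0" by (simp add: e_def shift_coeff_def)
        have "(\<Sum>n<M. cnj z ^ n * (if n = 0 then \<gamma> 0 else cnj (e n))) = (\<Sum>n<M. (if n = 0 then \<gamma> 0 else 0) + cnj (e n * z ^ n))"
          by (intro sum.cong refl) (simp add: e0 mult.commute)
        also have "\<dots> = (\<Sum>n<M. if n = 0 then \<gamma> 0 else 0) + cnj (\<Sum>n<M. e n * z ^ n)"
          by (simp add: sum.distrib)
        also have "(\<Sum>n<M. if n = 0 then \<gamma> 0 else 0) = \<gamma> 0" using M by simp
        finally show ?thesis .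
      qed
      ultimately show ?thesis by simp
    qed
    have l1: "(\<lambda>M. norm ((\<Sum>n<M. \<gamma> n * z ^ n) + cnj (\<Sum>n<M. e n * z ^ n))) \<longlonglongrightarrow> norm (ps \<gamma> z + cnj (ps e z))"
      using ps_sums[OF \<gamma>l2 z] ps_sums[OF el2 z] unfolding sums_def by (intro tendsto_intros)
    have l2: "(\<lambda>M. K * ?B M) \<longlonglongrightarrow> K * (1 + 2 * (0 / (1 - norm z)))"
      using z by (intro tendsto_intros LIMSEQ_power_zero) auto
    have "norm (ps \<gamma> z + cnj (ps e z)) \<le> K * (1 + 2 * (0 / (1 - norm z)))"
    proof (rule tendsto_le[OF _ l2 l1])
      show "\<forall>\<^sub>F M in sequentially. norm ((\<Sum>n<M. \<gamma> n * z ^ n) + cnj (\<Sum>n<M. e n * z ^ n)) \<le> K * ?B M"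
        using eventually_gt_at_top[of 0] by eventually_elim (rule partial)
    qed simp
    then show ?thesis by simp
  qed
  \<comment> \<open>The bound passes from the harmonic extension to its non-tangential limits, which
    are the values of \<open>k\<close> almost everywhere by Fatou's theorem.\<close>
  have "AE t in circle_measure. norm (k t) \<le> K"
    using nt_limit_disc_ps[OF \<gamma>l2] nt_limit_disc_ps[OF el2]
  proof eventually_elim
    fix t assume n: "nt_limit_disc (ps \<gamma>) (cis t) (bdry \<gamma> t)" "nt_limit_disc (ps e) (cis t) (bdry e t)"
    let ?S = "{z. norm z < 1 \<and> norm (z - cis t) < 2 * (1 - norm z)}"
    have "(ps \<gamma> \<longlongrightarrow> bdry \<gamma> t) (at (cis t) within ?S)" "(ps e \<longlongrightarrow> bdry e t) (at (cis t) within ?S)"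
      using n[unfolded nt_limit_disc_def, rule_format, of 2] by auto
    then have "((\<lambda>z. norm (ps \<gamma> z + cnj (ps e z))) \<longlongrightarrow> norm (bdry \<gamma> t + cnj (bdry e t))) (at (cis t) within ?S)"
      by (intro tendsto_intros)
    moreover have "\<forall>\<^sub>F z in at (cis t) within ?S. norm (ps \<gamma> z + cnj (ps e z)) \<le> K"
      unfolding eventually_at_filter by (intro always_eventually) (auto intro: disc)
    ultimately show "norm (k t) \<le> K"
      unfolding k_def by (rule tendsto_upperbound) (rule at_within_stolz_region, simp)
  qed
  then show ?thesis using ksq kcoeff that by blast
qed

end

section \<open>Existence of the symbol\<close>

definition cut :: "(nat \<Rightarrow> complex) \<Rightarrow> nat \<Rightarrow> nat \<Rightarrow> complex" where
  "cut a N n = (if n < N then a n else 0)"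

lemma l2_cut: "l2 (cut a N)"
  by (rule l2_finite) (auto simp: cut_def intro: finite_subset[of _ "{..<N}"])

lemma ps_cut: assumes "norm z < 1" shows "ps (cut a N) z = (\<Sum>n<N. a n * z ^ n)"
proof -
  have "(\<Sum>k. cut a N k * z ^ k) = (\<Sum>k<N. cut a N k * z ^ k)"
    by (rule suminf_finite) (auto simp: cut_def)
  then show ?thesis using assms by (simp add: ps_def cut_def)
qed

lemma Gam_ps_cut: "Gam (ps (cut a N)) = (\<lambda>z. \<Sum>n<N. a n * Gam_basis n z)"
proof
  fix z show "Gam (ps (cut a N)) z = (\<Sum>n<N. a n * Gam_basis n z)"
  proof (cases "Im z > 0")
    case True
    from norm_cayley_less_1[OF this] True show ?thesis
      by (simp add: Gam_def Gam_basis_def ps_cut ps_unit_seq sum_distrib_left mult_ac)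
  qed (simp add: Gam_def Gam_basis_def)
qed

lemma Re_inner_Gam_ps:
  assumes "l2 a" shows "Re (inner_uhp (Gam (ps a)) (Gam (ps a))) = 2 * pi * (\<Sum>n. (norm (a n))\<^sup>2)"
  unfolding inner_uhp_Gam_ps[OF assms assms] L2_ip_bdry[OF assms assms, symmetric] L2_ip_self L2_sq_bdry[OF assms] by simp

lemma Re_inner_Gam_ps_cut: "Re (inner_uhp (Gam (ps (cut a N))) (Gam (ps (cut a N)))) = 2 * pi * (\<Sum>n<N. (norm (a n))\<^sup>2)"
proof -
  have "(\<Sum>n. (norm (cut a N n))\<^sup>2) = (\<Sum>n<N. (norm (cut a N n))\<^sup>2)"
    by (rule suminf_finite) (auto simp: cut_def)
  then show ?thesis by (simp add: Re_inner_Gam_ps[OF l2_cut] cut_def)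
qed

lemma mult_cayley_Gam_basis: "mult_op cayley (Gam_basis n) = Gam_basis (Suc n)"
proof -
  have "shift_coeff (unit_seq n) = unit_seq (Suc n)"
    by (auto simp: shift_coeff_def unit_seq_def fun_eq_iff split: nat.split)
  then show ?thesis
    by (simp add: Gam_basis_def Gam_shift_disc[symmetric] shift_disc_ps[OF l2_unit_seq])
qed

lemma op_Gam_cut:
  assumes C: "bounded_operator_on H2_uhp inner_uhp C" and w: "w \<in> H2_uhp"
  shows "inner_uhp (C (Gam (ps (cut a N)))) w = (\<Sum>n<N. a n * inner_uhp (C (Gam_basis n)) w)"
  unfolding Gam_ps_cut op_sum[OF C Gam_basis_in_H2_uhp]
  by (rule inner_uhp_sum_left[OF op_in[OF C Gam_basis_in_H2_uhp] w])

text \<open>The truncations converge in norm, their squared error being a tail of the squared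
  coefficients, and \<open>C\<close> is bounded.\<close>

lemma op_Gam_series:
  assumes C: "bounded_operator_on H2_uhp inner_uhp C" and a: "l2 a" and w: "w \<in> H2_uhp"
  shows "(\<lambda>N. \<Sum>n<N. a n * inner_uhp (C (Gam_basis n)) w) \<longlonglongrightarrow> inner_uhp (C (Gam (ps a))) w"
  unfolding op_Gam_cut[OF C w, symmetric]
proof (rule op_tendsto[OF C Gam_ps_in_H2_uhp[OF l2_cut] Gam_ps_in_H2_uhp[OF a] w])
  let ?s = "\<lambda>n. (norm (a n))\<^sup>2"
  have s: "summable ?s" using a by (simp add: l2_def)
  have "L2_sq lebesgue (bval_uhp (\<lambda>z. Gam (ps (cut a N)) z - Gam (ps a) z)) = 2 * pi * (suminf ?s - (\<Sum>n<N. ?s n))" for N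
  proof -
    define b where "b n = cut a N n + (- 1) * a n" for n
    have b: "l2 b" unfolding b_def[abs_def] by (intro l2_add l2_cmult l2_cut a)
    have b_eq: "b n = (if n < N then 0 else - a n)" for n by (simp add: b_def cut_def)
    have "ps b = (\<lambda>z. ps (cut a N) z + (- 1) * ps a z)"
      unfolding b_def[abs_def] ps_add[OF l2_cut l2_cmult[OF a]] ps_cmult[OF a] ..
    then have "(\<lambda>z. Gam (ps (cut a N)) z - Gam (ps a) z) = Gam (ps b)"
      by (auto simp: Gam_def fun_eq_iff right_diff_distrib)
    then have "L2_sq lebesgue (bval_uhp (\<lambda>z. Gam (ps (cut a N)) z - Gam (ps a) z)) = 2 * pi * (\<Sum>n. (norm (b n))\<^sup>2)"
      using Re_inner_Gam_ps[OF b] by (simp add: Re_inner_uhp_self)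
    also have "(\<Sum>n. (norm (b n))\<^sup>2) = (\<Sum>n. (norm (b (n + N)))\<^sup>2) + (\<Sum>n<N. (norm (b n))\<^sup>2)"
      by (rule suminf_split_initial_segment) (use b in \<open>simp add: l2_def\<close>)
    also have "\<dots> = (\<Sum>n. ?s (n + N))" by (simp add: b_eq)
    also have "\<dots> = suminf ?s - (\<Sum>n<N. ?s n)" by (rule suminf_minus_initial_segment[OF s])
    finally show ?thesis .
  qed
  moreover have "(\<lambda>N. 2 * pi * (suminf ?s - (\<Sum>n<N. ?s n))) \<longlonglongrightarrow> 2 * pi * (suminf ?s - suminf ?s)"
    by (intro tendsto_intros summable_LIMSEQ s)
  ultimately show "(\<lambda>N. L2_sq lebesgue (bval_uhp (\<lambda>z. Gam (ps (cut a N)) z - Gam (ps a) z))) \<longlonglongrightarrow> 0" by simp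
qed

lemma bounded_operator_id: "bounded_operator_on H2_uhp inner_uhp (\<lambda>F. F)"
  unfolding bounded_operator_on_def by (auto intro: exI[of _ 1])

lemma L2_ip_Gam_series:
  assumes a: "l2 a" and u: "square_integrable lebesgue u"
  shows "(\<lambda>N. \<Sum>n<N. a n * L2_ip lebesgue (line_basis n) u) \<longlonglongrightarrow> L2_ip lebesgue (bval_uhp (Gam (ps a))) u"
proof -
  have "L2_ip lebesgue (bval_uhp (Gam (ps a))) u = L2_ip lebesgue (line_bdry a) u"
    by (intro L2_ip_AE square_integrable_bval square_integrable_line_bdry u a Gam_ps_in_H2_uhp bval_uhp_Gam_ps) simp
  then show ?thesis
    using line_trig_tendsto[OF a u] by (simp add: L2_ip_line_trig[OF u])
qed

text \<open>Moves reflection and symbol to the second argument, so that the series expansion of the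
  first one applies.\<close>

lemma L2_ip_reflection:
  "L2_ip lebesgue (\<lambda>x. h x * reflection u x) v = L2_ip lebesgue u (reflection (\<lambda>x. cnj (h x) * v x))"
proof -
  have "L2_ip lebesgue u (reflection (\<lambda>x. cnj (h x) * v x)) = (LINT x|lebesgue. u x * (h (- x) * cnj (v (- x))))"
    by (simp add: L2_ip_def reflection_def)
  also have "\<dots> = (LINT x|lebesgue. u (- x) * (h x * cnj (v x)))"
    by (subst lebesgue_integral_real_affine[where c="-1" and t=0]) auto
  finally show ?thesis by (simp add: L2_ip_def reflection_def mult_ac)
qed

text \<open>
  The symbol on the line is \<open>- k (\<theta>) * cis \<theta>\<close> at \<open>x\<close> with angle \<open>\<theta>\<close>: the reflection \<open>x \<mapsto> - x\<close> becomes
  \<open>\<theta> \<mapsto> 2 * pi - \<theta>\<close>, and the factor \<open>- cis \<theta>\<close> turns the weight \<open>1 / (\<i> - x)\<close> back into \<open>1 / (x + \<i>)\<close>.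
\<close>
lemma line_basis_reflection:
  "- cis (cayley_angle x) * reflection (line_basis n) x = of_real (sqrt 2) / (of_real x + \<i>) * cis (- (real n * cayley_angle x))"
proof -
  have "cayley_angle (- x) = - cayley_angle x + 2 * pi" by (simp add: cayley_angle_def arctan_minus)
  then have "real n * cayley_angle (- x) = - (real n * cayley_angle x) + 2 * pi * real n"
    by (simp only: algebra_simps)
  then have "cis (real n * cayley_angle (- x)) = cis (- (real n * cayley_angle x)) * cis (2 * pi * real n)"
    by (simp only: cis_mult)
  also have "cis (2 * pi * real n) = 1" by (rule cis_multiple_2pi) simp
  finally have c: "cis (real n * cayley_angle (- x)) = cis (- (real n * cayley_angle x))" by simp
  have "- complex_of_real x + \<i> = - (of_real x - \<i>)" by simp
  then have "- ((of_real x - \<i>) / (of_real x + \<i>)) * (of_real (sqrt 2) / (- complex_of_real x + \<i>)) = of_real (sqrt 2) / (of_real x + \<i>)"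
    using of_real_minus_i_neq[of x] by (simp only: divide_minus_right minus_mult_minus) (simp del: right_minus_eq)
  from arg_cong[OF this, of "\<lambda>w. w * cis (- (real n * cayley_angle x))"] show ?thesis
    unfolding reflection_def line_basis_def c cis_cayley_angle of_real_minus mult.assoc .
qed

lemma cayley_commuting_imp_hankel_uhp:
  assumes C: "bounded_operator_on H2_uhp inner_uhp C"
    and comm: "\<And>f w. f \<in> H2_uhp \<Longrightarrow> w \<in> H2_uhp \<Longrightarrow> inner_uhp (C (mult_op cayley f)) w = inner_uhp (C f) (mult_op cayley w)"
  obtains h where "h \<in> Linf_real" "\<And>F. F \<in> H2_uhp \<Longrightarrow> C F = hankel_uhp h F"
proof -
  let ?E = Gam_basis
  note E = Gam_basis_in_H2_uhp
  define \<gamma> where "\<gamma> n = inner_uhp (C (?E n)) (?E 0) / (2 * pi)" for n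
  \<comment> \<open>Each use of the commutation relation moves one power of the Cayley function from
    the second argument to the first, so only \<open>i + j\<close> matters.\<close>
  have \<gamma>: "inner_uhp (C (?E i)) (?E j) = 2 * pi * \<gamma> (i + j)" for i j
  proof (induction j arbitrary: i)
    case (Suc j)
    have "inner_uhp (C (?E i)) (?E (Suc j)) = inner_uhp (C (?E (Suc i))) (?E j)"
      using comm[OF E E, of i j] by (simp add: mult_cayley_Gam_basis)
    then show ?case using Suc by simp
  qed (simp add: \<gamma>_def)
  obtain K0 where K0: "\<And>f. f \<in> H2_uhp \<Longrightarrow> sqrt (Re (inner_uhp (C f) (C f))) \<le> K0 * sqrt (Re (inner_uhp f f))"
    using C unfolding bounded_operator_on_def by blast
  define K where "K = \<bar>K0\<bar>"
  have K: "sqrt (Re (inner_uhp (C f) (C f))) \<le> K * sqrt (Re (inner_uhp f f))" if "f \<in> H2_uhp" for f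
    by (rule order_trans[OF K0[OF that]]) (auto simp: K_def Re_inner_uhp_self intro: mult_right_mono)
  interpret bounded_hankel_matrix \<gamma> K
  proof
    fix M and a b :: "nat \<Rightarrow> complex"
    define A where "A = Gam (ps (cut a M))"
    \<comment> \<open>Conjugated coefficients, because the inner product is conjugate linear in its
      second argument while the matrix form is bilinear.\<close>
    define B where "B = Gam (ps (cut (\<lambda>j. cnj (b j)) M))"
    have AB: "A \<in> H2_uhp" "B \<in> H2_uhp" unfolding A_def B_def by (intro Gam_ps_in_H2_uhp l2_cut)+
    have "inner_uhp (C A) B = (\<Sum>j<M. b j * inner_uhp (C A) (?E j))"
    proof -
      have "inner_uhp B (C A) = (\<Sum>j<M. cnj (b j) * inner_uhp (?E j) (C A))"
        unfolding B_def by (rule op_Gam_cut[OF bounded_operator_id op_in[OF C AB(1)]])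
      then show ?thesis
        unfolding inner_uhp_commute[of "C A"] by simp
    qed
    also have "\<dots> = (\<Sum>j<M. \<Sum>i<M. b j * (a i * (2 * pi * \<gamma> (i + j))))"
      unfolding A_def op_Gam_cut[OF C E] \<gamma> sum_distrib_left ..
    also have "\<dots> = 2 * pi * (\<Sum>i<M. \<Sum>j<M. \<gamma> (i + j) * a i * b j)"
      unfolding sum_distrib_left by (subst sum.swap) (simp add: mult_ac)
    finally have "2 * pi * norm (\<Sum>i<M. \<Sum>j<M. \<gamma> (i + j) * a i * b j) = norm (inner_uhp (C A) B)"
      by (simp add: norm_mult)
    also have "\<dots> \<le> sqrt (Re (inner_uhp (C A) (C A))) * sqrt (Re (inner_uhp B B))"
      by (intro inner_uhp_Cauchy_Schwarz op_in[OF C] AB)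
    also have "\<dots> \<le> (K * sqrt (Re (inner_uhp A A))) * sqrt (Re (inner_uhp B B))"
      by (intro mult_right_mono K AB) (simp add: Re_inner_uhp_self)
    also have "\<dots> = K * (sqrt (2 * pi) * sqrt (\<Sum>i<M. (norm (a i))\<^sup>2)) * (sqrt (2 * pi) * sqrt (\<Sum>j<M. (norm (b j))\<^sup>2))"
      unfolding A_def B_def Re_inner_Gam_ps_cut real_sqrt_mult[of "2 * pi"] complex_mod_cnj ..
    also have "\<dots> = (sqrt (2 * pi) * sqrt (2 * pi)) * (K * sqrt (\<Sum>i<M. (norm (a i))\<^sup>2) * sqrt (\<Sum>j<M. (norm (b j))\<^sup>2))"
      by (simp only: mult_ac)
    also have "sqrt (2 * pi) * sqrt (2 * pi) = 2 * pi" by (rule real_sqrt_mult_self[THEN trans]) simp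
    finally show "norm (\<Sum>i<M. \<Sum>j<M. \<gamma> (i + j) * a i * b j) \<le> K * sqrt (\<Sum>i<M. (norm (a i))\<^sup>2) * sqrt (\<Sum>j<M. (norm (b j))\<^sup>2)"
      by simp
  qed
  obtain k where k: "square_integrable circle_measure k" "AE t in circle_measure. norm (k t) \<le> K"
    "\<And>n. L2_ip circle_measure k (\<lambda>t. cis (real n * t)) = 2 * pi * \<gamma> n"
    using Nehari by blast
  define h where "h x = k (cayley_angle x) * - cis (cayley_angle x)" for x
  have h: "h \<in> Linf_real"
    unfolding Linf_real_def
  proof (intro CollectI conjI exI)
    show "h \<in> borel_measurable lebesgue"
      unfolding h_def[abs_def]
      by (intro borel_measurable_times borel_measurable_cayley_angle[OF k(1)] borel_measurable_lebesgue_continuous)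
        (auto simp: cis_cayley_angle intro!: continuous_intros)
    show "AE x in lebesgue. norm (h x) \<le> K"
      using AE_cayley_angle[OF k(2)] by eventually_elim (simp add: h_def norm_mult)
  qed
  have sq: "square_integrable lebesgue (\<lambda>x. h x * reflection u x)" if "square_integrable lebesgue u" for u
    using h that unfolding Linf_real_def
    by (auto intro!: square_integrable_bounded_mult square_integrable_reflection)
  have sq': "square_integrable lebesgue (reflection (\<lambda>x. cnj (h x) * u x))" if "square_integrable lebesgue u" for u
  proof (rule square_integrable_reflection)
    have "square_integrable lebesgue (\<lambda>x. h x * cnj (u x))"
      using h that unfolding Linf_real_def
      by (auto intro!: square_integrable_bounded_mult square_integrable_cnj)
    from square_integrable_cnj[OF this] show "square_integrable lebesgue (\<lambda>x. cnj (h x) * u x)" by simp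
  qed
  have basis: "L2_ip lebesgue (\<lambda>x. h x * reflection (line_basis n) x) (line_basis m) = inner_uhp (C (?E n)) (?E m)" for n m
  proof -
    have "h x * reflection (line_basis n) x = of_real (sqrt 2) / (of_real x + \<i>) * (k (cayley_angle x) * cis (- (real n * cayley_angle x)))" for x
      unfolding h_def mult.assoc line_basis_reflection by (simp only: mult_ac)
    then have "L2_ip lebesgue (\<lambda>x. h x * reflection (line_basis n) x) (line_basis m) =
        L2_ip circle_measure (\<lambda>t. k t * cis (- (real n * t))) (\<lambda>t. cis (real m * t))"
      unfolding line_basis_def[of m, abs_def]
      using cayley_transfer(2)[of "\<lambda>t. k t * cis (- (real n * t))" "\<lambda>t. cis (real m * t)"] by simp
    also have "\<dots> = L2_ip circle_measure k (\<lambda>t. cis (real (n + m) * t))"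
      unfolding L2_ip_def by (simp add: cis_cnj mult.assoc cis_mult algebra_simps)
    finally show ?thesis unfolding k(3) \<gamma> .
  qed
  \<comment> \<open>The identity on the basis is extended by series in the second argument here, and
    in the first argument below.\<close>
  have step: "inner_uhp (C (?E n)) G = L2_ip lebesgue (\<lambda>x. h x * reflection (line_basis n) x) (bval_uhp G)"
    if G: "G \<in> H2_uhp" for n G
  proof -
    obtain b where b: "l2 b" "G = Gam (ps b)" using H2_uhp_cases[OF G] .
    have "inner_uhp G (C (?E n)) = L2_ip lebesgue (bval_uhp G) (\<lambda>x. h x * reflection (line_basis n) x)"
    proof (rule LIMSEQ_unique)
      show "(\<lambda>N. \<Sum>m<N. b m * inner_uhp (?E m) (C (?E n))) \<longlonglongrightarrow> inner_uhp G (C (?E n))"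
        unfolding b(2) by (rule op_Gam_series[OF bounded_operator_id b(1) op_in[OF C E]])
      show "(\<lambda>N. \<Sum>m<N. b m * inner_uhp (?E m) (C (?E n))) \<longlonglongrightarrow> L2_ip lebesgue (bval_uhp G) (\<lambda>x. h x * reflection (line_basis n) x)"
        using L2_ip_Gam_series[OF b(1) sq[OF square_integrable_line_basis, of n]]
        unfolding b(2) inner_uhp_commute[of _ "C (?E n)"] basis[symmetric]
        unfolding L2_ip_commute[symmetric] .
    qed
    then show ?thesis
      unfolding inner_uhp_commute[of "C (?E n)"] L2_ip_commute[of _ "\<lambda>x. h x * reflection (line_basis n) x"] by simp
  qed
  have "hankel_uhp h F = C F" if F: "F \<in> H2_uhp" for F
    unfolding hankel_uhp_def
  proof (rule P_plus_eqI[OF hankel_uhp(1)[OF h F] op_in[OF C F]])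
    fix G assume G: "G \<in> H2_uhp"
    obtain a where a: "l2 a" "F = Gam (ps a)" using H2_uhp_cases[OF F] .
    show "inner_uhp (C F) G = L2_ip lebesgue (\<lambda>x. h x * reflection (bval_uhp F) x) (bval_uhp G)"
    proof (rule LIMSEQ_unique)
      show "(\<lambda>N. \<Sum>n<N. a n * inner_uhp (C (?E n)) G) \<longlonglongrightarrow> inner_uhp (C F) G"
        unfolding a(2) by (rule op_Gam_series[OF C a(1) G])
      show "(\<lambda>N. \<Sum>n<N. a n * inner_uhp (C (?E n)) G) \<longlonglongrightarrow> L2_ip lebesgue (\<lambda>x. h x * reflection (bval_uhp F) x) (bval_uhp G)"
        unfolding step[OF G] L2_ip_reflection a(2)
        by (rule L2_ip_Gam_series[OF a(1) sq'[OF square_integrable_bval[OF G]]])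
    qed
  qed
  then show ?thesis using that[OF h] by simp
qed

theorem theorem3p5:
  fixes C D :: "(complex \<Rightarrow> complex) \<Rightarrow> (complex \<Rightarrow> complex)"
  assumes C: "bounded_operator_on H2_uhp inner_uhp C"
    and D: "D = transfer_disc C"
  defines "a \<equiv> \<exists>h\<in>Linf_real. \<forall>f\<in>H2_uhp. C f = hankel_uhp h f"
    and "b \<equiv> \<forall>g\<in>Hinf_uhp. \<forall>f\<in>H2_uhp.
                C (mult_op g f) = adjoint_uhp (mult_op (sharp g)) (C f)"
    and "c \<equiv> \<forall>t>0. \<forall>f\<in>H2_uhp. C (S_uhp t f) = adjoint_uhp (S_uhp t) (C f)"
    and "d \<equiv> is_hankel_disc D"
  shows "(a \<longleftrightarrow> b) \<and> (b \<longleftrightarrow> c) \<and> (c \<longleftrightarrow> d)"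
proof -
  have ab: b if a
    using that hankel_intertwines unfolding a_def b_def by metis
  have bc: c if b
    unfolding c_def S_uhp_eq
  proof (intro allI impI ballI)
    fix t :: real and f assume "t > 0" and f: "f \<in> H2_uhp"
    then have "(\<lambda>z. exp (\<i> * of_real t * z)) \<in> Hinf_uhp" by (intro exp_in_Hinf) simp
    from that[unfolded b_def, rule_format, OF this f]
    show "C (mult_op (\<lambda>z. exp (\<i> * of_real t * z)) f) = adjoint_uhp (mult_op (\<lambda>z. exp (\<i> * of_real t * z))) (C f)"
      unfolding sharp_exp .
  qed
  have cd: d if c
    unfolding d_def D is_hankel_disc_transfer_iff[OF C]
    using that semigroup_imp_cayley[OF C] unfolding c_def by blast
  have da: a if d
    using that cayley_commuting_imp_hankel_uhp[OF C]
    unfolding a_def d_def D is_hankel_disc_transfer_iff[OF C] by metis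
  show ?thesis using ab bc cd da by blast
qed

end
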